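(* Assume the setting of the context: $K(\mathbf v,\mathbf u)=k(v_x,u_x)b(v_\perp)$ is a collision kernel and $f_0(\mathbf v)=a_0(v_x)b(v_\perp)$ an initial particle density satisfying mass conservation and (A1)-(A4), $V_\infty\ge 0$, and $E=F_0(V_\infty)$. Assume the Reversal Criterion $$\int_0^\infty k(0,z)\,a_0(z+V_\infty)\,dz<a_0(V_\infty).$$ Let the initial velocity of the cylinder be $V_0=V_\infty+\gamma$ with $\gamma>0$. Then there are constants $\gamma_1>0$ and $c,C>0$ (not depending on $\gamma$) such that for every $\gamma\in(0,\gamma_1)$ the following hold. (a) There exists at least one solution $(V,f)$ of the body-particle problem, i.e. $V\in C^1([0,\infty))$, $V(0)=V_0$, $\frac{dV}{dt}=E-F(t)$ for $t\ge 0$, where $F(t)$ is the force given in the context, and $f_\pm\in L^\infty$ (for $t\in[0,\infty)$, $\mathbf x\in\partial\Omega(t)$, $\mathbf v\in\mathbb R^d$) are the (almost everywhere defined) pre- and post-collision boundary densities determined explicitly by $V$ and $f_0$. (b) Every solution in this sense satisfies, for all $0<t<\infty$, $$\gamma e^{-B_0t}-\frac{c\,\gamma^{p+1}}{(1+t)^{d+p}}<V(t)-V_\infty<\gamma e^{-B_\infty t}-\frac{C\gamma^{p+1}}{t^{d+p}}\,\chi\{t\ge t_0+1\},$$ where $B_0=\max_{[V_\infty-\gamma,V_\infty+\gamma]}F_0'$, $B_\infty=\min_{[V_\infty-\gamma,V_\infty+\gamma]}F_0'$ and $t_0=K_0|\ln\gamma|$ for a fixed $K_0$ with $\frac1{B_0}\le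 K_0\le\frac2{B_0}$. In particular the velocity is reversed: $V(t)<V_\infty$ for all sufficiently large $t$.
   Context: Notation. $d\ge1$; $\mathbf x=(x,x_\perp)\in\mathbb R\times\mathbb R^{d-1}$, $\mathbf v=(v_x,v_\perp)\in\mathbb R\times\mathbb R^{d-1}$; $\mathbf i$ is the unit vector in the $x$-direction; $\chi\{\cdot\}$ is the indicator of a condition. Body. $\Omega(t)=\{(x,x_\perp):|x-X(t)|\le H,\ |x_\perp|\le r\}$ is a rigid cylinder parallel to the $x$-axis ($H,r>0$ fixed), moving only in the $x$-direction with $\frac{dX}{dt}=V(t)$, $\frac{dV}{dt}=E-F(t)$, where $E\ge 0$ is a constant force and $F$ is the force due to the particles. $\partial\Omega_R(t)$, $\partial\Omega_L(t)$ are its right and left ends. Particles. The density $f(t,\mathbf x,\mathbf v)$ satisfies $\partial_tf+\mathbf v\cdot\nabla_{\mathbf x}f=0$ outside $\Omega(t)$ and $f(0,\mathbf x,\mathbf v)=f_0(\mathbf v)$. On $\partial\Omega(t)$, $f_\pm(t,\mathbf x;\mathbf v)=\lim_{\epsilon\to0^+}f(t\pm\epsilon,\mathbf x\pm\epsilon\mathbf v,\mathbf v)$ are the densities after ($+$, outgoing velocities) and before ($-$, incoming velocities) collision; on the right end incoming means $v_x\le V(t)$ and outgoing $v_x\ge V(t)$, on the left end the opposite. Reflection law at the ends, for outgoing $\mathbf v$: $$f_+(t,\mathbf x;\mathbf v)=\int_{(u_x-V(t))(v_x-V(t))\le0}K(\mathbf v-\mathbf iV(t);\mathbf u-\mathbf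 iV(t))\,f_-(t,\mathbf x;\mathbf u)\,d\mathbf u .$$ On the lateral boundary, with outward normal $\mathbf n$: $f_+(t,\mathbf x;\mathbf v)=\int_{\mathbf u\cdot\mathbf n\le0}K_S(\mathbf v;\mathbf u)f_0(\mathbf u)\,d\mathbf u$ with $K_S\geq 0$ satisfying $\int_{\mathbf v\cdot\mathbf n\ge0}(\mathbf v\cdot\mathbf n)K_S(\mathbf v;\mathbf u)\,d\mathbf v=|\mathbf u\cdot\mathbf n|$; this produces no net horizontal force. Given the motion, $f_-$ at an end is explicit: for incoming $(t,\mathbf x,\mathbf u)$, if the backward path $\mathbf x-(t-s)\mathbf u$ lies on that end at some time $s\in(0,t)$ (a precollision), then $f_-(t,\mathbf x;\mathbf u)=f_+(\tau,\boldsymbol\xi;\mathbf u)$, with $\tau$ the latest such time and $\boldsymbol\xi=\mathbf x-(t-\tau)\mathbf u$; otherwise $f_-(t,\mathbf x;\mathbf u)=f_0(\mathbf u)$. (Precollision times can accumulate at $t$ only if $u_x=V(t)$, a null set.) Force. With $\ell(w)=w^2+\int_0^\infty v^2k(v,w)\,dv$, $$F(t)=\int_{\partial\Omega_R(t)}\!dS_{\mathbf x}\!\int_{u_x\le V(t)}\!\ell(u_x-V(t))f_-(t,\mathbf x;\mathbf u)\,d\mathbf u-\int_{\partial\Omega_L(t)}\!dS_{\mathbf x}\!\int_{u_x\ge V(t)}\!\ell(u_x-V(t))f_-(t,\mathbf x;\mathbf u)\,d\mathbf u ,$$ and, for $w\in\mathbb R$, $$F_0(w)=|\partial\Omega_L|\Big(\int_{u_x\le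 w}\ell(u_x-w)f_0(\mathbf u)\,d\mathbf u-\int_{u_x\ge w}\ell(u_x-w)f_0(\mathbf u)\,d\mathbf u\Big).$$ It is a standing fact that $F_0$ is an increasing $C^1$ function, with $B_0\ge B_\infty>0$. The equilibrium velocity $V_\infty\ge0$ is determined by $F_0(V_\infty)=E$. Standing assumptions on $K$, $f_0$, for some $\gamma=\gamma_*>0$ (hence for all smaller $\gamma$): Mass conservation: $\int_{v_x\ge0}v_xK(\mathbf v,\mathbf u)\,d\mathbf v=|u_x|$. (A1) $f_0(\mathbf v)=a_0(v_x)b(v_\perp)$, $K(\mathbf v,\mathbf u)=k(v_x,u_x)b(v_\perp)$, $\int b\,dv_\perp=1$, $b(0)>0$, all factors nonnegative and continuous, $f_0$ bounded, $a_0$ even, and $k$ even in each of its variables. (A2) $\sup_{|u_x|\le\gamma}\sup_{v_x\in\mathbb R}k(v_x,u_x)<\infty$. (A3) There are $0<p\le2$ and constants $c',C'>0$ with $c'|u_x|^p\le\int_{v_x\ge0}v_x^2k(v_x,u_x)\,dv_x\le C'|u_x|^p$ for $u_x\in[-\gamma,\gamma]$; moreover this integral is an even function of $u_x$, $C^1$ for $u_x\ne0$ and strictly decreasing for $u_x<0$. (A4) There is $M\in L^1(\mathbb R)$ with $k(v_x,z-y-V_\infty)a_0(z)\le M(z)$ for $|v_x|<2\gamma$, $|y|<\gamma$, $z\in\mathbb R$.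
   Formalization: "f_+ in L^∞" can fail under (A1)-(A4), so at the ends it is replaced by |f_+| ≤ M(1 + reflection of f_0), i.e. L^∞ whenever that reflection is bounded; on the lateral boundary f_+ is only given by its formula, with no L^∞ claim. *)

theory Defs
  imports "HOL-Analysis.Analysis"
begin

text \<open>
  The transversal space \<open>\<real>\<^bsup>d-1\<^esup>\<close> is the set of extensional functions on \<open>{1..<d}\<close> with product
  Lebesgue measure; for \<open>d = 1\<close> it is a single point of mass one. A point of \<open>\<real>\<^bsup>d\<^esup>\<close>, be it a
  position or a velocity, is a pair of a horizontal and a transversal component.
\<close>

type_synonym perp = "nat \<Rightarrow> real"
type_synonym vec = "real \<times> perp"

definition perp_measure :: "nat \<Rightarrow> perp measure" where
  "perp_measure d = (\<Pi>\<^sub>M i\<in>{1..<d}. lborel)"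

definition vec_measure :: "nat \<Rightarrow> vec measure" where
  "vec_measure d = lborel \<Otimes>\<^sub>M perp_measure d"

definition perp_zero :: "nat \<Rightarrow> perp" where
  "perp_zero d = (\<lambda>i\<in>{1..<d}. 0)"

definition perp_norm :: "nat \<Rightarrow> perp \<Rightarrow> real" where
  "perp_norm d y = L2_set y {1..<d}"

definition perp_inner :: "nat \<Rightarrow> perp \<Rightarrow> perp \<Rightarrow> real" where
  "perp_inner d y z = (\<Sum>i\<in>{1..<d}. y i * z i)"

definition hshift :: "real \<Rightarrow> vec \<Rightarrow> vec" where
  "hshift w v = (fst v - w, snd v)"  \<comment> \<open>\<open>v\<close> minus \<open>w\<close> times the horizontal unit vector\<close>

definition backward :: "nat \<Rightarrow> vec \<Rightarrow> real \<Rightarrow> vec \<Rightarrow> vec" where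
  "backward d x a u = (fst x - a * fst u, \<lambda>i\<in>{1..<d}. snd x i - a * snd u i)"  \<comment> \<open>\<open>x - a u\<close>\<close>

definition disk :: "nat \<Rightarrow> real \<Rightarrow> perp set" where
  "disk d r = {y \<in> space (perp_measure d). perp_norm d y \<le> r}"


section \<open>Kernel and initial density\<close>

definition mass_conservation :: "nat \<Rightarrow> (vec \<Rightarrow> vec \<Rightarrow> real) \<Rightarrow> bool" where
  "mass_conservation d K \<longleftrightarrow>
     (\<forall>u\<in>space (vec_measure d).
        has_bochner_integral (vec_measure d)
          (\<lambda>v. indicat_real {v. 0 \<le> fst v} v * (fst v * K v u)) \<bar>fst u\<bar>)"

definition factorization ::
  "nat \<Rightarrow> (vec \<Rightarrow> vec \<Rightarrow> real) \<Rightarrow> (vec \<Rightarrow> real) \<Rightarrow> (real \<Rightarrow> real \<Rightarrow> real) \<Rightarrow> (real \<Rightarrow> real) \<Rightarrow> (perp \<Rightarrow> real) \<Rightarrow> bool"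
where
  "factorization d K f0 k a0 b \<longleftrightarrow>
     (\<forall>v. f0 v = a0 (fst v) * b (snd v)) \<and>
     (\<forall>v u. K v u = k (fst v) (fst u) * b (snd v)) \<and>
     has_bochner_integral (perp_measure d) b 1 \<and>
     0 < b (perp_zero d) \<and>
     (\<forall>z. 0 \<le> a0 z) \<and> (\<forall>v u. 0 \<le> k v u) \<and> (\<forall>y\<in>space (perp_measure d). 0 \<le> b y) \<and>
     continuous_on UNIV a0 \<and>
     continuous_on UNIV (\<lambda>(v, u). k v u) \<and>
     continuous_on (space (perp_measure d)) b \<and>
     bounded (f0 ` space (vec_measure d)) \<and>
     (\<forall>z. a0 (- z) = a0 z) \<and>
     (\<forall>v u. k (- v) u = k v u) \<and> (\<forall>v u. k v (- u) = k v u)"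

definition kernel_bounded :: "(real \<Rightarrow> real \<Rightarrow> real) \<Rightarrow> real \<Rightarrow> bool" where
  "kernel_bounded k \<gamma> \<longleftrightarrow> (\<exists>M. \<forall>u v. \<bar>u\<bar> \<le> \<gamma> \<longrightarrow> k v u \<le> M)"

definition second_moment :: "(real \<Rightarrow> real \<Rightarrow> real) \<Rightarrow> real \<Rightarrow> real" where
  "second_moment k u = (LINT v:{0..}|lborel. v\<^sup>2 * k v u)"

definition second_moment_condition :: "(real \<Rightarrow> real \<Rightarrow> real) \<Rightarrow> real \<Rightarrow> real \<Rightarrow> bool" where
  "second_moment_condition k p \<gamma> \<longleftrightarrow>
     0 < p \<and> p \<le> 2 \<and>
     (\<forall>u. set_integrable lborel {0..} (\<lambda>v. v\<^sup>2 * k v u)) \<and>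
     (\<exists>c' C'. 0 < c' \<and> 0 < C' \<and>
        (\<forall>u\<in>{-\<gamma>..\<gamma>}. c' * \<bar>u\<bar> powr p \<le> second_moment k u \<and>
                       second_moment k u \<le> C' * \<bar>u\<bar> powr p)) \<and>
     (\<forall>u. second_moment k (- u) = second_moment k u) \<and>
     second_moment k C1_differentiable_on (- {0}) \<and>
     strict_antimono_on {..<0} (second_moment k)"

definition domination :: "(real \<Rightarrow> real \<Rightarrow> real) \<Rightarrow> (real \<Rightarrow> real) \<Rightarrow> real \<Rightarrow> real \<Rightarrow> bool" where
  "domination k a0 Vinf \<gamma> \<longleftrightarrow>
     (\<exists>M. integrable lborel M \<and>
        (\<forall>v y z. \<bar>v\<bar> < 2 * \<gamma> \<and> \<bar>y\<bar> < \<gamma> \<longrightarrow> k v (z - y - Vinf) * a0 z \<le> M z))"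

definition reversal_criterion :: "(real \<Rightarrow> real \<Rightarrow> real) \<Rightarrow> (real \<Rightarrow> real) \<Rightarrow> real \<Rightarrow> bool" where
  "reversal_criterion k a0 Vinf \<longleftrightarrow> (LINT z:{0..}|lborel. k 0 z * a0 (z + Vinf)) < a0 Vinf"

text \<open>
  The lateral kernel takes the outward normal as its first argument: for \<open>d \<ge> 3\<close> no function
  independent of the normal satisfies the flux identity at all lateral points. A lateral
  normal has no horizontal component, so it is given by its transversal part \<open>\<nu>\<close>.
\<close>

definition lateral_kernel :: "nat \<Rightarrow> (perp \<Rightarrow> vec \<Rightarrow> vec \<Rightarrow> real) \<Rightarrow> bool" where
  "lateral_kernel d KS \<longleftrightarrow>
     (\<forall>\<nu>\<in>space (perp_measure d). perp_norm d \<nu> = 1 \<longrightarrow>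
        (\<lambda>(v, u). KS \<nu> v u) \<in> borel_measurable (vec_measure d \<Otimes>\<^sub>M vec_measure d) \<and>
        (\<forall>v\<in>space (vec_measure d). \<forall>u\<in>space (vec_measure d). 0 \<le> KS \<nu> v u) \<and>
        (\<forall>u\<in>space (vec_measure d). perp_inner d \<nu> (snd u) \<le> 0 \<longrightarrow>
           has_bochner_integral (vec_measure d)
             (\<lambda>v. indicat_real {v. 0 \<le> perp_inner d \<nu> (snd v)} v *
                  (perp_inner d \<nu> (snd v) * KS \<nu> v u))
             \<bar>perp_inner d \<nu> (snd u)\<bar>))"


section \<open>Force without precollisions\<close>

definition impulse :: "(real \<Rightarrow> real \<Rightarrow> real) \<Rightarrow> real \<Rightarrow> real" where
  "impulse k w = w\<^sup>2 + second_moment k w"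

definition F0 :: "nat \<Rightarrow> real \<Rightarrow> (real \<Rightarrow> real \<Rightarrow> real) \<Rightarrow> (vec \<Rightarrow> real) \<Rightarrow> real \<Rightarrow> real" where
  "F0 d r k f0 w =
     measure (perp_measure d) (disk d r) *
       ((LINT u:{u. fst u \<le> w}|vec_measure d. impulse k (fst u - w) * f0 u) -
        (LINT u:{u. fst u \<ge> w}|vec_measure d. impulse k (fst u - w) * f0 u))"

text \<open>The last conjunct is positivity of the minimum of the derivative on the interval.\<close>

definition F0_regular ::
  "nat \<Rightarrow> real \<Rightarrow> (real \<Rightarrow> real \<Rightarrow> real) \<Rightarrow> (vec \<Rightarrow> real) \<Rightarrow> real \<Rightarrow> real \<Rightarrow> bool"
where
  "F0_regular d r k f0 Vinf \<gamma> \<longleftrightarrow>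
     (\<forall>w. integrable (vec_measure d) (\<lambda>u. impulse k (fst u - w) * f0 u)) \<and>
     F0 d r k f0 C1_differentiable_on UNIV \<and>
     mono (F0 d r k f0) \<and>
     (\<forall>w\<in>{Vinf - \<gamma>..Vinf + \<gamma>}. 0 < deriv (F0 d r k f0) w)"

definition max_slope :: "(real \<Rightarrow> real) \<Rightarrow> real \<Rightarrow> real \<Rightarrow> real" where
  "max_slope F Vinf \<gamma> = (SUP w\<in>{Vinf - \<gamma>..Vinf + \<gamma>}. deriv F w)"

definition min_slope :: "(real \<Rightarrow> real) \<Rightarrow> real \<Rightarrow> real \<Rightarrow> real" where
  "min_slope F Vinf \<gamma> = (INF w\<in>{Vinf - \<gamma>..Vinf + \<gamma>}. deriv F w)"


section \<open>The body-particle problem\<close>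

text \<open>
  The sign \<open>\<sigma>\<close> selects the right (\<open>\<sigma> = 1\<close>) or left (\<open>\<sigma> = -1\<close>) end of the cylinder centred
  at \<open>(X t, 0)\<close>. Boundary densities are functions of time, boundary point and velocity;
  \<open>fm\<close> and \<open>fp\<close> stand for the pre- and post-collision densities.
\<close>

type_synonym density = "real \<Rightarrow> vec \<Rightarrow> vec \<Rightarrow> real"

definition end_face :: "nat \<Rightarrow> real \<Rightarrow> real \<Rightarrow> (real \<Rightarrow> real) \<Rightarrow> real \<Rightarrow> real \<Rightarrow> vec set" where
  "end_face d H r X \<sigma> t = {(x, y). x = X t + \<sigma> * H \<and> y \<in> disk d r}"

definition incoming :: "(real \<Rightarrow> real) \<Rightarrow> real \<Rightarrow> real \<Rightarrow> vec \<Rightarrow> bool" where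
  "incoming V \<sigma> t u \<longleftrightarrow> \<sigma> * (fst u - V t) \<le> 0"

definition outgoing :: "(real \<Rightarrow> real) \<Rightarrow> real \<Rightarrow> real \<Rightarrow> vec \<Rightarrow> bool" where
  "outgoing V \<sigma> t v \<longleftrightarrow> \<sigma> * (fst v - V t) \<ge> 0"

definition precollision_times ::
  "nat \<Rightarrow> real \<Rightarrow> real \<Rightarrow> (real \<Rightarrow> real) \<Rightarrow> real \<Rightarrow> real \<Rightarrow> vec \<Rightarrow> vec \<Rightarrow> real set"
where
  "precollision_times d H r X \<sigma> t x u =
     {s\<in>{0<..<t}. backward d x (t - s) u \<in> end_face d H r X \<sigma> s}"

text \<open>
  If precollision times accumulate at \<open>t\<close> there is no latest one and nothing is required; this
  only concerns velocities with horizontal component \<open>V t\<close>.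
\<close>

definition precollision_law ::
  "nat \<Rightarrow> real \<Rightarrow> real \<Rightarrow> (vec \<Rightarrow> real) \<Rightarrow> (real \<Rightarrow> real) \<Rightarrow> density \<Rightarrow> density \<Rightarrow> real \<Rightarrow> real \<Rightarrow> vec \<Rightarrow> vec \<Rightarrow> bool"
where
  "precollision_law d H r f0 X fm fp \<sigma> t x u \<longleftrightarrow>
     (precollision_times d H r X \<sigma> t x u = {} \<longrightarrow> fm t x u = f0 u) \<and>
     (\<forall>\<tau>\<in>precollision_times d H r X \<sigma> t x u.
        (\<forall>s\<in>precollision_times d H r X \<sigma> t x u. s \<le> \<tau>) \<longrightarrow>
          fm t x u = fp \<tau> (backward d x (t - \<tau>) u) u)"

definition reflection_integrand ::
  "(vec \<Rightarrow> vec \<Rightarrow> real) \<Rightarrow> real \<Rightarrow> (vec \<Rightarrow> real) \<Rightarrow> vec \<Rightarrow> vec \<Rightarrow> real"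
where
  "reflection_integrand K w g v u =
     indicat_real {u. (fst u - w) * (fst v - w) \<le> 0} u * (K (hshift w v) (hshift w u) * g u)"

definition end_law ::
  "nat \<Rightarrow> real \<Rightarrow> real \<Rightarrow> (vec \<Rightarrow> vec \<Rightarrow> real) \<Rightarrow> (vec \<Rightarrow> real) \<Rightarrow> (real \<Rightarrow> real) \<Rightarrow> (real \<Rightarrow> real) \<Rightarrow>
     density \<Rightarrow> density \<Rightarrow> real \<Rightarrow> bool"
where
  "end_law d H r K f0 X V fm fp \<sigma> \<longleftrightarrow>
     (\<forall>t\<ge>0. AE (y, u) in perp_measure d \<Otimes>\<^sub>M vec_measure d.
        y \<in> disk d r \<and> incoming V \<sigma> t u \<longrightarrow>
          precollision_law d H r f0 X fm fp \<sigma> t (X t + \<sigma> * H, y) u) \<and>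
     (\<forall>t\<ge>0. AE (y, v) in perp_measure d \<Otimes>\<^sub>M vec_measure d.
        y \<in> disk d r \<and> outgoing V \<sigma> t v \<longrightarrow>
          has_bochner_integral (vec_measure d)
            (reflection_integrand K (V t) (fm t (X t + \<sigma> * H, y)) v)
            (fp t (X t + \<sigma> * H, y) v))"

text \<open>
  Membership of the boundary densities in \<open>L\<^sup>\<infinity>\<close>. The kernel hypotheses do not control the
  reflection of the unperturbed density \<open>f0\<close> at large outgoing speeds: there it can be finite
  almost everywhere and yet essentially unbounded, and then so is \<open>fp\<close> for every motion of the
  body (already at \<open>t = 0\<close>). Therefore \<open>fp\<close> is bounded relative to this reflection. Whenever
  the reflection of \<open>f0\<close> is essentially bounded, the condition says exactly that \<open>fp\<close> is in
  \<open>L\<^sup>\<infinity>\<close>; for outgoing speeds near \<open>V t\<close>, the only ones that are ever involved in a second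
  collision, this is always so by the domination hypothesis.
\<close>

definition end_Linfinity ::
  "nat \<Rightarrow> real \<Rightarrow> real \<Rightarrow> (vec \<Rightarrow> vec \<Rightarrow> real) \<Rightarrow> (vec \<Rightarrow> real) \<Rightarrow> (real \<Rightarrow> real) \<Rightarrow> (real \<Rightarrow> real) \<Rightarrow>
     density \<Rightarrow> density \<Rightarrow> real \<Rightarrow> bool"
where
  "end_Linfinity d H r K f0 X V fm fp \<sigma> \<longleftrightarrow>
     set_borel_measurable (lborel \<Otimes>\<^sub>M (perp_measure d \<Otimes>\<^sub>M vec_measure d))
       {(t, y, u). 0 \<le> t \<and> y \<in> disk d r \<and> incoming V \<sigma> t u}
       (\<lambda>(t, y, u). fm t (X t + \<sigma> * H, y) u) \<and>
     set_borel_measurable (lborel \<Otimes>\<^sub>M (perp_measure d \<Otimes>\<^sub>M vec_measure d))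
       {(t, y, v). 0 \<le> t \<and> y \<in> disk d r \<and> outgoing V \<sigma> t v}
       (\<lambda>(t, y, v). fp t (X t + \<sigma> * H, y) v) \<and>
     (\<exists>M. \<forall>t\<ge>0. AE (y, u) in perp_measure d \<Otimes>\<^sub>M vec_measure d.
        y \<in> disk d r \<and> incoming V \<sigma> t u \<longrightarrow> \<bar>fm t (X t + \<sigma> * H, y) u\<bar> \<le> M) \<and>
     (\<exists>M. \<forall>t\<ge>0. AE (y, v) in perp_measure d \<Otimes>\<^sub>M vec_measure d.
        y \<in> disk d r \<and> outgoing V \<sigma> t v \<longrightarrow>
          \<bar>fp t (X t + \<sigma> * H, y) v\<bar> \<le>
            M * (1 + (LINT u|vec_measure d. reflection_integrand K (V t) f0 v u)))"

text \<open>
  The rim is left out: it has measure zero in the boundary and is shared with the ends. The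
  lateral densities never feed back into those on the ends.
\<close>

definition lateral_face :: "nat \<Rightarrow> real \<Rightarrow> real \<Rightarrow> (real \<Rightarrow> real) \<Rightarrow> real \<Rightarrow> vec set" where
  "lateral_face d H r X t =
     {(x, y). \<bar>x - X t\<bar> < H \<and> y \<in> space (perp_measure d) \<and> perp_norm d y = r}"

definition lateral_law ::
  "nat \<Rightarrow> real \<Rightarrow> real \<Rightarrow> (perp \<Rightarrow> vec \<Rightarrow> vec \<Rightarrow> real) \<Rightarrow> (vec \<Rightarrow> real) \<Rightarrow> (real \<Rightarrow> real) \<Rightarrow> density \<Rightarrow> density \<Rightarrow> bool"
where
  "lateral_law d H r KS f0 X fm fp \<longleftrightarrow>
     (\<forall>t\<ge>0. \<forall>x\<in>lateral_face d H r X t.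
        let \<nu> = (\<lambda>i\<in>{1..<d}. snd x i / r) in
          (AE u in vec_measure d. perp_inner d \<nu> (snd u) \<le> 0 \<longrightarrow> fm t x u = f0 u) \<and>
          (AE v in vec_measure d. 0 \<le> perp_inner d \<nu> (snd v) \<longrightarrow>
             fp t x v = (LINT u:{u. perp_inner d \<nu> (snd u) \<le> 0}|vec_measure d. KS \<nu> v u * f0 u)))"

definition force ::
  "nat \<Rightarrow> real \<Rightarrow> real \<Rightarrow> (real \<Rightarrow> real \<Rightarrow> real) \<Rightarrow> (real \<Rightarrow> real) \<Rightarrow> (real \<Rightarrow> real) \<Rightarrow> density \<Rightarrow> real \<Rightarrow> real"
where
  "force d H r k X V fm t =
     (LINT y:disk d r|perp_measure d. LINT u:{u. fst u \<le> V t}|vec_measure d.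
        impulse k (fst u - V t) * fm t (X t + H, y) u) -
     (LINT y:disk d r|perp_measure d. LINT u:{u. fst u \<ge> V t}|vec_measure d.
        impulse k (fst u - V t) * fm t (X t - H, y) u)"

definition force_convergent ::
  "nat \<Rightarrow> real \<Rightarrow> real \<Rightarrow> (real \<Rightarrow> real \<Rightarrow> real) \<Rightarrow> (real \<Rightarrow> real) \<Rightarrow> (real \<Rightarrow> real) \<Rightarrow> density \<Rightarrow> real \<Rightarrow> bool"
where
  "force_convergent d H r k X V fm t \<longleftrightarrow>
     (\<forall>\<sigma>\<in>{1, -1}. set_integrable (perp_measure d \<Otimes>\<^sub>M vec_measure d)
        {(y, u). y \<in> disk d r \<and> incoming V \<sigma> t u}
        (\<lambda>(y, u). impulse k (fst u - V t) * fm t (X t + \<sigma> * H, y) u))"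

definition body_particle_solution ::
  "nat \<Rightarrow> real \<Rightarrow> real \<Rightarrow> real \<Rightarrow> (vec \<Rightarrow> vec \<Rightarrow> real) \<Rightarrow> (real \<Rightarrow> real \<Rightarrow> real) \<Rightarrow>
     (perp \<Rightarrow> vec \<Rightarrow> vec \<Rightarrow> real) \<Rightarrow> (vec \<Rightarrow> real) \<Rightarrow> real \<Rightarrow> real \<Rightarrow>
     (real \<Rightarrow> real) \<Rightarrow> (real \<Rightarrow> real) \<Rightarrow> density \<Rightarrow> density \<Rightarrow> bool"
where
  "body_particle_solution d H r E K k KS f0 X0 V0 X V fm fp \<longleftrightarrow>
     X 0 = X0 \<and> V 0 = V0 \<and>
     (\<forall>t\<ge>0. (X has_real_derivative V t) (at t within {0..})) \<and>
     (\<forall>t\<ge>0. force_convergent d H r k X V fm t) \<and>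
     (\<forall>t\<ge>0. (V has_real_derivative E - force d H r k X V fm t) (at t within {0..})) \<and>
     continuous_on {0..} (\<lambda>t. E - force d H r k X V fm t) \<and>
     (\<forall>\<sigma>\<in>{1, -1}. end_law d H r K f0 X V fm fp \<sigma> \<and> end_Linfinity d H r K f0 X V fm fp \<sigma>) \<and>
     lateral_law d H r KS f0 X fm fp"

end

theory Submission
  imports Defs "HOL-Complex_Analysis.Great_Picard"
begin

text \<open>
  Write \<open>W = V - V\<^sub>\<infinity>\<close>, so that \<open>W' =
  -(F\<^sub>0(V\<^sub>\<infinity> + W) - F\<^sub>0(V\<^sub>\<infinity>)) - R\<close>, where
  \<open>R\<close> is the force due to particles that have collided before. A particle that hits an
  end at times \<open>s < t\<close> travels at the mean velocity of the body on \<open>[s,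
  t]\<close>, and its transversal velocity is \<open>O(1/t)\<close>: this produces the powers
  \<open>\<gamma>\<^sup>p\<^sup>+\<^sup>1\<close> and \<open>t\<^sup>d\<^sup>+\<^sup>p\<close>.
  While the body decelerates it never catches up with the particles reflected at its right end, so
  only the left end contributes; there the reversal criterion makes the reflected density smaller
  than \<open>f\<^sub>0\<close>, hence \<open>R\<close> is positive and pushes \<open>W\<close>
  below zero. Explicit barriers for \<open>W\<close> turn this into the two-sided estimate.

  Since the laws hold only almost everywhere, they are transported along the flow by the fact that
  the map to the latest precollision pulls null sets back to null sets. For the existence part the
  boundary densities of a given motion are a fixed point of a contraction (only relative velocities
  of order \<open>\<gamma>\<close> lead to a second collision), they depend continuously on the
  motion, and a delay scheme with a compactness argument yields a motion driven by its own force;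
  the a priori estimate removes the truncation.
\<close>

text \<open>The obstacle is circularity: the force at time \<open>t\<close> depends on the whole
  past, and its sign is known only while the motion keeps a certain shape. Hence a continuity
  argument: as long as \<open>W\<close> stays between the barriers the mean velocities are
  controlled, thus \<open>R\<close> is, and then the barriers hold strictly a little longer. Once
  \<open>W\<close> is negative the body may accelerate and the right end does contribute; but by
  then \<open>- W\<close> is at most of order \<open>\<gamma> powr (p + 1)\<close>, so that
  contribution is this quantity to the power \<open>p + 1\<close>, negligible against the left end,
  which still feels the displacement of order \<open>\<gamma>\<close> made at the start. The
  constants come from slope bounds on a fixed neighbourhood of \<open>Vinf\<close>, because
  \<open>B0\<close> and \<open>Binf\<close> vary with \<open>\<gamma>\<close>. An essential bound on
  the densities carries no transversal decay; since reflection multiplies by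
  \<open>b (snd v)\<close>, one positive lower bound of \<open>b\<close> near zero upgrades it to a
  bound by a multiple of \<open>b\<close>. The existence part can borrow the same a priori estimate
  because a truncated motion obeys the same force bounds for as long as the truncation is
  inactive.\<close>

declare One_nat_def [simp del]

section \<open>Lebesgue measure on the transversal space\<close>

interpretation lb: product_sigma_finite "\<lambda>_::nat. lborel :: real measure"
  by (simp add: product_sigma_finite_def sigma_finite_lborel)

interpretation perp: sigma_finite_measure "perp_measure d" for d
  unfolding perp_measure_def by (rule lb.sigma_finite) simp

interpretation lborel_perp: pair_sigma_finite "lborel :: real measure" "perp_measure d" for d
  by standard

interpretation vec: sigma_finite_measure "vec_measure d" for d
  unfolding vec_measure_def by (rule lborel_perp.sigma_finite_measure_axioms)

interpretation perp_vec: pair_sigma_finite "perp_measure d" "vec_measure d" for d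
  by standard

interpretation lborel_vec: pair_sigma_finite "lborel :: real measure" "vec_measure d" for d
  by standard

interpretation pv: sigma_finite_measure "perp_measure d \<Otimes>\<^sub>M vec_measure d" for d
  by (rule perp_vec.sigma_finite_measure_axioms)

interpretation lborel_pv: pair_sigma_finite "lborel :: real measure" "perp_measure d \<Otimes>\<^sub>M vec_measure d" for d
  by standard

lemma space_perp_measure: "space (perp_measure d) = extensional {1..<d}"
  by (simp add: perp_measure_def space_PiM PiE_def)

lemma space_vec_measure: "space (vec_measure d) = UNIV \<times> space (perp_measure d)"
  by (simp add: vec_measure_def space_pair_measure)

lemma perp_component_measurable: "i \<in> {1..<d} \<Longrightarrow> (\<lambda>y. y i) \<in> borel_measurable (perp_measure d)"
  unfolding perp_measure_def using measurable_component_singleton[of i "{1..<d}" "\<lambda>_. lborel :: real measure"] by simp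

lemma measurable_perp_component:
  assumes "f \<in> M \<rightarrow>\<^sub>M perp_measure d" "i \<in> {1..<d}"
  shows "(\<lambda>x. f x i) \<in> borel_measurable M"
  by (rule measurable_compose[OF assms(1) perp_component_measurable[OF assms(2)]])

lemma measurable_perp_restrict:
  assumes "\<And>i. i \<in> {1..<d} \<Longrightarrow> (\<lambda>x. f x i) \<in> borel_measurable M"
  shows "(\<lambda>x. \<lambda>i\<in>{1..<d}. f x i) \<in> M \<rightarrow>\<^sub>M perp_measure d"
  unfolding perp_measure_def by (rule measurable_restrict) (use assms in auto)

definition pback :: "nat \<Rightarrow> perp \<Rightarrow> real \<Rightarrow> perp \<Rightarrow> perp" where
  "pback d y a w = (\<lambda>i\<in>{1..<d}. y i - a * w i)"

lemma backward_eq: "backward d x a u = (fst x - a * fst u, pback d (snd x) a (snd u))"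
  by (simp add: backward_def pback_def)

lemma measurable_pback [measurable (raw)]:
  assumes "f \<in> M \<rightarrow>\<^sub>M perp_measure d" "g \<in> M \<rightarrow>\<^sub>M perp_measure d" "a \<in> borel_measurable M"
  shows "(\<lambda>x. pback d (f x) (a x) (g x)) \<in> M \<rightarrow>\<^sub>M perp_measure d"
  unfolding pback_def using measurable_perp_component[OF assms(1)] measurable_perp_component[OF assms(2)] assms(3)
  by (intro measurable_perp_restrict borel_measurable_diff borel_measurable_times)

lemma pback_in_space: "pback d y a w \<in> space (perp_measure d)"
  by (simp add: pback_def space_perp_measure)

lemma pback_pback: "pback d (pback d y a w) c w = pback d y (a + c) w"
  by (auto simp: pback_def algebra_simps)

lemma measurable_perp_norm [measurable (raw)]:
  assumes "f \<in> M \<rightarrow>\<^sub>M perp_measure d"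
  shows "(\<lambda>x. perp_norm d (f x)) \<in> borel_measurable M"
proof -
  have "(\<lambda>x. f x i) \<in> borel_measurable M" if "i \<in> {1..<d}" for i
    using assms that by (rule measurable_perp_component)
  then show ?thesis unfolding perp_norm_def L2_set_def by auto
qed

lemma sets_disk [measurable]: "disk d r \<in> sets (perp_measure d)"
  unfolding disk_def by measurable

text \<open>The volume of a ball is never computed: cubes have an explicit product measure, the disk
  lies between \<open>pbox d (r / d)\<close> and \<open>pbox d r\<close>, and the loss only affects
  constants. For \<open>d = 1\<close> the cube is the whole one-point space, of measure one.\<close>

definition pbox :: "nat \<Rightarrow> real \<Rightarrow> perp set" where
  "pbox d h = {w \<in> space (perp_measure d). \<forall>i\<in>{1..<d}. \<bar>w i\<bar> \<le> h}"

lemma pbox_eq_PiE: "pbox d h = PiE {1..<d} (\<lambda>_. {-h..h})"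
proof -
  have "\<bar>x\<bar> \<le> h \<longleftrightarrow> x \<in> {-h..h}" for x :: real by auto
  then show ?thesis unfolding pbox_def space_perp_measure PiE_def Pi_def by blast
qed

lemma sets_pbox [measurable]: "pbox d h \<in> sets (perp_measure d)"
  unfolding pbox_eq_PiE perp_measure_def by (rule sets_PiM_I_finite) auto

lemma emeasure_pbox: "0 \<le> h \<Longrightarrow> emeasure (perp_measure d) (pbox d h) = ennreal ((2 * h) ^ (d - 1))"
  unfolding pbox_eq_PiE perp_measure_def by (subst lb.emeasure_PiM) (auto simp: ennreal_power)

lemma measure_pbox: "0 \<le> h \<Longrightarrow> measure (perp_measure d) (pbox d h) = (2 * h) ^ (d - 1)"
  by (simp add: measure_def emeasure_pbox)

lemma component_le_perp_norm: "i \<in> {1..<d} \<Longrightarrow> \<bar>y i\<bar> \<le> perp_norm d y"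
  unfolding perp_norm_def using member_le_L2_set[of "{1..<d}" i "\<lambda>i. \<bar>y i\<bar>"] by (simp add: L2_set_def)

lemma disk_subset_pbox: "disk d r \<subseteq> pbox d r"
  unfolding disk_def pbox_def using component_le_perp_norm order_trans by blast

lemma pbox_subset_disk:
  assumes "0 \<le> r" "1 \<le> d"
  shows "pbox d (r / d) \<subseteq> disk d r"
proof
  fix w assume w: "w \<in> pbox d (r / d)"
  have "perp_norm d w \<le> (\<Sum>i\<in>{1..<d}. \<bar>w i\<bar>)"
    unfolding perp_norm_def by (rule L2_set_le_sum_abs)
  also have "\<dots> \<le> (\<Sum>i\<in>{1..<d}. r / d)"
    using w by (intro sum_mono) (auto simp: pbox_def)
  also have "\<dots> = (real d - 1) * (r / d)" using assms by (simp add: of_nat_diff)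
  also have "\<dots> \<le> real d * (r / d)" using assms by (intro mult_right_mono) auto
  also have "\<dots> = r" using assms by simp
  finally show "w \<in> disk d r" using w by (auto simp: disk_def pbox_def)
qed

lemma emeasure_disk_finite:
  assumes "0 \<le> r" shows "emeasure (perp_measure d) (disk d r) < \<infinity>"
proof -
  have "emeasure (perp_measure d) (disk d r) \<le> ennreal ((2 * r) ^ (d - 1))"
    using emeasure_mono[OF disk_subset_pbox sets_pbox, of d r] assms by (simp only: emeasure_pbox)
  then show ?thesis by (rule le_less_trans) simp
qed

text \<open>Boxes determine the product measure, and on a box the claim is the translation
  invariance of each one-dimensional factor.\<close>

lemma perp_measure_shift:
  "distr (perp_measure d) (perp_measure d) (\<lambda>y. \<lambda>i\<in>{1..<d}. y i + c i) = perp_measure d"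
proof -
  let ?f = "\<lambda>y. \<lambda>i\<in>{1..<d}. y i + c i"
  have f[measurable]: "?f \<in> perp_measure d \<rightarrow>\<^sub>M perp_measure d"
    by (intro measurable_perp_restrict borel_measurable_add perp_component_measurable) auto
  show ?thesis
    unfolding perp_measure_def
  proof (rule lb.PiM_eqI)
    fix A :: "nat \<Rightarrow> real set" assume A: "\<And>i. i \<in> {1..<d} \<Longrightarrow> A i \<in> sets lborel"
    have "emeasure (distr (perp_measure d) (perp_measure d) ?f) (PiE {1..<d} A)
       = emeasure (perp_measure d) (?f -` PiE {1..<d} A \<inter> space (perp_measure d))"
      using A by (intro emeasure_distr f) (auto simp: perp_measure_def intro!: sets_PiM_I_finite)
    also have "?f -` PiE {1..<d} A \<inter> space (perp_measure d) = PiE {1..<d} (\<lambda>i. (\<lambda>x. x + c i) -` A i)"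
      by (auto simp: space_perp_measure PiE_def Pi_def)
    also have "emeasure (perp_measure d) \<dots> = (\<Prod>i\<in>{1..<d}. emeasure lborel ((\<lambda>x. x + c i) -` A i))"
      unfolding perp_measure_def using A
      by (intro lb.emeasure_PiM) (auto intro!: measurable_sets_borel[OF _ A[simplified]])
    also have "\<dots> = (\<Prod>i\<in>{1..<d}. emeasure lborel (A i))"
    proof (rule prod.cong[OF refl])
      fix i assume i: "i \<in> {1..<d}"
      have "emeasure lborel (A i) = emeasure (distr lborel borel ((+) (c i))) (A i)"
        by (simp add: lborel_distr_plus)
      also have "\<dots> = emeasure lborel ((\<lambda>x. x + c i) -` A i)"
        using A[OF i] by (subst emeasure_distr) (auto simp: add.commute[of _ "c i"])
      finally show "emeasure lborel ((\<lambda>x. x + c i) -` A i) = emeasure lborel (A i)" by simp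
    qed
    finally show "emeasure (distr (Pi\<^sub>M {1..<d} (\<lambda>_. lborel)) (Pi\<^sub>M {1..<d} (\<lambda>_. lborel)) ?f) (PiE {1..<d} A)
       = (\<Prod>i\<in>{1..<d}. emeasure lborel (A i))" unfolding perp_measure_def .
  qed (auto simp: perp_measure_def)
qed

lemma nn_integral_pback_shift:
  assumes [measurable]: "f \<in> borel_measurable (perp_measure d)"
  shows "(\<integral>\<^sup>+ y. f (pback d y a w) \<partial>perp_measure d) = (\<integral>\<^sup>+ y. f y \<partial>perp_measure d)"
proof -
  have m[measurable]: "(\<lambda>y. \<lambda>i\<in>{1..<d}. y i + (- a * w i)) \<in> perp_measure d \<rightarrow>\<^sub>M perp_measure d"
    by (intro measurable_perp_restrict borel_measurable_add perp_component_measurable) auto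
  have "(\<integral>\<^sup>+ y. f y \<partial>perp_measure d) =
    (\<integral>\<^sup>+ y. f y \<partial>distr (perp_measure d) (perp_measure d) (\<lambda>y. \<lambda>i\<in>{1..<d}. y i + (- a * w i)))"
    by (simp only: perp_measure_shift)
  also have "\<dots> = (\<integral>\<^sup>+ y. f (\<lambda>i\<in>{1..<d}. y i + (- a * w i)) \<partial>perp_measure d)"
    by (rule nn_integral_distr[OF m]) (simp add: assms)
  finally show ?thesis unfolding pback_def by (simp only: add_uminus_conv_diff minus_mult_left[symmetric])
qed

text \<open>Slicing along the first coordinate: with the others fixed, the sphere equation is
  quadratic and has at most two solutions. For \<open>d = 1\<close> the norm is zero and the set is
  empty. Grazing the rim is where \<open>hit\<close> jumps, so the continuity arguments rest on this
  nullity.\<close>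

lemma sphere_null:
  assumes "a \<noteq> 0" "0 < r"
  shows "{w \<in> space (perp_measure d). perp_norm d (pback d y a w) = r} \<in> null_sets (perp_measure d)"
    (is "?N \<in> _")
proof -
  \<comment> \<open>\<open>y\<close> is arbitrary; only its coordinates in \<open>{1..<d}\<close>
    enter, and restricting it to them puts it into the space, so that measurability applies.\<close>
  have y: "pback d y a w = pback d (\<lambda>i\<in>{1..<d}. y i) a w" for w by (auto simp: pback_def)
  have [measurable]: "?N \<in> sets (perp_measure d)"
    unfolding y[of _] by (measurable) (auto simp: space_perp_measure)
  have "emeasure (perp_measure d) ?N = 0"
  proof (cases "{1..<d} = {}")
    case True
    then have "?N = {}" using \<open>0 < r\<close> by (auto simp: perp_norm_def)
    then show ?thesis by (metis emeasure_empty)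
  next
    case False
    then have I: "{1..<d} = insert 1 {2..<d}" by auto
    have meas: "?N \<in> sets (Pi\<^sub>M (insert 1 {2..<d}) (\<lambda>_. lborel))"
      using \<open>?N \<in> sets (perp_measure d)\<close> unfolding perp_measure_def I .
    have "emeasure (perp_measure d) ?N = (\<integral>\<^sup>+ w. indicator ?N w \<partial>Pi\<^sub>M (insert 1 {2..<d}) (\<lambda>_. lborel))"
      using nn_integral_indicator[OF \<open>?N \<in> sets (perp_measure d)\<close>] unfolding perp_measure_def I by (rule sym)
    also have "\<dots> = (\<integral>\<^sup>+ w. (\<integral>\<^sup>+ x. indicator ?N (w(1 := x)) \<partial>lborel) \<partial>Pi\<^sub>M {2..<d} (\<lambda>_. lborel))"
      using meas by (intro lb.product_nn_integral_insert) (auto intro!: borel_measurable_indicator)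
    also have "\<dots> = (\<integral>\<^sup>+ w. 0 \<partial>Pi\<^sub>M {2..<d} (\<lambda>_. lborel :: real measure))"
    proof (rule nn_integral_cong)
      fix w :: perp assume "w \<in> space (Pi\<^sub>M {2..<d} (\<lambda>_. lborel))"
      define q where "q = r\<^sup>2 - (\<Sum>i\<in>{2..<d}. (y i - a * w i)\<^sup>2)"
      have sub: "{x. w(1 := x) \<in> ?N} \<subseteq> {(y 1 - sqrt q) / a, (y 1 + sqrt q) / a}"
      proof
        fix x assume "x \<in> {x. w(1 := x) \<in> ?N}"
        then have n: "perp_norm d (pback d y a (w(1 := x))) = r" by simp
        have "perp_norm d (pback d y a (w(1 := x))) = sqrt (\<Sum>i\<in>{1..<d}. (y i - a * (w(1 := x)) i)\<^sup>2)"
          unfolding perp_norm_def L2_set_def pback_def by (intro arg_cong[of _ _ sqrt] sum.cong) auto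
        also have "(\<Sum>i\<in>{1..<d}. (y i - a * (w(1 := x)) i)\<^sup>2) = (y 1 - a * x)\<^sup>2 + (\<Sum>i\<in>{2..<d}. (y i - a * w i)\<^sup>2)"
          unfolding I by (subst sum.insert) (auto intro!: sum.cong)
        finally have e: "r = sqrt ((y 1 - a * x)\<^sup>2 + (\<Sum>i\<in>{2..<d}. (y i - a * w i)\<^sup>2))"
          unfolding n .
        have "0 \<le> (y 1 - a * x)\<^sup>2 + (\<Sum>i\<in>{2..<d}. (y i - a * w i)\<^sup>2)"
          by (intro add_nonneg_nonneg sum_nonneg) auto
        then have "(y 1 - a * x)\<^sup>2 = q" unfolding q_def e by (subst real_sqrt_pow2) auto
        then have "\<bar>y 1 - a * x\<bar> = sqrt q" using real_sqrt_abs[of "y 1 - a * x"] by simp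
        then have "a * x = y 1 - sqrt q \<or> a * x = y 1 + sqrt q" by linarith
        then show "x \<in> {(y 1 - sqrt q) / a, (y 1 + sqrt q) / a}"
          using \<open>a \<noteq> 0\<close> by (auto simp: field_simps)
      qed
      have "(\<integral>\<^sup>+ x. indicator ?N (w(1 := x)) \<partial>lborel) = (\<integral>\<^sup>+ x. indicator {x. w(1 := x) \<in> ?N} x \<partial>lborel)"
        by (intro nn_integral_cong) (auto simp: indicator_def)
      also have "\<dots> \<le> (\<integral>\<^sup>+ x. indicator {(y 1 - sqrt q) / a, (y 1 + sqrt q) / a} x \<partial>lborel)"
        using sub by (intro nn_integral_mono) (auto simp: indicator_def)
      also have "\<dots> = emeasure lborel {(y 1 - sqrt q) / a, (y 1 + sqrt q) / a}"
        by (rule nn_integral_indicator) auto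
      also have "\<dots> = 0" by (rule emeasure_lborel_countable) auto
      finally show "(\<integral>\<^sup>+ x. indicator ?N (w(1 := x)) \<partial>lborel) = 0" by simp
    qed
    finally show ?thesis by simp
  qed
  then show ?thesis using \<open>?N \<in> sets (perp_measure d)\<close> by (rule null_setsI)
qed

section \<open>Integrals and almost everywhere statements on products\<close>

lemma has_bochner_integral_pair_mult:
  fixes f :: "'a \<Rightarrow> real" and g :: "'b \<Rightarrow> real"
  assumes "sigma_finite_measure M" "sigma_finite_measure N"
    and f: "has_bochner_integral M f x" and g: "has_bochner_integral N g y"
  shows "has_bochner_integral (M \<Otimes>\<^sub>M N) (\<lambda>z. f (fst z) * g (snd z)) (x * y)"
proof -
  interpret pair_sigma_finite M N using assms by (simp add: pair_sigma_finite_def)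
  have [measurable]: "f \<in> borel_measurable M" "g \<in> borel_measurable N"
    and fi: "integrable M f" and gi: "integrable N g"
    using f g by (auto simp: has_bochner_integral_iff)
  have i: "integrable (M \<Otimes>\<^sub>M N) (\<lambda>(a, b). f a * g b)"
    using fi gi by (intro Fubini_integrable) (auto simp: abs_mult)
  have "(\<integral>z. (\<lambda>(a, b). f a * g b) z \<partial>(M \<Otimes>\<^sub>M N)) = (\<integral>a. \<integral>b. f a * g b \<partial>N \<partial>M)"
    using integral_fst'[OF i] by simp
  also have "\<dots> = x * y"
    using f g by (simp add: has_bochner_integral_iff)
  finally show ?thesis using i by (simp add: has_bochner_integral_iff case_prod_beta')
qed

lemma AE_fst:
  assumes "sigma_finite_measure N" "AE x in M. Q x"
  shows "AE z in M \<Otimes>\<^sub>M N. Q (fst z)"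
proof -
  interpret sigma_finite_measure N by fact
  obtain A where A: "A \<in> null_sets M" "{x\<in>space M. \<not> Q x} \<subseteq> A"
    using assms(2) by (auto simp: eventually_ae_filter)
  have "A \<times> space N \<in> null_sets (M \<Otimes>\<^sub>M N)"
    using A by (auto simp: null_sets_def emeasure_pair_measure_Times)
  then show ?thesis
    by (rule AE_I') (use A in \<open>auto simp: space_pair_measure\<close>)
qed

lemma AE_snd:
  assumes "sigma_finite_measure N" "AE x in N. Q x"
  shows "AE z in M \<Otimes>\<^sub>M N. Q (snd z)"
proof -
  interpret sigma_finite_measure N by fact
  obtain A where A: "A \<in> null_sets N" "{x\<in>space N. \<not> Q x} \<subseteq> A"
    using assms(2) by (auto simp: eventually_ae_filter)
  have "space M \<times> A \<in> null_sets (M \<Otimes>\<^sub>M N)"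
    using A by (auto simp: null_sets_def emeasure_pair_measure_Times)
  then show ?thesis
    by (rule AE_I') (use A in \<open>auto simp: space_pair_measure\<close>)
qed

section \<open>The latest precollision time\<close>

text \<open>Oriented as for the left end, where incoming particles have \<open>z > V t\<close>: the
  strict inequality says that at time \<open>s\<close> the backward path lies to the right of the
  end. Near \<open>t\<close> this fails, so the supremum is the last crossing. An open condition
  instead of an equality makes \<open>tau\<close> monotone in \<open>z\<close> and measurable. The
  inserted 0 makes the supremum exist, and the value 0 stands for no crossing at a positive
  time.\<close>

definition tau :: "(real \<Rightarrow> real) \<Rightarrow> real \<Rightarrow> real \<Rightarrow> real" where
  "tau X t z = Sup (insert 0 {s. 0 < s \<and> s < t \<and> (t - s) * z < X t - X s})"

lemma tau_bdd: "bdd_above (insert 0 {s. 0 < s \<and> s < t \<and> (t - s) * z < X t - X (s::real)})"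
  by (rule bdd_aboveI[of _ "max 0 t"]) auto

lemma tau_nonneg: "0 \<le> tau X t z"
  unfolding tau_def by (rule cSup_upper[OF _ tau_bdd]) simp

lemma less_tau_iff:
  assumes "0 \<le> a"
  shows "a < tau X t z \<longleftrightarrow> (\<exists>s. a < s \<and> s < t \<and> (t - s) * z < X t - X s)"
  unfolding tau_def less_cSup_iff[OF insert_not_empty tau_bdd] using assms by (auto intro: order_le_less_trans)

lemma tau_le: "0 \<le> t \<Longrightarrow> tau X t z \<le> t"
  by (meson less_tau_iff linorder_not_less order.asym)

lemma tau_eq_0: "t \<le> 0 \<Longrightarrow> tau X t z = 0"
  using less_tau_iff[of 0 X t z] tau_nonneg[of X t z] by force

lemma tau_ge: "0 < s \<Longrightarrow> s < t \<Longrightarrow> (t - s) * z < X t - X s \<Longrightarrow> s \<le> tau X t z"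
  unfolding tau_def by (rule cSup_upper[OF _ tau_bdd]) simp

lemma tau_cong:
  assumes "\<And>s. 0 < s \<Longrightarrow> s \<le> t \<Longrightarrow> X s = Y s"
  shows "tau X t z = tau Y t z"
proof -
  have "{s. 0 < s \<and> s < t \<and> (t - s) * z < X t - X s} = {s. 0 < s \<and> s < t \<and> (t - s) * z < Y t - Y s}"
    using assms[of t] assms by auto
  then show ?thesis by (simp add: tau_def)
qed

lemma tau_antimono: "z \<le> z' \<Longrightarrow> tau X t z' \<le> tau X t z"
  unfolding tau_def
  by (rule cSup_subset_mono[OF _ tau_bdd]) (auto intro: order_le_less_trans[OF mult_left_mono])

lemma countable_tau_discont: "countable {z. \<not> isCont (tau X t) z}"
proof -
  have "mono (\<lambda>z. tau X t (- z))" by (rule monoI) (simp add: tau_antimono)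
  then have c: "countable (uminus ` {z. \<not> isCont (\<lambda>z. tau X t (- z)) z})"
    by (intro countable_image mono_ctble_discont)
  have "{z. \<not> isCont (tau X t) z} \<subseteq> uminus ` {z. \<not> isCont (\<lambda>z. tau X t (- z)) z}"
  proof
    fix z assume z: "z \<in> {z. \<not> isCont (tau X t) z}"
    have "\<not> isCont (\<lambda>z. tau X t (- z)) (- z)"
    proof
      assume "isCont (\<lambda>z. tau X t (- z)) (- z)"
      moreover have "isCont uminus z" by (intro continuous_intros)
      ultimately show False
        using z isCont_o2[of z uminus "\<lambda>z. tau X t (- z)"] by simp
    qed
    then show "z \<in> uminus ` {z. \<not> isCont (\<lambda>z. tau X t (- z)) z}"
      by (intro image_eqI[of _ _ "- z"]) auto
  qed
  then show ?thesis using c by (rule countable_subset)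
qed

locale trajectory =
  fixes X V :: "real \<Rightarrow> real"
  assumes deriv: "\<And>t. 0 \<le> t \<Longrightarrow> (X has_real_derivative V t) (at t within {0..})"
    and contV: "continuous_on {0..} V"
begin

lemma contX: "continuous_on {0..} X"
  using deriv by (intro DERIV_continuous_on) auto

lemma deriv_at: "0 < t \<Longrightarrow> (X has_real_derivative V t) (at t)"
  using deriv[of t] at_within_interior[of t "{0..}"] by simp

lemma isContX: "0 < t \<Longrightarrow> isCont X t"
  using deriv_at DERIV_isCont by blast

lemma isContV: "0 < t \<Longrightarrow> isCont V t"
  using contV continuous_on_interior[of "{0..}" V t] by simp

lemma mean_value:
  assumes "0 \<le> s" "s < t"
  obtains r where "s < r" "r < t" "X t - X s = (t - s) * V r"
proof -
  have c: "continuous_on {s..t} X"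
    using contX by (rule continuous_on_subset) (use assms in auto)
  obtain l r where r: "s < r" "r < t" "DERIV X r :> l" "X t - X s = (t - s) * l"
    using MVT[OF \<open>s < t\<close> c] deriv_at assms
    by (meson order_le_less_trans real_differentiable_def)
  then have "l = V r" using deriv_at[of r] assms DERIV_unique by force
  then show thesis using r that by blast
qed

text \<open>By continuity \<open>V\<close> stays below \<open>z\<close> near \<open>t\<close>, and
  so do the mean velocities. Hence contacts cannot accumulate at \<open>t\<close> for a strictly
  incoming velocity.\<close>

lemma near_end:
  assumes "0 < t" "V t < z"
  obtains \<delta> where "0 < \<delta>" "\<delta> < t" "\<And>s. t - \<delta> < s \<Longrightarrow> s < t \<Longrightarrow> X t - X s < (t - s) * z"
proof -
  have "eventually (\<lambda>r. V r < z) (at t)"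
    using isContV[OF assms(1)] assms(2) unfolding isCont_def by (rule order_tendstoD(2))
  then obtain e where e: "e > 0" "\<And>r. r \<noteq> t \<Longrightarrow> dist r t < e \<Longrightarrow> V r < z"
    unfolding eventually_at by auto
  show thesis
  proof (rule that[of "min e t / 2"])
    fix s assume s: "t - min e t / 2 < s" "s < t"
    then have "0 \<le> s" using assms by linarith
    from mean_value[OF this s(2)] obtain r where r: "s < r" "r < t" "X t - X s = (t - s) * V r" .
    have "V r < z" using r s e(1) assms by (intro e) (auto simp: dist_real_def)
    then show "X t - X s < (t - s) * z" using r s by simp
  qed (use e assms in auto)
qed

text \<open>Limits at the supremum from both sides: no time after it satisfies the strict
  inequality, which gives one direction; and the reverse strict inequality there would persist to
  its left, where admissible times must be found arbitrarily close.\<close>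

lemma tau_root:
  assumes "V t < z" "0 < tau X t z"
  shows "tau X t z < t" "X t - X (tau X t z) = (t - tau X t z) * z"
proof -
  let ?\<tau> = "tau X t z"
  have t: "0 < t" using assms(2) tau_eq_0[of t X z] by linarith
  obtain \<delta> where \<delta>: "0 < \<delta>" "\<delta> < t" "\<And>s. t - \<delta> < s \<Longrightarrow> s < t \<Longrightarrow> X t - X s < (t - s) * z"
    using near_end[OF t assms(1)] by blast
  have "\<not> t - \<delta> < ?\<tau>"
    using \<delta> by (subst less_tau_iff) (auto dest: order.asym)
  then show lt: "?\<tau> < t" using \<delta> by linarith
  have cont: "isCont (\<lambda>s. X t - X s - (t - s) * z) ?\<tau>"
    using isContX[OF assms(2)] by (intro continuous_intros)
  have "X t - X ?\<tau> - (t - ?\<tau>) * z \<le> 0"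
  proof (rule tendsto_upperbound)
    show "((\<lambda>s. X t - X s - (t - s) * z) \<longlongrightarrow> X t - X ?\<tau> - (t - ?\<tau>) * z) (at_right ?\<tau>)"
      using cont unfolding isCont_def by (rule filterlim_mono) (auto intro: at_le)
    show "\<forall>\<^sub>F s in at_right ?\<tau>. X t - X s - (t - s) * z \<le> 0"
      unfolding eventually_at_right[OF lt]
    proof (intro exI[of _ t] conjI lt allI impI)
      fix s assume "?\<tau> < s" "s < t"
      then have "\<not> (t - s) * z < X t - X s"
        using tau_ge[of s t z X] assms(2) by force
      then show "X t - X s - (t - s) * z \<le> 0" by simp
    qed
  qed simp
  moreover have "\<not> X t - X ?\<tau> - (t - ?\<tau>) * z < 0"
  proof
    assume neg: "X t - X ?\<tau> - (t - ?\<tau>) * z < 0"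
    have "\<forall>\<^sub>F s in at_left ?\<tau>. X t - X s - (t - s) * z < 0"
    proof (rule order_tendstoD(2)[OF _ neg])
      show "((\<lambda>s. X t - X s - (t - s) * z) \<longlongrightarrow> X t - X ?\<tau> - (t - ?\<tau>) * z) (at_left ?\<tau>)"
        using cont unfolding isCont_def by (rule filterlim_mono) (auto intro: at_le)
    qed
    then obtain b where b: "b < ?\<tau>" "\<And>s. b < s \<Longrightarrow> s < ?\<tau> \<Longrightarrow> X t - X s - (t - s) * z < 0"
      unfolding eventually_at_left[OF assms(2)] by blast
    have "max 0 b < ?\<tau>" using assms(2) b by simp
    then obtain s where s: "max 0 b < s" "s < t" "(t - s) * z < X t - X s"
      by (subst (asm) less_tau_iff) auto
    then have "s \<le> ?\<tau>" by (intro tau_ge) auto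
    have "X t - X s - (t - s) * z < 0"
    proof (cases "s = ?\<tau>")
      case False
      then show ?thesis using s \<open>s \<le> ?\<tau>\<close> by (intro b) auto
    qed (use neg in simp)
    with s show False by simp
  qed
  ultimately show "X t - X ?\<tau> = (t - ?\<tau>) * z" by linarith
qed

text \<open>\<open>tau\<close> may overlook a tangential contact, where the path touches the end
  without crossing it. For any slower \<open>z'\<close> the same contact becomes a strict crossing,
  so \<open>s \<le> tau X t z'\<close>, and letting \<open>z'\<close> tend to \<open>z\<close> gives
  the claim at continuity points. By monotonicity these are all \<open>z\<close> outside a countable
  set.\<close>

lemma root_le_tau:
  assumes "isCont (tau X t) z" "0 < s" "s < t" "X t - X s = (t - s) * z"
  shows "s \<le> tau X t z"
proof (rule tendsto_lowerbound)
  show "(tau X t \<longlongrightarrow> tau X t z) (at_left z)"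
    using assms(1) unfolding isCont_def by (rule filterlim_mono) (auto intro: at_le)
  show "\<forall>\<^sub>F z' in at_left z. s \<le> tau X t z'"
    unfolding eventually_at_left[of "z - 1" z, simplified]
  proof (intro exI[of _ "z - 1"] conjI allI impI)
    fix z' assume "z - 1 < z'" "z' < z"
    then show "s \<le> tau X t z'"
      using assms by (intro tau_ge) auto
  qed simp
qed simp

text \<open>The crossing condition is open in \<open>s\<close>, so in a superlevel set
  \<open>s\<close> may be taken rational, which leaves a countable union.\<close>

lemma measurable_tau:
  assumes [measurable]: "f \<in> borel_measurable M" "g \<in> borel_measurable M"
  shows "(\<lambda>x. tau X (f x) (g x)) \<in> borel_measurable M"
  unfolding borel_measurable_iff_greater
proof
  fix a :: real
  \<comment> \<open>\<open>X\<close> is controlled only at nonnegative times; precomposing with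
    \<open>max 0\<close> makes it continuous on the whole line.\<close>
  have "continuous_on UNIV (\<lambda>t. X (max 0 t))"
    by (rule continuous_on_compose2[OF contX]) (auto intro!: continuous_intros)
  then have [measurable]: "(\<lambda>t. X (max 0 t)) \<in> borel_measurable borel"
    by (rule borel_measurable_continuous_onI)
  show "{x \<in> space M. a < tau X (f x) (g x)} \<in> sets M"
  proof (cases "a < 0")
    case True
    then have "{x \<in> space M. a < tau X (f x) (g x)} = space M"
      using tau_nonneg by (auto intro: less_le_trans)
    then show ?thesis by simp
  next
    case False
    have "{x \<in> space M. a < tau X (f x) (g x)} =
      (\<Union>q\<in>{q. a < real_of_rat q}. {x \<in> space M. real_of_rat q < f x \<and>
          (f x - real_of_rat q) * g x < X (max 0 (f x)) - X (real_of_rat q)})" (is "?A = ?B")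
    proof
      show "?B \<subseteq> ?A" using False by (auto simp: less_tau_iff)
      show "?A \<subseteq> ?B"
      proof
        fix x assume "x \<in> ?A"
        then obtain s where x: "x \<in> space M" and s: "a < s" "s < f x" "(f x - s) * g x < X (f x) - X s"
          using False by (auto simp: less_tau_iff)
        have "isCont (\<lambda>s. X (f x) - X s - (f x - s) * g x) s"
          using isContX[of s] False s by (intro continuous_intros) auto
        then have "\<forall>\<^sub>F s in at s. 0 < X (f x) - X s - (f x - s) * g x"
          unfolding isCont_def by (rule order_tendstoD(1)) (use s in simp)
        then obtain e where e: "e > 0" "\<And>r. r \<noteq> s \<Longrightarrow> dist r s < e \<Longrightarrow> 0 < X (f x) - X r - (f x - r) * g x"
          unfolding eventually_at by auto
        obtain q where q: "s < real_of_rat q" "real_of_rat q < min (f x) (s + e)"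
          using of_rat_dense[of s "min (f x) (s + e)"] s e by auto
        have "0 < X (f x) - X (real_of_rat q) - (f x - real_of_rat q) * g x"
          using q by (intro e) (auto simp: dist_real_def)
        moreover have "max 0 (f x) = f x" using False s by simp
        ultimately show "x \<in> ?B" using x q s by (intro UN_I[of q]) auto
      qed
    qed
    also have "\<dots> \<in> sets M"
    proof (rule sets.countable_UN'')
      show "countable {q. a < real_of_rat q}" by simp
    qed measurable
    finally show ?thesis .
  qed
qed

text \<open>With \<open>Y t = X t - t * z\<close> the contact equation reads
  \<open>Y t = Y s\<close>. The image of a null set under the differentiable \<open>Y\<close> is
  null, and so is the preimage of a null set where the derivative \<open>V t - z\<close> does not
  vanish.\<close>

lemma null_preimage:
  assumes N: "N \<in> null_sets lborel"
  shows "AE t in lborel. 0 < t \<and> V t \<noteq> z \<longrightarrow> \<not> (\<exists>s\<in>N. 0 < s \<and> X t - X s = (t - s) * z)"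
proof -
  let ?Y = "\<lambda>t. X t - t * z"
  let ?S = "{t. 0 < t \<and> V t \<noteq> z}" and ?T = "?Y ` (N \<inter> {0<..})"
  have dY: "(?Y has_real_derivative (V t - z)) (at t)" if "0 < t" for t
    using deriv_at[OF that] by (auto intro!: derivative_eq_intros)
  have "N \<in> null_sets lebesgue" using N by (rule null_sets_completionI)
  then have "negligible N" by (simp add: negligible_iff_null_sets)
  then have "negligible (N \<inter> {0<..})" by (rule negligible_subset) auto
  moreover have "?Y differentiable_on (N \<inter> {0<..})"
    unfolding differentiable_on_def
  proof
    fix t assume "t \<in> N \<inter> {0<..}"
    then have "?Y differentiable (at t)" using dY[of t] unfolding real_differentiable_def by blast
    then show "?Y differentiable (at t within N \<inter> {0<..})" by (rule differentiable_at_withinI)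
  qed
  ultimately have T: "negligible ?T"
    by (intro negligible_differentiable_image_negligible) auto
  have "negligible {t \<in> ?S. ?Y t \<in> ?T}"
  proof (rule negligible_differentiable_vimage[OF T, where f' = "\<lambda>t. times (V t - z)"])
    fix t assume t: "t \<in> ?S"
    show "inj (times (V t - z))" using t by (auto simp: inj_on_def)
    show "(?Y has_derivative times (V t - z)) (at t within ?S)"
      using dY[of t] t by (auto simp: has_field_derivative_def intro: has_derivative_at_withinI)
  qed
  then have "AE t in lebesgue. t \<notin> {t \<in> ?S. ?Y t \<in> ?T}"
    by (intro AE_not_in) (simp add: negligible_iff_null_sets)
  then have "AE t in lborel. t \<notin> {t \<in> ?S. ?Y t \<in> ?T}"
    unfolding AE_completion_iff .
  then show ?thesis
  proof (rule AE_mp, intro AE_I2 impI notI)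
    fix t assume t: "t \<notin> {t \<in> ?S. ?Y t \<in> ?T}" "0 < t \<and> V t \<noteq> z"
      and "\<exists>s\<in>N. 0 < s \<and> X t - X s = (t - s) * z"
    then obtain s where s: "s \<in> N" "0 < s" "X t - X s = (t - s) * z" by blast
    then have "?Y t = ?Y s" by (simp add: algebra_simps)
    then have "?Y t \<in> ?T" using s by (intro image_eqI[of _ _ s]) auto
    then show False using t by simp
  qed
qed

end

text \<open>Convexity of the disk. If a backward path is over the disk now and at some earlier
  contact, it is over it at every contact in between, so it suffices to test the latest one, as
  \<open>hit\<close> does.\<close>

lemma disk_between:
  assumes y: "y \<in> disk d r" and a: "pback d y a w \<in> disk d r" and c: "0 \<le> c" "c \<le> a"
  shows "pback d y c w \<in> disk d r"
proof (cases "a = 0")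
  case True
  then show ?thesis using c a by simp
next
  case False
  define l where "l = c / a"
  have l: "0 \<le> l" "l \<le> 1" using c False by (auto simp: l_def)
  have "perp_norm d (pback d y c w) = L2_set (\<lambda>i. (1 - l) * y i + l * pback d y a w i) {1..<d}"
    unfolding perp_norm_def
    by (rule L2_set_cong) (use False in \<open>auto simp: l_def pback_def field_simps\<close>)
  also have "\<dots> \<le> L2_set (\<lambda>i. (1 - l) * y i) {1..<d} + L2_set (\<lambda>i. l * pback d y a w i) {1..<d}"
    by (rule L2_set_triangle_ineq)
  also have "\<dots> = (1 - l) * perp_norm d y + l * perp_norm d (pback d y a w)"
    using l by (simp add: perp_norm_def L2_set_right_distrib)
  also have "\<dots> \<le> (1 - l) * r + l * r"
    using y a l by (intro add_mono mult_left_mono) (auto simp: disk_def)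
  also have "\<dots> = r" by (simp add: algebra_simps)
  finally show ?thesis by (simp add: disk_def pback_in_space)
qed

lemma measurable_split3:
  assumes "(\<lambda>(t, y, u). F t y u) \<in> A \<Otimes>\<^sub>M (B \<Otimes>\<^sub>M C) \<rightarrow>\<^sub>M N"
    and "f \<in> M \<rightarrow>\<^sub>M A" "g \<in> M \<rightarrow>\<^sub>M B" "h \<in> M \<rightarrow>\<^sub>M C"
  shows "(\<lambda>x. F (f x) (g x) (h x)) \<in> M \<rightarrow>\<^sub>M N"
  using measurable_compose[OF _ assms(1), of "\<lambda>x. (f x, g x, h x)" M] assms by simp

lemma AE_zero_if_nn_integral_zero:
  "(\<integral>\<^sup>+x. f x \<partial>M) = 0 \<Longrightarrow> f \<in> borel_measurable M \<Longrightarrow> AE x in M. f x = 0"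
  by (simp add: nn_integral_0_iff_AE)

lemma nn_integral_zero_if_AE: "AE x in M. f x = 0 \<Longrightarrow> (\<integral>\<^sup>+x. f x \<partial>M) = 0"
  using nn_integral_cong_AE[of f "\<lambda>_. 0" M] by simp

section \<open>Latest precollisions at either end, and transport of null sets along the flow\<close>

lemmas sf_perp = perp.sigma_finite_measure_axioms
lemmas sf_vec = lborel_perp.sigma_finite_measure_axioms[folded vec_measure_def]
lemmas sf_perp_vec = perp_vec.sigma_finite_measure_axioms

text \<open>Reflecting the axis by \<open>- \<sigma>\<close> turns the right end into a left one, so
  one notion of latest contact serves both ends.\<close>

definition ptau :: "real \<Rightarrow> (real \<Rightarrow> real) \<Rightarrow> real \<Rightarrow> real \<Rightarrow> real" where
  "ptau \<sigma> X t z = tau (\<lambda>s. - \<sigma> * X s) t (- \<sigma> * z)"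

definition hit :: "nat \<Rightarrow> real \<Rightarrow> real \<Rightarrow> (real \<Rightarrow> real) \<Rightarrow> real \<Rightarrow> perp \<Rightarrow> vec \<Rightarrow> bool" where
  "hit d r \<sigma> X t y u \<longleftrightarrow> 0 < ptau \<sigma> X t (fst u) \<and>
     pback d y (t - ptau \<sigma> X t (fst u)) (snd u) \<in> disk d r"

text \<open>Excludes the countably many velocities at which a tangential contact could escape
  \<open>ptau\<close>.\<close>

definition regular :: "real \<Rightarrow> (real \<Rightarrow> real) \<Rightarrow> real \<Rightarrow> real \<Rightarrow> bool" where
  "regular \<sigma> X t z \<longleftrightarrow> isCont (tau (\<lambda>s. - \<sigma> * X s) t) (- \<sigma> * z)"

lemma AE_not_countable: "countable A \<Longrightarrow> AE z in lborel. z \<notin> (A :: real set)"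
  by (intro AE_not_in null_setsI emeasure_lborel_countable) (auto intro: sets.countable)

lemma AE_regular: "\<sigma> \<in> {1, -1} \<Longrightarrow> AE z in lborel. regular \<sigma> X t z"
proof -
  assume \<sigma>: "\<sigma> \<in> {1, -1}"
  let ?D = "{z. \<not> isCont (tau (\<lambda>s. - \<sigma> * X s) t) z}"
  have "countable ((\<lambda>z. - \<sigma> * z) ` ?D)" by (intro countable_image countable_tau_discont)
  then have "AE z in lborel. z \<notin> (\<lambda>z. - \<sigma> * z) ` ?D" by (rule AE_not_countable)
  then show ?thesis
  proof (rule AE_mp, intro AE_I2 impI)
    fix z assume z: "z \<notin> (\<lambda>z. - \<sigma> * z) ` ?D"
    have "z = - \<sigma> * (- \<sigma> * z)" using \<sigma> by auto
    with z show "regular \<sigma> X t z" unfolding regular_def by blast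
  qed
qed

context trajectory begin

lemma trajectory_scaled: "trajectory (\<lambda>s. c * X s) (\<lambda>s. c * V s)"
  by unfold_locales (auto intro!: DERIV_cmult deriv continuous_intros contV)

lemma measurable_ptau [measurable (raw)]:
  assumes "f \<in> borel_measurable M" "g \<in> borel_measurable M"
  shows "(\<lambda>x. ptau \<sigma> X (f x) (g x)) \<in> borel_measurable M"
  unfolding ptau_def
  by (intro trajectory.measurable_tau[OF trajectory_scaled[of "- \<sigma>"]] assms borel_measurable_times) auto

lemma ptau_eq_0: "t \<le> 0 \<Longrightarrow> ptau \<sigma> X t z = 0"
  by (simp add: ptau_def tau_eq_0)

lemma ptau_root:
  assumes "\<sigma> \<in> {1, -1}" "\<sigma> * (z - V t) < 0" "0 < ptau \<sigma> X t z"
  shows "ptau \<sigma> X t z < t" "X t - X (ptau \<sigma> X t z) = (t - ptau \<sigma> X t z) * z"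
proof -
  interpret T: trajectory "\<lambda>s. - \<sigma> * X s" "\<lambda>s. - \<sigma> * V s" by (rule trajectory_scaled)
  have v: "- \<sigma> * V t < - \<sigma> * z" using assms(2) by (simp add: algebra_simps)
  show "ptau \<sigma> X t z < t"
    using T.tau_root(1)[OF v] assms(3) by (simp add: ptau_def)
  show "X t - X (ptau \<sigma> X t z) = (t - ptau \<sigma> X t z) * z"
    using T.tau_root(2)[OF v] assms(1,3) by (auto simp: ptau_def)
qed

text \<open>Confines the velocities of recolliding particles to the range of the velocity of the
  body; every smallness factor \<open>G\<close> below comes from here.\<close>

lemma ptau_velocity:
  assumes "\<sigma> \<in> {1, -1}" "\<sigma> * (z - V t) < 0" "0 < ptau \<sigma> X t z"
  obtains r where "ptau \<sigma> X t z < r" "r < t" "z = V r"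
proof -
  have "0 \<le> ptau \<sigma> X t z" using assms by simp
  from mean_value[OF this ptau_root(1)[OF assms]]
  obtain r where "ptau \<sigma> X t z < r" "r < t" "X t - X (ptau \<sigma> X t z) = (t - ptau \<sigma> X t z) * V r" .
  with ptau_root[OF assms] that show thesis by auto
qed

lemma root_le_ptau:
  assumes "\<sigma> \<in> {1, -1}" "regular \<sigma> X t z" "0 < s" "s < t" "X t - X s = (t - s) * z"
  shows "s \<le> ptau \<sigma> X t z"
proof -
  interpret T: trajectory "\<lambda>s. - \<sigma> * X s" "\<lambda>s. - \<sigma> * V s" by (rule trajectory_scaled)
  show ?thesis unfolding ptau_def
    by (rule T.root_le_tau) (use assms in \<open>auto simp: regular_def\<close>)
qed

text \<open>For regular velocities the law, which speaks of a maximum of contact times that might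
  not exist, becomes an explicit formula at \<open>ptau\<close>.\<close>

lemma precollision_law_iff:
  assumes \<sigma>: "\<sigma> \<in> {1, -1}" and y: "y \<in> disk d r" and inc: "\<sigma> * (fst u - V t) < 0"
    and reg: "regular \<sigma> X t (fst u)"
  shows "precollision_law d H r f0 X fm fp \<sigma> t (X t + \<sigma> * H, y) u \<longleftrightarrow>
    fm t (X t + \<sigma> * H, y) u =
      (if hit d r \<sigma> X t y u
       then fp (ptau \<sigma> X t (fst u))
         (X (ptau \<sigma> X t (fst u)) + \<sigma> * H, pback d y (t - ptau \<sigma> X t (fst u)) (snd u)) u
       else f0 u)"
proof -
  let ?\<tau> = "ptau \<sigma> X t (fst u)" and ?P = "precollision_times d H r X \<sigma> t (X t + \<sigma> * H, y) u"
  have P: "s \<in> ?P \<longleftrightarrow> 0 < s \<and> s < t \<and> X t - X s = (t - s) * fst u \<and> pback d y (t - s) (snd u) \<in> disk d r" for s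
    by (auto simp: precollision_times_def backward_eq end_face_def)
  have le: "s \<le> ?\<tau>" if "s \<in> ?P" for s
    using root_le_ptau[OF \<sigma> reg] that P by blast
  show ?thesis
  proof (cases "hit d r \<sigma> X t y u")
    case True
    then have pos: "0 < ?\<tau>" by (simp add: hit_def)
    have in_P: "?\<tau> \<in> ?P"
      using ptau_root[OF \<sigma> inc pos] True pos by (auto simp: P hit_def)
    have "precollision_law d H r f0 X fm fp \<sigma> t (X t + \<sigma> * H, y) u \<longleftrightarrow>
        fm t (X t + \<sigma> * H, y) u = fp ?\<tau> (backward d (X t + \<sigma> * H, y) (t - ?\<tau>) u) u"
      unfolding precollision_law_def using in_P le by (metis empty_iff order_antisym)
    moreover have "X t + \<sigma> * H - (t - ?\<tau>) * fst u = X ?\<tau> + \<sigma> * H"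
      using ptau_root(2)[OF \<sigma> inc pos] by simp
    ultimately show ?thesis using True by (simp add: backward_eq)
  next
    case False
    have "?P = {}"
    proof (rule ccontr)
      assume "?P \<noteq> {}"
      then obtain s where s: "s \<in> ?P" by blast
      then have pos: "0 < ?\<tau>" using le[OF s] P by force
      have "pback d y (t - ?\<tau>) (snd u) \<in> disk d r"
        by (rule disk_between[OF y, of "t - s"]) (use s P le[OF s] ptau_root(1)[OF \<sigma> inc pos] in auto)
      with pos False show False by (simp add: hit_def)
    qed
    then show ?thesis using False by (simp add: precollision_law_def)
  qed
qed

text \<open>Transfers almost everywhere statements along the flow: a property of the post-collision
  density that holds outside a null set may be used at the latest precollision of almost every
  particle, for almost every \<open>t\<close>. Velocities are not changed by free flight, so after a
  shear in the transversal variable only a one-dimensional statement about times is left, namely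
  \<open>null_preimage\<close>.\<close>

lemma pullback_null:
  assumes \<sigma>: "\<sigma> \<in> {1, -1}" and N: "N \<in> null_sets (lborel \<Otimes>\<^sub>M (perp_measure d \<Otimes>\<^sub>M vec_measure d))"
  shows "AE t in lborel. AE q in perp_measure d \<Otimes>\<^sub>M vec_measure d.
     0 < ptau \<sigma> X t (fst (snd q)) \<and> \<sigma> * (fst (snd q) - V t) < 0 \<longrightarrow>
     (ptau \<sigma> X t (fst (snd q)), pback d (fst q) (t - ptau \<sigma> X t (fst (snd q))) (snd (snd q)), snd q) \<notin> N"
proof -
  let ?P = "perp_measure d" and ?U = "vec_measure d"
  have N_meas[measurable]: "N \<in> sets (lborel \<Otimes>\<^sub>M (?P \<Otimes>\<^sub>M ?U))" using N by blast
  have [measurable]: "fst \<in> borel_measurable ?U" "snd \<in> ?U \<rightarrow>\<^sub>M ?P"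
    by (simp_all add: vec_measure_def)
  have "continuous_on UNIV (\<lambda>t. V (max 0 t))"
    by (rule continuous_on_compose2[OF contV]) (auto intro!: continuous_intros)
  then have [measurable]: "(\<lambda>t. V (max 0 t)) \<in> borel_measurable borel"
    by (rule borel_measurable_continuous_onI)
  define c where "c t u \<longleftrightarrow> 0 < ptau \<sigma> X t (fst u) \<and> \<sigma> * (fst u - V (max 0 t)) < 0" for t and u :: vec
  \<comment> \<open>Freely moving particles keep their position minus time times velocity: in this
    sheared variable the transversal position is the same at both collisions, so for fixed
    \<open>y\<close> and \<open>u\<close> only the time varies. \<open>g\<close> is \<open>h\<close>
    in the sheared variable.\<close>
  define n :: "real \<Rightarrow> perp \<Rightarrow> vec \<Rightarrow> ennreal" where
    "n s y u = indicator N (s, pback d y (- s) (snd u), u)" for s y u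
  define g :: "real \<Rightarrow> perp \<Rightarrow> vec \<Rightarrow> ennreal" where
    "g t y u = of_bool (c t u) * n (ptau \<sigma> X t (fst u)) y u" for t y u
  define h :: "real \<Rightarrow> perp \<Rightarrow> vec \<Rightarrow> ennreal" where
    "h t y u = of_bool (c t u) *
       indicator N (ptau \<sigma> X t (fst u), pback d y (t - ptau \<sigma> X t (fst u)) (snd u), u)" for t y u
  have [measurable]: "Measurable.pred (lborel \<Otimes>\<^sub>M ?U) (\<lambda>(t, u). c t u)"
    unfolding c_def by measurable
  have n_meas: "(\<lambda>(s, y, u). n s y u) \<in> borel_measurable (lborel \<Otimes>\<^sub>M (?P \<Otimes>\<^sub>M ?U))"
    unfolding n_def by measurable
  note [measurable (raw)] = measurable_split3[OF n_meas]
  have h_meas: "(\<lambda>(t, y, u). h t y u) \<in> borel_measurable (lborel \<Otimes>\<^sub>M (?P \<Otimes>\<^sub>M ?U))"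
    unfolding h_def by measurable
  note [measurable (raw)] = measurable_split3[OF h_meas]
  have g_meas: "(\<lambda>(t, y, u). g t y u) \<in> borel_measurable (lborel \<Otimes>\<^sub>M (?P \<Otimes>\<^sub>M ?U))"
    unfolding g_def n_def by measurable
  note [measurable (raw)] = measurable_split3[OF g_meas]
  have swap: "(\<integral>\<^sup>+t. \<integral>\<^sup>+y. \<integral>\<^sup>+u. F t y u \<partial>?U \<partial>?P \<partial>lborel) = (\<integral>\<^sup>+u. \<integral>\<^sup>+t. \<integral>\<^sup>+y. F t y u \<partial>?P \<partial>lborel \<partial>?U)"
    if [measurable]: "(\<lambda>(t, y, u). F t y u) \<in> borel_measurable (lborel \<Otimes>\<^sub>M (?P \<Otimes>\<^sub>M ?U))"
    for F :: "real \<Rightarrow> perp \<Rightarrow> vec \<Rightarrow> ennreal"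
  proof -
    note [measurable (raw)] = measurable_split3[OF that]
    have "(\<integral>\<^sup>+t. \<integral>\<^sup>+y. \<integral>\<^sup>+u. F t y u \<partial>?U \<partial>?P \<partial>lborel) = (\<integral>\<^sup>+t. \<integral>\<^sup>+u. \<integral>\<^sup>+y. F t y u \<partial>?P \<partial>?U \<partial>lborel)"
      by (intro nn_integral_cong perp_vec.Fubini'[symmetric]) measurable
    also have "\<dots> = (\<integral>\<^sup>+u. \<integral>\<^sup>+t. \<integral>\<^sup>+y. F t y u \<partial>?P \<partial>lborel \<partial>?U)"
      by (intro lborel_vec.Fubini'[symmetric]) measurable
    finally show ?thesis .
  qed
  \<comment> \<open>From the null set \<open>N\<close> to null sections in time, for almost every
    \<open>u\<close> and \<open>y\<close>; the shear leaves the integral over \<open>y\<close>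
    unchanged.\<close>
  have "0 = (\<integral>\<^sup>+q. indicator N q \<partial>(lborel \<Otimes>\<^sub>M (?P \<Otimes>\<^sub>M ?U)))"
    using N by (subst nn_integral_indicator) auto
  also have "\<dots> = (\<integral>\<^sup>+s. \<integral>\<^sup>+q. indicator N (s, q) \<partial>(?P \<Otimes>\<^sub>M ?U) \<partial>lborel)"
    by (rule sigma_finite_measure.nn_integral_fst[OF sf_perp_vec, symmetric]) measurable
  also have "\<dots> = (\<integral>\<^sup>+s. \<integral>\<^sup>+y. \<integral>\<^sup>+u. indicator N (s, y, u) \<partial>?U \<partial>?P \<partial>lborel)"
    by (intro nn_integral_cong sigma_finite_measure.nn_integral_fst[OF sf_vec, symmetric]) measurable
  also have "\<dots> = (\<integral>\<^sup>+u. \<integral>\<^sup>+s. \<integral>\<^sup>+y. indicator N (s, y, u) \<partial>?P \<partial>lborel \<partial>?U)"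
    by (rule swap) simp
  also have "\<dots> = (\<integral>\<^sup>+u. \<integral>\<^sup>+s. \<integral>\<^sup>+y. n s y u \<partial>?P \<partial>lborel \<partial>?U)"
    unfolding n_def
    by (intro nn_integral_cong nn_integral_pback_shift[symmetric, where f = "\<lambda>y. indicator N (_, y, _)"]) measurable
  also have "\<dots> = (\<integral>\<^sup>+u. \<integral>\<^sup>+y. \<integral>\<^sup>+s. n s y u \<partial>lborel \<partial>?P \<partial>?U)"
    by (intro nn_integral_cong lborel_perp.Fubini'[symmetric]) measurable
  finally have "AE u in ?U. (\<integral>\<^sup>+y. \<integral>\<^sup>+s. n s y u \<partial>lborel \<partial>?P) = 0"
    by (intro AE_zero_if_nn_integral_zero) (simp, measurable)
  moreover have "(\<integral>\<^sup>+y. \<integral>\<^sup>+t. g t y u \<partial>lborel \<partial>?P) = 0"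
    if "(\<integral>\<^sup>+y. \<integral>\<^sup>+s. n s y u \<partial>lborel \<partial>?P) = 0" and u: "u \<in> space ?U" for u
  proof -
    have [measurable]: "(\<lambda>(s, y). n s y u) \<in> borel_measurable (lborel \<Otimes>\<^sub>M ?P)"
      "(\<lambda>(s, y). g s y u) \<in> borel_measurable (lborel \<Otimes>\<^sub>M ?P)"
      using u by measurable
    have "AE y in ?P. (\<integral>\<^sup>+s. n s y u \<partial>lborel) = 0"
      using that(1) by (rule AE_zero_if_nn_integral_zero) measurable
    then have "AE y in ?P. (\<integral>\<^sup>+t. g t y u \<partial>lborel) = 0"
    proof (rule AE_mp, intro AE_I2 impI)
      fix y assume y: "y \<in> space ?P" and n0: "(\<integral>\<^sup>+s. n s y u \<partial>lborel) = 0"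
      have ny[measurable]: "(\<lambda>s. n s y u) \<in> borel_measurable lborel"
        "(\<lambda>s. g s y u) \<in> borel_measurable lborel"
        using u y by measurable
      define N1 where "N1 = {s. n s y u \<noteq> 0}"
      have "AE s in lborel. n s y u = 0"
        using n0 ny by (simp add: nn_integral_0_iff_AE)
      moreover have "N1 \<in> sets lborel" unfolding N1_def using ny by measurable
      ultimately have "N1 \<in> null_sets lborel"
        by (subst AE_iff_null_sets) (auto simp: N1_def)
      from null_preimage[OF this, of "fst u"]
      have "AE t in lborel. g t y u = 0"
      proof (rule AE_mp, intro AE_I2 impI)
        fix t assume *: "0 < t \<and> V t \<noteq> fst u \<longrightarrow> \<not> (\<exists>s\<in>N1. 0 < s \<and> X t - X s = (t - s) * fst u)"
        show "g t y u = 0"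
        proof (rule ccontr)
          assume "g t y u \<noteq> 0"
          then have ct: "c t u" and nn: "n (ptau \<sigma> X t (fst u)) y u \<noteq> 0" by (auto simp: g_def)
          have pos: "0 < ptau \<sigma> X t (fst u)" using ct by (simp add: c_def)
          have t: "0 < t" using ptau_eq_0[of t \<sigma> "fst u"] pos by linarith
          have v: "\<sigma> * (fst u - V t) < 0" using ct t by (simp add: c_def)
          have "V t \<noteq> fst u" using v by auto
          then show False
            using * t nn pos ptau_root[OF \<sigma> v pos] by (auto simp: N1_def)
        qed
      qed
      then show "(\<integral>\<^sup>+t. g t y u \<partial>lborel) = 0"
        using ny by (simp add: nn_integral_0_iff_AE)
    qed
    then show ?thesis by (rule nn_integral_zero_if_AE)
  qed
  ultimately have "AE u in ?U. (\<integral>\<^sup>+y. \<integral>\<^sup>+t. g t y u \<partial>lborel \<partial>?P) = 0"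
    by auto
  then have "0 = (\<integral>\<^sup>+u. \<integral>\<^sup>+y. \<integral>\<^sup>+t. g t y u \<partial>lborel \<partial>?P \<partial>?U)"
    by (rule nn_integral_zero_if_AE[symmetric])
  also have "\<dots> = (\<integral>\<^sup>+u. \<integral>\<^sup>+t. \<integral>\<^sup>+y. g t y u \<partial>?P \<partial>lborel \<partial>?U)"
    by (intro nn_integral_cong lborel_perp.Fubini') measurable
  also have "\<dots> = (\<integral>\<^sup>+u. \<integral>\<^sup>+t. \<integral>\<^sup>+y. h t y u \<partial>?P \<partial>lborel \<partial>?U)"
  proof (rule nn_integral_cong, rule nn_integral_cong)
    fix u and t :: real assume u: "u \<in> space ?U" and "t \<in> space lborel"
    have "(\<lambda>y. h t y u) \<in> borel_measurable ?P"
      using u by measurable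
    from nn_integral_pback_shift[OF this, of "- t" "snd u"]
    show "(\<integral>\<^sup>+y. g t y u \<partial>?P) = (\<integral>\<^sup>+y. h t y u \<partial>?P)"
      by (simp add: g_def h_def n_def pback_pback)
  qed
  also have "\<dots> = (\<integral>\<^sup>+t. \<integral>\<^sup>+y. \<integral>\<^sup>+u. h t y u \<partial>?U \<partial>?P \<partial>lborel)"
    by (rule swap[OF h_meas, symmetric])
  also have "\<dots> = (\<integral>\<^sup>+t. \<integral>\<^sup>+q. h t (fst q) (snd q) \<partial>(?P \<Otimes>\<^sub>M ?U) \<partial>lborel)"
  proof (rule nn_integral_cong)
    fix t :: real
    have "(\<lambda>q. h t (fst q) (snd q)) \<in> borel_measurable (?P \<Otimes>\<^sub>M ?U)" by measurable
    from sigma_finite_measure.nn_integral_fst[OF sf_vec this]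
    show "(\<integral>\<^sup>+y. \<integral>\<^sup>+u. h t y u \<partial>?U \<partial>?P) = (\<integral>\<^sup>+q. h t (fst q) (snd q) \<partial>(?P \<Otimes>\<^sub>M ?U))"
      by simp
  qed
  finally have "AE t in lborel. (\<integral>\<^sup>+q. h t (fst q) (snd q) \<partial>(?P \<Otimes>\<^sub>M ?U)) = 0"
    by (intro AE_zero_if_nn_integral_zero) (simp, measurable)
  then show ?thesis
  proof (rule eventually_mono)
    fix t assume "(\<integral>\<^sup>+q. h t (fst q) (snd q) \<partial>(?P \<Otimes>\<^sub>M ?U)) = 0"
    then have "AE q in ?P \<Otimes>\<^sub>M ?U. h t (fst q) (snd q) = 0"
      by (rule AE_zero_if_nn_integral_zero) measurable
    then show "AE q in ?P \<Otimes>\<^sub>M ?U. 0 < ptau \<sigma> X t (fst (snd q)) \<and> \<sigma> * (fst (snd q) - V t) < 0 \<longrightarrow>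
     (ptau \<sigma> X t (fst (snd q)), pback d (fst q) (t - ptau \<sigma> X t (fst (snd q))) (snd (snd q)), snd q) \<notin> N"
    proof (rule AE_mp, intro AE_I2 impI)
      fix q assume q: "h t (fst q) (snd q) = 0"
        and c1: "0 < ptau \<sigma> X t (fst (snd q)) \<and> \<sigma> * (fst (snd q) - V t) < 0"
      then have "0 < t" using ptau_eq_0[of t \<sigma> "fst (snd q)"] by (metis linorder_not_less order_less_irrefl)
      then have "c t (snd q)" using c1 by (simp add: c_def)
      with q show "(ptau \<sigma> X t (fst (snd q)), pback d (fst q) (t - ptau \<sigma> X t (fst (snd q))) (snd (snd q)), snd q) \<notin> N"
        by (auto simp: h_def indicator_def split: if_splits)
    qed
  qed
qed

end

section \<open>The barrier argument\<close>

definition mean :: "(real \<Rightarrow> real) \<Rightarrow> real \<Rightarrow> real \<Rightarrow> real" where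
  "mean X s t = (X t - X s) / (t - s)"

text \<open>
  The bounds on the precollision force at time \<open>t\<close> that enter the dynamics: \<open>RL\<close> and \<open>RR\<close> are
  the contributions of the left and right end. Velocities of particles that hit the same end
  at time \<open>s\<close> and again at time \<open>t\<close> equal the mean velocity of the body on \<open>[s, t]\<close>.
\<close>

definition mean_above :: "(real \<Rightarrow> real) \<Rightarrow> (real \<Rightarrow> real) \<Rightarrow> real \<Rightarrow> real \<Rightarrow> real \<Rightarrow> bool" where
  "mean_above X V t m1 m2 \<longleftrightarrow> 0 \<le> m1 \<and> 0 \<le> m2 \<and>
     (\<forall>s. 0 < s \<and> s \<le> t / 2 \<longrightarrow> mean X s t - V t \<le> m1) \<and>
     (\<forall>s. t / 2 < s \<and> s < t \<longrightarrow> mean X s t - V t \<le> m2)"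

definition mean_below :: "(real \<Rightarrow> real) \<Rightarrow> (real \<Rightarrow> real) \<Rightarrow> real \<Rightarrow> real \<Rightarrow> real \<Rightarrow> bool" where
  "mean_below X V t m1 m2 \<longleftrightarrow> 0 \<le> m1 \<and> 0 \<le> m2 \<and>
     (\<forall>s. 0 < s \<and> s \<le> t / 2 \<longrightarrow> V t - mean X s t \<le> m1) \<and>
     (\<forall>s. t / 2 < s \<and> s < t \<longrightarrow> V t - mean X s t \<le> m2)"

text \<open>Precollisions before \<open>t / 2\<close> force the transversal velocity to be of order
  \<open>1 / t\<close> and so carry the factor \<open>(1 + t) powr (1 - real d)\<close>; later ones
  do not and are estimated by means over a recent past. The exponent \<open>p + 1\<close> combines
  an impulse of order \<open>p\<close> with the length of a velocity interval.\<close>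

definition rbound ::
  "real \<Rightarrow> real \<Rightarrow> real \<Rightarrow> nat \<Rightarrow> (real \<Rightarrow> real) \<Rightarrow> (real \<Rightarrow> real) \<Rightarrow> real \<Rightarrow> real \<Rightarrow> bool" where
  "rbound c3 C3 p d X V t \<rho> \<longleftrightarrow> (\<exists>RL RR. \<rho> = RL + RR \<and> 0 \<le> RL \<and>
     (\<forall>w. 0 \<le> w \<and> w \<le> mean X 0 t - V t \<longrightarrow> c3 * w powr (p + 1) * (1 + t) powr (1 - real d) \<le> RL) \<and>
     (\<forall>m1 m2. mean_above X V t m1 m2 \<longrightarrow>
        RL \<le> C3 * (m1 powr (p + 1) * (1 + t) powr (1 - real d) + m2 powr (p + 1))) \<and>
     (\<forall>m1 m2. mean_below X V t m1 m2 \<longrightarrow>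
        \<bar>RR\<bar> \<le> C3 * (m1 powr (p + 1) * (1 + t) powr (1 - real d) + m2 powr (p + 1))))"

text \<open>\<open>rbound\<close> is available only for almost every time, whereas the crossing
  arguments need the force at one specific time; continuity bridges the gap.\<close>

lemma AE_le_extend:
  fixes f g :: "real \<Rightarrow> real"
  assumes "a < b" "continuous_on {a..b} f" "continuous_on {a..b} g"
    and ae: "AE t in lborel. a < t \<and> t < b \<longrightarrow> f t \<le> g t"
    and t: "t \<in> {a..b}"
  shows "f t \<le> g t"
proof (rule ccontr)
  assume "\<not> f t \<le> g t"
  then have pos: "0 < f t - g t" by simp
  have "continuous_on {a..b} (\<lambda>s. f s - g s)" using assms by (intro continuous_intros)
  then obtain e where e: "e > 0" "\<And>s. s \<in> {a..b} \<Longrightarrow> dist s t < e \<Longrightarrow> dist (f s - g s) (f t - g t) < f t - g t"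
    using pos t unfolding continuous_on_iff by meson
  define l u where "l = max a (t - e)" and "u = min b (t + e)"
  have lu: "l < u" using assms(1) t e(1) by (auto simp: l_def u_def)
  have "AE s in lborel. s \<notin> {l<..<u}"
    using ae
  proof (rule eventually_mono)
    fix s assume *: "a < s \<and> s < b \<longrightarrow> f s \<le> g s"
    show "s \<notin> {l<..<u}"
    proof
      assume "s \<in> {l<..<u}"
      then have s: "a < s" "s < b" "dist s t < e" by (auto simp: l_def u_def dist_real_def)
      with e(2)[of s] * show False by (auto simp: dist_real_def)
    qed
  qed
  then have "{l<..<u} \<in> null_sets lborel" by (subst AE_iff_null_sets) auto
  then show False using lu by (auto simp: null_sets_def)
qed

text \<open>At the first zero a negative derivative would make slightly earlier values positive. The
  hypothesis \<open>neg\<close> may assume negativity on the whole past, since the bounds on the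
  force depend on the history.\<close>

lemma first_crossing:
  fixes f :: "real \<Rightarrow> real"
  assumes "a \<le> b" and cont: "continuous_on {a..b} f" and fa: "f a < 0"
    and der: "\<And>s. a < s \<Longrightarrow> s \<le> b \<Longrightarrow> (f has_real_derivative f' s) (at s)"
    and neg: "\<And>s. a < s \<Longrightarrow> s \<le> b \<Longrightarrow> f s = 0 \<Longrightarrow> (\<And>r. a \<le> r \<Longrightarrow> r < s \<Longrightarrow> f r < 0) \<Longrightarrow> f' s < 0"
    and x: "x \<in> {a..b}"
  shows "f x < 0"
proof (rule ccontr)
  assume nx: "\<not> f x < 0"
  let ?S = "{s \<in> {a..b}. 0 \<le> f s}"
  have S: "?S \<noteq> {}" "bdd_below ?S" using nx x by (auto intro: bdd_belowI[of _ a])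
  have "closed ?S"
    using cont by (intro continuous_on_closed_Collect_le) auto
  define s where "s = Inf ?S"
  have sS: "s \<in> ?S" unfolding s_def by (rule closed_contains_Inf[OF S \<open>closed ?S\<close>])
  have below: "f r < 0" if "a \<le> r" "r < s" for r
    using cInf_lower[OF _ S(2), of r] that sS by (fastforce simp: s_def not_le[symmetric])
  have "a < s" using sS fa by (cases "a = s") auto
  have "f s = 0"
  proof (rule ccontr)
    assume "f s \<noteq> 0"
    then have "0 < f s" using sS by auto
    moreover have c: "continuous_on {a..s} f" using cont sS by (auto intro: continuous_on_subset)
    ultimately obtain r where "a \<le> r" "r \<le> s" "f r = 0"
      using IVT'[of f a 0 s] fa \<open>a < s\<close> by (auto simp: less_imp_le)
    then show False using below[of r] \<open>0 < f s\<close> by (cases "r = s") auto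
  qed
  then have "f' s < 0" using neg[of s] \<open>a < s\<close> sS below by auto
  then obtain e where e: "e > 0" "\<And>h. 0 < h \<Longrightarrow> h < e \<Longrightarrow> f s < f (s - h)"
    using DERIV_neg_dec_left[OF der[of s]] \<open>a < s\<close> sS by auto
  define h where "h = min e (s - a) / 2"
  have "0 < h" "h < e" "a \<le> s - h" "s - h < s" using e(1) \<open>a < s\<close> by (auto simp: h_def min_def field_simps)
  then show False using e(2)[of h] below[of "s - h"] \<open>f s = 0\<close> by force
qed

lemma powr_neg_le_1: "1 \<le> (x::real) \<Longrightarrow> 0 \<le> a \<Longrightarrow> x powr (- a) \<le> 1"
  using powr_mono[of "-a" 0 x] by simp

lemma powr_mult3:
  "0 \<le> a \<Longrightarrow> 0 \<le> b \<Longrightarrow> 0 \<le> c \<Longrightarrow> (a * b * c) powr x = a powr x * b powr x * (c::real) powr x"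
  by (simp add: powr_mult)

text \<open>\<open>W\<close> is \<open>V - Vinf\<close>, \<open>Y\<close> the corresponding position
  and \<open>\<Phi>\<close> the increment of \<open>F0\<close>. \<open>A1\<close> and
  \<open>A2\<close> are the coefficient and the time shift of the lower barrier, \<open>C1\<close>
  and \<open>c6\<close> the coefficients of the upper and lower bound for \<open>R\<close>,
  \<open>Ce\<close> dominates an exponential by a power, and after \<open>s0\<close> the exponential
  bound for \<open>W\<close> has fallen below the mean velocity of order
  \<open>\<gamma> / t\<close>. \<open>small1\<close> keeps the barrier below half of
  \<open>\<gamma> * exp (- BM)\<close>, and \<open>small2\<close> makes the right end contribute
  less than the left one.\<close>

locale core = trajectory Y W for Y W :: "real \<Rightarrow> real" +
  fixes \<Phi> R :: "real \<Rightarrow> real" and \<gamma> B0 Binf bm BM p c3 C3 A1 A2 Ce s0 c6 C1 q :: real and d :: nat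
  assumes p: "0 < p" and d: "1 \<le> d" and q: "q = real d + p"
    and bm: "0 < bm" "bm \<le> Binf" "Binf \<le> B0" "B0 \<le> BM"
    and pos: "0 < \<gamma>" "0 < c3" "0 < C3" "0 < A1" "0 \<le> Ce"
    and A2: "1 \<le> A2" "2 * q \<le> bm * A2"
    and C1: "C1 = C3 * ((4 / bm + 5) powr (p + 1) + (Ce + 1) powr (p + 1)) + 1"
    and A1: "C1 * A2 powr q < bm / 2 * A1"
    and Ce: "\<And>t. 0 \<le> t \<Longrightarrow> exp (- bm * t / 2) \<le> Ce * (1 + t) powr (- q)"
    and s0: "1 \<le> s0" "\<And>t. s0 \<le> t \<Longrightarrow> exp (- bm * t) \<le> exp (- BM) / (4 * t)"
    and c6: "c6 = c3 * (exp (- BM) / 4) powr (p + 1) / 2"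
    and small1: "A1 * \<gamma> powr p \<le> exp (- BM) / 2 * min 1 (q - 1)"
    and small2: "C3 * ((4 * A1 / (q - 1)) powr (p + 1) + (2 powr q * A1) powr (p + 1))
       * (\<gamma> powr (p + 1)) powr p \<le> min 1 c6"
    and W0: "W 0 = \<gamma>"
    and dW: "\<And>t. 0 \<le> t \<Longrightarrow> (W has_real_derivative (- \<Phi> (W t) - R t)) (at t within {0..})"
    and contR: "continuous_on {0..} R"
    and cont\<Phi>: "continuous_on {-\<gamma>..\<gamma>} \<Phi>"
    and \<Phi>_pos: "\<And>x. 0 \<le> x \<Longrightarrow> x \<le> \<gamma> \<Longrightarrow> Binf * x \<le> \<Phi> x \<and> \<Phi> x \<le> B0 * x"
    and \<Phi>_neg: "\<And>x. - \<gamma> \<le> x \<Longrightarrow> x \<le> 0 \<Longrightarrow> B0 * x \<le> \<Phi> x \<and> \<Phi> x \<le> Binf * x"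
    and rb: "\<And>T. 0 < T \<Longrightarrow> (\<And>s. 0 \<le> s \<Longrightarrow> s < T \<Longrightarrow> \<bar>W s\<bar> \<le> 2 * \<gamma>) \<Longrightarrow>
       AE t in lborel. 0 < t \<and> t < T \<longrightarrow> rbound c3 C3 p d Y W t (R t)"
begin

definition g where "g = \<gamma> powr (p + 1)"
text \<open>Room for the reversal: \<open>lo\<close> is the solution of the linear equation with the
  steepest slope, minus a term that decays like the precollision force.\<close>

definition \<psi> where "\<psi> t = A1 * g * (A2 + t) powr (- q)"
definition lo where "lo t = \<gamma> * exp (- B0 * t) - \<psi> t"

lemma q1: "1 < q" using q p d by (simp add: of_nat_le_iff[of 1 d, symmetric] del: of_nat_le_iff)

lemma g_eq: "g = \<gamma> * \<gamma> powr p" and g_pos: "0 < g"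
  using pos by (simp_all add: g_def powr_add)

lemma A1g: "A1 * g \<le> \<gamma> * (exp (- BM) / 2)" "A1 * g \<le> \<gamma> * (exp (- BM) / 2) * (q - 1)" "A1 * g < \<gamma>"
proof -
  have e: "0 < exp (- BM)" "exp (- BM) \<le> 1" using bm by auto
  have "A1 * \<gamma> powr p \<le> exp (- BM) / 2 * 1"
    by (rule order_trans[OF small1], intro mult_left_mono) (use e in auto)
  then have "\<gamma> * (A1 * \<gamma> powr p) \<le> \<gamma> * (exp (- BM) / 2 * 1)" using pos by (intro mult_left_mono) auto
  then show 1: "A1 * g \<le> \<gamma> * (exp (- BM) / 2)" by (simp add: g_eq mult_ac)
  have "A1 * \<gamma> powr p \<le> exp (- BM) / 2 * (q - 1)"
    by (rule order_trans[OF small1], intro mult_left_mono) (use e in auto)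
  then have "\<gamma> * (A1 * \<gamma> powr p) \<le> \<gamma> * (exp (- BM) / 2 * (q - 1))" using pos by (intro mult_left_mono) auto
  then show "A1 * g \<le> \<gamma> * (exp (- BM) / 2) * (q - 1)" by (simp add: g_eq mult_ac)
  have "\<gamma> * (exp (- BM) / 2) \<le> \<gamma> * (1 / 2)" using e pos by (intro mult_left_mono) auto
  then show "A1 * g < \<gamma>" using 1 pos by linarith
qed

lemma \<psi>_pos: "0 \<le> t \<Longrightarrow> 0 < \<psi> t"
  unfolding \<psi>_def using pos g_pos A2 by (intro mult_pos_pos) auto

lemma \<psi>_le: assumes "0 \<le> t" shows "\<psi> t \<le> A1 * g * (1 + t) powr (- q)"
proof -
  have "(A2 + t) powr (- q) \<le> (1 + t) powr (- q)"
    using assms A2 q1 by (intro powr_mono2') auto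
  then show ?thesis unfolding \<psi>_def using pos g_pos by (intro mult_left_mono) auto
qed

lemma \<psi>_le': assumes "0 \<le> t" shows "\<psi> t \<le> \<gamma> * (1 + t) powr (- q)" "\<psi> t \<le> A1 * g"
proof -
  show "\<psi> t \<le> \<gamma> * (1 + t) powr (- q)"
    by (rule order_trans[OF \<psi>_le[OF assms]], intro mult_right_mono) (use A1g(3) in auto)
  have "A1 * g * (1 + t) powr (- q) \<le> A1 * g * 1"
    using assms q1 pos g_pos by (intro mult_left_mono powr_neg_le_1) auto
  then show "\<psi> t \<le> A1 * g" using \<psi>_le[OF assms] by linarith
qed

lemma \<psi>_deriv:
  assumes "0 \<le> t" shows "(\<psi> has_real_derivative - (q / (A2 + t)) * \<psi> t) (at t)"
proof -
  have "0 < A2 + t" using assms A2 by linarith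
  then have e: "(A2 + t) powr (- q - 1) = (A2 + t) powr (- q) / (A2 + t)"
    by (simp add: powr_diff)
  have "((\<lambda>t. A1 * g * (A2 + t) powr (- q)) has_real_derivative A1 * g * (- q * (A2 + t) powr (- q - 1) * 1)) (at t)"
    using \<open>0 < A2 + t\<close> by (intro DERIV_cmult DERIV_fun_powr[of "\<lambda>t. A2 + t"]) (auto intro!: derivative_eq_intros)
  then show ?thesis unfolding \<psi>_def e by (simp add: mult_ac)
qed

text \<open>\<open>A2\<close> makes the relative decay rate \<open>q / (A2 + t)\<close> of
  \<open>\<psi>\<close> at most \<open>bm / 2\<close>; \<open>A1\<close> makes the remaining
  \<open>bm / 2 * \<psi> t\<close> exceed the upper bound for \<open>R\<close>.\<close>

lemma \<psi>_barrier:
  assumes "0 \<le> t" shows "C1 * g * (1 + t) powr (- q) < bm * \<psi> t - (q / (A2 + t)) * \<psi> t"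
proof -
  have "q / (A2 + t) \<le> bm / 2"
  proof -
    have "2 * q \<le> bm * (A2 + t)" using A2 bm assms by (simp add: distrib_left add_increasing2)
    then show ?thesis using A2 assms by (simp add: field_simps)
  qed
  then have "q / (A2 + t) * \<psi> t \<le> bm / 2 * \<psi> t" using \<psi>_pos[OF assms] by (intro mult_right_mono) auto
  then have 1: "bm / 2 * \<psi> t \<le> bm * \<psi> t - (q / (A2 + t)) * \<psi> t" by linarith
  have "(A2 * (1 + t)) powr (- q) \<le> (A2 + t) powr (- q)"
    using A2 assms q1 by (intro powr_mono2') (auto simp: algebra_simps mult_right_mono mult_le_cancel_right1)
  moreover have "(A2 * (1 + t)) powr (- q) = A2 powr (- q) * (1 + t) powr (- q)"
    using A2 assms by (simp add: powr_mult)
  ultimately have 2: "A1 * g * (A2 powr (- q) * (1 + t) powr (- q)) \<le> \<psi> t"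
    unfolding \<psi>_def using pos g_pos by (intro mult_left_mono) auto
  have "C1 < bm / 2 * A1 * A2 powr (- q)"
    using A1 A2 by (simp add: powr_minus field_simps)
  then have "C1 * (g * (1 + t) powr (- q)) < bm / 2 * A1 * A2 powr (- q) * (g * (1 + t) powr (- q))"
    using g_pos assms by (intro mult_strict_right_mono mult_pos_pos) auto
  also have "\<dots> = bm / 2 * (A1 * g * (A2 powr (- q) * (1 + t) powr (- q)))" by simp
  also have "\<dots> \<le> bm / 2 * \<psi> t" using 2 bm by (intro mult_left_mono) auto
  finally show ?thesis using 1 by (simp add: mult_ac)
qed

lemma W_deriv: "0 < t \<Longrightarrow> (W has_real_derivative (- \<Phi> (W t) - R t)) (at t)"
  using dW[of t] at_within_interior[of t "{0..}"] by simp

lemma mean_eq: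
  assumes "0 \<le> s" "s < t" obtains r where "s < r" "r < t" "mean Y s t = W r"
  using mean_value[OF assms] assms unfolding mean_def by (metis diff_gt_0_iff_gt less_irrefl nonzero_mult_div_cancel_left)

lemma contW_on: "0 \<le> a \<Longrightarrow> continuous_on {a..b} W"
  by (rule continuous_on_subset[OF contV]) auto

lemma contR_on: "0 \<le> a \<Longrightarrow> continuous_on {a..b} R"
  by (rule continuous_on_subset[OF contR]) auto

text \<open>The bounds on \<open>R\<close> concern positive times only. As \<open>t\<close> tends to
  0 all mean velocities approach \<open>W t\<close>, so the right-end part tends to 0, and the
  left-end part is nonnegative.\<close>

lemma R0_nonneg: "0 \<le> R 0"
proof (rule ccontr)
  assume neg: "\<not> 0 \<le> R 0"
  \<comment> \<open>Chosen such that \<open>C3 * (2 * e powr (p + 1))\<close> equals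
    \<open>- R 0 / 2\<close>.\<close>
  define e where "e = (- R 0 / (4 * C3)) powr (1 / (p + 1))"
  have e: "0 < e" "e powr (p + 1) = - R 0 / (4 * C3)"
    using neg pos p by (auto simp: e_def powr_powr divide_less_0_iff)
  define e' where "e' = min (e / 2) \<gamma>"
  have "0 < e'" using e pos by (simp add: e'_def)
  then obtain \<delta> where \<delta>: "\<delta> > 0" "\<And>s. s \<in> {0..} \<Longrightarrow> dist s 0 < \<delta> \<Longrightarrow> dist (W s) (W 0) < e'"
    using contV unfolding continuous_on_iff by (metis atLeast_iff order_refl)
  have close: "\<bar>W s - \<gamma>\<bar> < e'" if "0 \<le> s" "s < \<delta>" for s
    using \<delta>(2)[of s] that W0 by (simp add: dist_real_def)
  have "AE t in lborel. 0 < t \<and> t < \<delta> \<longrightarrow> rbound c3 C3 p d Y W t (R t)"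
    by (rule rb[OF \<delta>(1)]) (use close e'_def pos in \<open>smt (verit)\<close>)
  then have "AE t in lborel. 0 < t \<and> t < \<delta> / 2 \<longrightarrow> R 0 / 2 \<le> R t"
  proof (rule eventually_mono, intro impI)
    fix t assume *: "0 < t \<and> t < \<delta> \<longrightarrow> rbound c3 C3 p d Y W t (R t)" and t: "0 < t \<and> t < \<delta> / 2"
    have m: "\<bar>mean Y s t - W t\<bar> \<le> e" if "0 < s" "s < t" for s
    proof -
      have "0 \<le> s" using that by simp
      from mean_eq[OF this that(2)] obtain r where "s < r" "r < t" "mean Y s t = W r" .
      then have "\<bar>W r - \<gamma>\<bar> < e'" "\<bar>W t - \<gamma>\<bar> < e'" using close[of r] close[of t] t that by auto
      then show ?thesis unfolding \<open>mean Y s t = W r\<close> e'_def by linarith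
    qed
    have mb: "mean_below Y W t e e"
      unfolding mean_below_def using m e(1) t by (auto simp: abs_le_iff)
    obtain RL RR where RR: "R t = RL + RR" "0 \<le> RL"
      "\<bar>RR\<bar> \<le> C3 * (e powr (p + 1) * (1 + t) powr (1 - real d) + e powr (p + 1))"
      using * t mb unfolding rbound_def by auto
    have "(1 + t) powr (1 - real d) \<le> 1" using powr_neg_le_1[of "1 + t" "real d - 1"] t d by simp
    then have "e powr (p + 1) * (1 + t) powr (1 - real d) \<le> e powr (p + 1) * 1"
      by (intro mult_left_mono) auto
    then have "C3 * (e powr (p + 1) * (1 + t) powr (1 - real d) + e powr (p + 1)) \<le> C3 * (2 * e powr (p + 1))"
      using pos by (intro mult_left_mono) auto
    also have "\<dots> = - R 0 / 2" using e pos by simp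
    finally show "R 0 / 2 \<le> R t" using RR by linarith
  qed
  then have "R 0 / 2 \<le> R 0"
    by (intro AE_le_extend[of 0 "\<delta> / 2" "\<lambda>_. R 0 / 2" R 0]) (use \<delta>(1) in \<open>auto intro!: contR_on\<close>)
  then show False using neg by simp
qed

text \<open>The bootstrap hypothesis on \<open>[0, T)\<close>. Under it both inequalities become
  strict at \<open>T\<close> itself, see \<open>barrier_at_T\<close>, so they persist and
  \<open>all_ok\<close> follows.\<close>

definition ok where "ok T \<longleftrightarrow> 0 < T \<and> (\<forall>s. 0 \<le> s \<and> s < T \<longrightarrow> \<bar>W s\<bar> \<le> \<gamma> \<and> lo s < W s)"

text \<open>At time 0 the bound \<open>W \<le> \<gamma>\<close> is attained; it holds just
  afterwards because the initial derivative is strictly negative.\<close>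

lemma initial_ok: "\<exists>T. ok T"
proof -
  have "- \<Phi> (W 0) - R 0 < 0"
    using R0_nonneg \<Phi>_pos[of \<gamma>] pos bm by (simp add: W0) (smt (verit) mult_pos_pos)
  from has_real_derivative_neg_dec_right[OF dW[of 0] this]
  obtain e where e: "e > 0" "\<And>h. 0 < h \<Longrightarrow> h < e \<Longrightarrow> W h < \<gamma>" by (auto simp: W0)
  have "0 < min \<gamma> (\<psi> 0)" using pos \<psi>_pos[of 0] by simp
  then obtain \<delta> where \<delta>: "\<delta> > 0" "\<And>s. s \<in> {0..} \<Longrightarrow> dist s 0 < \<delta> \<Longrightarrow> dist (W s - \<gamma> * exp (- B0 * s) + \<psi> s) (W 0 - \<gamma> * exp (- B0 * 0) + \<psi> 0) < min \<gamma> (\<psi> 0)"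
  proof -
    have "continuous_on {0..} \<psi>"
      using \<psi>_deriv by (intro continuous_at_imp_continuous_on ballI DERIV_isCont) auto
    then have "continuous_on {0..} (\<lambda>s. W s - \<gamma> * exp (- B0 * s) + \<psi> s)"
      by (intro continuous_intros contV)
    then show thesis using that \<open>0 < min \<gamma> (\<psi> 0)\<close> unfolding continuous_on_iff by (metis atLeast_iff order_refl)
  qed
  obtain \<delta>' where \<delta>': "\<delta>' > 0" "\<And>s. s \<in> {0..} \<Longrightarrow> dist s 0 < \<delta>' \<Longrightarrow> dist (W s) (W 0) < \<gamma>"
    using contV pos unfolding continuous_on_iff by (metis atLeast_iff order_refl)
  have "ok (min e (min \<delta> \<delta>'))"
    unfolding ok_def
  proof (intro conjI allI impI)
    fix s assume s: "0 \<le> s \<and> s < min e (min \<delta> \<delta>')"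
    have "W s \<le> \<gamma>" using e(2)[of s] s W0 by (cases "s = 0") auto
    moreover have "0 < W s" using \<delta>'(2)[of s] s W0 by (simp add: dist_real_def abs_less_iff)
    ultimately show "\<bar>W s\<bar> \<le> \<gamma>" by simp
    show "lo s < W s" using \<delta>(2)[of s] s W0 unfolding lo_def by (simp add: dist_real_def abs_less_iff)
  qed (use e \<delta> \<delta>' in auto)
  then show ?thesis by blast
qed

section \<open>Consequences of the bootstrap hypothesis on [0, T)\<close>

context
  fixes T assumes ok: "ok T"
begin

lemma T_pos: "0 < T" and W_abs: "0 \<le> s \<Longrightarrow> s < T \<Longrightarrow> \<bar>W s\<bar> \<le> \<gamma>" and W_lo: "0 \<le> s \<Longrightarrow> s < T \<Longrightarrow> lo s < W s"
  using ok by (auto simp: ok_def)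

lemma rb_ae: "AE t in lborel. 0 < t \<and> t < T \<longrightarrow> rbound c3 C3 p d Y W t (R t)"
  using T_pos by (rule rb) (use W_abs pos in \<open>smt (verit)\<close>)

lemma extend_lower:
  assumes "0 \<le> a" "a < b" "b \<le> T" "continuous_on {a..b} f"
    and "\<And>t. a < t \<Longrightarrow> t < b \<Longrightarrow> rbound c3 C3 p d Y W t (R t) \<Longrightarrow> f t \<le> R t"
  shows "f b \<le> R b"
proof (rule AE_le_extend[OF \<open>a < b\<close> assms(4) contR_on[OF \<open>0 \<le> a\<close>]])
  show "AE t in lborel. a < t \<and> t < b \<longrightarrow> f t \<le> R t"
    using rb_ae by (rule eventually_mono) (use assms in auto)
qed (use assms in auto)

lemma extend_upper:
  assumes "0 \<le> a" "a < b" "b \<le> T" "continuous_on {a..b} f"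
    and "\<And>t. a < t \<Longrightarrow> t < b \<Longrightarrow> rbound c3 C3 p d Y W t (R t) \<Longrightarrow> R t \<le> f t"
  shows "R b \<le> f b"
proof (rule AE_le_extend[OF \<open>a < b\<close> contR_on[OF \<open>0 \<le> a\<close>] assms(4)])
  show "AE t in lborel. a < t \<and> t < b \<longrightarrow> R t \<le> f t"
    using rb_ae by (rule eventually_mono) (use assms in auto)
qed (use assms in auto)

lemma strict_decreasing:
  assumes "\<And>s. 0 < s \<Longrightarrow> s < t \<Longrightarrow> - \<Phi> (W s) - R s < 0" "0 \<le> a" "a < b" "b \<le> t"
  shows "W b < W a"
proof (rule DERIV_neg_imp_decreasing_open[OF \<open>a < b\<close> _ contW_on[OF \<open>0 \<le> a\<close>]])
  fix x assume "a < x" "x < b"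
  then show "\<exists>y. DERIV W x :> y \<and> y < 0"
    using W_deriv[of x] assms(1)[of x] assms by (intro exI[of _ "- \<Phi> (W x) - R x"]) auto
qed

lemma mean_below_decreasing:
  assumes "\<And>a b. 0 \<le> a \<Longrightarrow> a < b \<Longrightarrow> b \<le> t \<Longrightarrow> W b < W a"
  shows "mean_below Y W t 0 0"
proof -
  have "W t - mean Y s t \<le> 0" if s: "0 < s" "s < t" for s
  proof -
    have "0 \<le> s" using s by simp
    from mean_eq[OF this s(2)] obtain r where "s < r" "r < t" "mean Y s t = W r" .
    then show ?thesis using assms[of r t] s by simp
  qed
  then show ?thesis unfolding mean_below_def by auto
qed

text \<open>While the motion decreases, \<open>W s\<close> is below every earlier mean: the
  right-end part is bounded by 0, and the left-end part is at least the positive \<open>f\<close>. A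
  continuous minorant keeps the inequality strict when passing from almost every \<open>s\<close> to
  \<open>t\<close>.\<close>

lemma R_pos_decreasing:
  assumes t: "0 < t" "t < T" and neg: "\<And>s. 0 < s \<Longrightarrow> s < t \<Longrightarrow> - \<Phi> (W s) - R s < 0"
  shows "0 < R t"
proof -
  have dec: "W b < W a" if "0 \<le> a" "a < b" "b \<le> t" for a b
    using strict_decreasing[OF neg] that by blast
  define f where "f s = c3 * (mean Y 0 s - W s) powr (p + 1) * (1 + s) powr (1 - real d)" for s
  have mpos: "0 < mean Y 0 s - W s" if s: "0 < s" "s \<le> t" for s
  proof -
    from mean_eq[OF order_refl s(1)] obtain r where "0 < r" "r < s" "mean Y 0 s = W r" .
    then show ?thesis using dec[of r s] s by simp
  qed
  \<comment> \<open>Starting at \<open>t / 2\<close> keeps away from time 0, where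
    \<open>mean Y 0 s\<close> has a vanishing denominator.\<close>
  have "f t \<le> R t"
  proof (rule extend_lower[of "t / 2" t])
    show "continuous_on {t / 2..t} f"
    proof -
      have "(Y x - Y 0) / (x - 0) - W x \<noteq> 0" if "x \<in> {t / 2..t}" for x
        using mpos[of x] that t by (simp add: mean_def)
      then show ?thesis unfolding f_def mean_def
        using t by (intro continuous_intros contW_on continuous_on_subset[OF contX]) auto
    qed
    fix s assume s: "t / 2 < s" "s < t" and "rbound c3 C3 p d Y W s (R s)"
    then obtain RL RR where R: "R s = RL + RR" "\<And>w. 0 \<le> w \<Longrightarrow> w \<le> mean Y 0 s - W s \<Longrightarrow> c3 * w powr (p + 1) * (1 + s) powr (1 - real d) \<le> RL"
      "\<And>m1 m2. mean_below Y W s m1 m2 \<Longrightarrow> \<bar>RR\<bar> \<le> C3 * (m1 powr (p + 1) * (1 + s) powr (1 - real d) + m2 powr (p + 1))"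
      unfolding rbound_def by auto
    have "mean_below Y W s 0 0" by (rule mean_below_decreasing) (use dec s in auto)
    from R(3)[OF this] have "RR = 0" by simp
    then show "f s \<le> R s" using R(1) R(2)[of "mean Y 0 s - W s"] mpos[of s] s t by (simp add: f_def)
  qed (use t in auto)
  moreover have "0 < f t" using mpos[of t] t pos by (simp add: f_def)
  ultimately show ?thesis by simp
qed

text \<open>Consider the first time at which the derivative is not negative. The motion has
  decreased until then, so \<open>R\<close> is positive there, while \<open>\<Phi>\<close> is
  nonnegative; at time 0 the roles are exchanged. Either way the derivative is negative after
  all.\<close>

lemma decreasing_while_nonneg:
  assumes "0 \<le> t" "t < T" "\<And>s. 0 \<le> s \<Longrightarrow> s \<le> t \<Longrightarrow> 0 \<le> W s"
  shows "- \<Phi> (W t) - R t < 0"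
proof (rule ccontr)
  assume nt: "\<not> - \<Phi> (W t) - R t < 0"
  let ?S = "{s \<in> {0..t}. 0 \<le> - \<Phi> (W s) - R s}"
  have c: "continuous_on {0..t} (\<lambda>s. - \<Phi> (W s) - R s)"
    by (intro continuous_intros contR_on continuous_on_compose2[OF cont\<Phi> contW_on])
      (use W_abs assms in \<open>fastforce simp: abs_le_iff\<close>)+
  have S: "?S \<noteq> {}" "bdd_below ?S" using nt assms(1) by (auto intro: bdd_belowI[of _ 0])
  have "closed ?S" using c by (intro continuous_on_closed_Collect_le) auto
  define s where "s = Inf ?S"
  have sS: "s \<in> ?S" unfolding s_def by (rule closed_contains_Inf[OF S \<open>closed ?S\<close>])
  have below: "- \<Phi> (W r) - R r < 0" if "0 \<le> r" "r < s" for r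
    using cInf_lower[OF _ S(2), of r] that sS by (fastforce simp: s_def not_le[symmetric])
  have "0 \<le> \<Phi> (W s)"
  proof -
    have "0 \<le> W s" "W s \<le> \<gamma>" using assms sS W_abs[of s] by auto
    then have "Binf * W s \<le> \<Phi> (W s)" using \<Phi>_pos by blast
    moreover have "0 \<le> Binf * W s" using \<open>0 \<le> W s\<close> bm by simp
    ultimately show ?thesis by linarith
  qed
  have "0 < \<Phi> (W s) + R s"
  proof (cases "s = 0")
    case True
    have "Binf * \<gamma> \<le> \<Phi> \<gamma>" using \<Phi>_pos[of \<gamma>] pos by simp
    moreover have "0 < Binf * \<gamma>" using bm pos by simp
    ultimately show ?thesis using R0_nonneg True W0 by simp
  next
    case False
    then have "0 < R s" using sS assms below by (intro R_pos_decreasing) auto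
    with \<open>0 \<le> \<Phi> (W s)\<close> show ?thesis by simp
  qed
  with sS show False by simp
qed

lemma phase1_decreasing:
  assumes "t < T" "\<And>s. 0 \<le> s \<Longrightarrow> s \<le> t \<Longrightarrow> 0 \<le> W s" "0 \<le> a" "a < b" "b \<le> t"
  shows "W b < W a"
  by (rule strict_decreasing[OF _ assms(3-5)]) (use assms in \<open>intro decreasing_while_nonneg; simp\<close>)

text \<open>The barrier is positive up to time 1, so \<open>W\<close> can become negative only
  later; this is the source of \<open>1 \<le> t\<close> in \<open>phase\<close>.\<close>

lemma lo_pos: "0 \<le> t \<Longrightarrow> t \<le> 1 \<Longrightarrow> 0 < lo t"
proof -
  assume t: "0 \<le> t" "t \<le> 1"
  have "B0 * t \<le> BM * 1" using t bm by (intro mult_mono) auto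
  then have "\<gamma> * exp (- BM) \<le> \<gamma> * exp (- B0 * t)" using pos by simp
  moreover have "\<psi> t \<le> \<gamma> * (exp (- BM) / 2)" using \<psi>_le'(2)[OF t(1)] A1g(1) by linarith
  moreover have "0 < \<gamma> * exp (- BM)" using pos by simp
  ultimately show ?thesis unfolding lo_def by linarith
qed

lemma Y_lower:
  assumes "0 \<le> s" "s \<le> t" "t < T"
  shows "\<gamma> / B0 * (exp (- B0 * s) - exp (- B0 * t)) - A1 * g / (q - 1) \<le> Y t - Y s"
proof -
  \<comment> \<open>\<open>L\<close> is an antiderivative of \<open>lo\<close>. The total effect of
    \<open>\<psi>\<close> on the position is at most \<open>A1 * g / (q - 1)\<close>, finite because
    \<open>q > 1\<close>.\<close>
  define L where "L t = - \<gamma> / B0 * exp (- B0 * t) + A1 * g / (q - 1) * (A2 + t) powr (1 - q)" for t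
  have B0: "0 < B0" using bm by simp
  have dL: "(L has_real_derivative lo x) (at x)" if "0 \<le> x" for x
  proof -
    have "0 < A2 + x" using that A2 by linarith
    have "((\<lambda>t. A1 * g / (q - 1) * (A2 + t) powr (1 - q)) has_real_derivative
       A1 * g / (q - 1) * ((1 - q) * (A2 + x) powr (1 - q - 1) * 1)) (at x)"
      using \<open>0 < A2 + x\<close> DERIV_fun_powr[of "\<lambda>t. A2 + t" 1 x "1 - q"]
      by (intro DERIV_cmult) (auto intro!: derivative_eq_intros)
    moreover have "A1 * g / (q - 1) * ((1 - q) * (A2 + x) powr (1 - q - 1) * 1) = - \<psi> x"
      using q1 by (simp add: \<psi>_def field_simps)
    ultimately have 1: "((\<lambda>t. A1 * g / (q - 1) * (A2 + t) powr (1 - q)) has_real_derivative - \<psi> x) (at x)" by simp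
    have 2: "((\<lambda>t. - \<gamma> / B0 * exp (- B0 * t)) has_real_derivative \<gamma> * exp (- B0 * x)) (at x)"
      using B0 by (auto intro!: derivative_eq_intros)
    show ?thesis unfolding L_def[abs_def] lo_def using DERIV_add[OF 2 1] by simp
  qed
  have "Y s - L s \<le> Y t - L t"
  proof (cases "s = t")
    case False
    then have "s < t" using assms by simp
    have "Y s - L s < Y t - L t"
    proof (rule DERIV_pos_imp_increasing_open[OF \<open>s < t\<close>])
      fix x assume x: "s < x" "x < t"
      show "\<exists>y. ((\<lambda>t. Y t - L t) has_real_derivative y) (at x) \<and> 0 < y"
        using DERIV_diff[OF deriv_at[of x] dL[of x]] W_lo[of x] x assms
        by (intro exI[of _ "W x - lo x"]) auto
    next
      have "continuous_on {s..t} L"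
        using assms by (intro continuous_at_imp_continuous_on ballI DERIV_isCont[OF dL]) auto
      then show "continuous_on {s..t} (\<lambda>t. Y t - L t)"
        using assms by (intro continuous_intros continuous_on_subset[OF contX]) auto
    qed
    then show ?thesis by simp
  qed simp
  moreover have "L t - L s \<ge> \<gamma> / B0 * (exp (- B0 * s) - exp (- B0 * t)) - A1 * g / (q - 1)"
  proof -
    have "A1 * g / (q - 1) * (A2 + s) powr (1 - q) \<le> A1 * g / (q - 1) * 1"
      using pos g_pos q1 A2 assms powr_neg_le_1[of "A2 + s" "q - 1"] by (intro mult_left_mono) auto
    moreover have "0 \<le> A1 * g / (q - 1) * (A2 + t) powr (1 - q)"
      using pos g_pos q1 by simp
    ultimately show ?thesis by (simp add: L_def algebra_simps)
  qed
  ultimately show ?thesis by linarith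
qed

text \<open>Relative to the equilibrium motion the body gains by time 1 a displacement of order
  \<open>\<gamma>\<close>, of which a fixed part is never lost. So the mean over
  \<open>[0, t]\<close> decays only like \<open>\<gamma> / t\<close>, far slower than the
  exponential bound for \<open>W\<close>; this keeps the left-end contribution alive at late
  times.\<close>

lemma mean_0_lower:
  assumes "1 \<le> t" "t < T"
  shows "\<gamma> * exp (- BM) / (2 * t) \<le> mean Y 0 t"
proof -
  have B0: "0 < B0" using bm by simp
  have "B0 * exp (- B0) \<le> 1 - exp (- B0)"
  proof -
    have "(1 + B0) * exp (- B0) \<le> exp B0 * exp (- B0)" by (intro mult_right_mono exp_ge_add_one_self) auto
    then show ?thesis by (simp add: algebra_simps exp_add[symmetric])
  qed
  moreover have "exp (- B0 * t) \<le> exp (- B0)" using assms B0 by simp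
  ultimately have "B0 * exp (- B0) \<le> 1 - exp (- B0 * t)" by linarith
  then have "exp (- B0) \<le> (1 - exp (- B0 * t)) / B0" using B0 by (simp add: field_simps)
  moreover have "exp (- BM) \<le> exp (- B0)" using bm by simp
  ultimately have "exp (- BM) \<le> (1 - exp (- B0 * t)) / B0" by linarith
  then have "\<gamma> * exp (- BM) \<le> \<gamma> * ((1 - exp (- B0 * t)) / B0)"
    by (rule mult_left_mono) (use pos in simp)
  moreover have "A1 * g / (q - 1) \<le> \<gamma> * (exp (- BM) / 2)"
    using A1g(2) q1 by (simp add: field_simps)
  moreover have "\<gamma> / B0 * (exp (- B0 * 0) - exp (- B0 * t)) - A1 * g / (q - 1) \<le> Y t - Y 0"
    using assms by (intro Y_lower) auto
  ultimately have "\<gamma> * exp (- BM) / 2 \<le> Y t - Y 0" by simp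
  then have "\<gamma> * exp (- BM) / 2 / t \<le> (Y t - Y 0) / t" using assms by (intro divide_right_mono) auto
  then show ?thesis by (simp add: mean_def)
qed

text \<open>Either \<open>W\<close> has not been negative so far, or it is negative now; that a
  negative \<open>W\<close> never returns is proved in \<open>stays_negative\<close>.\<close>

definition phase where
  "phase t \<longleftrightarrow> (\<forall>s. 0 \<le> s \<and> s \<le> t \<longrightarrow> 0 \<le> W s) \<or> (W t < 0 \<and> 1 \<le> t)"

text \<open>Means of order \<open>1 / t\<close> to the power \<open>p + 1\<close>, times the
  transversal factor: this is how the exponent \<open>d + p\<close> arises.\<close>

lemma powr_collect: "0 < x \<Longrightarrow> x powr (- (p + 1)) * x powr (1 - real d) = x powr (- q)"
proof -
  have "- (p + 1) + (1 - real d) = - q" by (simp add: q)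
  then show "x powr (- (p + 1)) * x powr (1 - real d) = x powr (- q)"
    by (simp only: powr_add[symmetric])
qed

text \<open>In the first phase the motion decreases and both bounds are 0. Once \<open>W t\<close>
  is negative, a mean can fall below \<open>W t\<close> only by being negative itself, hence by an
  amount of order \<open>g\<close>: early means through the displacement, late ones through
  \<open>lo\<close>. So the right end contributes \<open>g powr (p + 1)\<close>, and
  \<open>small2\<close> absorbs the surplus \<open>g powr p\<close>.\<close>

lemma mean_below_bound:
  assumes t: "0 < t" "t < T" and ph: "phase t"
  shows "\<exists>m1 m2. mean_below Y W t m1 m2 \<and>
    C3 * (m1 powr (p + 1) * (1 + t) powr (1 - real d) + m2 powr (p + 1)) \<le> min 1 c6 * g * (1 + t) powr (- q)"
proof (cases "\<forall>s. 0 \<le> s \<and> s \<le> t \<longrightarrow> 0 \<le> W s")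
  case True
  have "mean_below Y W t 0 0"
    by (rule mean_below_decreasing) (use True t phase1_decreasing in blast)
  moreover have "0 \<le> c6" using pos by (simp add: c6)
  ultimately show ?thesis using g_pos by (intro exI[of _ 0]) simp
next
  case False
  then have W: "W t < 0" "1 \<le> t" using ph by (auto simp: phase_def)
  define a1 a2 where "a1 = 4 * A1 / (q - 1)" and "a2 = 2 powr q * A1"
  define m1 m2 where "m1 = a1 * g * (1 + t) powr (- 1)" and "m2 = a2 * g * (1 + t) powr (- q)"
  have nn: "0 \<le> a1" "0 \<le> a2" "0 \<le> m1" "0 \<le> m2"
    using pos g_pos q1 by (auto simp: a1_def a2_def m1_def m2_def)
  have "mean_below Y W t m1 m2"
    unfolding mean_below_def
  proof (intro conjI nn allI impI)
    fix s assume s: "0 < s \<and> s \<le> t / 2"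
    have B0: "0 < B0" using bm by simp
    have "exp (- B0 * t) \<le> exp (- B0 * s)" using s t B0 by simp
    then have "0 \<le> \<gamma> / B0 * (exp (- B0 * s) - exp (- B0 * t))" using pos B0 by (intro mult_nonneg_nonneg) auto
    then have Y: "- (A1 * g / (q - 1)) \<le> Y t - Y s" using Y_lower[of s t] s t by linarith
    have "- mean Y s t \<le> A1 * g / (q - 1) / (t - s)"
      using divide_right_mono[OF Y, of "t - s"] s t by (simp add: mean_def)
    \<comment> \<open>From \<open>s \<le> t / 2\<close> and \<open>1 \<le> t\<close>:
      \<open>t - s \<ge> t / 2 \<ge> (1 + t) / 4\<close>.\<close>
    also have "\<dots> \<le> A1 * g / (q - 1) / ((1 + t) / 4)"
      using s t W pos g_pos q1 by (intro divide_left_mono) auto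
    also have "\<dots> = m1" using t q1 by (simp add: m1_def a1_def powr_minus field_simps)
    finally show "W t - mean Y s t \<le> m1" using W by linarith
  next
    fix s assume s: "t / 2 < s \<and> s < t"
    have "0 \<le> s" using s t by simp
    from mean_eq[OF this conjunct2[OF s]] obtain r where r: "s < r" "r < t" "mean Y s t = W r" .
    have r0: "0 \<le> r" using r s t by linarith
    have "- W r < \<psi> r - \<gamma> * exp (- B0 * r)" using W_lo[of r] r r0 t by (simp add: lo_def)
    also have "\<dots> \<le> \<psi> r" using pos by simp
    also have "\<dots> \<le> A1 * g * (1 + r) powr (- q)" using \<psi>_le r0 by simp
    also have "\<dots> \<le> A1 * g * ((1 + t) / 2) powr (- q)"
      using r s t pos g_pos q1 by (intro mult_left_mono powr_mono2') auto
    also have "\<dots> = m2" using t by (simp add: m2_def a2_def powr_divide powr_minus field_simps)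
    finally show "W t - mean Y s t \<le> m2" using W r by linarith
  qed
  moreover have "C3 * (m1 powr (p + 1) * (1 + t) powr (1 - real d) + m2 powr (p + 1)) \<le> min 1 c6 * g * (1 + t) powr (- q)"
  proof -
    have "m1 powr (p + 1) * (1 + t) powr (1 - real d) = a1 powr (p + 1) * g powr (p + 1) * (((1 + t) powr (- 1)) powr (p + 1) * (1 + t) powr (1 - real d))"
      unfolding m1_def using nn g_pos by (subst powr_mult3) auto
    also have "((1 + t) powr (- 1)) powr (p + 1) = (1 + t) powr (- (p + 1))" unfolding powr_powr by simp
    finally have 1: "m1 powr (p + 1) * (1 + t) powr (1 - real d) = a1 powr (p + 1) * g powr (p + 1) * (1 + t) powr (- q)"
      using t by (simp only: powr_collect)
    have "m2 powr (p + 1) = a2 powr (p + 1) * g powr (p + 1) * (1 + t) powr (- q * (p + 1))"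
      using nn g_pos by (simp add: m2_def powr_mult powr_powr)
    also have "\<dots> \<le> a2 powr (p + 1) * g powr (p + 1) * (1 + t) powr (- q)"
      using t p q1 nn by (intro mult_left_mono powr_mono) (auto simp: algebra_simps)
    finally have "m1 powr (p + 1) * (1 + t) powr (1 - real d) + m2 powr (p + 1) \<le>
       (a1 powr (p + 1) + a2 powr (p + 1)) * g powr (p + 1) * (1 + t) powr (- q)"
      unfolding 1 by (simp add: distrib_right)
    then have "C3 * (m1 powr (p + 1) * (1 + t) powr (1 - real d) + m2 powr (p + 1)) \<le>
        C3 * ((a1 powr (p + 1) + a2 powr (p + 1)) * g powr (p + 1) * (1 + t) powr (- q))"
      using pos by (intro mult_left_mono) auto
    also have "\<dots> = (C3 * (a1 powr (p + 1) + a2 powr (p + 1)) * g powr p) * (g * (1 + t) powr (- q))"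
      using g_pos by (simp add: powr_add)
    also have "\<dots> \<le> min 1 c6 * (g * (1 + t) powr (- q))"
      using small2 g_pos unfolding a1_def a2_def g_def by (intro mult_right_mono) auto
    finally show ?thesis by simp
  qed
  ultimately show ?thesis by blast
qed

text \<open>The mean over \<open>[0, t]\<close> exceeds \<open>W t\<close> by at least
  \<open>w\<close>, so the left end gives twice \<open>c6 * g * (1 + t) powr (- q)\<close>, and the
  right end takes back at most half of it. The final factor \<open>1 / 2\<close> in
  \<open>c6\<close> is there for this.\<close>

lemma R_lower:
  assumes t: "1 \<le> t" "t < T" and ph: "phase t" and W: "W t \<le> \<gamma> * exp (- BM) / (4 * t)"
    and r: "rbound c3 C3 p d Y W t (R t)"
  shows "c6 * g * (1 + t) powr (- q) \<le> R t"
proof -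
  obtain m1 m2 where m: "mean_below Y W t m1 m2"
    "C3 * (m1 powr (p + 1) * (1 + t) powr (1 - real d) + m2 powr (p + 1)) \<le> min 1 c6 * g * (1 + t) powr (- q)"
    using mean_below_bound[of t] t ph by auto
  obtain RL RR where R: "R t = RL + RR" "\<And>w. 0 \<le> w \<Longrightarrow> w \<le> mean Y 0 t - W t \<Longrightarrow> c3 * w powr (p + 1) * (1 + t) powr (1 - real d) \<le> RL"
    "\<bar>RR\<bar> \<le> C3 * (m1 powr (p + 1) * (1 + t) powr (1 - real d) + m2 powr (p + 1))"
    using r m(1) unfolding rbound_def by blast
  have "min 1 c6 * g * (1 + t) powr (- q) \<le> c6 * g * (1 + t) powr (- q)"
    using g_pos by (intro mult_right_mono) auto
  then have RR: "\<bar>RR\<bar> \<le> c6 * g * (1 + t) powr (- q)" using R(3) m(2) by linarith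
  define w where "w = \<gamma> * (exp (- BM) / 4) * (1 + t) powr (- 1)"
  have "w \<le> \<gamma> * exp (- BM) / (4 * t)" unfolding w_def powr_minus using t pos by (simp add: field_simps)
  also have "\<dots> = \<gamma> * exp (- BM) / (2 * t) - \<gamma> * exp (- BM) / (4 * t)" using t by (simp add: field_simps)
  also have "\<dots> \<le> mean Y 0 t - W t" using mean_0_lower[OF t] W by linarith
  finally have "c3 * w powr (p + 1) * (1 + t) powr (1 - real d) \<le> RL"
    using pos by (intro R(2)) (auto simp: w_def)
  moreover have "c3 * w powr (p + 1) * (1 + t) powr (1 - real d) = 2 * c6 * g * (1 + t) powr (- q)"
  proof -
    have "w powr (p + 1) = g * (exp (- BM) / 4) powr (p + 1) * ((1 + t) powr (- 1)) powr (p + 1)"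
      unfolding w_def g_def using pos by (subst powr_mult3) auto
    also have "((1 + t) powr (- 1)) powr (p + 1) = (1 + t) powr (- (p + 1))" unfolding powr_powr by simp
    finally have "c3 * w powr (p + 1) * (1 + t) powr (1 - real d) =
        c3 * (g * (exp (- BM) / 4) powr (p + 1)) * ((1 + t) powr (- (p + 1)) * (1 + t) powr (1 - real d))"
      by simp
    also have "\<dots> = 2 * c6 * g * (1 + t) powr (- q)"
      using t by (simp only: powr_collect c6) simp
    finally show ?thesis .
  qed
  ultimately show ?thesis using R(1) RR by linarith
qed

text \<open>At a return to zero \<open>\<Phi>\<close> vanishes while \<open>R\<close> is positive,
  so \<open>W\<close> would be decreasing there.\<close>

lemma stays_negative:
  assumes "0 \<le> s" "s \<le> t" "t < T" "W s < 0"
  shows "W t < 0"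
proof (rule first_crossing[OF \<open>s \<le> t\<close> contW_on[OF \<open>0 \<le> s\<close>] \<open>W s < 0\<close>, where f' = "\<lambda>t. - \<Phi> (W t) - R t"])
  show "(W has_real_derivative - \<Phi> (W x) - R x) (at x)" if "s < x" "x \<le> t" for x
    using that assms by (intro W_deriv) simp
  have s1: "1 < s" using lo_pos[of s] W_lo[of s] assms by force
  fix x assume x: "s < x" "x \<le> t" "W x = 0" and neg: "\<And>r. s \<le> r \<Longrightarrow> r < x \<Longrightarrow> W r < 0"
  have "c6 * g * (1 + x) powr (- q) \<le> R x"
  proof (rule extend_lower[OF \<open>0 \<le> s\<close> \<open>s < x\<close>])
    show "continuous_on {s..x} (\<lambda>x. c6 * g * (1 + x) powr (- q))"
      using s1 by (intro continuous_intros) auto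
    fix r assume r: "s < r" "r < x" "rbound c3 C3 p d Y W r (R r)"
    have "0 < \<gamma> * exp (- BM) / (4 * r)" using pos s1 r by simp
    then show "c6 * g * (1 + r) powr (- q) \<le> R r"
      using r s1 x assms neg[of r] by (intro R_lower) (auto simp: phase_def)
  qed (use x assms in auto)
  moreover have "0 < c6 * g * (1 + x) powr (- q)" using g_pos pos s1 x by (simp add: c6)
  moreover have "\<Phi> 0 = 0" using \<Phi>_pos[of 0] pos by simp
  ultimately show "- \<Phi> (W x) - R x < 0" using x by simp
qed (use assms in auto)

lemma phase: assumes "0 \<le> t" "t < T" shows "phase t"
proof (cases "\<forall>s. 0 \<le> s \<and> s \<le> t \<longrightarrow> 0 \<le> W s")
  case False
  then obtain s where s: "0 \<le> s" "s \<le> t" "W s < 0" by force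
  have "1 < s" using lo_pos[of s] W_lo[of s] s assms by force
  then show ?thesis using stays_negative[of s t] s assms by (auto simp: phase_def)
qed (simp add: phase_def)

text \<open>Before the reversal \<open>R\<close> is positive, so \<open>W\<close> decays faster than
  the linear equation with the smallest slope; afterwards \<open>W\<close> is negative.\<close>

lemma W_upper:
  assumes t: "0 < t" "t < T"
  shows "W t < \<gamma> * exp (- Binf * t)"
proof (cases "\<forall>s. 0 \<le> s \<and> s \<le> t \<longrightarrow> 0 \<le> W s")
  case True
  have "W t * exp (Binf * t) < W 0 * exp (Binf * 0)"
  proof (rule DERIV_neg_imp_decreasing_open[OF \<open>0 < t\<close>])
    fix x assume x: "0 < x" "x < t"
    have "((\<lambda>t. W t * exp (Binf * t)) has_real_derivative
       (- \<Phi> (W x) - R x) * exp (Binf * x) + exp (Binf * x) * Binf * W x) (at x)"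
      by (rule DERIV_mult'[THEN DERIV_cong, OF W_deriv[OF x(1)]]) (auto intro!: derivative_eq_intros)
    moreover have "(- \<Phi> (W x) - R x) * exp (Binf * x) + exp (Binf * x) * Binf * W x = exp (Binf * x) * (Binf * W x - \<Phi> (W x) - R x)"
      by (simp add: algebra_simps)
    moreover have "Binf * W x - \<Phi> (W x) - R x < 0"
    proof -
      have "0 < R x"
        using x t True by (intro R_pos_decreasing decreasing_while_nonneg) auto
      moreover have "Binf * W x \<le> \<Phi> (W x)" using True x t W_abs[of x] \<Phi>_pos[of "W x"] by auto
      ultimately show ?thesis by simp
    qed
    ultimately show "\<exists>y. ((\<lambda>t. W t * exp (Binf * t)) has_real_derivative y) (at x) \<and> y < 0"
      by (metis exp_gt_zero mult_pos_neg)
  qed (intro continuous_intros contW_on, simp)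
  then show ?thesis by (simp add: W0 exp_minus field_simps)
next
  case False
  then have "W t < 0" using phase[of t] t by (auto simp: phase_def)
  then show ?thesis using pos by (smt (verit) exp_gt_zero mult_pos_pos)
qed

text \<open>The displacement after \<open>s\<close> is at most the integral of the exponential
  bound, \<open>\<gamma> / bm\<close>; spread over a time of at least \<open>t / 2\<close> it gives
  a mean of order \<open>1 / t\<close>. Late means are exponentially small. One unit in each
  coefficient pays for a negative \<open>W t\<close>.\<close>

lemma mean_above_bound:
  assumes t: "0 < t" "t < T"
  shows "mean_above Y W t (\<gamma> * (4 / bm + 5) * (1 + t) powr (- 1)) (\<gamma> * (Ce + 1) * (1 + t) powr (- q))"
proof -
  have W: "- W t \<le> \<gamma> * (1 + t) powr (- q)"
  proof -
    have "- W t < \<psi> t - \<gamma> * exp (- B0 * t)" using W_lo[of t] t by (simp add: lo_def)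
    also have "\<dots> \<le> \<psi> t" using pos by simp
    also have "\<dots> \<le> \<gamma> * (1 + t) powr (- q)" using \<psi>_le'(1) t by simp
    finally show ?thesis by simp
  qed
  have e1: "(1 + t) powr (- q) \<le> (1 + t) powr (- 1)" using t q1 by (intro powr_mono) auto
  have e2: "(1 + t) powr (- 1) = 1 / (1 + t)" using t by (simp add: powr_minus field_simps)
  have W1: "- W t \<le> \<gamma> * (1 + t) powr (- 1)"
    by (rule order_trans[OF W], intro mult_left_mono e1) (use pos in simp)
  show ?thesis
    unfolding mean_above_def
  proof (intro conjI allI impI)
    fix s assume s: "0 < s \<and> s \<le> t / 2"
    have "mean Y s t \<le> \<gamma> * (4 / bm + 4) * (1 + t) powr (- 1)"
    proof (cases "t \<le> 1")
      case True
      have "0 \<le> s" "s < t" using s t by auto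
      from mean_eq[OF this] obtain r where r: "s < r" "r < t" "mean Y s t = W r" .
      then have "mean Y s t \<le> \<gamma>" using W_abs[of r] s t by auto
      also have "\<dots> \<le> \<gamma> * (4 * (1 + t) powr (- 1))" unfolding e2 using True t pos by (simp add: field_simps)
      also have "\<dots> \<le> \<gamma> * (4 / bm + 4) * (1 + t) powr (- 1)" using pos bm by (simp add: algebra_simps)
      finally show ?thesis .
    next
      case False
      have Binf: "0 < Binf" using bm by simp
      define L where "L t = - \<gamma> / Binf * exp (- Binf * t)" for t
      have dL: "(L has_real_derivative \<gamma> * exp (- Binf * x)) (at x)" for x
        unfolding L_def[abs_def] using Binf by (auto intro!: derivative_eq_intros)
      have "L s - Y s < L t - Y t"
      proof (rule DERIV_pos_imp_increasing_open[where f = "\<lambda>t. L t - Y t"])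
        show "s < t" using s t by auto
        fix x assume x: "s < x" "x < t"
        show "\<exists>y. ((\<lambda>t. L t - Y t) has_real_derivative y) (at x) \<and> 0 < y"
          using DERIV_diff[OF dL[of x] deriv_at[of x]] W_upper[of x] x s t
          by (intro exI[of _ "\<gamma> * exp (- Binf * x) - W x"]) auto
      next
        have "continuous_on {s..t} L"
          by (intro continuous_at_imp_continuous_on ballI DERIV_isCont[OF dL])
        then show "continuous_on {s..t} (\<lambda>t. L t - Y t)"
          using s by (intro continuous_intros continuous_on_subset[OF contX]) auto
      qed
      moreover have "L t \<le> 0" using pos Binf by (simp add: L_def)
      moreover have "- L s \<le> \<gamma> / bm"
      proof -
        have "- L s \<le> \<gamma> / Binf * 1" unfolding L_def using pos Binf s by (simp add: divide_right_mono mult_left_le)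
        also have "\<dots> \<le> \<gamma> / bm * 1" using bm pos by (simp add: frac_le)
        finally show ?thesis by simp
      qed
      ultimately have Y: "Y t - Y s \<le> \<gamma> / bm" by linarith
      have "mean Y s t \<le> \<gamma> / bm / (t - s)" unfolding mean_def using Y s t by (intro divide_right_mono) auto
      also have "\<dots> \<le> \<gamma> / bm / ((1 + t) / 4)"
        using s t False pos bm by (intro divide_left_mono) auto
      also have "\<dots> = \<gamma> * (4 / bm) * (1 + t) powr (- 1)" unfolding e2 by simp
      also have "\<dots> \<le> \<gamma> * (4 / bm + 4) * (1 + t) powr (- 1)" using pos bm by (intro mult_right_mono mult_left_mono) auto
      finally show ?thesis .
    qed
    moreover have "\<gamma> * (4 / bm + 5) * u = \<gamma> * (4 / bm + 4) * u + \<gamma> * u" for u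
      by (simp add: algebra_simps)
    ultimately show "mean Y s t - W t \<le> \<gamma> * (4 / bm + 5) * (1 + t) powr (- 1)"
      using W1 by (simp only:)
  next
    fix s assume s: "t / 2 < s \<and> s < t"
    have "0 \<le> s" using s t by simp
    from mean_eq[OF this conjunct2[OF s]] obtain r where r: "s < r" "r < t" "mean Y s t = W r" .
    have "0 < r" using r s t by linarith
    then have "W r \<le> \<gamma> * exp (- Binf * r)" using W_upper[of r] r t by simp
    also have "\<dots> \<le> \<gamma> * exp (- bm * t / 2)"
    proof -
      have "bm * (t / 2) \<le> Binf * r" using bm s r t by (intro mult_mono) auto
      then show ?thesis using pos by simp
    qed
    also have "\<dots> \<le> \<gamma> * (Ce * (1 + t) powr (- q))" using Ce[of t] t pos by (intro mult_left_mono) auto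
    finally show "mean Y s t - W t \<le> \<gamma> * (Ce + 1) * (1 + t) powr (- q)"
      using W r by (simp add: algebra_simps)
  qed (use pos bm in auto)
qed

text \<open>The left end accounts for \<open>C1 - 1\<close>, and the right end for at most the final
  \<open>1\<close>, since \<open>min 1 c6 \<le> 1\<close>.\<close>

lemma R_upper:
  assumes t: "0 < t" "t < T" and r: "rbound c3 C3 p d Y W t (R t)"
  shows "R t \<le> C1 * g * (1 + t) powr (- q)"
proof -
  obtain m1 m2 where m: "mean_below Y W t m1 m2"
    "C3 * (m1 powr (p + 1) * (1 + t) powr (1 - real d) + m2 powr (p + 1)) \<le> min 1 c6 * g * (1 + t) powr (- q)"
    using mean_below_bound[of t] phase t by auto
  define a1 a2 where "a1 = 4 / bm + 5" and "a2 = Ce + 1"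
  define n1 n2 where "n1 = \<gamma> * a1 * (1 + t) powr (- 1)" and "n2 = \<gamma> * a2 * (1 + t) powr (- q)"
  have ma: "mean_above Y W t n1 n2" using mean_above_bound[OF t] by (simp add: n1_def n2_def a1_def a2_def)
  have nn: "0 \<le> a1" "0 \<le> a2" using bm pos by (auto simp: a1_def a2_def)
  obtain RL RR where R: "R t = RL + RR" 
    "RL \<le> C3 * (n1 powr (p + 1) * (1 + t) powr (1 - real d) + n2 powr (p + 1))"
    "\<bar>RR\<bar> \<le> C3 * (m1 powr (p + 1) * (1 + t) powr (1 - real d) + m2 powr (p + 1))"
    using r m(1) ma unfolding rbound_def by blast
  have "min 1 c6 * g * (1 + t) powr (- q) \<le> 1 * g * (1 + t) powr (- q)"
    using g_pos by (intro mult_right_mono) auto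
  then have RR: "RR \<le> g * (1 + t) powr (- q)" using R(3) m(2) by linarith
  have "n1 powr (p + 1) = g * a1 powr (p + 1) * ((1 + t) powr (- 1)) powr (p + 1)"
    unfolding n1_def g_def using nn pos by (subst powr_mult3) auto
  also have "((1 + t) powr (- 1)) powr (p + 1) = (1 + t) powr (- (p + 1))" unfolding powr_powr by simp
  finally have "n1 powr (p + 1) * (1 + t) powr (1 - real d) =
     g * a1 powr (p + 1) * ((1 + t) powr (- (p + 1)) * (1 + t) powr (1 - real d))" by simp
  then have 1: "n1 powr (p + 1) * (1 + t) powr (1 - real d) = g * a1 powr (p + 1) * (1 + t) powr (- q)"
    using t by (simp only: powr_collect)
  have "n2 powr (p + 1) = g * a2 powr (p + 1) * ((1 + t) powr (- q)) powr (p + 1)"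
    unfolding n2_def g_def using nn pos by (subst powr_mult3) auto
  also have "\<dots> = g * a2 powr (p + 1) * (1 + t) powr (- q * (p + 1))" by (simp add: powr_powr)
  also have "\<dots> \<le> g * a2 powr (p + 1) * (1 + t) powr (- q)"
    using t p q1 nn g_pos by (intro mult_left_mono powr_mono) (auto simp: algebra_simps)
  finally have "n1 powr (p + 1) * (1 + t) powr (1 - real d) + n2 powr (p + 1) \<le>
      (a1 powr (p + 1) + a2 powr (p + 1)) * (g * (1 + t) powr (- q))"
    unfolding 1 by (simp add: algebra_simps)
  then have "C3 * (n1 powr (p + 1) * (1 + t) powr (1 - real d) + n2 powr (p + 1)) \<le>
      C3 * ((a1 powr (p + 1) + a2 powr (p + 1)) * (g * (1 + t) powr (- q)))"
    using pos by (intro mult_left_mono) auto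
  also have "\<dots> = (C1 - 1) * g * (1 + t) powr (- q)" by (simp add: C1 a1_def a2_def)
  finally show ?thesis using R(1,2) RR by (simp add: algebra_simps)
qed

text \<open>If \<open>W\<close> touched \<open>lo\<close> at \<open>T\<close>, then
  \<open>\<psi>_barrier\<close> would make the derivative of \<open>lo - W\<close> negative there,
  so \<open>lo - W\<close> would be positive just before \<open>T\<close>, against
  \<open>ok T\<close>.\<close>

lemma barrier_at_T: "lo T < W T" "\<bar>W T\<bar> < \<gamma>"
proof -
  have cT: "isCont W T" by (rule isContV[OF T_pos])
  have lim: "(W \<longlongrightarrow> W T) (at_left T)"
    using cT unfolding isCont_def by (rule filterlim_mono) (auto intro: at_le)
  have "W T \<le> \<gamma> * exp (- Binf * T)"
  proof (rule tendsto_le[OF _ _ lim])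
    show "((\<lambda>t. \<gamma> * exp (- Binf * t)) \<longlongrightarrow> \<gamma> * exp (- Binf * T)) (at_left T)"
      by (intro tendsto_intros)
    show "\<forall>\<^sub>F t in at_left T. W t \<le> \<gamma> * exp (- Binf * t)"
      using eventually_at_left_real[OF T_pos] by (rule eventually_mono) (use W_upper in force)
  qed simp
  also have "\<dots> < \<gamma>" using pos bm T_pos by simp
  finally have up: "W T < \<gamma>" .
  have dlo: "(lo has_real_derivative - B0 * (\<gamma> * exp (- B0 * t)) + (q / (A2 + t)) * \<psi> t) (at t)" if "0 \<le> t" for t
    unfolding lo_def[abs_def] using \<psi>_deriv[OF that] by (auto intro!: derivative_eq_intros)
  have "lo T \<le> W T"
  proof (rule tendsto_le[OF _ lim])
    show "(lo \<longlongrightarrow> lo T) (at_left T)"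
      using DERIV_isCont[OF dlo[of T]] T_pos unfolding isCont_def by (auto intro: filterlim_mono at_le)
    show "\<forall>\<^sub>F t in at_left T. lo t \<le> W t"
      using eventually_at_left_real[OF T_pos] by (rule eventually_mono) (auto intro!: less_imp_le W_lo)
  qed simp
  moreover have "- \<gamma> < lo T"
  proof -
    have "\<psi> T < \<gamma>" using \<psi>_le'(2)[of T] A1g(3) T_pos by linarith
    moreover have "0 < \<gamma> * exp (- B0 * T)" using pos by simp
    ultimately show ?thesis unfolding lo_def by linarith
  qed
  ultimately show aT: "\<bar>W T\<bar> < \<gamma>" using up by linarith
  have RT: "R T \<le> C1 * g * (1 + T) powr (- q)"
  proof (rule extend_upper[of "T / 2" T])
    show "continuous_on {T / 2..T} (\<lambda>t. C1 * g * (1 + t) powr (- q))"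
      using T_pos by (intro continuous_intros) auto
  qed (use T_pos R_upper in auto)
  show "lo T < W T"
  proof (rule ccontr)
    assume "\<not> lo T < W T"
    then have eq: "W T = lo T" using \<open>lo T \<le> W T\<close> by simp
    let ?e = "\<gamma> * exp (- B0 * T)"
    let ?D = "(- B0 * ?e + (q / (A2 + T)) * \<psi> T) - (- \<Phi> (W T) - R T)"
    have "((\<lambda>t. lo t - W t) has_real_derivative ?D) (at T)"
      using T_pos by (intro DERIV_diff dlo W_deriv) auto
    moreover have "?D < 0"
    proof -
      have b: "R T < bm * \<psi> T - (q / (A2 + T)) * \<psi> T" using \<psi>_barrier[of T] RT T_pos by simp
      have \<psi>T: "0 < \<psi> T" using \<psi>_pos T_pos by simp
      have W: "W T = ?e - \<psi> T" using eq by (simp add: lo_def)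
      \<comment> \<open>The slope that applies depends on the sign of \<open>W T\<close>; lowering
        the coefficient of \<open>\<psi>\<close> to \<open>bm\<close> and raising that of the
        exponential to \<open>B0\<close> covers both cases.\<close>
      have "\<Phi> (W T) \<le> B0 * ?e - bm * \<psi> T"
      proof (cases "0 \<le> W T")
        case True
        then have "\<Phi> (W T) \<le> B0 * W T" using \<Phi>_pos aT by auto
        also have "\<dots> = B0 * ?e - B0 * \<psi> T" unfolding W by (simp add: algebra_simps)
        also have "\<dots> \<le> B0 * ?e - bm * \<psi> T" using bm \<psi>T by (simp add: mult_right_mono)
        finally show ?thesis .
      next
        case False
        then have "\<Phi> (W T) \<le> Binf * W T" using \<Phi>_neg aT by auto
        also have "\<dots> = Binf * ?e - Binf * \<psi> T" unfolding W by (simp add: algebra_simps)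
        also have "\<dots> \<le> B0 * ?e - bm * \<psi> T" using bm \<psi>T pos by (intro diff_mono mult_right_mono) auto
        finally show ?thesis .
      qed
      then show ?thesis using b by (simp add: algebra_simps)
    qed
    ultimately obtain e where e: "e > 0" "\<And>h. 0 < h \<Longrightarrow> h < e \<Longrightarrow> lo T - W T < lo (T - h) - W (T - h)"
      using DERIV_neg_dec_left[of "\<lambda>t. lo t - W t" ?D T] by auto
    define h where "h = min e T / 2"
    have "0 < h" "h < e" "0 \<le> T - h" "T - h < T" using e(1) T_pos by (auto simp: h_def)
    then show False using e(2)[of h] W_lo[of "T - h"] eq by simp
  qed
qed

lemma R_lower_late:
  assumes t: "s0 < t" "t < T"
  shows "c6 * g * (1 + t) powr (- q) \<le> R t"
proof (rule extend_lower[of s0 t])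
  show "continuous_on {s0..t} (\<lambda>t. c6 * g * (1 + t) powr (- q))"
    using s0 by (intro continuous_intros) auto
  fix r assume r: "s0 < r" "r < t" "rbound c3 C3 p d Y W r (R r)"
  have r0: "0 < r" using r s0 by linarith
  have "W r \<le> \<gamma> * exp (- Binf * r)" using W_upper[of r] r r0 t by simp
  also have "\<dots> \<le> \<gamma> * exp (- bm * r)" using r0 pos bm by simp
  also have "\<dots> \<le> \<gamma> * (exp (- BM) / (4 * r))" using s0(2)[of r] r pos by (intro mult_left_mono) auto
  finally have W: "W r \<le> \<gamma> * exp (- BM) / (4 * r)" by simp
  show "c6 * g * (1 + r) powr (- q) \<le> R r"
    using r t s0(1) by (intro R_lower phase W) auto
qed (use t s0 in auto)

end

lemma all_ok: "0 < T \<Longrightarrow> ok T"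
proof (rule ccontr)
  assume T: "0 < T" and nok: "\<not> ok T"
  define bad where "bad = {s. 0 \<le> s \<and> \<not> (\<bar>W s\<bar> \<le> \<gamma> \<and> lo s < W s)}"
  have ne: "bad \<noteq> {}" using T nok by (auto simp: ok_def bad_def)
  have bdd: "bdd_below bad" by (rule bdd_belowI[of _ 0]) (simp add: bad_def)
  define S where "S = Inf bad"
  obtain T0 where T0: "ok T0" using initial_ok by blast
  then have "T0 \<le> S" unfolding S_def
    by (intro cInf_greatest[OF ne]) (auto simp: bad_def ok_def not_less[symmetric])
  then have "0 < S" using T0 by (auto simp: ok_def)
  have okS: "ok S"
    unfolding ok_def
  proof (intro conjI allI impI \<open>0 < S\<close>)
    fix s assume s: "0 \<le> s \<and> s < S"
    then have "s \<notin> bad" using cInf_lower[OF _ bdd, of s] by (auto simp: S_def)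
    then show "\<bar>W s\<bar> \<le> \<gamma>" "lo s < W s" using s by (auto simp: bad_def)
  qed
  have cW: "isCont W S" using isContV[OF \<open>0 < S\<close>] .
  have clo: "isCont lo S"
    unfolding lo_def using DERIV_isCont[OF \<psi>_deriv[of S]] \<open>0 < S\<close> by (intro continuous_intros) auto
  have "\<forall>\<^sub>F s in at S. 0 < W s - lo s"
    using isCont_diff[OF cW clo] barrier_at_T(1)[OF okS] unfolding isCont_def by (intro order_tendstoD(1)) auto
  moreover have "\<forall>\<^sub>F s in at S. \<bar>W s\<bar> < \<gamma>"
    using isCont_rabs[OF cW] barrier_at_T(2)[OF okS] unfolding isCont_def by (intro order_tendstoD(2)) auto
  ultimately have "\<forall>\<^sub>F s in at S. 0 < W s - lo s \<and> \<bar>W s\<bar> < \<gamma>" by (rule eventually_conj)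
  then obtain e where e: "e > 0" "\<And>s. s \<noteq> S \<Longrightarrow> dist s S < e \<Longrightarrow> 0 < W s - lo s \<and> \<bar>W s\<bar> < \<gamma>"
    unfolding eventually_at by auto
  have "S + e \<le> S"
    unfolding S_def
  proof (rule cInf_greatest[OF ne])
    fix s assume s: "s \<in> bad"
    then have "S \<le> s" unfolding S_def by (rule cInf_lower[OF _ bdd])
    moreover have "s \<noteq> S" using s barrier_at_T[OF okS] by (auto simp: bad_def)
    ultimately show "Inf bad + e \<le> s"
      using e(2)[of s] s unfolding S_def[symmetric] by (force simp: bad_def dist_real_def)
  qed
  then show False using e(1) by simp
qed

section \<open>Estimates for all times\<close>

lemma W_abs_le: "0 \<le> t \<Longrightarrow> \<bar>W t\<bar> \<le> \<gamma>"
  using all_ok[of "t + 1"] by (auto simp: ok_def)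

lemma W_lower_bound:
  assumes "0 \<le> t" shows "\<gamma> * exp (- B0 * t) - A1 * \<gamma> powr (p + 1) / (1 + t) powr q < W t"
proof -
  have "lo t < W t" using all_ok[of "t + 1"] assms by (auto simp: ok_def)
  then show ?thesis using \<psi>_le[OF assms] by (simp add: lo_def g_def powr_minus divide_inverse)
qed

lemma W_upper_bound: "0 < t \<Longrightarrow> W t < \<gamma> * exp (- Binf * t)"
  using W_upper[OF all_ok[of "t + 1"]] by simp

text \<open>On the unit interval before \<open>t\<close>, \<open>W\<close> is compared with the
  exponential minus a linear ramp of slope \<open>\<eta>\<close>. The force, at least
  \<open>\<rho>\<close>, pays for the slope of the ramp and for \<open>BM * \<eta>\<close>, the
  possible change of \<open>\<Phi>\<close> across it; with \<open>\<rho> = (BM + 2) * \<eta>\<close>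
  one \<open>\<eta>\<close> is left over. This is the origin of the constant and of the
  \<open>+ 1\<close> in the starting time.\<close>

lemma W_upper_bound_late:
  assumes t: "s0 + 1 < t"
  shows "W t < \<gamma> * exp (- Binf * t) - c6 * 2 powr (- q) / (BM + 2) * \<gamma> powr (p + 1) / t powr q"
proof -
  have BM: "0 < BM" using bm by simp
  have t1: "1 < t" using t s0 by simp
  \<comment> \<open>\<open>1 + s \<le> 2 * t\<close> on the whole interval, so \<open>\<rho>\<close>
    is a common lower bound for the force there.\<close>
  define \<rho> where "\<rho> = c6 * g * (2 * t) powr (- q)"
  have \<rho>: "0 < \<rho>" using g_pos pos t1 by (simp add: \<rho>_def c6)
  define \<eta> where "\<eta> = \<rho> / (BM + 2)"
  have \<eta>: "0 < \<eta>" "(BM + 2) * \<eta> = \<rho>" using \<rho> BM by (auto simp: \<eta>_def)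
  let ?f = "\<lambda>s. W s - \<gamma> * exp (- Binf * s) + \<eta> * (s - (t - 1))"
  let ?f' = "\<lambda>s. - \<Phi> (W s) - R s + Binf * (\<gamma> * exp (- Binf * s)) + \<eta>"
  have "?f t < 0"
  proof (rule first_crossing[where f = ?f and f' = ?f' and a = "t - 1" and b = t])
    show "continuous_on {t - 1..t} ?f" using t1 by (intro continuous_intros contW_on) auto
    show "?f (t - 1) < 0" using W_upper_bound[of "t - 1"] t1 by simp
    fix s assume s: "t - 1 < s" "s \<le> t"
    show "(?f has_real_derivative ?f' s) (at s)"
      using W_deriv[of s] s t1 by (auto intro!: derivative_eq_intros)
    assume zero: "?f s = 0"
    have s00: "s0 < s" using s t by simp
    have "\<rho> \<le> c6 * g * (1 + s) powr (- q)"
      unfolding \<rho>_def using s t1 q1 g_pos pos by (intro mult_left_mono powr_mono2') (auto simp: c6)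
    then have R: "\<rho> \<le> R s" using R_lower_late[OF all_ok[of "s + 1"], of s] s00 s0 by simp
    have h: "0 \<le> s - (t - 1)" "s - (t - 1) \<le> 1" using s by auto
    let ?e = "\<gamma> * exp (- Binf * s)"
    define x where "x = \<eta> * (s - (t - 1))"
    have W: "W s = ?e - x" using zero by (simp add: x_def)
    have h1: "x \<le> \<eta>" "0 \<le> x" using mult_left_mono[OF h(2), of \<eta>] h \<eta> by (auto simp: x_def)
    have "Binf * ?e - BM * \<eta> \<le> \<Phi> (W s)"
    proof (cases "0 \<le> W s")
      case True
      have "Binf * x \<le> BM * \<eta>" using h1 bm by (intro mult_mono) auto
      then have "Binf * ?e - BM * \<eta> \<le> Binf * W s" unfolding W by (simp add: algebra_simps)
      also have "\<dots> \<le> \<Phi> (W s)" using True \<Phi>_pos[of "W s"] W_abs_le[of s] s t1 by auto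
      finally show ?thesis .
    next
      case False
      have "B0 * x \<le> BM * \<eta>" using h1 bm by (intro mult_mono) auto
      moreover have "Binf * ?e \<le> B0 * ?e" using bm pos by (intro mult_right_mono) auto
      ultimately have "Binf * ?e - BM * \<eta> \<le> B0 * W s" unfolding W by (simp add: algebra_simps)
      also have "\<dots> \<le> \<Phi> (W s)" using False \<Phi>_neg[of "W s"] W_abs_le[of s] s t1 by auto
      finally show ?thesis .
    qed
    then show "?f' s < 0" using R \<eta> by (simp add: algebra_simps)
  qed auto
  moreover have "\<eta> = c6 * 2 powr (- q) / (BM + 2) * \<gamma> powr (p + 1) / t powr q"
    using t1 by (simp add: \<eta>_def \<rho>_def g_def powr_mult powr_minus field_simps)
  ultimately show ?thesis by simp
qed

end

section \<open>Choice of the constants, uniformly in \<gamma>\<close>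

lemma small_powr:
  assumes "0 < (a::real)" "0 < K" "0 \<le> A"
  obtains \<gamma>1 where "0 < \<gamma>1" "\<And>\<gamma>. 0 < \<gamma> \<Longrightarrow> \<gamma> < \<gamma>1 \<Longrightarrow> A * \<gamma> powr a \<le> K"
proof (rule that[of "(K / (A + 1)) powr (1 / a)"])
  fix \<gamma> :: real assume g: "0 < \<gamma>" "\<gamma> < (K / (A + 1)) powr (1 / a)"
  then have "\<gamma> powr a \<le> ((K / (A + 1)) powr (1 / a)) powr a"
    using assms by (intro powr_mono2) auto
  also have "\<dots> = K / (A + 1)" using assms by (simp add: powr_powr)
  finally have "(A + 1) * \<gamma> powr a \<le> K" using assms by (simp add: field_simps)
  moreover have "0 \<le> \<gamma> powr a" by simp
  ultimately show "A * \<gamma> powr a \<le> K" by (simp only: distrib_right)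
qed (use assms in simp)

text \<open>This is \<open>ln x \<le> x - 1\<close> at \<open>x = (1 + t) * (a / q)\<close>,
  multiplied by \<open>q\<close> and exponentiated.\<close>

lemma powr_le_exp:
  assumes "0 < (q::real)" "0 < a" "0 \<le> t"
  shows "exp (- a * t) \<le> exp (a - q - q * ln (a / q)) * (1 + t) powr (- q)"
proof -
  have "ln ((1 + t) * (a / q)) \<le> (1 + t) * (a / q) - 1"
    using assms by (intro ln_le_minus_one) simp
  moreover have "ln ((1 + t) * (a / q)) = ln (1 + t) + ln (a / q)"
    using assms by (subst ln_mult) auto
  ultimately have "ln (1 + t) \<le> (1 + t) * (a / q) - 1 - ln (a / q)" by linarith
  then have "q * ln (1 + t) \<le> q * ((1 + t) * (a / q) - 1 - ln (a / q))"
    using assms by (intro mult_left_mono) auto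
  also have "\<dots> = (1 + t) * a - q - q * ln (a / q)" using assms by (simp add: field_simps)
  finally have "- a * t \<le> (a - q - q * ln (a / q)) + - q * ln (1 + t)" by (simp add: algebra_simps)
  then have "exp (- a * t) \<le> exp ((a - q - q * ln (a / q)) + - q * ln (1 + t))" by simp
  also have "\<dots> = exp (a - q - q * ln (a / q)) * (1 + t) powr (- q)"
    using assms by (simp only: exp_add powr_def) simp
  finally show ?thesis .
qed

text \<open>All constants are fixed from \<open>d\<close>, \<open>p\<close>, \<open>bm\<close>,
  \<open>BM\<close>, \<open>c3\<close> and \<open>C3\<close> before \<open>\<gamma>\<close> and the
  motion enter. The late estimate starts at \<open>\<bar>ln \<gamma>\<bar> / BM + 1\<close>, which
  lies beyond \<open>s0 + 1\<close> because \<open>\<gamma>1\<close> is at most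
  \<open>exp (- BM * (s0 + 1))\<close>.\<close>

lemma barrier_bounds:
  assumes d: "1 \<le> (d::nat)" and p: "0 < p" and b: "0 < bm" "bm \<le> BM" and c: "0 < c3" "0 < C3"
  obtains \<gamma>1 c C where "0 < \<gamma>1" "0 < c" "0 < C"
    "\<And>\<gamma> B0 Binf Y W \<Phi> R. \<lbrakk>0 < \<gamma>; \<gamma> < \<gamma>1; bm \<le> Binf; Binf \<le> B0; B0 \<le> BM; trajectory Y W; W 0 = \<gamma>;
      \<And>t. 0 \<le> t \<Longrightarrow> (W has_real_derivative (- \<Phi> (W t) - R t)) (at t within {0..});
      continuous_on {0..} R; continuous_on {-\<gamma>..\<gamma>} \<Phi>;
      \<And>x. 0 \<le> x \<Longrightarrow> x \<le> \<gamma> \<Longrightarrow> Binf * x \<le> \<Phi> x \<and> \<Phi> x \<le> B0 * x;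
      \<And>x. - \<gamma> \<le> x \<Longrightarrow> x \<le> 0 \<Longrightarrow> B0 * x \<le> \<Phi> x \<and> \<Phi> x \<le> Binf * x;
      \<And>T. 0 < T \<Longrightarrow> (\<And>s. 0 \<le> s \<Longrightarrow> s < T \<Longrightarrow> \<bar>W s\<bar> \<le> 2 * \<gamma>) \<Longrightarrow>
         AE t in lborel. 0 < t \<and> t < T \<longrightarrow> rbound c3 C3 p d Y W t (R t)\<rbrakk> \<Longrightarrow>
      (\<forall>t\<ge>0. \<bar>W t\<bar> \<le> \<gamma>) \<and>
      (\<forall>t\<ge>0. \<gamma> * exp (- B0 * t) - c * \<gamma> powr (p + 1) / (1 + t) powr (real d + p) < W t) \<and>
      (\<forall>t>0. W t < \<gamma> * exp (- Binf * t)) \<and>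
      (\<forall>t\<ge>\<bar>ln \<gamma>\<bar> / BM + 1. W t < \<gamma> * exp (- Binf * t) - C * \<gamma> powr (p + 1) / t powr (real d + p))"
proof -
  define q where "q = real d + p"
  have q: "1 < q" using d p by (simp add: q_def)
  define Ce where "Ce = exp (bm / 2 - q - q * ln (bm / 2 / q))"
  have Ce: "exp (- bm * t / 2) \<le> Ce * (1 + t) powr (- q)" if "0 \<le> t" for t
    using powr_le_exp[of q "bm / 2" t] that q b by (simp add: Ce_def)
  have Ce0: "0 < Ce" by (simp add: Ce_def)
  \<comment> \<open>One half of the exponent provides the factor \<open>1 / t\<close>; beyond
    \<open>s0\<close> the other half provides the constant
    \<open>exp (- BM) / (4 * Ce)\<close>.\<close>
  define s0 where "s0 = max 1 (2 / bm * ln (4 * Ce * exp BM))"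
  have s0: "exp (- bm * t) \<le> exp (- BM) / (4 * t)" if "s0 \<le> t" for t
  proof -
    have t: "1 \<le> t" "2 / bm * ln (4 * Ce * exp BM) \<le> t" using that by (auto simp: s0_def)
    have "t powr 1 \<le> (1 + t) powr q"
      using t q by (intro order_trans[OF powr_mono[of 1 q t] powr_mono2]) auto
    then have "(1 + t) powr (- q) \<le> 1 / t" using t by (simp add: powr_minus field_simps)
    then have e1: "exp (- bm * t / 2) \<le> Ce * (1 / t)"
      by (intro order_trans[OF Ce mult_left_mono]) (use t Ce0 in auto)
    have "ln (4 * Ce * exp BM) \<le> bm * t / 2" using t b by (simp add: field_simps)
    then have "exp (ln (4 * Ce * exp BM)) \<le> exp (bm * t / 2)" by (simp only: exp_le_cancel_iff)
    then have "4 * Ce * exp BM \<le> exp (bm * t / 2)" using Ce0 by simp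
    then have e2: "exp (- bm * t / 2) \<le> exp (- BM) / (4 * Ce)"
      using Ce0 by (simp add: exp_minus field_simps)
    have "exp (- bm * t) = exp (- bm * t / 2) * exp (- bm * t / 2)" by (simp add: exp_add[symmetric])
    also have "\<dots> \<le> exp (- BM) / (4 * Ce) * (Ce * (1 / t))"
      using Ce0 e1 e2 by (intro mult_mono) auto
    also have "\<dots> = exp (- BM) / (4 * t)" using Ce0 by simp
    finally show ?thesis .
  qed
  define C1 where "C1 = C3 * ((4 / bm + 5) powr (p + 1) + (Ce + 1) powr (p + 1)) + 1"
  have C1: "0 < C1" unfolding C1_def using c by (intro add_nonneg_pos mult_nonneg_nonneg add_nonneg_nonneg) auto
  define A2 where "A2 = max 1 (2 * q / bm)"
  have A2: "1 \<le> A2" "2 * q \<le> bm * A2" using b by (auto simp: A2_def max_def field_simps)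
  define A1 where "A1 = 2 / bm * (C1 * A2 powr q + 1)"
  have A1: "0 < A1" "C1 * A2 powr q < bm / 2 * A1"
    unfolding A1_def using b C1 by (auto intro!: divide_pos_pos add_nonneg_pos)
  define c6 where "c6 = c3 * (exp (- BM) / 4) powr (p + 1) / 2"
  have c6: "0 < c6" using c by (simp add: c6_def)
  obtain g1 where g1: "0 < g1" "\<And>\<gamma>. 0 < \<gamma> \<Longrightarrow> \<gamma> < g1 \<Longrightarrow> A1 * \<gamma> powr p \<le> exp (- BM) / 2 * min 1 (q - 1)"
    using small_powr[OF p, of "exp (- BM) / 2 * min 1 (q - 1)" A1] A1 q by auto
  define C4 where "C4 = C3 * ((4 * A1 / (q - 1)) powr (p + 1) + (2 powr q * A1) powr (p + 1))"
  have C4: "0 \<le> C4" using c by (simp add: C4_def)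
  have pp: "0 < (p + 1) * p" using p by simp
  obtain g2 where g2: "0 < g2" "\<And>\<gamma>. 0 < \<gamma> \<Longrightarrow> \<gamma> < g2 \<Longrightarrow> C4 * \<gamma> powr ((p + 1) * p) \<le> min 1 c6"
    using small_powr[OF pp, of "min 1 c6" C4] C4 c6 by auto
  define \<gamma>1 where "\<gamma>1 = min (exp (- BM * (s0 + 1))) (min g1 g2)"
  show thesis
  proof (rule that[of \<gamma>1 A1 "c6 * 2 powr (- q) / (BM + 2)"])
    show "0 < \<gamma>1" using g1 g2 by (simp add: \<gamma>1_def)
    show "0 < A1" by (rule A1)
    show "0 < c6 * 2 powr (- q) / (BM + 2)" using c6 b by simp
    fix \<gamma> B0 Binf :: real and Y W \<Phi> R :: "real \<Rightarrow> real"
    assume g: "0 < \<gamma>" "\<gamma> < \<gamma>1" and B: "bm \<le> Binf" "Binf \<le> B0" "B0 \<le> BM" and tr: "trajectory Y W" and h: "W 0 = \<gamma>"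
      "\<And>t. 0 \<le> t \<Longrightarrow> (W has_real_derivative (- \<Phi> (W t) - R t)) (at t within {0..})"
      "continuous_on {0..} R" "continuous_on {-\<gamma>..\<gamma>} \<Phi>"
      "\<And>x. 0 \<le> x \<Longrightarrow> x \<le> \<gamma> \<Longrightarrow> Binf * x \<le> \<Phi> x \<and> \<Phi> x \<le> B0 * x"
      "\<And>x. - \<gamma> \<le> x \<Longrightarrow> x \<le> 0 \<Longrightarrow> B0 * x \<le> \<Phi> x \<and> \<Phi> x \<le> Binf * x"
      "\<And>T. 0 < T \<Longrightarrow> (\<And>s. 0 \<le> s \<Longrightarrow> s < T \<Longrightarrow> \<bar>W s\<bar> \<le> 2 * \<gamma>) \<Longrightarrow>
         AE t in lborel. 0 < t \<and> t < T \<longrightarrow> rbound c3 C3 p d Y W t (R t)"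
    interpret trajectory Y W by (rule tr)
    interpret core Y W \<Phi> R \<gamma> B0 Binf bm BM p c3 C3 A1 A2 Ce s0 c6 C1 q d
    proof unfold_locales
      show "C3 * ((4 * A1 / (q - 1)) powr (p + 1) + (2 powr q * A1) powr (p + 1)) * (\<gamma> powr (p + 1)) powr p \<le> min 1 c6"
        using g2(2)[of \<gamma>] g by (simp add: C4_def powr_powr \<gamma>1_def)
      show "A1 * \<gamma> powr p \<le> exp (- BM) / 2 * min 1 (q - 1)" using g1(2) g by (simp add: \<gamma>1_def)
      show "1 \<le> s0" by (simp add: s0_def)
    qed (fact p d q_def b B g c A1 A2 C1_def Ce s0 c6_def h less_imp_le[OF Ce0])+
    show "(\<forall>t\<ge>0. \<bar>W t\<bar> \<le> \<gamma>) \<and>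
      (\<forall>t\<ge>0. \<gamma> * exp (- B0 * t) - A1 * \<gamma> powr (p + 1) / (1 + t) powr (real d + p) < W t) \<and>
      (\<forall>t>0. W t < \<gamma> * exp (- Binf * t)) \<and>
      (\<forall>t\<ge>\<bar>ln \<gamma>\<bar> / BM + 1. W t < \<gamma> * exp (- Binf * t)
         - c6 * 2 powr (- q) / (BM + 2) * \<gamma> powr (p + 1) / t powr (real d + p))"
    proof (intro conjI allI impI)
      fix t assume t: "\<bar>ln \<gamma>\<bar> / BM + 1 \<le> t"
      have "\<gamma> < exp (- BM * (s0 + 1))" using g by (simp add: \<gamma>1_def)
      then have "ln \<gamma> < - BM * (s0 + 1)" using g(1) by (metis exp_gt_zero ln_exp ln_less_cancel_iff)
      then have "BM * (s0 + 1) < \<bar>ln \<gamma>\<bar>" by simp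
      then have "s0 + 1 < \<bar>ln \<gamma>\<bar> / BM" using b by (simp add: field_simps)
      then have "s0 + 1 < t" using t by simp
      from W_upper_bound_late[OF this]
      show "W t < \<gamma> * exp (- Binf * t) - c6 * 2 powr (- q) / (BM + 2) * \<gamma> powr (p + 1) / t powr (real d + p)"
        by (simp only: q_def)
    qed (use W_abs_le W_lower_bound W_upper_bound q_def in auto)
  qed
qed

lemma has_bochner_integral_le:
  fixes f g :: "'a \<Rightarrow> real"
  assumes "has_bochner_integral M f x" "has_bochner_integral M g y" "AE z in M. f z \<le> g z"
  shows "x \<le> y"
  using assms integral_mono_AE[of M f g] by (auto simp: has_bochner_integral_iff)

lemma has_bochner_integral_abs_le:
  fixes f g :: "'a \<Rightarrow> real"
  assumes f: "has_bochner_integral M f x" and g: "has_bochner_integral M g y" and le: "AE z in M. \<bar>f z\<bar> \<le> g z"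
  shows "\<bar>x\<bar> \<le> y"
proof -
  have "x \<le> y"
    by (rule has_bochner_integral_le[OF f g]) (use le in \<open>auto elim!: eventually_mono\<close>)
  moreover have "- x \<le> y"
    by (rule has_bochner_integral_le[OF has_bochner_integral_minus[OF f] g]) (use le in \<open>auto elim!: eventually_mono\<close>)
  ultimately show ?thesis by simp
qed

lemma has_bochner_integral_indicator_interval:
  "a \<le> c \<Longrightarrow> has_bochner_integral lborel (indicat_real {a..c}) (c - a)"
  by (intro has_bochner_integral_iff[THEN iffD2]) auto

section \<open>Kinetic data\<close>

text \<open>The hypotheses with their constants named, on one radius \<open>gs\<close> that suits
  all of them. The impulse is of order \<open>\<bar>w\<bar> powr p\<close> because its quadratic
  part is absorbed, see \<open>kinetic_exists\<close>. \<open>M\<close> is the dominating function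
  of the domination hypothesis.\<close>

locale kinetic =
  fixes d :: nat and r :: real and k :: "real \<Rightarrow> real \<Rightarrow> real" and f0 :: "vec \<Rightarrow> real"
    and a0 :: "real \<Rightarrow> real" and b :: "perp \<Rightarrow> real" and Vinf p gs km bM aM cl Cl \<delta>b bl :: real
    and M :: "real \<Rightarrow> real"
  assumes d: "1 \<le> d" and r: "0 < r" and p: "0 < p" and gs: "0 < gs"
    and f0_eq: "\<And>v. f0 v = a0 (fst v) * b (snd v)"
    and a0_cont: "continuous_on UNIV a0" and a0_nonneg: "\<And>z. 0 \<le> a0 z" and a0_le: "\<And>z. a0 z \<le> aM"
    and aM: "0 < aM"
    and b_int: "has_bochner_integral (perp_measure d) b 1"
    and b_nonneg: "\<And>w. w \<in> space (perp_measure d) \<Longrightarrow> 0 \<le> b w"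
    and b_le: "\<And>w. w \<in> space (perp_measure d) \<Longrightarrow> b w \<le> bM"
    and bl: "0 < \<delta>b" "0 < bl" "\<And>w. w \<in> pbox d \<delta>b \<Longrightarrow> bl \<le> b w"
    and k_nonneg: "\<And>v u. 0 \<le> k v u" and k_cont: "continuous_on UNIV (\<lambda>(v, u). k v u)"
    and k_le: "\<And>v u. \<bar>u\<bar> \<le> gs \<Longrightarrow> k v u \<le> km"
    and impulse_nonneg: "\<And>w. 0 \<le> impulse k w"
    and impulse_bounds: "0 < cl" "\<And>w. \<bar>w\<bar> \<le> gs \<Longrightarrow> cl * \<bar>w\<bar> powr p \<le> impulse k w"
      "\<And>w. \<bar>w\<bar> \<le> gs \<Longrightarrow> impulse k w \<le> Cl * \<bar>w\<bar> powr p"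
    and impulse_cont: "continuous_on (- {0}) (impulse k)"
    and M_int: "integrable lborel M"
    and M_dom: "\<And>v y z. \<bar>v\<bar> < 2 * gs \<Longrightarrow> \<bar>y\<bar> < gs \<Longrightarrow> k v (z - y - Vinf) * a0 z \<le> M z"
    and impulse_int: "\<And>w. integrable (vec_measure d) (\<lambda>u. impulse k (fst u - w) * f0 u)"
begin

abbreviation "P \<equiv> perp_measure d"
abbreviation "U \<equiv> vec_measure d"

lemma fst_meas [measurable]: "fst \<in> borel_measurable U"
  and snd_meas [measurable]: "snd \<in> U \<rightarrow>\<^sub>M P"
  by (simp_all add: vec_measure_def)

lemma b_meas [measurable]: "b \<in> borel_measurable P"
  using b_int by (auto simp: has_bochner_integral_iff)

lemma a0_meas [measurable]: "a0 \<in> borel_measurable borel"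
  using a0_cont by (rule borel_measurable_continuous_onI)

lemma f0_meas [measurable]: "f0 \<in> borel_measurable U"
proof -
  have "f0 = (\<lambda>v. a0 (fst v) * b (snd v))" by (rule ext) (rule f0_eq)
  then show ?thesis by simp
qed

lemma k_meas [measurable (raw)]:
  assumes "f \<in> borel_measurable N" "g \<in> borel_measurable N"
  shows "(\<lambda>x. k (f x) (g x)) \<in> borel_measurable N"
proof -
  have "(\<lambda>(v, u). k v u) \<in> borel_measurable (borel \<Otimes>\<^sub>M borel)"
    unfolding borel_prod using k_cont by (rule borel_measurable_continuous_onI)
  from measurable_compose[OF measurable_Pair[OF assms] this] show ?thesis by simp
qed

lemma impulse_meas [measurable]: "impulse k \<in> borel_measurable borel"
proof -
  have "(\<lambda>x. if x = 0 then impulse k 0 else indicat_real (- {0}) x *\<^sub>R impulse k x) \<in> borel_measurable borel"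
    using borel_measurable_continuous_on_indicator[OF _ impulse_cont] by measurable
  moreover have "(\<lambda>x. if x = 0 then impulse k 0 else indicat_real (- {0}) x *\<^sub>R impulse k x) = impulse k"
    by (auto simp: indicator_def)
  ultimately show ?thesis by simp
qed

lemma aM_nonneg: "0 \<le> aM" using aM by simp

lemma bM_pos: "0 < bM"
proof -
  have "(\<lambda>i\<in>{1..<d}. 0) \<in> pbox d \<delta>b" using bl by (simp add: pbox_def space_perp_measure)
  then show ?thesis using bl(3) b_le bl(2) by (fastforce simp: pbox_def)
qed

lemma km_nonneg: "0 \<le> km" using k_le[of 0 0] k_nonneg[of 0 0] gs by simp

lemma Cl_nonneg: "0 \<le> Cl"
proof -
  have "\<bar>gs\<bar> = gs" using gs by simp
  then have "cl * gs powr p \<le> Cl * gs powr p" using impulse_bounds(2,3)[of gs] by simp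
  then have "(Cl - cl) * gs powr p \<ge> 0" by (simp add: algebra_simps)
  then have "cl \<le> Cl" using gs by (simp add: zero_le_mult_iff)
  then show ?thesis using impulse_bounds(1) by simp
qed

lemma U_pair:
  fixes f :: "real \<Rightarrow> real" and g :: "perp \<Rightarrow> real"
  shows "has_bochner_integral lborel f x \<Longrightarrow> has_bochner_integral P g y \<Longrightarrow>
   has_bochner_integral U (\<lambda>u. f (fst u) * g (snd u)) (x * y)"
  unfolding vec_measure_def
  by (rule has_bochner_integral_pair_mult[where f = f and g = g])
    (simp_all add: lborel.sigma_finite_measure_axioms sf_perp)

lemma U_int:
  fixes f :: "real \<Rightarrow> real"
  shows "has_bochner_integral lborel f x \<Longrightarrow>
   has_bochner_integral U (\<lambda>u. f (fst u) * b (snd u)) x"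
  using U_pair[OF _ b_int] by simp

text \<open>The reflection of \<open>f0\<close> at an end with velocity \<open>V\<close> is
  \<open>b (snd v) * J \<sigma> V (fst v)\<close>: the kernel imposes the transversal profile, and
  the incoming transversal velocity integrates to 1.\<close>

definition J :: "real \<Rightarrow> real \<Rightarrow> real \<Rightarrow> real" where
  "J \<sigma> V x = (LINT z|lborel. of_bool (\<sigma> * (z - V) \<le> 0) * (k (x - V) (z - V) * a0 z))"

definition cJ where "cJ = (LINT z|lborel. M z)"

lemma J_dom:
  assumes "\<bar>V - Vinf\<bar> < gs" "\<bar>x - V\<bar> < 2 * gs"
  shows "norm (of_bool (\<sigma> * (z - V) \<le> 0) * (k (x - V) (z - V) * a0 z)) \<le> M z"
proof -
  have "k (x - V) (z - (V - Vinf) - Vinf) * a0 z \<le> M z" using assms by (intro M_dom)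
  then have "k (x - V) (z - V) * a0 z \<le> M z" by simp
  moreover have "0 \<le> k (x - V) (z - V) * a0 z" using k_nonneg a0_nonneg by simp
  ultimately show ?thesis by (auto simp: abs_mult)
qed

lemma J_int:
  assumes "\<bar>V - Vinf\<bar> < gs" "\<bar>x - V\<bar> < 2 * gs"
  shows "has_bochner_integral lborel (\<lambda>z. of_bool (\<sigma> * (z - V) \<le> 0) * (k (x - V) (z - V) * a0 z)) (J \<sigma> V x)"
  unfolding J_def
proof (rule has_bochner_integral_integrable, rule Bochner_Integration.integrable_bound[OF M_int])
  show "AE z in lborel. norm (of_bool (\<sigma> * (z - V) \<le> 0) * (k (x - V) (z - V) * a0 z)) \<le> norm (M z)"
    by (rule AE_I2, rule order_trans[OF J_dom[OF assms]]) simp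
qed measurable

lemma J_nonneg: "0 \<le> J \<sigma> V x"
  unfolding J_def using k_nonneg a0_nonneg by (intro integral_nonneg_AE AE_I2) simp

lemma J_le:
  assumes "\<bar>V - Vinf\<bar> < gs" "\<bar>x - V\<bar> < 2 * gs"
  shows "J \<sigma> V x \<le> cJ"
  unfolding cJ_def
  by (rule has_bochner_integral_le[OF J_int[OF assms] has_bochner_integral_integrable[OF M_int]])
    (rule AE_I2, rule order_trans[OF _ J_dom[OF assms, of \<sigma>]], simp)

lemma cJ_nonneg: "0 \<le> cJ"
  using J_nonneg[of 0 Vinf Vinf] J_le[of Vinf Vinf 0] gs by linarith

lemma J_meas [measurable (raw)]:
  assumes [measurable]: "f \<in> borel_measurable N" "g \<in> borel_measurable N"
  shows "(\<lambda>x. J \<sigma> (f x) (g x)) \<in> borel_measurable N"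
  unfolding J_def by measurable

text \<open>Dominated convergence with \<open>M\<close>; the indicator jumps only at the single
  velocity \<open>z = V\<close>.\<close>

lemma J_tendsto:
  assumes Vn: "Vn \<longlonglongrightarrow> V" and xn: "xn \<longlonglongrightarrow> x"
    and r: "\<And>n. \<bar>Vn n - Vinf\<bar> < gs" "\<And>n. \<bar>xn n - Vn n\<bar> < 2 * gs"
  shows "(\<lambda>n. J \<sigma> (Vn n) (xn n)) \<longlonglongrightarrow> J \<sigma> V x"
  unfolding J_def
proof (rule integral_dominated_convergence[where w = M])
  show "AE z in lborel. norm (of_bool (\<sigma> * (z - Vn n) \<le> 0) * (k (xn n - Vn n) (z - Vn n) * a0 z)) \<le> M z" for n
    by (rule AE_I2) (rule J_dom[OF r])
  have "AE z in lborel. z \<noteq> V" by (rule AE_lborel_singleton)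
  then show "AE z in lborel. (\<lambda>n. of_bool (\<sigma> * (z - Vn n) \<le> 0) * (k (xn n - Vn n) (z - Vn n) * a0 z)) \<longlonglongrightarrow>
      of_bool (\<sigma> * (z - V) \<le> 0) * (k (x - V) (z - V) * a0 z)"
  proof (rule eventually_mono)
    fix z assume z: "z \<noteq> V"
    have s: "(\<lambda>n. \<sigma> * (z - Vn n)) \<longlonglongrightarrow> \<sigma> * (z - V)" by (intro tendsto_intros Vn)
    have "eventually (\<lambda>n. (\<sigma> * (z - Vn n) \<le> 0) = (\<sigma> * (z - V) \<le> 0)) sequentially"
    proof (cases "\<sigma> = 0")
      case False
      then have "\<sigma> * (z - V) \<noteq> 0" using z by simp
      then have "\<sigma> * (z - V) < 0 \<or> 0 < \<sigma> * (z - V)" by linarith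
      then show ?thesis
      proof
        assume neg: "\<sigma> * (z - V) < 0"
        show ?thesis using order_tendstoD(2)[OF s neg] by (rule eventually_mono) (use neg in simp)
      next
        assume pos: "0 < \<sigma> * (z - V)"
        show ?thesis using order_tendstoD(1)[OF s pos] by (rule eventually_mono) (use pos in simp)
      qed
    qed simp
    then have 1: "eventually (\<lambda>n. of_bool (\<sigma> * (z - V) \<le> 0) = (of_bool (\<sigma> * (z - Vn n) \<le> 0) :: real)) sequentially"
      by (rule eventually_mono) simp
    have 2: "(\<lambda>n. k (xn n - Vn n) (z - Vn n)) \<longlonglongrightarrow> k (x - V) (z - V)"
    proof -
      have "isCont (\<lambda>(v, u). k v u) (x - V, z - V)"
        using k_cont by (simp add: continuous_on_eq_continuous_at)
      moreover have "(\<lambda>n. (xn n - Vn n, z - Vn n)) \<longlonglongrightarrow> (x - V, z - V)"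
        by (intro tendsto_intros Vn xn)
      ultimately show ?thesis
        using isCont_tendsto_compose[of "(x - V, z - V)" "\<lambda>(v, u). k v u"] by force
    qed
    show "(\<lambda>n. of_bool (\<sigma> * (z - Vn n) \<le> 0) * (k (xn n - Vn n) (z - Vn n) * a0 z)) \<longlonglongrightarrow>
      of_bool (\<sigma> * (z - V) \<le> 0) * (k (x - V) (z - V) * a0 z)"
      by (intro tendsto_intros 2 tendsto_eventually) (use 1 in \<open>auto elim!: eventually_mono\<close>)
  qed
qed (measurable, rule M_int)

end

section \<open>Boundary densities of a solution\<close>

lemma incoming_iff:
  fixes u v w \<sigma> :: real
  assumes "\<sigma> \<in> {1, -1}" "0 < \<sigma> * (v - w)"
  shows "(u - w) * (v - w) \<le> 0 \<longleftrightarrow> \<sigma> * (u - w) \<le> 0"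
  using assms by (auto simp: mult_le_0_iff)

lemma AE_pv_fst: "AE x in lborel. Q x \<Longrightarrow> AE q in perp_measure d \<Otimes>\<^sub>M vec_measure d. Q (fst (snd q))"
  unfolding vec_measure_def
  by (rule AE_snd[OF sf_vec[unfolded vec_measure_def], of "\<lambda>u. Q (fst u)"])
     (rule AE_fst[OF sf_perp])

lemma AE_vec_fst: "AE x in lborel. Q x \<Longrightarrow> AE u in vec_measure d. Q (fst u)"
  unfolding vec_measure_def by (rule AE_fst[OF sf_perp])

context trajectory begin

lemma V_meas: "(\<lambda>t. V (max 0 t)) \<in> borel_measurable borel"
proof -
  have "continuous_on UNIV (\<lambda>t. V (max 0 t))"
    by (rule continuous_on_compose2[OF contV]) (auto intro!: continuous_intros)
  then show ?thesis by (rule borel_measurable_continuous_onI)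
qed

text \<open>If \<open>V\<close> were below \<open>z\<close> at the latest contact, slightly later
  times would satisfy the defining inequality of \<open>tau\<close> as well. So a particle is
  outgoing at its precollision, and \<open>fp\<close> is evaluated where the reflection law
  determines it.\<close>

lemma tau_leaving:
  assumes "V t < z" "0 < tau X t z"
  shows "z \<le> V (tau X t z)"
proof (rule ccontr)
  let ?\<tau> = "tau X t z"
  assume "\<not> z \<le> V ?\<tau>"
  then have "V ?\<tau> < z" by simp
  then have "\<forall>\<^sub>F s in at ?\<tau>. V s < z"
    using isContV[OF assms(2)] unfolding isCont_def by (intro order_tendstoD(2)) auto
  then obtain e where e: "e > 0" "\<And>s. s \<noteq> ?\<tau> \<Longrightarrow> dist s ?\<tau> < e \<Longrightarrow> V s < z"
    unfolding eventually_at by auto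
  define s where "s = ?\<tau> + min e (t - ?\<tau>) / 2"
  have s: "?\<tau> < s" "s < t" "s < ?\<tau> + e" using e(1) tau_root(1)[OF assms] by (auto simp: s_def min_def field_simps)
  have "0 \<le> ?\<tau>" using assms by simp
  from mean_value[OF this s(1)] obtain x where x: "?\<tau> < x" "x < s" "X s - X ?\<tau> = (s - ?\<tau>) * V x" .
  have "V x < z" using e(2)[of x] x s by (auto simp: dist_real_def)
  then have "X s - X ?\<tau> < (s - ?\<tau>) * z" using x s by simp
  then have "(t - s) * z < X t - X s" using tau_root(2)[OF assms] by (simp add: algebra_simps)
  then have "s \<le> ?\<tau>" using s assms by (intro tau_ge) auto
  then show False using s by simp
qed

lemma ptau_leaving:
  assumes "\<sigma> \<in> {1, -1}" "\<sigma> * (z - V t) < 0" "0 < ptau \<sigma> X t z"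
  shows "0 \<le> \<sigma> * (z - V (ptau \<sigma> X t z))"
proof -
  interpret T: trajectory "\<lambda>s. - \<sigma> * X s" "\<lambda>s. - \<sigma> * V s" by (rule trajectory_scaled)
  have v: "- \<sigma> * V t < - \<sigma> * z" using assms(2) by (simp add: algebra_simps)
  show ?thesis
    using T.tau_leaving[OF v] assms(3) by (simp add: ptau_def algebra_simps)
qed

end

text \<open>With the velocity confined to radius \<open>G / 2\<close> up to time \<open>T\<close>,
  any two velocities involved in a repeated collision differ by at most \<open>G\<close>.\<close>

locale motion = kinetic + trajectory X V for X V :: "real \<Rightarrow> real" +
  fixes G T :: real
  assumes G: "0 < G" "G < gs" and V_range: "\<And>s. 0 \<le> s \<Longrightarrow> s < T \<Longrightarrow> \<bar>V s - Vinf\<bar> \<le> G / 2"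
begin

lemma hit_range:
  assumes "\<sigma> \<in> {1, -1}" "\<sigma> * (z - V t) < 0" "0 < ptau \<sigma> X t z" "t < T"
  shows "\<bar>z - Vinf\<bar> \<le> G / 2" "\<bar>z - V t\<bar> \<le> G" "\<bar>z - V (ptau \<sigma> X t z)\<bar> \<le> G"
    "\<bar>V (ptau \<sigma> X t z) - Vinf\<bar> \<le> G / 2"
proof -
  from ptau_velocity[OF assms(1-3)] obtain s where s: "ptau \<sigma> X t z < s" "s < t" "z = V s" .
  have "\<bar>V s - Vinf\<bar> \<le> G / 2" "\<bar>V t - Vinf\<bar> \<le> G / 2" "\<bar>V (ptau \<sigma> X t z) - Vinf\<bar> \<le> G / 2"
    by (rule V_range; use s assms in linarith)+
  then show "\<bar>z - Vinf\<bar> \<le> G / 2" "\<bar>z - V t\<bar> \<le> G" "\<bar>z - V (ptau \<sigma> X t z)\<bar> \<le> G"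
    "\<bar>V (ptau \<sigma> X t z) - Vinf\<bar> \<le> G / 2" using s(3) by linarith+
qed

lemma near: "0 \<le> t \<Longrightarrow> t < T \<Longrightarrow> \<bar>V t - Vinf\<bar> < gs"
  using V_range[of t] G by linarith

end

locale end_solution = motion +
  fixes H :: real and K :: "vec \<Rightarrow> vec \<Rightarrow> real" and fm fp :: density and \<sigma> :: real
  assumes \<sigma>: "\<sigma> \<in> {1, -1}"
    and K_eq: "\<And>v u. K v u = k (fst v) (fst u) * b (snd v)"
    and law: "end_law d H r K f0 X V fm fp \<sigma>"
    and Linf: "end_Linfinity d H r K f0 X V fm fp \<sigma>"
begin

abbreviation face where "face t y \<equiv> (X t + \<sigma> * H, y)"

lemma reflection_eq:
  assumes "0 < \<sigma> * (fst v - w)"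
  shows "reflection_integrand K w h v u =
    b (snd v) * (of_bool (\<sigma> * (fst u - w) \<le> 0) * (k (fst v - w) (fst u - w) * h u))"
  using incoming_iff[OF \<sigma> assms, of "fst u"]
  by (auto simp: reflection_integrand_def K_eq hshift_def indicator_def)

lemma reflection_f0:
  assumes "0 < \<sigma> * (fst v - w)" "\<bar>w - Vinf\<bar> < gs" "\<bar>fst v - w\<bar> < 2 * gs"
  shows "has_bochner_integral U (reflection_integrand K w f0 v) (b (snd v) * J \<sigma> w (fst v))"
proof -
  have "has_bochner_integral U (\<lambda>u. b (snd v) * (of_bool (\<sigma> * (fst u - w) \<le> 0) * (k (fst v - w) (fst u - w) * a0 (fst u)) * b (snd u)))
     (b (snd v) * J \<sigma> w (fst v))"
    by (intro has_bochner_integral_mult_right U_int J_int assms)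
  then show ?thesis unfolding reflection_eq[OF assms(1), abs_def] f0_eq by (simp add: mult_ac)
qed

lemma fm_eq:
  assumes "0 < t"
  shows "AE q in P \<Otimes>\<^sub>M U. fst q \<in> disk d r \<and> \<sigma> * (fst (snd q) - V t) < 0 \<longrightarrow>
     fm t (face t (fst q)) (snd q) =
      (if hit d r \<sigma> X t (fst q) (snd q)
       then fp (ptau \<sigma> X t (fst (snd q)))
         (face (ptau \<sigma> X t (fst (snd q))) (pback d (fst q) (t - ptau \<sigma> X t (fst (snd q))) (snd (snd q)))) (snd q)
       else f0 (snd q))"
proof -
  have "AE q in P \<Otimes>\<^sub>M U. regular \<sigma> X t (fst (snd q))"
    by (rule AE_pv_fst[OF AE_regular[OF \<sigma>]])
  moreover have "AE q in P \<Otimes>\<^sub>M U. fst q \<in> disk d r \<and> incoming V \<sigma> t (snd q) \<longrightarrow>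
      precollision_law d H r f0 X fm fp \<sigma> t (face t (fst q)) (snd q)"
    using law assms unfolding end_law_def by (auto simp: case_prod_beta')
  ultimately show ?thesis
    by eventually_elim (use precollision_law_iff[OF \<sigma>] in \<open>auto simp: incoming_def\<close>)
qed

text \<open>Bounds relative to the weight \<open>b\<close>, since a bare essential bound would not
  be integrable over the transversal velocities. \<open>good\<close> compares \<open>fp\<close> with
  the reflection of \<open>f0\<close> at slow relative speeds, the only ones involved in a second
  collision; \<open>close\<close> is what this means for \<open>fm\<close> one flight later.\<close>

definition good where
  "good A \<longleftrightarrow> (AE t in lborel. 0 < t \<and> t < T \<longrightarrow>
     (AE q in P \<Otimes>\<^sub>M U. fst q \<in> disk d r \<and> 0 \<le> \<sigma> * (fst (snd q) - V t) \<and> \<bar>fst (snd q) - V t\<bar> \<le> G \<longrightarrow>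
       \<bar>fp t (face t (fst q)) (snd q) - b (snd (snd q)) * J \<sigma> (V t) (fst (snd q))\<bar> \<le> A * b (snd (snd q))))"

definition close where
  "close A t \<longleftrightarrow> (AE q in P \<Otimes>\<^sub>M U. fst q \<in> disk d r \<and> \<sigma> * (fst (snd q) - V t) < 0 \<longrightarrow>
     (if hit d r \<sigma> X t (fst q) (snd q)
      then \<bar>fm t (face t (fst q)) (snd q) - b (snd (snd q)) * J \<sigma> (V (ptau \<sigma> X t (fst (snd q)))) (fst (snd q))\<bar>
         \<le> A * b (snd (snd q))
      else fm t (face t (fst q)) (snd q) = f0 (snd q)))"

text \<open>Cutting off outside the outgoing set gives a function that is measurable on the whole
  product, so that exceptional sets can be formed from it.\<close>

definition FP where
  "FP q = indicat_real {(t, y, v). 0 \<le> t \<and> y \<in> disk d r \<and> outgoing V \<sigma> t v} q *\<^sub>R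
     (case q of (t, y, v) \<Rightarrow> fp t (face t y) v)"

lemma FP_meas [measurable]: "FP \<in> borel_measurable (lborel \<Otimes>\<^sub>M (P \<Otimes>\<^sub>M U))"
  using Linf unfolding end_Linfinity_def set_borel_measurable_def FP_def[abs_def] by simp

lemma FP_eq: "0 \<le> t \<Longrightarrow> y \<in> disk d r \<Longrightarrow> 0 \<le> \<sigma> * (fst v - V t) \<Longrightarrow> FP (t, y, v) = fp t (face t y) v"
  by (simp add: FP_def outgoing_def)

definition bad where
  "bad A = {q \<in> space (lborel \<Otimes>\<^sub>M (P \<Otimes>\<^sub>M U)). 0 < fst q \<and> fst q < T \<and> fst (snd q) \<in> disk d r \<and>
     0 \<le> \<sigma> * (fst (snd (snd q)) - V (max 0 (fst q))) \<and> \<bar>fst (snd (snd q)) - V (max 0 (fst q))\<bar> \<le> G \<and>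
     \<not> \<bar>FP q - b (snd (snd (snd q))) * J \<sigma> (V (max 0 (fst q))) (fst (snd (snd q)))\<bar> \<le> A * b (snd (snd (snd q)))}"

lemma bad_meas: "bad A \<in> sets (lborel \<Otimes>\<^sub>M (P \<Otimes>\<^sub>M U))"
proof -
  note [measurable] = V_meas
  show ?thesis unfolding bad_def by measurable
qed

lemma bad_null:
  assumes "good A" shows "bad A \<in> null_sets (lborel \<Otimes>\<^sub>M (P \<Otimes>\<^sub>M U))"
proof -
  have "AE t in lborel. AE q in P \<Otimes>\<^sub>M U. (t, q) \<notin> bad A"
    using assms unfolding good_def
  proof (rule eventually_mono)
    fix t assume *: "0 < t \<and> t < T \<longrightarrow>
     (AE q in P \<Otimes>\<^sub>M U. fst q \<in> disk d r \<and> 0 \<le> \<sigma> * (fst (snd q) - V t) \<and> \<bar>fst (snd q) - V t\<bar> \<le> G \<longrightarrow>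
       \<bar>fp t (face t (fst q)) (snd q) - b (snd (snd q)) * J \<sigma> (V t) (fst (snd q))\<bar> \<le> A * b (snd (snd q)))"
    show "AE q in P \<Otimes>\<^sub>M U. (t, q) \<notin> bad A"
    proof (cases "0 < t \<and> t < T")
      case True
      with * have "AE q in P \<Otimes>\<^sub>M U. fst q \<in> disk d r \<and> 0 \<le> \<sigma> * (fst (snd q) - V t) \<and> \<bar>fst (snd q) - V t\<bar> \<le> G \<longrightarrow>
       \<bar>fp t (face t (fst q)) (snd q) - b (snd (snd q)) * J \<sigma> (V t) (fst (snd q))\<bar> \<le> A * b (snd (snd q))" by blast
      then show ?thesis
        by (rule eventually_mono) (use True FP_eq[of t] in \<open>auto simp: bad_def\<close>)
    qed (auto simp: bad_def)
  qed
  then have "AE q in lborel \<Otimes>\<^sub>M (P \<Otimes>\<^sub>M U). q \<notin> bad A"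
  proof (intro pair_sigma_finite.AE_pair_measure[OF lborel_pv.pair_sigma_finite_axioms])
    have "{x \<in> space (lborel \<Otimes>\<^sub>M (P \<Otimes>\<^sub>M U)). x \<notin> bad A} = space (lborel \<Otimes>\<^sub>M (P \<Otimes>\<^sub>M U)) - bad A" by blast
    then show "{x \<in> space (lborel \<Otimes>\<^sub>M (P \<Otimes>\<^sub>M U)). x \<notin> bad A} \<in> sets (lborel \<Otimes>\<^sub>M (P \<Otimes>\<^sub>M U))"
      using sets.compl_sets[OF bad_meas[of A]] by simp
  qed
  then show ?thesis using AE_iff_null_sets[OF bad_meas] by blast
qed

text \<open>\<open>pullback_null\<close> moves the exceptional set of \<open>good\<close> along the
  flow; at the precollision the particle is outgoing and slow relative to the end, so the bound of
  \<open>good\<close> applies there.\<close>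

lemma good_imp_close:
  assumes "good A"
  shows "AE t in lborel. 0 < t \<and> t < T \<longrightarrow> close A t"
  using pullback_null[OF \<sigma> bad_null[OF assms]]
proof (rule eventually_mono, intro impI)
  fix t
  assume t: "0 < t \<and> t < T" and "AE q in P \<Otimes>\<^sub>M U. 0 < ptau \<sigma> X t (fst (snd q)) \<and> \<sigma> * (fst (snd q) - V t) < 0 \<longrightarrow>
     (ptau \<sigma> X t (fst (snd q)), pback d (fst q) (t - ptau \<sigma> X t (fst (snd q))) (snd (snd q)), snd q) \<notin> bad A"
  moreover have "AE q in P \<Otimes>\<^sub>M U. q \<in> space (P \<Otimes>\<^sub>M U)" by (rule AE_space)
  ultimately show "close A t"
    unfolding close_def using fm_eq[OF conjunct1[OF t]]
  proof eventually_elim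
    case (elim q)
    let ?\<tau> = "ptau \<sigma> X t (fst (snd q))"
    have q: "fst q \<in> disk d r \<and> \<sigma> * (fst (snd q) - V t) < 0" using elim(4) .
      show "if hit d r \<sigma> X t (fst q) (snd q)
      then \<bar>fm t (face t (fst q)) (snd q) - b (snd (snd q)) * J \<sigma> (V ?\<tau>) (fst (snd q))\<bar> \<le> A * b (snd (snd q))
      else fm t (face t (fst q)) (snd q) = f0 (snd q)"
      proof (cases "hit d r \<sigma> X t (fst q) (snd q)")
        case True
        then have pos: "0 < ?\<tau>" and y: "pback d (fst q) (t - ?\<tau>) (snd (snd q)) \<in> disk d r" by (auto simp: hit_def)
        have lt: "?\<tau> < t" using ptau_root(1)[OF \<sigma> _ pos] q by simp
        have out: "0 \<le> \<sigma> * (fst (snd q) - V ?\<tau>)" using ptau_leaving[OF \<sigma> _ pos] q by simp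
        have near: "\<bar>fst (snd q) - V ?\<tau>\<bar> \<le> G" using hit_range(3)[OF \<sigma> _ pos] q t by simp
        have sp: "(?\<tau>, pback d (fst q) (t - ?\<tau>) (snd (snd q)), snd q) \<in> space (lborel \<Otimes>\<^sub>M (P \<Otimes>\<^sub>M U))"
          using elim(2) by (auto simp: space_pair_measure pback_in_space)
        have nb: "(?\<tau>, pback d (fst q) (t - ?\<tau>) (snd (snd q)), snd q) \<notin> bad A" using elim(1) pos q by blast
        have "max 0 ?\<tau> = ?\<tau>" using pos by simp
        then have "\<bar>FP (?\<tau>, pback d (fst q) (t - ?\<tau>) (snd (snd q)), snd q) - b (snd (snd q)) * J \<sigma> (V ?\<tau>) (fst (snd q))\<bar> \<le> A * b (snd (snd q))"
          using nb sp pos lt t y out near unfolding bad_def by auto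
        then show ?thesis
          using True elim(3) q FP_eq[OF _ y, of ?\<tau> "snd q"] pos out by simp
      qed (use elim q in simp)
  qed
qed

text \<open>\<open>fm\<close> and \<open>f0\<close> differ only at velocities within
  \<open>G\<close> of \<open>V t\<close>, where \<open>k\<close> is at most \<open>km\<close>;
  integrating over this interval of length \<open>2 * G\<close> produces
  \<open>km * (2 * G)\<close>, the contraction constant of the feedback.\<close>

lemma close_imp_bound:
  assumes t: "0 < t" "t < T" and A: "0 \<le> A" and close: "close A t"
  shows "AE q in P \<Otimes>\<^sub>M U. fst q \<in> disk d r \<and> 0 \<le> \<sigma> * (fst (snd q) - V t) \<and> \<bar>fst (snd q) - V t\<bar> \<le> G \<longrightarrow>
       \<bar>fp t (face t (fst q)) (snd q) - b (snd (snd q)) * J \<sigma> (V t) (fst (snd q))\<bar>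
         \<le> km * (2 * G) * (A + cJ + aM) * b (snd (snd q))"
proof -
  define S where "S = A + cJ + aM"
  have S: "0 \<le> S" using A cJ_nonneg aM_nonneg by (simp add: S_def)
  have diff: "\<bar>fm t (face t y) u - f0 u\<bar> \<le> S * (indicat_real {V t - G..V t + G} (fst u) * b (snd u))"
    if inc: "\<sigma> * (fst u - V t) < 0" and u: "u \<in> space U"
     and c: "if hit d r \<sigma> X t y u
      then \<bar>fm t (face t y) u - b (snd u) * J \<sigma> (V (ptau \<sigma> X t (fst u))) (fst u)\<bar> \<le> A * b (snd u)
      else fm t (face t y) u = f0 u" for y u
  proof (cases "hit d r \<sigma> X t y u")
    case True
    then have pos: "0 < ptau \<sigma> X t (fst u)" by (simp add: hit_def)
    note rng = hit_range[OF \<sigma> inc pos t(2)]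
    have b0: "0 \<le> b (snd u)" using u by (auto simp: space_vec_measure intro!: b_nonneg)
    let ?J = "J \<sigma> (V (ptau \<sigma> X t (fst u))) (fst u)"
    have "0 \<le> ?J" "?J \<le> cJ" using rng G by (auto intro!: J_nonneg J_le)
    then have "0 \<le> b (snd u) * ?J" "b (snd u) * ?J \<le> b (snd u) * cJ" using b0 by (auto intro: mult_left_mono)
    moreover have "0 \<le> f0 u" "f0 u \<le> b (snd u) * aM"
      using b0 a0_nonneg[of "fst u"] mult_right_mono[OF a0_le[of "fst u"] b0] by (auto simp: f0_eq mult.commute)
    ultimately have "\<bar>fm t (face t y) u - f0 u\<bar> \<le> A * b (snd u) + b (snd u) * cJ + b (snd u) * aM"
      using c True by (simp only: if_True)
    also have "\<dots> = S * b (snd u)" by (simp add: S_def algebra_simps)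
    finally show ?thesis using rng by (simp add: indicator_def abs_le_iff)
  next
    case False
    then show ?thesis using c S u by (auto simp: space_vec_measure b_nonneg indicator_def)
  qed
  have "AE y in P. AE u in U. y \<in> disk d r \<and> \<sigma> * (fst u - V t) < 0 \<longrightarrow>
      (if hit d r \<sigma> X t y u
      then \<bar>fm t (face t y) u - b (snd u) * J \<sigma> (V (ptau \<sigma> X t (fst u))) (fst u)\<bar> \<le> A * b (snd u)
      else fm t (face t y) u = f0 u)"
    using perp_vec.AE_pair[OF close[unfolded close_def]] by (simp only: fst_conv snd_conv)
  from AE_fst[OF sf_vec this]
  have 1: "AE q in P \<Otimes>\<^sub>M U. AE u in U. fst q \<in> disk d r \<and> \<sigma> * (fst u - V t) < 0 \<longrightarrow>
      (if hit d r \<sigma> X t (fst q) u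
      then \<bar>fm t (face t (fst q)) u - b (snd u) * J \<sigma> (V (ptau \<sigma> X t (fst u))) (fst u)\<bar> \<le> A * b (snd u)
      else fm t (face t (fst q)) u = f0 u)" .
  have 2: "AE q in P \<Otimes>\<^sub>M U. fst q \<in> disk d r \<and> outgoing V \<sigma> t (snd q) \<longrightarrow>
      has_bochner_integral U (reflection_integrand K (V t) (fm t (face t (fst q))) (snd q)) (fp t (face t (fst q)) (snd q))"
    using law t unfolding end_law_def by (auto simp: case_prod_beta')
  have 3: "AE q in P \<Otimes>\<^sub>M U. fst (snd q) \<noteq> V t" by (rule AE_pv_fst) (rule AE_lborel_singleton)
  have 4: "AE q in P \<Otimes>\<^sub>M U. q \<in> space (P \<Otimes>\<^sub>M U)" by (rule AE_space)
  show ?thesis using 1 2 3 4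
  proof eventually_elim
    case (elim q)
    obtain y v where q: "q = (y, v)" by (cases q)
    show ?case
    proof (intro impI)
      assume "fst q \<in> disk d r \<and> 0 \<le> \<sigma> * (fst (snd q) - V t) \<and> \<bar>fst (snd q) - V t\<bar> \<le> G"
      then have y: "y \<in> disk d r" and out: "0 \<le> \<sigma> * (fst v - V t)" and vG: "\<bar>fst v - V t\<bar> \<le> G" by (auto simp: q)
      have "\<sigma> * (fst v - V t) \<noteq> 0" using elim(3) \<sigma> by (auto simp: q)
      then have out': "0 < \<sigma> * (fst v - V t)" using out by linarith
      have bv: "0 \<le> b (snd v)" using elim(4) by (auto simp: q space_pair_measure space_vec_measure intro!: b_nonneg)
      have near: "\<bar>V t - Vinf\<bar> < gs" "\<bar>fst v - V t\<bar> < 2 * gs" using near[of t] t vG G by auto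
      have i1: "has_bochner_integral U (reflection_integrand K (V t) (fm t (face t y)) v) (fp t (face t y) v)"
        using elim(2) y out by (simp add: q outgoing_def)
      have i: "has_bochner_integral U (\<lambda>u. reflection_integrand K (V t) (fm t (face t y)) v u - reflection_integrand K (V t) f0 v u)
         (fp t (face t y) v - b (snd v) * J \<sigma> (V t) (fst v))"
        by (rule has_bochner_integral_diff[OF i1 reflection_f0[OF out' near]])
      have g: "has_bochner_integral U (\<lambda>u. b (snd v) * km * S * (indicat_real {V t - G..V t + G} (fst u) * b (snd u)))
         (b (snd v) * km * S * ((V t + G) - (V t - G)))"
        using G by (intro has_bochner_integral_mult_right U_int has_bochner_integral_indicator_interval) auto
      have "\<bar>fp t (face t y) v - b (snd v) * J \<sigma> (V t) (fst v)\<bar> \<le> b (snd v) * km * S * ((V t + G) - (V t - G))"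
      proof (rule has_bochner_integral_abs_le[OF i g])
        have "AE u in U. fst u \<noteq> V t" by (rule AE_vec_fst) (rule AE_lborel_singleton)
        moreover have "AE u in U. u \<in> space U" by (rule AE_space)
        moreover note elim(1)
        ultimately show "AE u in U. \<bar>reflection_integrand K (V t) (fm t (face t y)) v u - reflection_integrand K (V t) f0 v u\<bar>
           \<le> b (snd v) * km * S * (indicat_real {V t - G..V t + G} (fst u) * b (snd u))"
        proof eventually_elim
          case (elim u)
          have bu: "0 \<le> b (snd u)" using elim(2) by (auto simp: space_vec_measure intro!: b_nonneg)
          let ?I = "indicat_real {V t - G..V t + G} (fst u) * b (snd u)"
          have I: "0 \<le> ?I" using bu by simp
          show ?case
          proof (cases "\<sigma> * (fst u - V t) \<le> 0")
            case True
            have "\<sigma> * (fst u - V t) \<noteq> 0" using elim(1) \<sigma> by auto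
            then have inc: "\<sigma> * (fst u - V t) < 0" using True by linarith
            have dd: "\<bar>fm t (face t y) u - f0 u\<bar> \<le> S * ?I"
              using elim(3)[unfolded q fst_conv] y inc by (intro diff[OF inc elim(2)]) blast
            have "reflection_integrand K (V t) (fm t (face t y)) v u - reflection_integrand K (V t) f0 v u
               = b (snd v) * (k (fst v - V t) (fst u - V t) * (fm t (face t y) u - f0 u))"
              unfolding reflection_eq[OF out'] using True by (simp add: algebra_simps)
            then have e: "\<bar>reflection_integrand K (V t) (fm t (face t y)) v u - reflection_integrand K (V t) f0 v u\<bar>
               = b (snd v) * (k (fst v - V t) (fst u - V t) * \<bar>fm t (face t y) u - f0 u\<bar>)"
              using bv k_nonneg by (simp add: abs_mult)
            have "k (fst v - V t) (fst u - V t) * \<bar>fm t (face t y) u - f0 u\<bar> \<le> km * (S * ?I)"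
            proof (cases "\<bar>fst u - V t\<bar> \<le> G")
              case True
              then show ?thesis using k_nonneg k_le[of "fst u - V t"] G dd S I km_nonneg by (intro mult_mono) auto
            next
              case False
              then have "indicat_real {V t - G..V t + G} (fst u) = 0" by (auto simp: indicator_def)
              then show ?thesis using dd by simp
            qed
            then show ?thesis unfolding e using bv mult_left_mono by (fastforce simp: mult.assoc)
          next
            case False
            then show ?thesis
              unfolding reflection_eq[OF out'] using bv km_nonneg S I by simp
          qed
        qed
      qed
      then show "\<bar>fp t (face t (fst q)) (snd q) - b (snd (snd q)) * J \<sigma> (V t) (fst (snd q))\<bar>
         \<le> km * (2 * G) * (A + cJ + aM) * b (snd (snd q))"
        by (simp add: q S_def mult_ac)
    qed
  qed
qed

lemma close_imp_good:
  assumes "0 \<le> A" "AE t in lborel. 0 < t \<and> t < T \<longrightarrow> close A t"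
  shows "good (km * (2 * G) * (A + cJ + aM))"
  unfolding good_def using assms(2)
  by (rule eventually_mono) (use close_imp_bound[OF _ _ assms(1)] in blast)

text \<open>Turns the essential bound into a bound by a multiple of \<open>b\<close>. In the
  reflection law the outgoing transversal velocity enters only through the factor
  \<open>b (snd v)\<close>, so \<open>fp\<close> is \<open>b\<close> times a function
  \<open>h\<close> of \<open>y\<close> and the horizontal velocity. At one transversal velocity with
  \<open>b \<ge> bl\<close> the essential bound controls \<open>h\<close>, hence \<open>fp\<close>
  at all transversal velocities.\<close>

lemma good_initial: "\<exists>A\<ge>0. good A"
proof -
  obtain M0 where M0: "\<And>t. 0 \<le> t \<Longrightarrow> AE q in P \<Otimes>\<^sub>M U. fst q \<in> disk d r \<and> outgoing V \<sigma> t (snd q) \<longrightarrow>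
     \<bar>fp t (face t (fst q)) (snd q)\<bar> \<le> M0 * (1 + (LINT u|U. reflection_integrand K (V t) f0 (snd q) u))"
    using Linf unfolding end_Linfinity_def by (auto simp: case_prod_beta')
  define M1 where "M1 = \<bar>M0\<bar> * (1 + bM * cJ)"
  define A where "A = M1 / bl + cJ"
  have M1: "0 \<le> M1" using bM_pos cJ_nonneg by (simp add: M1_def)
  then have A: "0 \<le> A" using bl(2) cJ_nonneg by (simp add: A_def)
  have "good A"
    unfolding good_def
  proof (rule AE_I2, rule impI)
    fix t assume t: "0 < t \<and> t < T"
    define h where "h y x = (LINT u|U. of_bool (\<sigma> * (fst u - V t) \<le> 0) * (k (x - V t) (fst u - V t) * fm t (face t y) u))" for y x
    have nr: "\<bar>V t - Vinf\<bar> < gs" using near t by simp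
    have 1: "AE q in P \<Otimes>\<^sub>M U. fst q \<in> disk d r \<and> outgoing V \<sigma> t (snd q) \<longrightarrow>
        has_bochner_integral U (reflection_integrand K (V t) (fm t (face t (fst q))) (snd q)) (fp t (face t (fst q)) (snd q))"
      using law t unfolding end_law_def by (auto simp: case_prod_beta')
    have 2: "AE q in P \<Otimes>\<^sub>M U. q \<in> space (P \<Otimes>\<^sub>M U)" by (rule AE_space)
    have t0: "0 \<le> t" using t by simp
    have "AE q in P \<Otimes>\<^sub>M U. fst q \<in> disk d r \<and> 0 < \<sigma> * (fst (snd q) - V t) \<and> \<bar>fst (snd q) - V t\<bar> \<le> G \<longrightarrow>
       FP (t, q) = b (snd (snd q)) * h (fst q) (fst (snd q)) \<and> \<bar>FP (t, q)\<bar> \<le> M1"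
      using 1 2 M0[OF t0]
    proof (eventually_elim, intro impI)
      fix q assume e: "fst q \<in> disk d r \<and> outgoing V \<sigma> t (snd q) \<longrightarrow>
          has_bochner_integral U (reflection_integrand K (V t) (fm t (face t (fst q))) (snd q)) (fp t (face t (fst q)) (snd q))"
        "q \<in> space (P \<Otimes>\<^sub>M U)" "fst q \<in> disk d r \<and> outgoing V \<sigma> t (snd q) \<longrightarrow>
          \<bar>fp t (face t (fst q)) (snd q)\<bar> \<le> M0 * (1 + (LINT u|U. reflection_integrand K (V t) f0 (snd q) u))"
        and q: "fst q \<in> disk d r \<and> 0 < \<sigma> * (fst (snd q) - V t) \<and> \<bar>fst (snd q) - V t\<bar> \<le> G"
      have out: "outgoing V \<sigma> t (snd q)" using q by (simp add: outgoing_def)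
      have sp: "snd (snd q) \<in> space P" using e(2) by (auto simp: space_pair_measure space_vec_measure)
      have FP: "FP (t, q) = fp t (face t (fst q)) (snd q)"
        using FP_eq[of t "fst q" "snd q"] q t by simp
      have i: "has_bochner_integral U (reflection_integrand K (V t) (fm t (face t (fst q))) (snd q)) (fp t (face t (fst q)) (snd q))"
        using e(1) q out by blast
      have eq: "reflection_integrand K (V t) h' (snd q) u = b (snd (snd q)) *
          (of_bool (\<sigma> * (fst u - V t) \<le> 0) * (k (fst (snd q) - V t) (fst u - V t) * h' u))" for h' u
        by (rule reflection_eq) (use q in blast)
      have "fp t (face t (fst q)) (snd q) = (LINT u|U. reflection_integrand K (V t) (fm t (face t (fst q))) (snd q) u)"
        using has_bochner_integral_integral_eq[OF i] by simp
      also have "\<dots> = b (snd (snd q)) * h (fst q) (fst (snd q))"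
        unfolding eq h_def by (rule integral_mult_right_zero)
      finally have fph: "fp t (face t (fst q)) (snd q) = b (snd (snd q)) * h (fst q) (fst (snd q))" .
      have nv: "\<bar>fst (snd q) - V t\<bar> < 2 * gs" using q G by auto
      have "(LINT u|U. reflection_integrand K (V t) f0 (snd q) u) = b (snd (snd q)) * J \<sigma> (V t) (fst (snd q))"
        by (rule has_bochner_integral_integral_eq[OF reflection_f0]) (use q nr nv in auto)
      then have "\<bar>fp t (face t (fst q)) (snd q)\<bar> \<le> M0 * (1 + b (snd (snd q)) * J \<sigma> (V t) (fst (snd q)))"
        using e(3) q out by simp
      also have "\<dots> \<le> \<bar>M0\<bar> * (1 + bM * cJ)"
        using b_nonneg[OF sp] b_le[OF sp] J_nonneg J_le[OF nr nv] bM_pos cJ_nonneg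
        by (intro mult_mono add_mono) auto
      finally show "FP (t, q) = b (snd (snd q)) * h (fst q) (fst (snd q)) \<and> \<bar>FP (t, q)\<bar> \<le> M1"
        using FP fph by (simp add: M1_def)
    qed
    then have "AE y in P. AE u in U. y \<in> disk d r \<and> 0 < \<sigma> * (fst u - V t) \<and> \<bar>fst u - V t\<bar> \<le> G \<longrightarrow>
       FP (t, y, u) = b (snd u) * h y (fst u) \<and> \<bar>FP (t, y, u)\<bar> \<le> M1"
      using perp_vec.AE_pair by fastforce
    then have "AE y in P. AE x in lborel. AE w in P. y \<in> disk d r \<and> 0 < \<sigma> * (x - V t) \<and> \<bar>x - V t\<bar> \<le> G \<longrightarrow>
       FP (t, y, x, w) = b w * h y x \<and> \<bar>FP (t, y, x, w)\<bar> \<le> M1"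
    proof (rule eventually_mono)
      fix y assume "AE u in U. y \<in> disk d r \<and> 0 < \<sigma> * (fst u - V t) \<and> \<bar>fst u - V t\<bar> \<le> G \<longrightarrow>
       FP (t, y, u) = b (snd u) * h y (fst u) \<and> \<bar>FP (t, y, u)\<bar> \<le> M1"
      from lborel_perp.AE_pair[OF this[unfolded vec_measure_def]]
      show "AE x in lborel. AE w in P. y \<in> disk d r \<and> 0 < \<sigma> * (x - V t) \<and> \<bar>x - V t\<bar> \<le> G \<longrightarrow>
       FP (t, y, x, w) = b w * h y x \<and> \<bar>FP (t, y, x, w)\<bar> \<le> M1" by (simp only: fst_conv snd_conv)
    qed
    moreover have "AE y in P. AE x in lborel. x \<noteq> V t" by (intro AE_I2 AE_lborel_singleton)
    moreover have "AE y in P. y \<in> space P" by (rule AE_space)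
    ultimately have fin: "AE y in P. AE x in lborel. AE w in P. y \<in> disk d r \<and> 0 \<le> \<sigma> * (x - V t) \<and> \<bar>x - V t\<bar> \<le> G \<longrightarrow>
       \<bar>FP (t, y, x, w) - b w * J \<sigma> (V t) x\<bar> \<le> A * b w"
    proof eventually_elim
      case (elim y)
      show ?case using elim(1,2)
      proof eventually_elim
        case (elim x)
        show ?case
        proof (cases "y \<in> disk d r \<and> 0 \<le> \<sigma> * (x - V t) \<and> \<bar>x - V t\<bar> \<le> G")
          case True
          have "\<sigma> * (x - V t) \<noteq> 0" using elim(2) \<sigma> by auto
          then have c: "y \<in> disk d r \<and> 0 < \<sigma> * (x - V t) \<and> \<bar>x - V t\<bar> \<le> G" using True by linarith
          have q: "AE w in P. FP (t, y, x, w) = b w * h y x \<and> \<bar>FP (t, y, x, w)\<bar> \<le> M1"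
            using elim(1) by (rule eventually_mono) (use c in blast)
          \<comment> \<open>The factorization holds only for almost every \<open>w\<close>, but the
            cube has positive measure and so contains a suitable one.\<close>
          have "\<exists>w\<in>pbox d \<delta>b. FP (t, y, x, w) = b w * h y x \<and> \<bar>FP (t, y, x, w)\<bar> \<le> M1"
          proof (rule ccontr)
            assume n: "\<not> (\<exists>w\<in>pbox d \<delta>b. FP (t, y, x, w) = b w * h y x \<and> \<bar>FP (t, y, x, w)\<bar> \<le> M1)"
            have "AE w in P. w \<notin> pbox d \<delta>b" using q by (rule eventually_mono) (use n in blast)
            then have "pbox d \<delta>b \<in> null_sets P" by (subst AE_iff_null_sets) auto
            then show False using bl(1) by (auto simp: null_sets_def emeasure_pbox)
          qed
          then obtain w where w: "w \<in> pbox d \<delta>b" "\<bar>b w * h y x\<bar> \<le> M1" by auto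
          have "bl * \<bar>h y x\<bar> \<le> b w * \<bar>h y x\<bar>" using bl(3)[OF w(1)] by (intro mult_right_mono) auto
          also have "\<dots> = \<bar>b w * h y x\<bar>" using bl(3)[OF w(1)] bl(2) by (simp add: abs_mult)
          finally have hb: "\<bar>h y x\<bar> \<le> M1 / bl" using w(2) bl(2) by (simp add: field_simps)
          have "\<bar>x - V t\<bar> < 2 * gs" using True G by auto
          then have J: "0 \<le> J \<sigma> (V t) x" "J \<sigma> (V t) x \<le> cJ" using nr by (auto intro: J_nonneg J_le)
          have "AE w in P. w \<in> space P" by (rule AE_space)
          with q show ?thesis
          proof eventually_elim
            case (elim w)
            have "\<bar>FP (t, y, x, w) - b w * J \<sigma> (V t) x\<bar> = b w * \<bar>h y x - J \<sigma> (V t) x\<bar>"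
              using elim b_nonneg[of w] by (simp add: right_diff_distrib[symmetric] abs_mult)
            also have "\<dots> \<le> b w * A" using hb J elim b_nonneg[of w] by (intro mult_left_mono) (auto simp: A_def)
            finally show ?case by (simp add: mult.commute)
          qed
        next
          case False
          then show ?thesis by (intro AE_I2) blast
        qed
      qed
    qed
    let ?Q = "\<lambda>q. fst q \<in> disk d r \<and> 0 \<le> \<sigma> * (fst (snd q) - V t) \<and> \<bar>fst (snd q) - V t\<bar> \<le> G \<longrightarrow>
       \<bar>FP (t, q) - b (snd (snd q)) * J \<sigma> (V t) (fst (snd q))\<bar> \<le> A * b (snd (snd q))"
    have "AE y in P. AE u in U. ?Q (y, u)"
      using fin AE_space
    proof eventually_elim
      case (elim y)
      then have [measurable]: "(\<lambda>u. FP (t, y, u)) \<in> borel_measurable U"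
        using t by measurable
      show ?case
        unfolding vec_measure_def
      proof (rule lborel_perp.AE_pair_measure)
        have "{u \<in> space U. y \<in> disk d r \<and> 0 \<le> \<sigma> * (fst u - V t) \<and> \<bar>fst u - V t\<bar> \<le> G \<longrightarrow>
          \<bar>FP (t, y, u) - b (snd u) * J \<sigma> (V t) (fst u)\<bar> \<le> A * b (snd u)} \<in> sets U" by measurable
        then show "{u \<in> space (lborel \<Otimes>\<^sub>M P). ?Q (y, u)} \<in> sets (lborel \<Otimes>\<^sub>M P)"
          by (simp only: vec_measure_def fst_conv snd_conv)
        show "AE x in lborel. AE w in P. ?Q (y, x, w)" using elim(1) by (simp only: fst_conv snd_conv)
      qed
    qed
    then have "AE q in P \<Otimes>\<^sub>M U. ?Q q"
      by (intro perp_vec.AE_pair_measure) measurable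
    then show "AE q in P \<Otimes>\<^sub>M U. fst q \<in> disk d r \<and> 0 \<le> \<sigma> * (fst (snd q) - V t) \<and> \<bar>fst (snd q) - V t\<bar> \<le> G \<longrightarrow>
       \<bar>fp t (face t (fst q)) (snd q) - b (snd (snd q)) * J \<sigma> (V t) (fst (snd q))\<bar> \<le> A * b (snd (snd q))"
      by (rule eventually_mono) (use FP_eq[OF t0] in force)
  qed
  then show ?thesis using A by blast
qed

text \<open>
  Feeding a bound back into the reflection law improves it by a constant factor, so the
  solution-dependent bound is replaced by one that only depends on the kernel data.
\<close>

lemma good_final:
  assumes small: "km * (2 * G) \<le> 1 / 4"
  shows "good (km * (2 * G) * (2 * (cJ + aM)))" "AE t in lborel. 0 < t \<and> t < T \<longrightarrow> close (km * (2 * G) * (2 * (cJ + aM))) t"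
proof -
  define S where "S = cJ + aM"
  have S: "0 < S" using cJ_nonneg aM by (simp add: S_def)
  let ?\<kappa> = "km * (2 * G)"
  have \<kappa>: "0 \<le> ?\<kappa>" using km_nonneg G by simp
  have step: "good (?\<kappa> * (A + S))" if "good A" "0 \<le> A" for A
    using close_imp_good[OF that(2) good_imp_close[OF that(1)]] by (simp add: S_def add.assoc)
  have mono: "good B" if g: "good A" and "A \<le> B" for A B
    unfolding good_def using g[unfolded good_def]
  proof (rule eventually_mono, intro impI)
    fix t assume "0 < t \<and> t < T" and *: "0 < t \<and> t < T \<longrightarrow>
     (AE q in P \<Otimes>\<^sub>M U. fst q \<in> disk d r \<and> 0 \<le> \<sigma> * (fst (snd q) - V t) \<and> \<bar>fst (snd q) - V t\<bar> \<le> G \<longrightarrow>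
       \<bar>fp t (face t (fst q)) (snd q) - b (snd (snd q)) * J \<sigma> (V t) (fst (snd q))\<bar> \<le> A * b (snd (snd q)))"
    then have "AE q in P \<Otimes>\<^sub>M U. fst q \<in> disk d r \<and> 0 \<le> \<sigma> * (fst (snd q) - V t) \<and> \<bar>fst (snd q) - V t\<bar> \<le> G \<longrightarrow>
       \<bar>fp t (face t (fst q)) (snd q) - b (snd (snd q)) * J \<sigma> (V t) (fst (snd q))\<bar> \<le> A * b (snd (snd q))" by blast
    moreover have "AE q in P \<Otimes>\<^sub>M U. q \<in> space (P \<Otimes>\<^sub>M U)" by (rule AE_space)
    ultimately show "AE q in P \<Otimes>\<^sub>M U. fst q \<in> disk d r \<and> 0 \<le> \<sigma> * (fst (snd q) - V t) \<and> \<bar>fst (snd q) - V t\<bar> \<le> G \<longrightarrow>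
       \<bar>fp t (face t (fst q)) (snd q) - b (snd (snd q)) * J \<sigma> (V t) (fst (snd q))\<bar> \<le> B * b (snd (snd q))"
    proof (eventually_elim, intro impI)
      fix q assume *: "fst q \<in> disk d r \<and> 0 \<le> \<sigma> * (fst (snd q) - V t) \<and> \<bar>fst (snd q) - V t\<bar> \<le> G \<longrightarrow>
       \<bar>fp t (face t (fst q)) (snd q) - b (snd (snd q)) * J \<sigma> (V t) (fst (snd q))\<bar> \<le> A * b (snd (snd q))"
       "q \<in> space (P \<Otimes>\<^sub>M U)" "fst q \<in> disk d r \<and> 0 \<le> \<sigma> * (fst (snd q) - V t) \<and> \<bar>fst (snd q) - V t\<bar> \<le> G"
      have "0 \<le> b (snd (snd q))" using *(2) by (auto simp: space_pair_measure space_vec_measure intro!: b_nonneg)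
      then have "A * b (snd (snd q)) \<le> B * b (snd (snd q))" using \<open>A \<le> B\<close> by (intro mult_right_mono)
      then show "\<bar>fp t (face t (fst q)) (snd q) - b (snd (snd q)) * J \<sigma> (V t) (fst (snd q))\<bar> \<le> B * b (snd (snd q))"
        using * by (meson order_trans)
    qed
  qed
  obtain A0 where A0: "0 \<le> A0" "good A0" using good_initial by blast
  \<comment> \<open>\<open>S / 3\<close> is the fixed point of the map
    \<open>A \<mapsto> (A + S) / 4\<close>, which dominates one feedback step.\<close>
  have it: "good (A0 / 4 ^ n + S / 3)" for n
  proof (induction n)
    case 0
    then show ?case using A0 S by (intro mono[OF A0(2)]) auto
  next
    case (Suc n)
    have n0: "0 \<le> A0 / 4 ^ n + S / 3" using A0 S by (intro add_nonneg_nonneg) auto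
    have "?\<kappa> * (A0 / 4 ^ n + S / 3 + S) \<le> 1 / 4 * (A0 / 4 ^ n + S / 3 + S)"
      using small n0 S by (intro mult_right_mono) auto
    also have "\<dots> = A0 / 4 ^ Suc n + S / 3" by (simp add: field_simps)
    finally show ?case using mono[OF step[OF Suc n0]] by blast
  qed
  have "(\<lambda>n. A0 * (1 / 4) ^ n) \<longlonglongrightarrow> A0 * 0" by (intro tendsto_intros LIMSEQ_power_zero) simp
  then have "eventually (\<lambda>n. A0 * (1 / 4) ^ n < S / 3) sequentially"
    using S by (intro order_tendstoD(2)) auto
  then obtain n where "A0 * (1 / 4) ^ n < S / 3" by (auto simp: eventually_sequentially)
  moreover have "A0 * (1 / 4) ^ n = A0 / 4 ^ n" by (simp add: power_one_over)
  ultimately have "A0 / 4 ^ n + S / 3 \<le> S" using S by linarith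
  then have "good S" using mono[OF it] by blast
  \<comment> \<open>One more step replaces the bound \<open>S\<close> by one with the factor
    \<open>G\<close>, which becomes small with \<open>G\<close>.\<close>
  then have "good (?\<kappa> * (S + S))" by (rule step) (use S in simp)
  then show g: "good (?\<kappa> * (2 * (cJ + aM)))" by (simp add: S_def)
  show "AE t in lborel. 0 < t \<and> t < T \<longrightarrow> close (?\<kappa> * (2 * (cJ + aM))) t" by (rule good_imp_close[OF g])
qed

end

section \<open>Bounds on the precollision force\<close>

context kinetic begin

definition mu where "mu = measure P (disk d r)"

lemma disk_int: "has_bochner_integral P (indicat_real (disk d r)) mu"
  using emeasure_disk_finite[of r d] r unfolding mu_def
  by (intro has_bochner_integral_real_indicator) auto

lemma mu_nonneg: "0 \<le> mu" by (simp add: mu_def)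

lemma PU_int:
  fixes f :: "perp \<Rightarrow> real" and g :: "vec \<Rightarrow> real"
  assumes "has_bochner_integral P f x" "has_bochner_integral U g y"
  shows "has_bochner_integral (P \<Otimes>\<^sub>M U) (\<lambda>q. f (fst q) * g (snd q)) (x * y)"
  by (rule has_bochner_integral_pair_mult[OF sf_perp sf_vec assms])

lemma pbox_int:
  assumes "0 \<le> h" shows "has_bochner_integral P (indicat_real (pbox d h)) ((2 * h) ^ (d - 1))"
  using has_bochner_integral_real_indicator[of "pbox d h" P] emeasure_pbox[of h d] measure_pbox[of h d] assms
  by simp

text \<open>Two bounds on the mass of slow transversal velocities: the trivial one serves small
  times and the volume bound large times; \<open>decay_bound\<close> merges them.\<close>

lemma b_box_int:
  assumes "0 \<le> h"
  shows "\<exists>x. has_bochner_integral P (\<lambda>w. b w * indicat_real (pbox d h) w) x \<and> 0 \<le> x \<and> x \<le> 1 \<and> x \<le> bM * (2 * h) ^ (d - 1)"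
proof -
  define x where "x = (LINT w|P. b w * indicat_real (pbox d h) w)"
  have i: "has_bochner_integral P (\<lambda>w. b w * indicat_real (pbox d h) w) x"
    unfolding x_def
  proof (rule has_bochner_integral_integrable)
    have "integrable P b" using b_int by (auto simp: has_bochner_integral_iff)
    from integrable_mult_indicator[OF sets_pbox this]
    show "integrable P (\<lambda>w. b w * indicat_real (pbox d h) w)" by (simp add: mult.commute)
  qed
  have "0 \<le> x" unfolding x_def by (intro integral_nonneg_AE AE_I2) (simp add: b_nonneg)
  moreover have "x \<le> 1"
    by (rule has_bochner_integral_le[OF i b_int]) (auto simp: indicator_def b_nonneg intro!: AE_I2)
  moreover have "x \<le> bM * (2 * h) ^ (d - 1)"
    by (rule has_bochner_integral_le[OF i has_bochner_integral_mult_right[OF pbox_int[OF assms]]])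
      (auto simp: indicator_def b_le intro!: AE_I2)
  ultimately show ?thesis using i by blast
qed

definition C\<beta> where "C\<beta> = max (2 ^ (d - 1)) (bM * (16 * r) ^ (d - 1))"

lemma decay_bound:
  assumes "0 < t" "x \<le> 1" "x \<le> bM * (2 * (4 * r / t)) ^ (d - 1)"
  shows "x \<le> C\<beta> * (1 + t) powr (1 - real d)"
proof -
  have e: "(1 + t) powr (1 - real d) = 1 / (1 + t) ^ (d - 1)"
  proof -
    have "(1 + t) powr (1 - real d) = (1 + t) powr (- real (d - 1))" using d by (simp add: of_nat_diff)
    then show ?thesis using assms(1) by (simp add: powr_minus powr_realpow divide_inverse)
  qed
  show ?thesis
  proof (cases "t \<le> 1")
    case True
    have "(1 + t) ^ (d - 1) \<le> 2 ^ (d - 1)" using True assms(1) by (intro power_mono) auto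
    then have "1 \<le> 2 ^ (d - 1) * (1 / (1 + t) ^ (d - 1))" using assms(1) by (simp add: field_simps)
    also have "\<dots> \<le> C\<beta> * (1 / (1 + t) ^ (d - 1))"
      unfolding C\<beta>_def using assms(1) by (intro mult_right_mono) auto
    finally show ?thesis using assms(2) by (simp add: e)
  next
    case False
    have "2 * (4 * r / t) \<le> 16 * r / (1 + t)" using False r by (simp add: field_simps)
    then have "(2 * (4 * r / t)) ^ (d - 1) \<le> (16 * r / (1 + t)) ^ (d - 1)"
      using False r by (intro power_mono) auto
    then have "x \<le> bM * (16 * r / (1 + t)) ^ (d - 1)"
      using assms(3) bM_pos by (meson less_imp_le mult_left_mono order_trans)
    also have "\<dots> = bM * (16 * r) ^ (d - 1) * (1 / (1 + t) ^ (d - 1))" by (simp add: power_divide)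
    also have "\<dots> \<le> C\<beta> * (1 / (1 + t) ^ (d - 1))"
      unfolding C\<beta>_def using assms(1) by (intro mult_right_mono) auto
    finally show ?thesis by (simp add: e)
  qed
qed

definition C3 where "C3 = 2 * (mu + 1) * (2 * (cJ + aM)) * (Cl + 1) * max C\<beta> 1"

lemma C3_pos: "0 < C3"
  unfolding C3_def using mu_nonneg cJ_nonneg aM Cl_nonneg by (intro mult_pos_pos) auto

text \<open>Product of the measure of the starting cube, the density gap \<open>a\<close>, the
  impulse on a velocity interval of length \<open>w / 4\<close> beginning at distance
  \<open>w / 2\<close>, the lower bound \<open>bl\<close> of \<open>b\<close>, and the size of the
  transversal velocity cube; see \<open>lower_functional\<close>.\<close>

definition c3 where "c3 a = (r / d) ^ (d - 1) * (a * cl * (1 / 2) powr p / 4 * bl) * (2 * min \<delta>b (r / (2 * d))) ^ (d - 1)"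

lemma c3_pos: "0 < a \<Longrightarrow> 0 < c3 a"
  unfolding c3_def using r d impulse_bounds(1) bl by (intro mult_pos_pos zero_less_power) auto

end

context motion begin

definition side :: "real \<Rightarrow> real \<Rightarrow> perp \<times> vec \<Rightarrow> real" where
  "side \<sigma> t q = of_bool (fst q \<in> disk d r \<and> \<sigma> * (fst (snd q) - V t) \<le> 0)"

lemma hit_mean:
  assumes \<sigma>: "\<sigma> \<in> {1, -1}" and inc: "\<sigma> * (fst u - V t) < 0" and hit: "hit d r \<sigma> X t y u"
  shows "0 < ptau \<sigma> X t (fst u)" "ptau \<sigma> X t (fst u) < t" "mean X (ptau \<sigma> X t (fst u)) t = fst u"
proof -
  show pos: "0 < ptau \<sigma> X t (fst u)" using hit by (simp add: hit_def)
  show lt: "ptau \<sigma> X t (fst u) < t" by (rule ptau_root(1)[OF \<sigma> inc pos])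
  show "mean X (ptau \<sigma> X t (fst u)) t = fst u" using ptau_root(2)[OF \<sigma> inc pos] lt by (simp add: mean_def)
qed

text \<open>\<open>\<phi>\<close> stands for \<open>fm - f0\<close> at one end. It is nonzero only
  after a precollision, and then the velocity is a mean velocity of the body, so
  \<open>\<bar>fst u - V t\<bar>\<close> is at most \<open>m1\<close> or \<open>m2\<close>; an
  interval of that size and an impulse of order \<open>p\<close> give the power
  \<open>p + 1\<close>. An early precollision moreover confines \<open>snd u\<close> to a cube of
  side of order \<open>1 / t\<close>.\<close>

lemma upper_functional:
  assumes t: "0 < t" "t < T" and \<sigma>: "\<sigma> \<in> {1, -1}" and S: "0 \<le> S" "S \<le> 2 * (cJ + aM)"
    and int: "has_bochner_integral (P \<Otimes>\<^sub>M U) (\<lambda>q. side \<sigma> t q * (impulse k (fst (snd q) - V t) * \<phi> q)) D"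
    and ae: "AE q in P \<Otimes>\<^sub>M U. fst q \<in> disk d r \<and> \<sigma> * (fst (snd q) - V t) < 0 \<longrightarrow>
      (if hit d r \<sigma> X t (fst q) (snd q) then \<bar>\<phi> q\<bar> \<le> S * b (snd (snd q)) else \<phi> q = 0)"
    and m: "0 \<le> m1" "0 \<le> m2"
      "\<And>s. 0 < s \<Longrightarrow> s \<le> t / 2 \<Longrightarrow> - \<sigma> * (mean X s t - V t) \<le> m1"
      "\<And>s. t / 2 < s \<Longrightarrow> s < t \<Longrightarrow> - \<sigma> * (mean X s t - V t) \<le> m2"
  shows "\<bar>D\<bar> \<le> C3 * (m1 powr (p + 1) * (1 + t) powr (1 - real d) + m2 powr (p + 1))"
proof -
  \<comment> \<open>Both collision points lie over the disk and are at least \<open>t / 2\<close>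
    apart in time, so each transversal coordinate of the velocity is at most
    \<open>2 * r / (t / 2)\<close>.\<close>
  define h where "h = 4 * r / t"
  have h: "0 \<le> h" using t r by (simp add: h_def)
  obtain x where x: "has_bochner_integral P (\<lambda>w. b w * indicat_real (pbox d h) w) x" "0 \<le> x" "x \<le> 1" "x \<le> bM * (2 * h) ^ (d - 1)"
    using b_box_int[OF h] by blast
  have xd: "x \<le> C\<beta> * (1 + t) powr (1 - real d)"
    using decay_bound[OF t(1) x(3)] x(4) by (simp add: h_def)
  define i1 i2 where "i1 = indicat_real {V t - m1..V t + m1}" and "i2 = indicat_real {V t - m2..V t + m2}"
  define B where "B q = S * Cl * m1 powr p * (indicat_real (disk d r) (fst q) * (i1 (fst (snd q)) * (b (snd (snd q)) * indicat_real (pbox d h) (snd (snd q)))))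
     + S * Cl * m2 powr p * (indicat_real (disk d r) (fst q) * (i2 (fst (snd q)) * b (snd (snd q))))" for q :: "perp \<times> vec"
  have "has_bochner_integral (P \<Otimes>\<^sub>M U) B (S * Cl * m1 powr p * (mu * (((V t + m1) - (V t - m1)) * x))
     + S * Cl * m2 powr p * (mu * ((V t + m2) - (V t - m2))))"
    unfolding B_def i1_def i2_def
    by (intro has_bochner_integral_add has_bochner_integral_mult_right PU_int disk_int U_pair x(1) U_int
        has_bochner_integral_indicator_interval) (use m in auto)
  then have "\<bar>D\<bar> \<le> S * Cl * m1 powr p * (mu * (((V t + m1) - (V t - m1)) * x))
     + S * Cl * m2 powr p * (mu * ((V t + m2) - (V t - m2)))"
  proof (rule has_bochner_integral_abs_le[OF int])
    have ne: "AE q in P \<Otimes>\<^sub>M U. fst (snd q) \<noteq> V t" by (rule AE_pv_fst) (rule AE_lborel_singleton)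
    have sp: "AE q in P \<Otimes>\<^sub>M U. q \<in> space (P \<Otimes>\<^sub>M U)" by (rule AE_space)
    show "AE q in P \<Otimes>\<^sub>M U. \<bar>side \<sigma> t q * (impulse k (fst (snd q) - V t) * \<phi> q)\<bar> \<le> B q"
      using ae ne sp
    proof eventually_elim
      case (elim q)
      obtain y u where q: "q = (y, u)" by (cases q)
      have bu: "0 \<le> b (snd u)" using elim(3) by (auto simp: q space_pair_measure space_vec_measure intro!: b_nonneg)
      have B0: "0 \<le> B q" unfolding B_def i1_def i2_def using S Cl_nonneg bu by (auto simp: q)
      show ?case
      proof (cases "y \<in> disk d r \<and> \<sigma> * (fst u - V t) \<le> 0 \<and> \<phi> q \<noteq> 0")
        case False
        then have "side \<sigma> t q * (impulse k (fst (snd q) - V t) * \<phi> q) = 0" by (auto simp: side_def q)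
        then show ?thesis using B0 by (simp only: abs_zero)
      next
        case True
        have "\<sigma> * (fst u - V t) \<noteq> 0" using elim(2) \<sigma> by (auto simp: q)
        then have inc: "\<sigma> * (fst u - V t) < 0" using True by linarith
        have hit: "hit d r \<sigma> X t y u" and \<phi>: "\<bar>\<phi> q\<bar> \<le> S * b (snd u)"
          using elim(1) True inc unfolding q fst_conv snd_conv by (auto split: if_splits)
        let ?\<tau> = "ptau \<sigma> X t (fst u)"
        note hm = hit_mean[OF \<sigma> inc hit]
        have z: "\<bar>fst u - V t\<bar> = - \<sigma> * (fst u - V t)" using \<sigma> inc by (auto simp: abs_if)
        have zG: "\<bar>fst u - V t\<bar> \<le> gs" using hit_range(2)[OF \<sigma> inc hm(1) t(2)] G by simp
        have bound: "\<bar>side \<sigma> t q * (impulse k (fst (snd q) - V t) * \<phi> q)\<bar> \<le> S * Cl * m powr p * b (snd u)"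
          if "\<bar>fst u - V t\<bar> \<le> m" for m
        proof -
          have "\<bar>side \<sigma> t q * (impulse k (fst (snd q) - V t) * \<phi> q)\<bar> = impulse k (fst u - V t) * \<bar>\<phi> q\<bar>"
            using True impulse_nonneg by (simp add: side_def q abs_mult)
          also have "\<dots> \<le> (Cl * m powr p) * (S * b (snd u))"
          proof (rule mult_mono[OF _ \<phi>])
            have "impulse k (fst u - V t) \<le> Cl * \<bar>fst u - V t\<bar> powr p" by (rule impulse_bounds(3)[OF zG])
            also have "\<dots> \<le> Cl * m powr p" using that Cl_nonneg p by (intro mult_left_mono powr_mono2) auto
            finally show "impulse k (fst u - V t) \<le> Cl * m powr p" .
          qed (use Cl_nonneg in auto)
          finally show ?thesis by (simp add: mult_ac)
        qed
        show ?thesis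
        proof (cases "?\<tau> \<le> t / 2")
          case early: True
          have zm: "\<bar>fst u - V t\<bar> \<le> m1" using m(3)[OF hm(1) early] hm(3) z by simp
          have "snd u \<in> pbox d h"
            unfolding pbox_def
          proof (intro CollectI conjI ballI)
            show "snd u \<in> space P" using elim(3) by (auto simp: q space_pair_measure space_vec_measure)
            fix i assume i: "i \<in> {1..<d}"
            have "\<bar>y i\<bar> \<le> r" using True disk_subset_pbox[of d r] i by (auto simp: pbox_def)
            moreover have "\<bar>y i - (t - ?\<tau>) * snd u i\<bar> \<le> r"
              using hit disk_subset_pbox[of d r] i by (auto simp: hit_def pbox_def pback_def)
            ultimately have "(t - ?\<tau>) * \<bar>snd u i\<bar> \<le> 2 * r"
              using hm(2) by (simp add: abs_mult[symmetric])
            moreover have "t / 2 * \<bar>snd u i\<bar> \<le> (t - ?\<tau>) * \<bar>snd u i\<bar>" using early by (intro mult_right_mono) auto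
            ultimately show "\<bar>snd u i\<bar> \<le> h" using t by (simp add: h_def field_simps)
          qed
          then have "S * Cl * m1 powr p * b (snd u) \<le> B q"
            unfolding B_def i1_def i2_def using zm True S Cl_nonneg bu by (simp add: q indicator_def abs_le_iff)
          then show ?thesis using bound[OF zm] by simp
        next
          case late: False
          have zm: "\<bar>fst u - V t\<bar> \<le> m2" using m(4)[of ?\<tau>] late hm z by simp
          then have "S * Cl * m2 powr p * b (snd u) \<le> B q"
            unfolding B_def i1_def i2_def using True S Cl_nonneg bu by (simp add: q indicator_def abs_le_iff)
          then show ?thesis using bound[OF zm] by simp
        qed
      qed
    qed
  qed
  also have "\<dots> = 2 * mu * S * Cl * (m1 powr (p + 1) * x + m2 powr (p + 1))"
  proof -
    have "m1 powr (p + 1) = m1 powr p * m1" "m2 powr (p + 1) = m2 powr p * m2"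
      using m by (simp_all add: powr_add)
    then show ?thesis by (simp add: algebra_simps)
  qed
  also have "\<dots> \<le> 2 * mu * S * Cl * (max C\<beta> 1 * (m1 powr (p + 1) * (1 + t) powr (1 - real d) + m2 powr (p + 1)))"
  proof (intro mult_left_mono)
    have "m1 powr (p + 1) * x \<le> m1 powr (p + 1) * (max C\<beta> 1 * (1 + t) powr (1 - real d))"
      by (intro mult_left_mono order_trans[OF xd] mult_right_mono) auto
    moreover have "m2 powr (p + 1) \<le> max C\<beta> 1 * m2 powr (p + 1)"
      using mult_right_mono[of 1 "max C\<beta> 1" "m2 powr (p + 1)"] by simp
    ultimately show "m1 powr (p + 1) * x + m2 powr (p + 1) \<le>
       max C\<beta> 1 * (m1 powr (p + 1) * (1 + t) powr (1 - real d) + m2 powr (p + 1))"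
      by (simp add: algebra_simps)
  qed (use mu_nonneg S Cl_nonneg in auto)
  also have "\<dots> = (2 * mu * S * Cl * max C\<beta> 1) * (m1 powr (p + 1) * (1 + t) powr (1 - real d) + m2 powr (p + 1))" by simp
  also have "\<dots> \<le> C3 * (m1 powr (p + 1) * (1 + t) powr (1 - real d) + m2 powr (p + 1))"
    unfolding C3_def using mu_nonneg S Cl_nonneg cJ_nonneg aM by (intro mult_right_mono mult_mono) auto
  finally show ?thesis .
qed

text \<open>At time 0 the crossing inequality is strict, so by continuity it also holds at some
  positive time.\<close>

lemma ptau_pos_left:
  assumes "0 < t" "z < mean X 0 t"
  shows "0 < ptau (-1) X t z"
proof -
  have "t * z < X t - X 0" using assms by (simp add: mean_def field_simps)
  then have pos: "0 < X t - X 0 - (t - 0) * z" by simp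
  have c: "continuous_on {0..} (\<lambda>s. X t - X s - (t - s) * z)"
    by (intro continuous_intros contX)
  then obtain e where e: "e > 0" "\<And>s. s \<in> {0..} \<Longrightarrow> dist s 0 < e \<Longrightarrow>
      dist (X t - X s - (t - s) * z) (X t - X 0 - (t - 0) * z) < X t - X 0 - (t - 0) * z"
    using pos unfolding continuous_on_iff by (metis atLeast_iff order_refl)
  define s where "s = min e t / 2"
  have s: "0 < s" "s < t" "s < e" using e(1) assms by (auto simp: s_def)
  have "dist (X t - X s - (t - s) * z) (X t - X 0 - (t - 0) * z) < X t - X 0 - (t - 0) * z"
    using e(2)[of s] s by (simp add: dist_real_def)
  then have "(t - s) * z < X t - X s" by (simp add: dist_real_def abs_less_iff)
  then have "s \<le> tau X t z" using s by (intro tau_ge) auto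
  then show ?thesis using s by (simp add: ptau_def)
qed

text \<open>Starting in a cube of half side \<open>r / (2 * d)\<close> and moving transversally by
  at most as much, the backward path stays in the cube of half side \<open>r / d\<close>, hence over
  the disk.\<close>

lemma hit_left:
  assumes t: "0 < (t::real)" and z: "V t < fst u" "fst u < mean X 0 t"
    and y: "y \<in> pbox d (r / (2 * d))" and w: "snd u \<in> pbox d (r / (2 * real d * t))"
  shows "hit d r (-1) X t y u"
proof -
  let ?\<tau> = "ptau (-1) X t (fst u)"
  have pos: "0 < ?\<tau>" using ptau_pos_left[OF t z(2)] .
  have inc: "-1 * (fst u - V t) < 0" using z by simp
  have lt: "?\<tau> < t" using ptau_root(1)[OF _ inc pos] by simp
  have "pback d y (t - ?\<tau>) (snd u) \<in> pbox d (r / d)"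
    unfolding pbox_def
  proof (intro CollectI conjI ballI pback_in_space)
    fix i assume i: "i \<in> {1..<d}"
    have "\<bar>(t - ?\<tau>) * snd u i\<bar> \<le> t * (r / (2 * real d * t))"
      unfolding abs_mult using w i lt pos t r by (intro mult_mono) (auto simp: pbox_def)
    also have "\<dots> = r / (2 * d)" using t by simp
    finally have "\<bar>(t - ?\<tau>) * snd u i\<bar> \<le> r / (2 * d)" .
    moreover have "\<bar>y i\<bar> \<le> r / (2 * d)" using y i by (auto simp: pbox_def)
    moreover have "r / (2 * d) + r / (2 * d) = r / d" by simp
    ultimately show "\<bar>pback d y (t - ?\<tau>) (snd u) i\<bar> \<le> r / d"
      using i by (simp only: pback_def restrict_apply')
  qed
  then show ?thesis using pos r d pbox_subset_disk[of r d] by (auto simp: hit_def)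
qed

text \<open>Every velocity strictly between \<open>V t\<close> and the mean over
  \<open>[0, t]\<close> has met the left end before if it is transversally slow. Integrating over an
  explicit box of such velocities, at horizontal distance \<open>w / 2\<close> to
  \<open>3 * w / 4\<close> from \<open>V t\<close>, gives the bound; stopping short of
  \<open>w\<close> keeps them strictly below the mean.\<close>

lemma lower_functional:
  assumes t: "0 < t" "t < T" and a: "0 < a"
    and int: "has_bochner_integral (P \<Otimes>\<^sub>M U) (\<lambda>q. side (-1) t q * (impulse k (fst (snd q) - V t) * \<phi> q)) D"
    and ae: "AE q in P \<Otimes>\<^sub>M U. fst q \<in> disk d r \<and> -1 * (fst (snd q) - V t) < 0 \<longrightarrow>
      (if hit d r (-1) X t (fst q) (snd q) then a * b (snd (snd q)) \<le> \<phi> q else \<phi> q = 0)"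
    and w: "0 \<le> w" "w \<le> mean X 0 t - V t"
  shows "c3 a * w powr (p + 1) * (1 + t) powr (1 - real d) \<le> D" (is "?L \<le> _")
proof -
  have ne: "AE q in P \<Otimes>\<^sub>M U. fst (snd q) \<noteq> V t" by (rule AE_pv_fst) (rule AE_lborel_singleton)
  have sp: "AE q in P \<Otimes>\<^sub>M U. q \<in> space (P \<Otimes>\<^sub>M U)" by (rule AE_space)
  have nonneg: "AE q in P \<Otimes>\<^sub>M U. 0 \<le> side (-1) t q * (impulse k (fst (snd q) - V t) * \<phi> q)"
    using ae ne sp
  proof eventually_elim
    case (elim q)
    have bu: "0 \<le> b (snd (snd q))" using elim(3) by (auto simp: space_pair_measure space_vec_measure intro!: b_nonneg)
    show ?case
    proof (cases "fst q \<in> disk d r \<and> V t \<le> fst (snd q)")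
      case True
      then have "(if hit d r (-1) X t (fst q) (snd q) then a * b (snd (snd q)) \<le> \<phi> q else \<phi> q = 0)"
        using elim by auto
      moreover have "0 \<le> a * b (snd (snd q))" using a bu by simp
      ultimately have "0 \<le> \<phi> q" by (simp split: if_splits)
      then show ?thesis using impulse_nonneg by (simp add: side_def)
    qed (auto simp: side_def)
  qed
  have D0: "0 \<le> D"
    by (rule has_bochner_integral_le[OF has_bochner_integral_zero int nonneg])
  show "?L \<le> D"
  proof (cases "w = 0")
    case True
    then show ?thesis using D0 by simp
  next
    case False
    then have w0: "0 < w" using w by simp
    \<comment> \<open>At most \<open>\<delta>b\<close>, so that \<open>b \<ge> bl\<close>, and at
      most \<open>r / (2 * d * t)\<close>, so that \<open>hit_left\<close> applies; the denominator
      \<open>1 + t\<close> serves small and large \<open>t\<close> alike.\<close>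
    define h where "h = min \<delta>b (r / (2 * d)) / (1 + t)"
    have h: "0 < h" using bl(1) r d t by (simp add: h_def)
    have h1: "h \<le> \<delta>b"
    proof -
      have "min \<delta>b (r / (2 * d)) / (1 + t) \<le> min \<delta>b (r / (2 * d)) / 1"
        using bl(1) r d t by (intro divide_left_mono) auto
      then show ?thesis by (simp add: h_def)
    qed
    have h2: "h \<le> r / (2 * real d * t)"
    proof -
      have "min \<delta>b (r / (2 * d)) / (1 + t) \<le> r / (2 * d) / t"
        using bl(1) r d t by (intro frac_le) auto
      then show ?thesis by (simp add: h_def mult.assoc)
    qed
    have wG: "w \<le> gs"
    proof -
      from mean_value[OF order_refl t(1)] obtain s where s: "0 < s" "s < t" "X t - X 0 = (t - 0) * V s" .
      then have "mean X 0 t = V s" using t by (simp add: mean_def)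
      then show ?thesis using V_range[of s] V_range[of t] s t w G by linarith
    qed
    define B where "B q = indicat_real (pbox d (r / (2 * d))) (fst q) *
       (a * cl * (w / 2) powr p * bl * (indicat_real {V t + w / 2..V t + 3 * w / 4} (fst (snd q)) * indicat_real (pbox d h) (snd (snd q))))"
       for q :: "perp \<times> vec"
    have "has_bochner_integral (P \<Otimes>\<^sub>M U) B ((2 * (r / (2 * d))) ^ (d - 1) *
       (a * cl * (w / 2) powr p * bl * (((V t + 3 * w / 4) - (V t + w / 2)) * (2 * h) ^ (d - 1))))"
      unfolding B_def
      by (intro PU_int has_bochner_integral_mult_right U_pair pbox_int has_bochner_integral_indicator_interval)
        (use r h w0 in auto)
    then have "(2 * (r / (2 * d))) ^ (d - 1) *
       (a * cl * (w / 2) powr p * bl * (((V t + 3 * w / 4) - (V t + w / 2)) * (2 * h) ^ (d - 1))) \<le> D"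
    proof (rule has_bochner_integral_le[OF _ int])
      show "AE q in P \<Otimes>\<^sub>M U. B q \<le> side (-1) t q * (impulse k (fst (snd q) - V t) * \<phi> q)"
        using ae nonneg
      proof eventually_elim
        case (elim q)
        obtain y u where q: "q = (y, u)" by (cases q)
        show ?case
        proof (cases "y \<in> pbox d (r / (2 * d)) \<and> V t + w / 2 \<le> fst u \<and> fst u \<le> V t + 3 * w / 4 \<and> snd u \<in> pbox d h")
          case False
          then have "B q = 0" by (auto simp: B_def q indicator_def)
          then show ?thesis using elim(2) by simp
        next
          case True
          have yd: "y \<in> disk d r"
          proof -
            have "pbox d (r / (2 * d)) \<subseteq> pbox d (r / d)"
            proof -
              have "r / (2 * d) \<le> r / d" using r d by (simp add: field_simps)
              then show ?thesis unfolding pbox_def by fastforce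
            qed
            then show ?thesis using True pbox_subset_disk[of r d] r d by auto
          qed
          have z: "V t < fst u" "fst u < mean X 0 t" using True w0 w by auto
          have sw: "snd u \<in> pbox d (r / (2 * real d * t))" using True h2 unfolding pbox_def by fastforce
          have hit: "hit d r (-1) X t y u" using hit_left[OF t(1) z _ sw] True by simp
          then have \<phi>: "a * b (snd u) \<le> \<phi> q" using elim(1) yd z by (simp add: q)
          have "snd u \<in> pbox d \<delta>b" using True h1 unfolding pbox_def by fastforce
          then have "a * bl \<le> \<phi> q" using bl(3)[of "snd u"] a \<phi> by (meson less_imp_le mult_left_mono order_trans)
          moreover have "cl * (w / 2) powr p \<le> impulse k (fst u - V t)"
          proof -
            have "cl * (w / 2) powr p \<le> cl * \<bar>fst u - V t\<bar> powr p"
              using True w0 p impulse_bounds(1) by (intro mult_left_mono powr_mono2) auto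
            also have "\<dots> \<le> impulse k (fst u - V t)"
              using True w0 wG by (intro impulse_bounds(2)) auto
            finally show ?thesis .
          qed
          ultimately have "(cl * (w / 2) powr p) * (a * bl) \<le> impulse k (fst u - V t) * \<phi> q"
            using a bl impulse_bounds(1) impulse_nonneg by (intro mult_mono) auto
          then show ?thesis using True yd z by (simp add: B_def side_def q indicator_def mult_ac)
        qed
      qed
    qed
    moreover have "(2 * (r / (2 * d))) ^ (d - 1) *
       (a * cl * (w / 2) powr p * bl * (((V t + 3 * w / 4) - (V t + w / 2)) * (2 * h) ^ (d - 1))) = ?L"
    proof -
      have e: "(1 + t) powr (1 - real d) = 1 / (1 + t) ^ (d - 1)"
      proof -
        have "(1 + t) powr (1 - real d) = (1 + t) powr (- real (d - 1))" using d by (simp add: of_nat_diff)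
        then show ?thesis using t by (simp add: powr_minus powr_realpow divide_inverse)
      qed
      have e2: "(w / 2) powr p * ((V t + 3 * w / 4) - (V t + w / 2)) = (1 / 2) powr p / 4 * w powr (p + 1)"
        using w0 by (simp add: powr_divide powr_add field_simps)
      have e3: "(2 * h) ^ (d - 1) = (2 * min \<delta>b (r / (2 * d))) ^ (d - 1) * (1 + t) powr (1 - real d)"
        unfolding e h_def by (simp add: power_divide)
      have e4: "2 * (r / (2 * d)) = r / d" by simp
      have "(2 * (r / (2 * d))) ^ (d - 1) *
       (a * cl * (w / 2) powr p * bl * (((V t + 3 * w / 4) - (V t + w / 2)) * (2 * h) ^ (d - 1)))
       = (r / d) ^ (d - 1) * (a * cl * bl * ((w / 2) powr p * ((V t + 3 * w / 4) - (V t + w / 2))) * (2 * h) ^ (d - 1))"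
        unfolding e4 by (simp add: mult_ac)
      also have "\<dots> = ?L" unfolding e2 e3 c3_def by (simp add: mult_ac)
      finally show ?thesis .
    qed
    ultimately show ?thesis by simp
  qed
qed

end

text \<open>\<open>gap\<close> is the reversal criterion made uniform: near \<open>Vinf\<close> the
  reflection of \<open>f0\<close> at the left end, enlarged by the error that
  \<open>good_final\<close> allows, stays below \<open>f0\<close> by the fixed margin
  \<open>a\<close>, all divided by \<open>b\<close>.\<close>

locale full_solution = motion +
  fixes H :: real and K :: "vec \<Rightarrow> vec \<Rightarrow> real" and fm fp :: density and a :: real
  assumes K_eq: "\<And>v u. K v u = k (fst v) (fst u) * b (snd v)"
    and laws: "\<And>\<sigma>. \<sigma> \<in> {1, -1} \<Longrightarrow> end_law d H r K f0 X V fm fp \<sigma>"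
    and Linfs: "\<And>\<sigma>. \<sigma> \<in> {1, -1} \<Longrightarrow> end_Linfinity d H r K f0 X V fm fp \<sigma>"
    and conv: "\<And>t. 0 \<le> t \<Longrightarrow> force_convergent d H r k X V fm t"
    and small: "km * (2 * G) \<le> 1 / 4"
    and a: "0 < a"
    and gap: "\<And>V x. \<bar>V - Vinf\<bar> \<le> G / 2 \<Longrightarrow> \<bar>x - Vinf\<bar> \<le> G / 2 \<Longrightarrow>
       J (-1) V x + km * (2 * G) * (2 * (cJ + aM)) + a \<le> a0 x"
begin

definition D where
  "D \<sigma> t = (LINT q|(P \<Otimes>\<^sub>M U). side \<sigma> t q * (impulse k (fst (snd q) - V t) *
     (fm t (X t + \<sigma> * H, fst q) (snd q) - f0 (snd q))))"

lemma f0_part: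
  assumes "\<sigma> \<in> {1, -1}"
  shows "integrable U (\<lambda>u. of_bool (\<sigma> * (fst u - w) \<le> 0) * (impulse k (fst u - w) * f0 u))"
proof (rule Bochner_Integration.integrable_bound[OF impulse_int[of w]])
  show "AE u in U. norm (of_bool (\<sigma> * (fst u - w) \<le> 0) * (impulse k (fst u - w) * f0 u)) \<le> norm (impulse k (fst u - w) * f0 u)"
    by (rule AE_I2) (auto simp: abs_mult)
qed measurable

lemma parts:
  assumes t: "0 \<le> t" and \<sigma>: "\<sigma> \<in> {1, -1}"
  shows "has_bochner_integral (P \<Otimes>\<^sub>M U) (\<lambda>q. side \<sigma> t q * (impulse k (fst (snd q) - V t) *
     (fm t (X t + \<sigma> * H, fst q) (snd q) - f0 (snd q)))) (D \<sigma> t)"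
    and "(LINT y:disk d r|P. LINT u|U. of_bool (\<sigma> * (fst u - V t) \<le> 0) * (impulse k (fst u - V t) * fm t (X t + \<sigma> * H, y) u))
      = D \<sigma> t + mu * (LINT u|U. of_bool (\<sigma> * (fst u - V t) \<le> 0) * (impulse k (fst u - V t) * f0 u))"
proof -
  define i0 where "i0 = (LINT u|U. of_bool (\<sigma> * (fst u - V t) \<le> 0) * (impulse k (fst u - V t) * f0 u))"
  let ?F = "\<lambda>q. side \<sigma> t q * (impulse k (fst (snd q) - V t) * fm t (X t + \<sigma> * H, fst q) (snd q))"
  let ?f = "\<lambda>q. side \<sigma> t q * (impulse k (fst (snd q) - V t) * f0 (snd q))"
  have "integrable (P \<Otimes>\<^sub>M U) (\<lambda>q. indicat_real {(y, u). y \<in> disk d r \<and> incoming V \<sigma> t u} q *\<^sub>R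
     (case q of (y, u) \<Rightarrow> impulse k (fst u - V t) * fm t (X t + \<sigma> * H, y) u))"
    using conv[OF t] \<sigma> unfolding force_convergent_def set_integrable_def by blast
  moreover have "(\<lambda>q. indicat_real {(y, u). y \<in> disk d r \<and> incoming V \<sigma> t u} q *\<^sub>R
     (case q of (y, u) \<Rightarrow> impulse k (fst u - V t) * fm t (X t + \<sigma> * H, y) u)) = ?F"
    by (auto simp: fun_eq_iff side_def incoming_def indicator_def)
  ultimately have F: "integrable (P \<Otimes>\<^sub>M U) ?F" by simp
  have "has_bochner_integral (P \<Otimes>\<^sub>M U) (\<lambda>q. indicat_real (disk d r) (fst q) *
      (of_bool (\<sigma> * (fst (snd q) - V t) \<le> 0) * (impulse k (fst (snd q) - V t) * f0 (snd q)))) (mu * i0)"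
    unfolding i0_def by (intro PU_int disk_int has_bochner_integral_integrable f0_part \<sigma>)
  moreover have "(\<lambda>q. indicat_real (disk d r) (fst q) *
      (of_bool (\<sigma> * (fst (snd q) - V t) \<le> 0) * (impulse k (fst (snd q) - V t) * f0 (snd q)))) = ?f"
    by (auto simp: fun_eq_iff side_def indicator_def)
  ultimately have f: "has_bochner_integral (P \<Otimes>\<^sub>M U) ?f (mu * i0)" by simp
  have diff: "has_bochner_integral (P \<Otimes>\<^sub>M U) (\<lambda>q. side \<sigma> t q * (impulse k (fst (snd q) - V t) *
     (fm t (X t + \<sigma> * H, fst q) (snd q) - f0 (snd q)))) (integral\<^sup>L (P \<Otimes>\<^sub>M U) ?F - mu * i0)"
    using has_bochner_integral_diff[OF has_bochner_integral_integrable[OF F] f] by (simp add: algebra_simps)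
  then have De: "D \<sigma> t = integral\<^sup>L (P \<Otimes>\<^sub>M U) ?F - mu * i0"
    unfolding D_def by (rule has_bochner_integral_integral_eq)
  show "has_bochner_integral (P \<Otimes>\<^sub>M U) (\<lambda>q. side \<sigma> t q * (impulse k (fst (snd q) - V t) *
     (fm t (X t + \<sigma> * H, fst q) (snd q) - f0 (snd q)))) (D \<sigma> t)"
    using diff De by simp
  have "(LINT y:disk d r|P. LINT u|U. of_bool (\<sigma> * (fst u - V t) \<le> 0) * (impulse k (fst u - V t) * fm t (X t + \<sigma> * H, y) u))
     = (LINT y|P. LINT u|U. ?F (y, u))"
    unfolding set_lebesgue_integral_def
  proof (rule Bochner_Integration.integral_cong[OF refl])
    fix y
    show "indicat_real (disk d r) y *\<^sub>R (LINT u|U. of_bool (\<sigma> * (fst u - V t) \<le> 0) * (impulse k (fst u - V t) * fm t (X t + \<sigma> * H, y) u)) =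
      (LINT u|U. ?F (y, u))"
      by (cases "y \<in> disk d r") (simp_all add: side_def)
  qed
  also have "\<dots> = integral\<^sup>L (P \<Otimes>\<^sub>M U) ?F"
    using perp_vec.integral_fst'[OF F] by simp
  finally show "(LINT y:disk d r|P. LINT u|U. of_bool (\<sigma> * (fst u - V t) \<le> 0) * (impulse k (fst u - V t) * fm t (X t + \<sigma> * H, y) u))
      = D \<sigma> t + mu * (LINT u|U. of_bool (\<sigma> * (fst u - V t) \<le> 0) * (impulse k (fst u - V t) * f0 u))"
    using De i0_def by simp
qed

lemma force_split:
  assumes "0 \<le> t"
  shows "force d H r k X V fm t - F0 d r k f0 (V t) = D 1 t - D (-1) t"
proof -
  have r: "(LINT u:{u. fst u \<le> V t}|U. h u) = (LINT u|U. of_bool (1 * (fst u - V t) \<le> 0) * h u)" for h :: "vec \<Rightarrow> real"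
    unfolding set_lebesgue_integral_def by (intro Bochner_Integration.integral_cong) (auto simp: indicator_def)
  have l: "(LINT u:{u. fst u \<ge> V t}|U. h u) = (LINT u|U. of_bool (-1 * (fst u - V t) \<le> 0) * h u)" for h :: "vec \<Rightarrow> real"
    unfolding set_lebesgue_integral_def by (intro Bochner_Integration.integral_cong) (auto simp: indicator_def)
  have e: "X t + 1 * H = X t + H" "X t + -1 * H = X t - H" by simp_all
  show ?thesis
    unfolding force_def F0_def r l mu_def[symmetric]
    using parts(2)[OF assms, of 1] parts(2)[OF assms, of "-1"] unfolding e by (simp add: algebra_simps)
qed

text \<open>At the left end \<open>f0 - fm\<close> is at least \<open>a\<close> times
  \<open>b\<close> after a precollision and 0 otherwise, so \<open>- D (-1) t\<close> is nonnegative
  and bounded below; it serves as \<open>RL\<close>, and \<open>D 1 t\<close> as \<open>RR\<close>.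
  The error \<open>A\<close> is at most \<open>cJ + aM\<close>, which keeps \<open>C3\<close>
  independent of \<open>G\<close>.\<close>

lemma force_rbound:
  "AE t in lborel. 0 < t \<and> t < T \<longrightarrow>
     rbound (c3 a) C3 p d X V t (force d H r k X V fm t - F0 d r k f0 (V t))"
proof -
  define A where "A = km * (2 * G) * (2 * (cJ + aM))"
  define S where "S = A + cJ + aM"
  have A: "0 \<le> A" "A \<le> cJ + aM"
  proof -
    have "0 \<le> cJ + aM" using cJ_nonneg aM by simp
    then show "0 \<le> A" using km_nonneg G by (simp add: A_def)
    have "A \<le> 1 / 4 * (2 * (cJ + aM))" unfolding A_def using small \<open>0 \<le> cJ + aM\<close> by (intro mult_right_mono) auto
    also have "\<dots> \<le> cJ + aM" using \<open>0 \<le> cJ + aM\<close> by (simp add: field_simps)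
    finally show "A \<le> cJ + aM" .
  qed
  have S: "0 \<le> S" "S \<le> 2 * (cJ + aM)" using A cJ_nonneg aM by (auto simp: S_def)
  have sol: "end_solution d r k f0 a0 b Vinf p gs km bM aM cl Cl \<delta>b bl M X V G T H K fm fp \<sigma>" if "\<sigma> \<in> {1, -1}" for \<sigma>
    by (intro end_solution.intro end_solution_axioms.intro motion_axioms that K_eq laws Linfs)
  define C where "C \<sigma> t \<longleftrightarrow> (AE q in P \<Otimes>\<^sub>M U. fst q \<in> disk d r \<and> \<sigma> * (fst (snd q) - V t) < 0 \<longrightarrow>
        (if hit d r \<sigma> X t (fst q) (snd q)
         then \<bar>fm t (X t + \<sigma> * H, fst q) (snd q) - b (snd (snd q)) * J \<sigma> (V (ptau \<sigma> X t (fst (snd q)))) (fst (snd q))\<bar>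
           \<le> A * b (snd (snd q))
         else fm t (X t + \<sigma> * H, fst q) (snd q) = f0 (snd q)))" for \<sigma> t
  have c: "AE t in lborel. 0 < t \<and> t < T \<longrightarrow> C \<sigma> t" if "\<sigma> \<in> {1, -1}" for \<sigma>
    using end_solution.good_final(2)[OF sol[OF that] small]
    unfolding end_solution.close_def[OF sol[OF that]] A_def C_def .
  have upper: "\<bar>x - f0 u\<bar> \<le> S * b (snd u)"
    if \<sigma>: "\<sigma> \<in> {1, -1}" and inc: "\<sigma> * (fst u - V t) < 0" and hit: "hit d r \<sigma> X t y u" and t: "t < T" and u: "u \<in> space U"
      and x: "\<bar>x - b (snd u) * J \<sigma> (V (ptau \<sigma> X t (fst u))) (fst u)\<bar> \<le> A * b (snd u)" for \<sigma> t y u x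
  proof -
    note rng = hit_range[OF \<sigma> inc hit_mean(1)[OF \<sigma> inc hit] t]
    have b0: "0 \<le> b (snd u)" using u by (auto simp: space_vec_measure intro!: b_nonneg)
    let ?J = "J \<sigma> (V (ptau \<sigma> X t (fst u))) (fst u)"
    have "0 \<le> ?J" "?J \<le> cJ" using rng G by (auto intro!: J_nonneg J_le)
    then have "0 \<le> b (snd u) * ?J" "b (snd u) * ?J \<le> b (snd u) * cJ" using b0 by (auto intro: mult_left_mono)
    moreover have "0 \<le> f0 u" "f0 u \<le> b (snd u) * aM"
      using b0 a0_nonneg[of "fst u"] mult_right_mono[OF a0_le[of "fst u"] b0] by (auto simp: f0_eq mult.commute)
    ultimately have "\<bar>x - f0 u\<bar> \<le> A * b (snd u) + b (snd u) * cJ + b (snd u) * aM"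
      using x by linarith
    then show ?thesis by (simp add: S_def algebra_simps)
  qed
  have lower: "a * b (snd u) \<le> f0 u - x"
    if inc: "-1 * (fst u - V t) < 0" and hit: "hit d r (-1) X t y u" and t: "t < T" and u: "u \<in> space U"
      and x: "\<bar>x - b (snd u) * J (-1) (V (ptau (-1) X t (fst u))) (fst u)\<bar> \<le> A * b (snd u)" for t y u x
  proof -
    have s: "-1 \<in> {1, -1 :: real}" by simp
    note rng = hit_range[OF s inc hit_mean(1)[OF s inc hit] t]
    have b0: "0 \<le> b (snd u)" using u by (auto simp: space_vec_measure intro!: b_nonneg)
    have "(J (-1) (V (ptau (-1) X t (fst u))) (fst u) + A + a) * b (snd u) \<le> a0 (fst u) * b (snd u)"
      unfolding A_def by (intro mult_right_mono gap rng b0)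
    then show ?thesis using x by (simp add: f0_eq algebra_simps abs_le_iff)
  qed
  have s: "1 \<in> {1, -1 :: real}" "-1 \<in> {1, -1 :: real}" by simp_all
  have sp: "AE q in P \<Otimes>\<^sub>M U. q \<in> space (P \<Otimes>\<^sub>M U)" by (rule AE_space)
  show ?thesis
    using eventually_conj[OF c[OF s(1)] c[OF s(2)]]
  proof (rule eventually_mono, intro impI)
    fix t assume "(0 < t \<and> t < T \<longrightarrow> C 1 t) \<and> (0 < t \<and> t < T \<longrightarrow> C (- 1) t)" and t: "0 < t \<and> t < T"
    then have C1: "C 1 t" and Cm: "C (- 1) t" by auto
    have up: "AE q in P \<Otimes>\<^sub>M U. fst q \<in> disk d r \<and> \<sigma> * (fst (snd q) - V t) < 0 \<longrightarrow>
      (if hit d r \<sigma> X t (fst q) (snd q) then \<bar>fm t (X t + \<sigma> * H, fst q) (snd q) - f0 (snd q)\<bar> \<le> S * b (snd (snd q))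
       else fm t (X t + \<sigma> * H, fst q) (snd q) - f0 (snd q) = 0)" if \<sigma>: "\<sigma> \<in> {1, -1}" and "C \<sigma> t" for \<sigma>
      using that(2)[unfolded C_def] sp
    proof (rule eventually_elim2, intro impI)
      fix q assume *: "fst q \<in> disk d r \<and> \<sigma> * (fst (snd q) - V t) < 0 \<longrightarrow>
        (if hit d r \<sigma> X t (fst q) (snd q)
         then \<bar>fm t (X t + \<sigma> * H, fst q) (snd q) - b (snd (snd q)) * J \<sigma> (V (ptau \<sigma> X t (fst (snd q)))) (fst (snd q))\<bar>
           \<le> A * b (snd (snd q))
         else fm t (X t + \<sigma> * H, fst q) (snd q) = f0 (snd q))" "q \<in> space (P \<Otimes>\<^sub>M U)"
        "fst q \<in> disk d r \<and> \<sigma> * (fst (snd q) - V t) < 0"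
      have "snd q \<in> space U" using *(2) by (auto simp: space_pair_measure)
      then show "if hit d r \<sigma> X t (fst q) (snd q) then \<bar>fm t (X t + \<sigma> * H, fst q) (snd q) - f0 (snd q)\<bar> \<le> S * b (snd (snd q))
       else fm t (X t + \<sigma> * H, fst q) (snd q) - f0 (snd q) = 0"
        using * t upper[OF \<sigma>, of "snd q" t "fst q"] by (cases "hit d r \<sigma> X t (fst q) (snd q)") auto
    qed
    have low: "AE q in P \<Otimes>\<^sub>M U. fst q \<in> disk d r \<and> -1 * (fst (snd q) - V t) < 0 \<longrightarrow>
      (if hit d r (-1) X t (fst q) (snd q) then a * b (snd (snd q)) \<le> f0 (snd q) - fm t (X t + -1 * H, fst q) (snd q)
       else f0 (snd q) - fm t (X t + -1 * H, fst q) (snd q) = 0)"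
      using Cm[unfolded C_def] sp
    proof (rule eventually_elim2, intro impI)
      fix q assume *: "fst q \<in> disk d r \<and> -1 * (fst (snd q) - V t) < 0 \<longrightarrow>
        (if hit d r (-1) X t (fst q) (snd q)
         then \<bar>fm t (X t + -1 * H, fst q) (snd q) - b (snd (snd q)) * J (-1) (V (ptau (-1) X t (fst (snd q)))) (fst (snd q))\<bar>
           \<le> A * b (snd (snd q))
         else fm t (X t + -1 * H, fst q) (snd q) = f0 (snd q))" "q \<in> space (P \<Otimes>\<^sub>M U)"
        "fst q \<in> disk d r \<and> -1 * (fst (snd q) - V t) < 0"
      have "snd q \<in> space U" using *(2) by (auto simp: space_pair_measure)
      then show "if hit d r (-1) X t (fst q) (snd q) then a * b (snd (snd q)) \<le> f0 (snd q) - fm t (X t + -1 * H, fst q) (snd q)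
       else f0 (snd q) - fm t (X t + -1 * H, fst q) (snd q) = 0"
        using * t lower[of "snd q" t "fst q"] by (cases "hit d r (-1) X t (fst q) (snd q)") auto
    qed
    have t0: "0 \<le> t" using t by simp
    have neg: "has_bochner_integral (P \<Otimes>\<^sub>M U) (\<lambda>q. side (-1) t q * (impulse k (fst (snd q) - V t) *
        (f0 (snd q) - fm t (X t + -1 * H, fst q) (snd q)))) (- D (-1) t)"
      using has_bochner_integral_minus[OF parts(1)[OF t0 s(2)]] by (simp add: algebra_simps)
    show "rbound (c3 a) C3 p d X V t (force d H r k X V fm t - F0 d r k f0 (V t))"
      unfolding rbound_def
    proof (intro exI conjI allI impI)
      show "force d H r k X V fm t - F0 d r k f0 (V t) = - D (-1) t + D 1 t"
        using force_split[OF t0] by simp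
      show "0 \<le> - D (-1) t"
      proof -
        have "AE q in P \<Otimes>\<^sub>M U. 0 \<le> side (-1) t q * (impulse k (fst (snd q) - V t) * (f0 (snd q) - fm t (X t + -1 * H, fst q) (snd q)))"
          using low sp AE_pv_fst[OF AE_lborel_singleton[of "V t"]]
        proof (eventually_elim)
          fix q assume *: "fst q \<in> disk d r \<and> -1 * (fst (snd q) - V t) < 0 \<longrightarrow>
              (if hit d r (-1) X t (fst q) (snd q) then a * b (snd (snd q)) \<le> f0 (snd q) - fm t (X t + -1 * H, fst q) (snd q)
               else f0 (snd q) - fm t (X t + -1 * H, fst q) (snd q) = 0)" "q \<in> space (P \<Otimes>\<^sub>M U)" "fst (snd q) \<noteq> V t"
          have "0 \<le> a * b (snd (snd q))"
            using *(2) a by (auto simp: space_pair_measure space_vec_measure intro!: b_nonneg mult_nonneg_nonneg)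
          then have "fst q \<in> disk d r \<and> V t \<le> fst (snd q) \<longrightarrow> 0 \<le> f0 (snd q) - fm t (X t + -1 * H, fst q) (snd q)"
            using *(1,3) by (auto split: if_splits)
          then show "0 \<le> side (-1) t q * (impulse k (fst (snd q) - V t) * (f0 (snd q) - fm t (X t + -1 * H, fst q) (snd q)))"
            using impulse_nonneg by (auto simp: side_def)
        qed
        then show ?thesis by (rule has_bochner_integral_le[OF has_bochner_integral_zero neg])
      qed
      fix w assume "0 \<le> w \<and> w \<le> mean X 0 t - V t"
      then show "c3 a * w powr (p + 1) * (1 + t) powr (1 - real d) \<le> - D (-1) t"
        using lower_functional[OF _ _ a neg low] t by blast
    next
      fix m1 m2 assume "mean_above X V t m1 m2"
      then show "- D (-1) t \<le> C3 * (m1 powr (p + 1) * (1 + t) powr (1 - real d) + m2 powr (p + 1))"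
        using upper_functional[OF _ _ s(2) S parts(1)[OF t0 s(2)] up[OF s(2) Cm], of m1 m2] t
        by (auto simp: mean_above_def)
    next
      fix m1 m2 assume "mean_below X V t m1 m2"
      then show "\<bar>D 1 t\<bar> \<le> C3 * (m1 powr (p + 1) * (1 + t) powr (1 - real d) + m2 powr (p + 1))"
        using upper_functional[OF _ _ s(1) S parts(1)[OF t0 s(1)] up[OF s(1) C1], of m1 m2] t
        by (auto simp: mean_below_def)
    qed
  qed
qed

end

section \<open>Boundary densities determined by a motion\<close>

text \<open>A nonintegrable \<open>f\<close> has integral 0 by convention, and then the claim is
  \<open>0 \<le> y\<close>.\<close>

lemma LINT_abs_le:
  fixes f g :: "'a \<Rightarrow> real"
  assumes g: "has_bochner_integral M g y" and le: "AE z in M. \<bar>f z\<bar> \<le> g z"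
  shows "\<bar>LINT z|M. f z\<bar> \<le> y"
proof (cases "integrable M f")
  case True
  then show ?thesis using has_bochner_integral_abs_le[OF has_bochner_integral_integrable g le] by blast
next
  case False
  have "0 \<le> y"
    by (rule has_bochner_integral_le[OF has_bochner_integral_zero g]) (use le in \<open>auto elim: eventually_mono\<close>)
  then show ?thesis using False by (simp add: not_integrable_integral_eq)
qed

text \<open>Compactness: contact times above \<open>c\<close> accumulate along a subsequence at some
  \<open>l\<close> in \<open>[c, t]\<close>. If \<open>l < t\<close>, the crossing inequality passes
  to the limit and contradicts the hypothesis on \<open>c\<close>; if \<open>l = t\<close>, the mean
  value theorem gives velocities above \<open>z\<close> at times tending to \<open>t\<close>,
  contradicting \<open>V t < z\<close>.\<close>

lemma tau_eventually_le:
  assumes Xn: "\<And>n. trajectory (Xn n) (Vn n)" and X: "trajectory X V"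
    and cX: "\<And>sn s. sn \<longlonglongrightarrow> s \<Longrightarrow> (\<And>n. 0 \<le> sn n) \<Longrightarrow> (\<lambda>n. Xn n (sn n)) \<longlonglongrightarrow> X s"
    and cV: "\<And>sn s. sn \<longlonglongrightarrow> s \<Longrightarrow> (\<And>n. 0 \<le> sn n) \<Longrightarrow> (\<lambda>n. Vn n (sn n)) \<longlonglongrightarrow> V s"
    and t: "tn \<longlonglongrightarrow> t" "\<And>n. 0 \<le> tn n" and z: "V t < z"
    and c: "0 \<le> c" "\<And>s. c \<le> s \<Longrightarrow> s < t \<Longrightarrow> X t - X s < (t - s) * z"
  shows "eventually (\<lambda>n. tau (Xn n) (tn n) z \<le> c) sequentially"
proof (rule ccontr)
  assume "\<not> eventually (\<lambda>n. tau (Xn n) (tn n) z \<le> c) sequentially"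
  from not_eventually_sequentiallyD[OF this]
  obtain f :: "nat \<Rightarrow> nat" where f0: "strict_mono f" "\<forall>n. \<not> tau (Xn (f n)) (tn (f n)) z \<le> c" by blast
  then have f: "strict_mono f" "\<And>n. \<not> tau (Xn (f n)) (tn (f n)) z \<le> c" by auto
  then have "\<forall>n. \<exists>s>c. s < tn (f n) \<and> (tn (f n) - s) * z < Xn (f n) (tn (f n)) - Xn (f n) s"
    using less_tau_iff[OF c(1)] by (simp add: not_le)
  then obtain s where s: "\<And>n. c < s n" "\<And>n. s n < tn (f n)"
    "\<And>n. (tn (f n) - s n) * z < Xn (f n) (tn (f n)) - Xn (f n) (s n)" by metis
  have "\<forall>n. \<exists>x>s n. x < tn (f n) \<and> z < Vn (f n) x"
  proof
    fix n
    have "0 \<le> s n" using s(1)[of n] c by simp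
    from trajectory.mean_value[OF Xn this s(2)] obtain x where "s n < x" "x < tn (f n)"
      "Xn (f n) (tn (f n)) - Xn (f n) (s n) = (tn (f n) - s n) * Vn (f n) x" .
    with s(2,3)[of n] show "\<exists>x>s n. x < tn (f n) \<and> z < Vn (f n) x"
      by (auto simp: mult_less_cancel_left_pos intro!: exI[of _ x])
  qed
  then obtain x where x: "\<And>n. s n < x n" "\<And>n. x n < tn (f n)" "\<And>n. z < Vn (f n) (x n)" by metis
  obtain B where B: "\<And>n. \<bar>tn n\<bar> \<le> B" using convergent_imp_Bseq[OF convergentI[OF t(1)]] unfolding Bseq_def by auto
  have "s n \<in> {0..B}" for n using s(1,2)[of n] c B[of "f n"] by auto
  then obtain l g where l: "l \<in> {0..B}" "strict_mono g" "(s \<circ> g) \<longlonglongrightarrow> l"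
    using compact_Icc[of 0 B] unfolding compact_def by metis
  define h where "h = f \<circ> g"
  have h: "strict_mono h" unfolding h_def using f(1) l(2) by (rule strict_mono_o)
  have tl: "(\<lambda>n. tn (h n)) \<longlonglongrightarrow> t" using LIMSEQ_subseq_LIMSEQ[OF t(1) h] by (simp add: comp_def)
  have sl: "(\<lambda>n. s (g n)) \<longlonglongrightarrow> l" using l(3) by (simp add: comp_def)
  \<comment> \<open>The convergence hypotheses concern full sequences; off the range of the
    subsequence \<open>h\<close> the arguments are filled up with their limit.\<close>
  have conv: "(\<lambda>n. Y (h n) (w n)) \<longlonglongrightarrow> y"
    if cc: "\<And>sn s. sn \<longlonglongrightarrow> s \<Longrightarrow> (\<And>n. 0 \<le> sn n) \<Longrightarrow> (\<lambda>n. Y n (sn n)) \<longlonglongrightarrow> Z s"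
      and w: "w \<longlonglongrightarrow> m" "\<And>n. 0 \<le> w n" "0 \<le> m" and y: "y = Z m" for Y :: "nat \<Rightarrow> real \<Rightarrow> real" and Z w m y
  proof -
    define sn where "sn n = (if n \<in> range h then w (inv h n) else m)" for n
    have inj: "inj h" using h by (rule strict_mono_imp_inj_on)
    have snh: "sn (h n) = w n" for n by (simp add: sn_def inj)
    have "sn \<longlonglongrightarrow> m"
    proof (rule LIMSEQ_I)
      fix e :: real assume "0 < e"
      then obtain N where N: "\<And>n. n \<ge> N \<Longrightarrow> norm (w n - m) < e" using LIMSEQ_D[OF w(1)] by blast
      show "\<exists>no. \<forall>n\<ge>no. norm (sn n - m) < e"
      proof (intro exI[of _ "h N"] allI impI)
        fix n assume n: "h N \<le> n"
        show "norm (sn n - m) < e"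
        proof (cases "n \<in> range h")
          case True
          then obtain j where j: "n = h j" by blast
          then have "N \<le> j" using n h by (simp add: strict_mono_less_eq)
          then show ?thesis using N[of j] snh[of j] j by simp
        qed (simp add: sn_def \<open>0 < e\<close>)
      qed
    qed
    moreover have "0 \<le> sn n" for n using w by (simp add: sn_def)
    ultimately have "(\<lambda>n. Y n (sn n)) \<longlonglongrightarrow> Z m" by (rule cc)
    from LIMSEQ_subseq_LIMSEQ[OF this h] show ?thesis by (simp add: comp_def snh y)
  qed
  have t0: "0 \<le> t" by (rule LIMSEQ_le_const[OF t(1)]) (use t(2) in auto)
  have "c \<le> l" by (rule LIMSEQ_le_const[OF sl]) (use s(1) in \<open>auto intro: less_imp_le\<close>)
  have "l \<le> t"
    by (rule LIMSEQ_le[OF sl tl]) (use s(2) in \<open>auto simp: h_def intro: less_imp_le\<close>)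
  show False
  proof (cases "l = t")
    case True
    have xl: "(\<lambda>n. x (g n)) \<longlonglongrightarrow> t"
      by (rule tendsto_sandwich[OF _ _ sl[unfolded True] tl]) (use x in \<open>auto simp: h_def intro!: always_eventually less_imp_le\<close>)
    have "(\<lambda>n. Vn (h n) (x (g n))) \<longlonglongrightarrow> V t"
    proof (rule conv[OF cV xl])
      show "0 \<le> x (g n)" for n using s(1)[of "g n"] x(1)[of "g n"] c by linarith
    qed (use t0 in auto)
    then have "z \<le> V t"
      by (rule LIMSEQ_le_const) (use x(3) in \<open>auto simp: h_def intro: less_imp_le\<close>)
    then show False using z by simp
  next
    case False
    then have lt: "l < t" using \<open>l \<le> t\<close> by simp
    have 1: "(\<lambda>n. Xn (h n) (tn (h n))) \<longlonglongrightarrow> X t"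
      by (rule conv[OF cX tl]) (use t t0 in auto)
    have 2: "(\<lambda>n. Xn (h n) (s (g n))) \<longlonglongrightarrow> X l"
    proof (rule conv[OF cX sl])
      show "0 \<le> s (g n)" for n using s(1)[of "g n"] c by linarith
    qed (use l in auto)
    have "(t - l) * z \<le> X t - X l"
      by (rule LIMSEQ_le[OF tendsto_mult[OF tendsto_diff[OF tl sl] tendsto_const] tendsto_diff[OF 1 2]])
        (use s(3) in \<open>auto simp: h_def intro: less_imp_le\<close>)
    then show False using c(2)[OF \<open>c \<le> l\<close> lt] by simp
  qed
qed

text \<open>One strict crossing of the limiting motion after time \<open>a\<close> persists for the
  approximating motions.\<close>

lemma tau_eventually_ge:
  assumes cX: "\<And>sn s. sn \<longlonglongrightarrow> s \<Longrightarrow> (\<And>n. 0 \<le> sn n) \<Longrightarrow> (\<lambda>n. Xn n (sn n)) \<longlonglongrightarrow> X s"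
    and t: "tn \<longlonglongrightarrow> t" "\<And>n. 0 \<le> tn n" and a: "0 \<le> a" "a < tau X t z"
  shows "eventually (\<lambda>n. a < tau (Xn n) (tn n) z) sequentially"
proof -
  obtain s where s: "a < s" "s < t" "(t - s) * z < X t - X s" using a by (auto simp: less_tau_iff)
  have "(\<lambda>n. (tn n - s) * z) \<longlonglongrightarrow> (t - s) * z" by (intro tendsto_intros t)
  moreover have "(\<lambda>n. Xn n (tn n)) \<longlonglongrightarrow> X t" by (rule cX[OF t])
  moreover have "(\<lambda>n. Xn n s) \<longlonglongrightarrow> X s"
    by (rule cX[where sn = "\<lambda>_. s"]) (use s a in auto)
  ultimately have "(\<lambda>n. Xn n (tn n) - Xn n s - (tn n - s) * z) \<longlonglongrightarrow> X t - X s - (t - s) * z"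
    by (intro tendsto_diff)
  then have "eventually (\<lambda>n. 0 < Xn n (tn n) - Xn n s - (tn n - s) * z) sequentially"
    using s by (intro order_tendstoD(1)) auto
  moreover have "eventually (\<lambda>n. s < tn n) sequentially" using t(1) s by (intro order_tendstoD(1))
  ultimately show ?thesis
    by eventually_elim (use s a in \<open>auto simp: less_tau_iff\<close>)
qed

text \<open>Excluded are irregular \<open>z\<close>, where a limiting contact may be tangential, and
  paths that meet the end exactly at time 0, where approximating motions may have a small positive
  contact time. The case of value 0 is stated as eventual equality because \<open>hit\<close> jumps
  there.\<close>

lemma tau_tendsto:
  assumes Xn: "\<And>n. trajectory (Xn n) (Vn n)" and X: "trajectory X V"
    and cX: "\<And>sn s. sn \<longlonglongrightarrow> s \<Longrightarrow> (\<And>n. 0 \<le> sn n) \<Longrightarrow> (\<lambda>n. Xn n (sn n)) \<longlonglongrightarrow> X s"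
    and cV: "\<And>sn s. sn \<longlonglongrightarrow> s \<Longrightarrow> (\<And>n. 0 \<le> sn n) \<Longrightarrow> (\<lambda>n. Vn n (sn n)) \<longlonglongrightarrow> V s"
    and t: "tn \<longlonglongrightarrow> t" "\<And>n. 0 \<le> tn n" and z: "V t < z" "isCont (tau X t) z" "X t - X 0 \<noteq> t * z \<or> t = 0"
  shows "tau X t z = 0 \<Longrightarrow> eventually (\<lambda>n. tau (Xn n) (tn n) z = 0) sequentially"
    and "0 < tau X t z \<Longrightarrow> (\<lambda>n. tau (Xn n) (tn n) z) \<longlonglongrightarrow> tau X t z"
proof -
  interpret trajectory X V by (rule X)
  have below: "X t - X s < (t - s) * z" if "tau X t z < s" "s < t" for s
  proof -
    have s0: "0 < s" using that tau_nonneg[of X t z] by simp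
    have "\<not> (t - s) * z < X t - X s" using tau_ge[OF s0 that(2)] that(1) by force
    moreover have "X t - X s \<noteq> (t - s) * z" using root_le_tau[OF z(2) s0 that(2)] that(1) by force
    ultimately show ?thesis by simp
  qed
  show "eventually (\<lambda>n. tau (Xn n) (tn n) z = 0) sequentially" if 0: "tau X t z = 0"
  proof -
    have "eventually (\<lambda>n. tau (Xn n) (tn n) z \<le> 0) sequentially"
    proof (rule tau_eventually_le[OF Xn X cX cV t z(1) order_refl])
      fix s :: real assume s: "0 \<le> s" "s < t"
      show "X t - X s < (t - s) * z"
      proof (cases "s = 0")
        case True
        have "\<not> t * z < X t - X 0"
        proof
          assume pos: "t * z < X t - X 0"
          have c: "continuous_on {0..} (\<lambda>s. X t - X s - (t - s) * z)"
            by (intro continuous_intros contX)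
          have "0 < X t - X 0 - (t - 0) * z" using pos by simp
          then obtain e where e: "e > 0" "\<And>s. s \<in> {0..} \<Longrightarrow> dist s 0 < e \<Longrightarrow>
              dist (X t - X s - (t - s) * z) (X t - X 0 - (t - 0) * z) < X t - X 0 - (t - 0) * z"
            using c unfolding continuous_on_iff by (metis atLeast_iff order_refl)
          define x where "x = min e t / 2"
          have x: "0 < x" "x < t" "x < e" using e(1) s True by (auto simp: x_def)
          have "dist (X t - X x - (t - x) * z) (X t - X 0 - (t - 0) * z) < X t - X 0 - (t - 0) * z"
            using e(2)[of x] x by (simp add: dist_real_def)
          then have "(t - x) * z < X t - X x" by (simp add: dist_real_def abs_less_iff)
          then have "x \<le> tau X t z" using x by (intro tau_ge) auto
          then show False using x 0 by simp
        qed
        then show ?thesis using z(3) s True by auto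
      qed (use below s 0 in simp)
    qed
    then show ?thesis by (rule eventually_mono) (use tau_nonneg in \<open>auto intro: order_antisym\<close>)
  qed
  assume pos: "0 < tau X t z"
  show "(\<lambda>n. tau (Xn n) (tn n) z) \<longlonglongrightarrow> tau X t z"
  proof (rule order_tendstoI)
    fix a assume "a < tau X t z"
    then have "max 0 a < tau X t z" using pos by simp
    then have "eventually (\<lambda>n. max 0 a < tau (Xn n) (tn n) z) sequentially"
      by (intro tau_eventually_ge[where X = X, OF cX t]) auto
    then show "eventually (\<lambda>n. a < tau (Xn n) (tn n) z) sequentially"
      by (rule eventually_mono) simp
  next
    fix a assume a: "tau X t z < a"
    define c where "c = (tau X t z + a) / 2"
    have c: "tau X t z < c" "c < a" using a by (auto simp: c_def)
    have "eventually (\<lambda>n. tau (Xn n) (tn n) z \<le> c) sequentially"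
      by (rule tau_eventually_le[OF Xn X cX cV t z(1)]) (use c pos below in auto)
    then show "eventually (\<lambda>n. tau (Xn n) (tn n) z < a) sequentially"
      by (rule eventually_mono) (use c in simp)
  qed
qed

locale small_motion = kinetic +
  fixes G L X0 :: real
  assumes G: "0 < G" "G < gs" and small: "km * (2 * G) \<le> 1 / 4" and L: "0 \<le> L"
begin

text \<open>Motions live on the whole line and share one Lipschitz constant: pointwise limits stay
  in this class, and convergence is then uniform on compact sets.\<close>

definition mot :: "(real \<Rightarrow> real) \<Rightarrow> bool" where
  "mot v \<longleftrightarrow> (\<forall>s t. \<bar>v s - v t\<bar> \<le> L * \<bar>s - t\<bar>) \<and> (\<forall>t. \<bar>v t - Vinf\<bar> \<le> G / 2)"

definition pos :: "(real \<Rightarrow> real) \<Rightarrow> real \<Rightarrow> real" where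
  "pos v t = X0 + integral {0..t} v"

lemma mot_lip: "mot v \<Longrightarrow> \<bar>v s - v t\<bar> \<le> L * \<bar>s - t\<bar>"
  and mot_range: "mot v \<Longrightarrow> \<bar>v t - Vinf\<bar> \<le> G / 2"
  by (simp_all add: mot_def)

lemma mot_cont: assumes "mot v" shows "continuous_on S v"
proof -
  have "L-lipschitz_on UNIV v"
    using mot_lip[OF assms] L by (auto simp: lipschitz_on_def dist_real_def)
  then show ?thesis using lipschitz_on_continuous_on continuous_on_subset by blast
qed

lemma mot_meas: "mot v \<Longrightarrow> v \<in> borel_measurable borel"
  by (rule borel_measurable_continuous_onI) (rule mot_cont)

lemma integral_deriv:
  assumes "continuous_on {0..} (f :: real \<Rightarrow> real)" "0 \<le> t"
  shows "((\<lambda>t. integral {0..t} f) has_real_derivative f t) (at t within {0..})"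
proof -
  have "((\<lambda>t. integral {0..t} f) has_real_derivative f t) (at t within {0..t + 1})"
    using assms by (intro integral_has_real_derivative continuous_on_subset[OF assms(1)]) auto
  moreover have "at t within {0..t + 1} = at t within {0..}"
    by (rule at_within_nhd[of t "{..<t + 1}"]) (use assms in auto)
  ultimately show ?thesis by simp
qed

lemma mot_trajectory: assumes "mot v" shows "trajectory (pos v) v"
proof
  show "(pos v has_real_derivative v t) (at t within {0..})" if "0 \<le> t" for t
    unfolding pos_def[abs_def]
    using DERIV_add[OF DERIV_const integral_deriv[OF mot_cont[OF assms] that]] by simp
qed (rule mot_cont[OF assms])

lemma mot_motion: "mot v \<Longrightarrow> motion d r k f0 a0 b Vinf p gs km bM aM cl Cl \<delta>b bl M (pos v) v G T"
  by (intro motion.intro kinetic_axioms mot_trajectory motion_axioms.intro G mot_range)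

lemma mot_tendsto:
  assumes m: "\<And>n. mot (vn n)" and lim: "\<And>t. (\<lambda>n. vn n t) \<longlonglongrightarrow> v t" and s: "sn \<longlonglongrightarrow> s"
  shows "(\<lambda>n. vn n (sn n)) \<longlonglongrightarrow> v s"
proof -
  have "(\<lambda>n. vn n (sn n) - vn n s) \<longlonglongrightarrow> 0"
  proof (rule Lim_null_comparison)
    show "eventually (\<lambda>n. norm (vn n (sn n) - vn n s) \<le> L * \<bar>sn n - s\<bar>) sequentially"
      using mot_lip[OF m] by auto
    have "(\<lambda>n. L * \<bar>sn n - s\<bar>) \<longlonglongrightarrow> L * \<bar>s - s\<bar>" by (intro tendsto_intros s)
    then show "(\<lambda>n. L * \<bar>sn n - s\<bar>) \<longlonglongrightarrow> 0" by simp
  qed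
  from tendsto_add[OF this lim[of s]] show ?thesis by simp
qed

lemma integral_lip:
  fixes f :: "real \<Rightarrow> real"
  assumes f: "continuous_on {0..} f" and B: "\<And>t. 0 \<le> t \<Longrightarrow> \<bar>f t\<bar> \<le> B" and ab: "0 \<le> a" "0 \<le> c"
  shows "\<bar>integral {0..a} f - integral {0..c} f\<bar> \<le> B * \<bar>a - c\<bar>"
proof -
  have *: "\<bar>integral {0..a} f - integral {0..c} f\<bar> \<le> B * \<bar>a - c\<bar>" if "0 \<le> c" "c \<le> a" for a c
  proof -
    have i: "f integrable_on {0..a}"
      by (rule integrable_continuous_interval) (rule continuous_on_subset[OF f], auto)
    have "integral {0..c} f + integral {c..a} f = integral {0..a} f"
      using that i by (intro Henstock_Kurzweil_Integration.integral_combine) auto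
    then have "integral {0..a} f - integral {0..c} f = integral {c..a} f" by simp
    moreover have "norm (integral {c..a} f) \<le> B * (a - c)"
      using that B by (intro integral_bound continuous_on_subset[OF f]) auto
    ultimately show ?thesis using that by simp
  qed
  show ?thesis
  proof (cases "c \<le> a")
    case False
    then show ?thesis using *[of a c] ab by (simp add: abs_minus_commute)
  qed (use * ab in simp)
qed

lemma pos_tendsto:
  assumes m: "\<And>n. mot (vn n)" "mot v" and lim: "\<And>t. (\<lambda>n. vn n t) \<longlonglongrightarrow> v t"
    and s: "sn \<longlonglongrightarrow> s" "\<And>n. 0 \<le> sn n"
  shows "(\<lambda>n. pos (vn n) (sn n)) \<longlonglongrightarrow> pos v s"
proof -
  define B where "B = \<bar>Vinf\<bar> + G / 2"
  have B: "\<bar>w t\<bar> \<le> B" if "mot w" for w t using mot_range[OF that, of t] unfolding B_def by linarith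
  have s0: "0 \<le> s" by (rule LIMSEQ_le_const[OF s(1)]) (use s(2) in auto)
  have "(\<lambda>n. integral {0..s} (vn n)) \<longlonglongrightarrow> integral {0..s} v"
    by (rule dominated_convergence(2)[where h = "\<lambda>_. B"])
      (use B m lim in \<open>auto intro!: integrable_continuous_interval mot_cont[OF m(1)]\<close>)
  moreover have "(\<lambda>n. integral {0..sn n} (vn n) - integral {0..s} (vn n)) \<longlonglongrightarrow> 0"
  proof (rule Lim_null_comparison)
    show "eventually (\<lambda>n. norm (integral {0..sn n} (vn n) - integral {0..s} (vn n)) \<le> B * \<bar>sn n - s\<bar>) sequentially"
      using integral_lip[OF mot_cont[OF m(1)] B[OF m(1)] s(2) s0] by auto
    have "(\<lambda>n. B * \<bar>sn n - s\<bar>) \<longlonglongrightarrow> B * \<bar>s - s\<bar>" by (intro tendsto_intros s)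
    then show "(\<lambda>n. B * \<bar>sn n - s\<bar>) \<longlonglongrightarrow> 0" by simp
  qed
  ultimately have "(\<lambda>n. X0 + (integral {0..sn n} (vn n) - integral {0..s} (vn n) + integral {0..s} (vn n))) \<longlonglongrightarrow> X0 + (0 + integral {0..s} v)"
    by (intro tendsto_intros)
  then show ?thesis by (simp add: pos_def)
qed

text \<open>The difference \<open>fm - f0\<close> when the post-collision density is written as
  \<open>b\<close> times \<open>J + e\<close>. The unknown \<open>e\<close> does not depend on the
  transversal velocity, because the kernel produces the profile \<open>b\<close>.\<close>

definition pert :: "real \<Rightarrow> (real \<Rightarrow> real) \<Rightarrow> (real \<Rightarrow> perp \<Rightarrow> real \<Rightarrow> real) \<Rightarrow> real \<Rightarrow> perp \<Rightarrow> vec \<Rightarrow> real" where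
  "pert \<sigma> v e t y u = (if hit d r \<sigma> (pos v) t y u
     then b (snd u) * (J \<sigma> (v (ptau \<sigma> (pos v) t (fst u))) (fst u)
       + e (ptau \<sigma> (pos v) t (fst u)) (pback d y (t - ptau \<sigma> (pos v) t (fst u)) (snd u)) (fst u) - a0 (fst u))
     else 0)"

text \<open>One operator for two purposes: with \<open>q = k (x - v t)\<close> it is the reflection
  of the perturbation divided by \<open>b\<close>, with \<open>q = impulse k\<close> the force
  density of the perturbation at the point \<open>y\<close>.\<close>

definition Psi where
  "Psi \<sigma> v q e t y = (LINT u|U. of_bool (\<sigma> * (fst u - v t) \<le> 0) * (q (fst u - v t) * pert \<sigma> v e t y u))"

definition adm :: "real \<Rightarrow> (real \<Rightarrow> perp \<Rightarrow> real \<Rightarrow> real) \<Rightarrow> bool" where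
  "adm A e \<longleftrightarrow> (\<lambda>(t, y, x). e t y x) \<in> borel_measurable (lborel \<Otimes>\<^sub>M (P \<Otimes>\<^sub>M lborel)) \<and>
     (\<forall>t. \<forall>y\<in>space P. \<forall>x. \<bar>e t y x\<bar> \<le> A)"

text \<open>Majorant profile for recolliding particles, whose horizontal velocity is within
  \<open>G / 2\<close> of \<open>Vinf\<close>. Its integral \<open>G\<close> is what makes the
  feedback contract.\<close>

definition W :: "vec \<Rightarrow> real" where
  "W u = indicat_real {Vinf - G / 2..Vinf + G / 2} (fst u) * b (snd u)"

lemma W_int: "has_bochner_integral U W G"
  using U_int[OF has_bochner_integral_indicator_interval[of "Vinf - G / 2" "Vinf + G / 2"]] G
  by (simp add: W_def[abs_def])

lemma W_nonneg: "u \<in> space U \<Longrightarrow> 0 \<le> W u"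
  by (auto simp: W_def space_vec_measure b_nonneg)

lemma W_eq: "\<bar>fst u - Vinf\<bar> \<le> G / 2 \<Longrightarrow> W u = b (snd u)"
proof -
  assume "\<bar>fst u - Vinf\<bar> \<le> G / 2"
  then have "fst u \<in> {Vinf - G / 2..Vinf + G / 2}" unfolding atLeastAtMost_iff by linarith
  then show ?thesis by (simp add: W_def)
qed

lemma pert_meas:
  assumes v: "mot v" and e: "adm A e"
    and [measurable]: "f \<in> borel_measurable N" "g \<in> N \<rightarrow>\<^sub>M P" "h \<in> N \<rightarrow>\<^sub>M U"
  shows "(\<lambda>x. pert \<sigma> v e (f x) (g x) (h x)) \<in> borel_measurable N"
proof -
  note [measurable (raw)] = trajectory.measurable_ptau[OF mot_trajectory[OF v]]
  have [measurable]: "v \<in> borel_measurable borel" by (rule mot_meas[OF v])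
  have em: "(\<lambda>(t, y, x). e t y x) \<in> borel_measurable (lborel \<Otimes>\<^sub>M (P \<Otimes>\<^sub>M lborel))"
    using e by (simp add: adm_def)
  have 1: "(\<lambda>x. ptau \<sigma> (pos v) (f x) (fst (h x))) \<in> borel_measurable N" by measurable
  have 2: "(\<lambda>x. pback d (g x) (f x - ptau \<sigma> (pos v) (f x) (fst (h x))) (snd (h x))) \<in> N \<rightarrow>\<^sub>M P" by measurable
  have 3: "(\<lambda>x. e (ptau \<sigma> (pos v) (f x) (fst (h x))) (pback d (g x) (f x - ptau \<sigma> (pos v) (f x) (fst (h x))) (snd (h x))) (fst (h x))) \<in> borel_measurable N"
    by (rule measurable_split3[OF em]) (use 1 2 in \<open>simp_all\<close>)
  note [measurable] = 1 2 3
  show ?thesis unfolding pert_def hit_def by measurable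
qed

lemma pert_bound:
  assumes \<sigma>: "\<sigma> \<in> {1, -1}" and v: "mot v" and e: "adm A e" and u: "u \<in> space U" and inc: "\<sigma> * (fst u - v t) < 0"
  shows "\<bar>pert \<sigma> v e t y u\<bar> \<le> (A + cJ + aM) * W u"
    and "pert \<sigma> v e t y u \<noteq> 0 \<Longrightarrow> \<bar>fst u - v t\<bar> \<le> G"
    and "adm A' e' \<Longrightarrow> (\<And>t y x. y \<in> space P \<Longrightarrow> \<bar>e t y x - e' t y x\<bar> \<le> D) \<Longrightarrow>
       \<bar>pert \<sigma> v e t y u - pert \<sigma> v e' t y u\<bar> \<le> D * W u"
proof -
  interpret m: motion d r k f0 a0 b Vinf p gs km bM aM cl Cl \<delta>b bl M "pos v" v G "t + 1" by (rule mot_motion[OF v])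
  have b0: "0 \<le> b (snd u)" using u by (auto simp: space_vec_measure intro!: b_nonneg)
  have A0: "0 \<le> A" using e pback_in_space[of d _ 0 _] unfolding adm_def by (meson abs_ge_zero order_trans)
  let ?\<tau> = "ptau \<sigma> (pos v) t (fst u)"
  show "\<bar>pert \<sigma> v e t y u\<bar> \<le> (A + cJ + aM) * W u"
  proof (cases "hit d r \<sigma> (pos v) t y u")
    case True
    note rng = m.hit_range[OF \<sigma> inc m.hit_mean(1)[OF \<sigma> inc True]]
    have W: "W u = b (snd u)" by (rule W_eq) (rule rng(1), simp)
    have "0 \<le> J \<sigma> (v ?\<tau>) (fst u)" "J \<sigma> (v ?\<tau>) (fst u) \<le> cJ"
      using rng G by (auto intro!: J_nonneg J_le)
    moreover have "\<bar>e ?\<tau> (pback d y (t - ?\<tau>) (snd u)) (fst u)\<bar> \<le> A"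
      using e pback_in_space unfolding adm_def by blast
    ultimately have "\<bar>J \<sigma> (v ?\<tau>) (fst u) + e ?\<tau> (pback d y (t - ?\<tau>) (snd u)) (fst u) - a0 (fst u)\<bar> \<le> A + cJ + aM"
      using a0_nonneg[of "fst u"] a0_le[of "fst u"] by linarith
    then have "b (snd u) * \<bar>J \<sigma> (v ?\<tau>) (fst u) + e ?\<tau> (pback d y (t - ?\<tau>) (snd u)) (fst u) - a0 (fst u)\<bar> \<le> b (snd u) * (A + cJ + aM)"
      using b0 by (rule mult_left_mono)
    then show ?thesis using True b0 by (simp add: pert_def W abs_mult mult.commute)
  next
    case False
    then show ?thesis using A0 cJ_nonneg aM W_nonneg[OF u] by (simp add: pert_def)
  qed
  show "\<bar>fst u - v t\<bar> \<le> G" if "pert \<sigma> v e t y u \<noteq> 0"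
  proof -
    have True: "hit d r \<sigma> (pos v) t y u" using that by (auto simp: pert_def split: if_splits)
    show ?thesis using m.hit_range(2)[OF \<sigma> inc m.hit_mean(1)[OF \<sigma> inc True]] by simp
  qed
  show "\<bar>pert \<sigma> v e t y u - pert \<sigma> v e' t y u\<bar> \<le> D * W u"
    if "adm A' e'" and D: "\<And>t y x. y \<in> space P \<Longrightarrow> \<bar>e t y x - e' t y x\<bar> \<le> D"
  proof (cases "hit d r \<sigma> (pos v) t y u")
    case True
    note rng = m.hit_range[OF \<sigma> inc m.hit_mean(1)[OF \<sigma> inc True]]
    have W: "W u = b (snd u)" by (rule W_eq) (rule rng(1), simp)
    have "b (snd u) * \<bar>e ?\<tau> (pback d y (t - ?\<tau>) (snd u)) (fst u) - e' ?\<tau> (pback d y (t - ?\<tau>) (snd u)) (fst u)\<bar> \<le> b (snd u) * D"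
      by (intro mult_left_mono D pback_in_space b0)
    moreover have "pert \<sigma> v e t y u - pert \<sigma> v e' t y u = b (snd u) * (e ?\<tau> (pback d y (t - ?\<tau>) (snd u)) (fst u) - e' ?\<tau> (pback d y (t - ?\<tau>) (snd u)) (fst u))"
      using True by (simp add: pert_def algebra_simps)
    ultimately show ?thesis using b0 by (simp add: abs_mult W mult.commute)
  next
    case False
    have "0 \<le> D" using D[OF pback_in_space] by (meson abs_ge_zero order_trans)
    then show ?thesis using False W_nonneg[OF u] by (simp add: pert_def)
  qed
qed

lemma AE_ne: "AE u in U. fst u \<noteq> c"
  by (rule AE_vec_fst) (rule AE_lborel_singleton)

lemma integrand_bound:
  assumes \<sigma>: "\<sigma> \<in> {1, -1}" and v: "mot v" and e: "adm A e"
    and Q: "\<And>\<zeta>. \<bar>\<zeta>\<bar> \<le> G \<Longrightarrow> \<bar>q \<zeta>\<bar> \<le> Q" and u: "u \<in> space U" "fst u \<noteq> v t"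
  shows "\<bar>of_bool (\<sigma> * (fst u - v t) \<le> 0) * (q (fst u - v t) * pert \<sigma> v e t y u)\<bar> \<le> Q * (A + cJ + aM) * W u"
proof -
  have A0: "0 \<le> A" using e pback_in_space[of d _ 0 _] unfolding adm_def by (meson abs_ge_zero order_trans)
  have Q0: "0 \<le> Q" using Q[of 0] G by simp
  have r0: "0 \<le> Q * (A + cJ + aM) * W u" using A0 Q0 cJ_nonneg aM W_nonneg[OF u(1)] by simp
  show ?thesis
  proof (cases "\<sigma> * (fst u - v t) \<le> 0 \<and> pert \<sigma> v e t y u \<noteq> 0")
    case True
    have "\<sigma> * (fst u - v t) \<noteq> 0" using u(2) \<sigma> by auto
    then have inc: "\<sigma> * (fst u - v t) < 0" using True by linarith
    note pb = pert_bound[OF \<sigma> v e u(1) inc]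
    have "\<bar>q (fst u - v t) * pert \<sigma> v e t y u\<bar> \<le> Q * ((A + cJ + aM) * W u)"
      unfolding abs_mult using Q0 by (intro mult_mono Q pb) (use True pb(2) in auto)
    then show ?thesis using True by (simp add: mult.assoc)
  qed (use r0 in auto)
qed

lemma integrand_int:
  assumes \<sigma>: "\<sigma> \<in> {1, -1}" and v: "mot v" and e: "adm A e" and [measurable]: "q \<in> borel_measurable borel"
    and Q: "\<And>\<zeta>. \<bar>\<zeta>\<bar> \<le> G \<Longrightarrow> \<bar>q \<zeta>\<bar> \<le> Q" and y: "y \<in> space P"
  shows "integrable U (\<lambda>u. of_bool (\<sigma> * (fst u - v t) \<le> 0) * (q (fst u - v t) * pert \<sigma> v e t y u))"
proof (rule Bochner_Integration.integrable_bound)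
  show "integrable U (\<lambda>u. Q * (A + cJ + aM) * W u)"
    using W_int by (auto simp: has_bochner_integral_iff)
  have [measurable]: "(\<lambda>u. pert \<sigma> v e t y u) \<in> borel_measurable U"
    by (rule pert_meas[OF v e]) (use y in auto)
  show "(\<lambda>u. of_bool (\<sigma> * (fst u - v t) \<le> 0) * (q (fst u - v t) * pert \<sigma> v e t y u)) \<in> borel_measurable U"
    by measurable
  show "AE u in U. norm (of_bool (\<sigma> * (fst u - v t) \<le> 0) * (q (fst u - v t) * pert \<sigma> v e t y u)) \<le> norm (Q * (A + cJ + aM) * W u)"
    unfolding real_norm_def using AE_ne[of "v t"] AE_space
    by eventually_elim (rule order_trans[OF integrand_bound[OF \<sigma> v e Q] abs_ge_self])
qed

lemma Psi_bound:
  assumes \<sigma>: "\<sigma> \<in> {1, -1}" and v: "mot v" and e: "adm A e"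
    and Q: "\<And>\<zeta>. \<bar>\<zeta>\<bar> \<le> G \<Longrightarrow> \<bar>q \<zeta>\<bar> \<le> Q"
  shows "\<bar>Psi \<sigma> v q e t y\<bar> \<le> Q * (A + cJ + aM) * G"
  unfolding Psi_def
proof (rule LINT_abs_le[OF has_bochner_integral_mult_right[OF W_int]])
  show "AE u in U. \<bar>of_bool (\<sigma> * (fst u - v t) \<le> 0) * (q (fst u - v t) * pert \<sigma> v e t y u)\<bar> \<le> Q * (A + cJ + aM) * W u"
    using AE_ne[of "v t"] AE_space
    by eventually_elim (rule integrand_bound[OF \<sigma> v e Q])
qed

lemma Psi_diff:
  assumes \<sigma>: "\<sigma> \<in> {1, -1}" and v: "mot v" and e: "adm A e" "adm A' e'" and q: "q \<in> borel_measurable borel"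
    and Q: "\<And>\<zeta>. \<bar>\<zeta>\<bar> \<le> G \<Longrightarrow> \<bar>q \<zeta>\<bar> \<le> Q" and y: "y \<in> space P"
    and D: "\<And>t y x. y \<in> space P \<Longrightarrow> \<bar>e t y x - e' t y x\<bar> \<le> D"
  shows "\<bar>Psi \<sigma> v q e t y - Psi \<sigma> v q e' t y\<bar> \<le> Q * D * G"
proof -
  have "Psi \<sigma> v q e t y - Psi \<sigma> v q e' t y = (LINT u|U. of_bool (\<sigma> * (fst u - v t) \<le> 0) * (q (fst u - v t) * pert \<sigma> v e t y u)
     - of_bool (\<sigma> * (fst u - v t) \<le> 0) * (q (fst u - v t) * pert \<sigma> v e' t y u))"
    unfolding Psi_def
    using Bochner_Integration.integral_diff[OF integrand_int[OF \<sigma> v e(1) q Q y, of t] integrand_int[OF \<sigma> v e(2) q Q y, of t]]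
    by simp
  moreover have "\<bar>\<dots>\<bar> \<le> Q * D * G"
  proof (rule LINT_abs_le[OF has_bochner_integral_mult_right[OF W_int]])
    show "AE u in U. \<bar>of_bool (\<sigma> * (fst u - v t) \<le> 0) * (q (fst u - v t) * pert \<sigma> v e t y u)
       - of_bool (\<sigma> * (fst u - v t) \<le> 0) * (q (fst u - v t) * pert \<sigma> v e' t y u)\<bar> \<le> Q * D * W u"
      using AE_ne[of "v t"] AE_space
    proof eventually_elim
      case (elim u)
      have Q0: "0 \<le> Q" using Q[of 0] G by simp
      have D0: "0 \<le> D" using D[OF pback_in_space] by (meson abs_ge_zero order_trans)
      have W0: "0 \<le> Q * D * W u" using Q0 D0 W_nonneg[OF elim(2)] by simp
      show ?case
      proof (cases "\<sigma> * (fst u - v t) \<le> 0 \<and> (pert \<sigma> v e t y u \<noteq> 0 \<or> pert \<sigma> v e' t y u \<noteq> 0)")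
        case True
        have "\<sigma> * (fst u - v t) \<noteq> 0" using elim(1) \<sigma> by auto
        then have inc: "\<sigma> * (fst u - v t) < 0" using True by linarith
        have near: "\<bar>fst u - v t\<bar> \<le> G"
          using True pert_bound(2)[OF \<sigma> v e(1) elim(2) inc] pert_bound(2)[OF \<sigma> v e(2) elim(2) inc] by blast
        have "\<bar>q (fst u - v t)\<bar> * \<bar>pert \<sigma> v e t y u - pert \<sigma> v e' t y u\<bar> \<le> Q * (D * W u)"
          using Q0 by (intro mult_mono Q near pert_bound(3)[OF \<sigma> v e(1) elim(2) inc e(2) D]) auto
        then show ?thesis using True by (simp add: abs_mult[symmetric] right_diff_distrib mult.assoc)
      qed (use W0 in auto)
    qed
  qed
  ultimately show ?thesis by simp
qed

lemma Psi_meas: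
  assumes v: "mot v" and e: "adm A e"
    and qm: "(\<lambda>(x, \<zeta>). q x \<zeta>) \<in> borel_measurable (N \<Otimes>\<^sub>M borel)"
    and [measurable]: "f \<in> borel_measurable N" "g \<in> N \<rightarrow>\<^sub>M P"
  shows "(\<lambda>x. Psi \<sigma> v (q x) e (f x) (g x)) \<in> borel_measurable N"
proof -
  have [measurable]: "v \<in> borel_measurable borel" by (rule mot_meas[OF v])
  have [measurable]: "(\<lambda>z. pert \<sigma> v e (f (fst z)) (g (fst z)) (snd z)) \<in> borel_measurable (N \<Otimes>\<^sub>M U)"
    by (rule pert_meas[OF v e]) measurable
  have [measurable]: "(\<lambda>z. q (fst z) (fst (snd z) - v (f (fst z)))) \<in> borel_measurable (N \<Otimes>\<^sub>M U)"
    using measurable_compose[OF _ qm, of "\<lambda>z. (fst z, fst (snd z) - v (f (fst z)))" "N \<Otimes>\<^sub>M U"] by simp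
  have "(\<lambda>(x, u). of_bool (\<sigma> * (fst u - v (f x)) \<le> 0) * (q x (fst u - v (f x)) * pert \<sigma> v e (f x) (g x) u)) \<in> borel_measurable (N \<Otimes>\<^sub>M U)"
    unfolding case_prod_beta' by measurable
  from sigma_finite_measure.borel_measurable_lebesgue_integral[OF sf_vec this]
  show ?thesis by (simp add: Psi_def)
qed

end

lemma geometric_limit:
  fixes a :: "nat \<Rightarrow> real"
  assumes d: "\<And>n. \<bar>a (Suc n) - a n\<bar> \<le> C * (1 / 4) ^ n"
  shows "a \<longlonglongrightarrow> lim a" "\<bar>a n - lim a\<bar> \<le> 2 * C * (1 / 4) ^ n"
proof -
  have C: "0 \<le> C" using d[of 0] by simp
  have j: "\<bar>a (n + j) - a n\<bar> \<le> 2 * C * (1 / 4) ^ n * (1 - (1 / 4) ^ j)" for n j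
  proof (induction j)
    case (Suc j)
    have "\<bar>a (n + Suc j) - a n\<bar> \<le> C * (1 / 4) ^ (n + j) + 2 * C * (1 / 4) ^ n * (1 - (1 / 4) ^ j)"
      using d[of "n + j"] Suc by simp
    also have "\<dots> \<le> 2 * C * (1 / 4) ^ n * (1 - (1 / 4) ^ Suc j)"
      using C by (simp add: power_add algebra_simps)
    finally show ?case .
  qed simp
  have b: "\<bar>a m - a n\<bar> \<le> 2 * C * (1 / 4) ^ n" if "n \<le> m" for m n
  proof -
    have "\<bar>a m - a n\<bar> \<le> 2 * C * (1 / 4) ^ n * (1 - (1 / 4) ^ (m - n))" using j[of n "m - n"] that by simp
    also have "\<dots> \<le> 2 * C * (1 / 4) ^ n * 1" using C by (intro mult_left_mono) auto
    finally show ?thesis by simp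
  qed
  have "Cauchy a"
  proof (rule CauchyI')
    fix e :: real assume e: "0 < e"
    have "(\<lambda>n. 2 * C * (1 / 4) ^ n) \<longlonglongrightarrow> 2 * C * 0" by (intro tendsto_intros LIMSEQ_power_zero) simp
    then have "eventually (\<lambda>n. 2 * C * (1 / 4) ^ n < e) sequentially" using e by (intro order_tendstoD(2)) auto
    then obtain N where N: "2 * C * (1 / 4) ^ N < e / 1" "\<And>n. N \<le> n \<Longrightarrow> 2 * C * (1 / 4) ^ n < e"
      by (auto simp: eventually_sequentially)
    show "\<exists>M. \<forall>m\<ge>M. \<forall>n>m. dist (a m) (a n) < e"
    proof (intro exI[of _ N] allI impI)
      fix m n assume "N \<le> m" "m < n"
      then show "dist (a m) (a n) < e" using b[of m n] N(2)[of m] by (simp add: dist_real_def abs_minus_commute)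
    qed
  qed
  then show l: "a \<longlonglongrightarrow> lim a" by (simp add: Cauchy_convergent_iff convergent_LIMSEQ_iff)
  have "(\<lambda>m. \<bar>a n - a m\<bar>) \<longlonglongrightarrow> \<bar>a n - lim a\<bar>" by (intro tendsto_intros l)
  then show "\<bar>a n - lim a\<bar> \<le> 2 * C * (1 / 4) ^ n"
    by (rule LIMSEQ_le_const2) (use b abs_minus_commute in \<open>metis\<close>)
qed

section \<open>Continuous dependence of the feedback operator on the motion\<close>

lemma perp_norm_tendsto:
  "(\<And>i. i \<in> {1..<d} \<Longrightarrow> (\<lambda>n. yn n i) \<longlonglongrightarrow> y i) \<Longrightarrow> (\<lambda>n. perp_norm d (yn n)) \<longlonglongrightarrow> perp_norm d y"
  unfolding perp_norm_def L2_set_def by (intro tendsto_intros) auto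

context small_motion begin

text \<open>Continuous convergence: times and positions vary with \<open>n\<close>, because the
  precollision points of the approximating motions move. The horizontal velocity \<open>x\<close>
  stays fixed, as free flight does not change it.\<close>

definition conv_dens where
  "conv_dens en e \<longleftrightarrow> (\<forall>sn s yn y x. sn \<longlonglongrightarrow> s \<and> (\<forall>n. 0 \<le> sn n) \<and> (\<forall>n. yn n \<in> disk d r) \<and> y \<in> disk d r \<and>
     (\<forall>i\<in>{1..<d}. (\<lambda>n. yn n i) \<longlonglongrightarrow> y i) \<longrightarrow> (\<lambda>n. en n (sn n) (yn n) x) \<longlonglongrightarrow> e s y x)"

text \<open>Once the horizontal velocity is fixed so is the contact time, and grazing the rim
  becomes a sphere equation for the transversal velocity; \<open>sphere_null\<close>
  applies.\<close>

lemma AE_boundary: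
  assumes v: "mot v" and y: "y \<in> space P"
  shows "AE u in U. 0 < ptau \<sigma> (pos v) t (fst u) \<and> ptau \<sigma> (pos v) t (fst u) < t \<longrightarrow>
     perp_norm d (pback d y (t - ptau \<sigma> (pos v) t (fst u)) (snd u)) \<noteq> r"
proof -
  note [measurable (raw)] = trajectory.measurable_ptau[OF mot_trajectory[OF v]]
  let ?Q = "\<lambda>u. 0 < ptau \<sigma> (pos v) t (fst u) \<and> ptau \<sigma> (pos v) t (fst u) < t \<longrightarrow>
     perp_norm d (pback d y (t - ptau \<sigma> (pos v) t (fst u)) (snd u)) \<noteq> r"
  have "{u \<in> space U. ?Q u} \<in> sets U" using y by measurable
  moreover have "AE x in lborel. AE w in P. ?Q (x, w)"
  proof (rule AE_I2)
    fix x
    show "AE w in P. ?Q (x, w)"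
    proof (cases "ptau \<sigma> (pos v) t x < t")
      case True
      then have "{w \<in> space P. perp_norm d (pback d y (t - ptau \<sigma> (pos v) t x) w) = r} \<in> null_sets P"
        using r by (intro sphere_null) auto
      from AE_not_in[OF this] AE_space show ?thesis
        by eventually_elim auto
    qed simp
  qed
  ultimately show ?thesis
    unfolding vec_measure_def by (intro lborel_perp.AE_pair_measure) (simp_all only: fst_conv snd_conv)
qed

text \<open>Dominated convergence with a multiple of \<open>W\<close>. The integrand converges
  unless the velocity equals that of the end, is irregular, belongs to a path through the end at
  time 0, or grazes the rim at the precollision; each of these is a null set.\<close>

lemma Psi_tendsto:
  assumes \<sigma>: "\<sigma> \<in> {1, -1}" and m: "\<And>n. mot (vn n)" "mot v" and lim: "\<And>t. (\<lambda>n. vn n t) \<longlonglongrightarrow> v t"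
    and t: "tn \<longlonglongrightarrow> t" "\<And>n. 0 \<le> tn n"
    and y: "\<And>n. yn n \<in> disk d r" "y \<in> disk d r" "\<And>i. i \<in> {1..<d} \<Longrightarrow> (\<lambda>n. yn n i) \<longlonglongrightarrow> y i"
    and e: "\<And>n. adm A (en n)" "adm A e" "conv_dens en e"
    and q: "\<And>n. qn n \<in> borel_measurable borel" "q \<in> borel_measurable borel"
      "\<And>n \<zeta>. \<bar>\<zeta>\<bar> \<le> G \<Longrightarrow> \<bar>qn n \<zeta>\<bar> \<le> Q" "\<And>z. z \<noteq> v t \<Longrightarrow> (\<lambda>n. qn n (z - vn n (tn n))) \<longlonglongrightarrow> q (z - v t)"
  shows "(\<lambda>n. Psi \<sigma> (vn n) (qn n) (en n) (tn n) (yn n)) \<longlonglongrightarrow> Psi \<sigma> v q e t y"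
  unfolding Psi_def
proof (rule integral_dominated_convergence[where w = "\<lambda>u. Q * (A + cJ + aM) * W u"])
  have ysp: "y \<in> space P" "\<And>n. yn n \<in> space P" using y by (auto simp: disk_def)
  have [measurable]: "v \<in> borel_measurable borel" "\<And>n. vn n \<in> borel_measurable borel" by (auto intro: mot_meas m)
  note q(1,2)[measurable]
  have [measurable]: "(\<lambda>u. pert \<sigma> v e t y u) \<in> borel_measurable U"
    by (rule pert_meas[OF m(2) e(2)]) (use ysp in auto)
  have [measurable]: "(\<lambda>u. pert \<sigma> (vn n) (en n) (tn n) (yn n) u) \<in> borel_measurable U" for n
    by (rule pert_meas[OF m(1) e(1)]) (use ysp in auto)
  show "(\<lambda>u. of_bool (\<sigma> * (fst u - v t) \<le> 0) * (q (fst u - v t) * pert \<sigma> v e t y u)) \<in> borel_measurable U" by measurable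
  show "(\<lambda>u. of_bool (\<sigma> * (fst u - vn n (tn n)) \<le> 0) * (qn n (fst u - vn n (tn n)) * pert \<sigma> (vn n) (en n) (tn n) (yn n) u)) \<in> borel_measurable U" for n
    by measurable
  show "integrable U (\<lambda>u. Q * (A + cJ + aM) * W u)" using W_int by (auto simp: has_bochner_integral_iff)
  show "AE u in U. norm (of_bool (\<sigma> * (fst u - vn n (tn n)) \<le> 0) * (qn n (fst u - vn n (tn n)) * pert \<sigma> (vn n) (en n) (tn n) (yn n) u)) \<le> Q * (A + cJ + aM) * W u" for n
    unfolding real_norm_def using AE_ne[of "vn n (tn n)"] AE_space
    by eventually_elim (rule integrand_bound[OF \<sigma> m(1) e(1) q(3)])
  have vt: "(\<lambda>n. vn n (tn n)) \<longlonglongrightarrow> v t" by (rule mot_tendsto[OF m(1) lim t(1)])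
  have mean: "AE u in U. pos v t - pos v 0 \<noteq> t * fst u \<or> t = 0"
  proof (cases "t = 0")
    case False
    show ?thesis using AE_ne[of "(pos v t - pos v 0) / t"] by (rule eventually_mono) (use False in \<open>auto simp: field_simps\<close>)
  qed simp
  interpret tr: trajectory "pos v" v by (rule mot_trajectory[OF m(2)])
  interpret mo: motion d r k f0 a0 b Vinf p gs km bM aM cl Cl \<delta>b bl M "pos v" v G "t + 1" by (rule mot_motion[OF m(2)])
  show "AE u in U. (\<lambda>n. of_bool (\<sigma> * (fst u - vn n (tn n)) \<le> 0) * (qn n (fst u - vn n (tn n)) * pert \<sigma> (vn n) (en n) (tn n) (yn n) u))
      \<longlonglongrightarrow> of_bool (\<sigma> * (fst u - v t) \<le> 0) * (q (fst u - v t) * pert \<sigma> v e t y u)"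
    using AE_ne[of "v t"] AE_vec_fst[OF AE_regular[OF \<sigma>, of "pos v" t]] mean AE_boundary[OF m(2) ysp(1), of \<sigma> t] AE_space
  proof eventually_elim
    fix u assume u: "fst u \<noteq> v t" "regular \<sigma> (pos v) t (fst u)" "pos v t - pos v 0 \<noteq> t * fst u \<or> t = 0"
      "0 < ptau \<sigma> (pos v) t (fst u) \<and> ptau \<sigma> (pos v) t (fst u) < t \<longrightarrow>
        perp_norm d (pback d y (t - ptau \<sigma> (pos v) t (fst u)) (snd u)) \<noteq> r" "u \<in> space U"
    have sc: "(\<lambda>n. \<sigma> * (fst u - vn n (tn n))) \<longlonglongrightarrow> \<sigma> * (fst u - v t)" by (intro tendsto_intros vt)
    have "\<sigma> * (fst u - v t) \<noteq> 0" using u(1) \<sigma> by auto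
    then consider (out) "0 < \<sigma> * (fst u - v t)" | (inc) "\<sigma> * (fst u - v t) < 0" by linarith
    then show "(\<lambda>n. of_bool (\<sigma> * (fst u - vn n (tn n)) \<le> 0) * (qn n (fst u - vn n (tn n)) * pert \<sigma> (vn n) (en n) (tn n) (yn n) u))
      \<longlonglongrightarrow> of_bool (\<sigma> * (fst u - v t) \<le> 0) * (q (fst u - v t) * pert \<sigma> v e t y u)"
    proof cases
      case out
      have "eventually (\<lambda>n. of_bool (\<sigma> * (fst u - vn n (tn n)) \<le> 0) * (qn n (fst u - vn n (tn n)) * pert \<sigma> (vn n) (en n) (tn n) (yn n) u) = 0) sequentially"
        using order_tendstoD(1)[OF sc out] by (rule eventually_mono) simp
      then show ?thesis using out by (simp add: tendsto_eventually)
    next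
      case inc
      have b1: "(\<lambda>n. of_bool (\<sigma> * (fst u - vn n (tn n)) \<le> 0) :: real) \<longlonglongrightarrow> of_bool (\<sigma> * (fst u - v t) \<le> 0)"
        by (rule tendsto_eventually, rule eventually_mono[OF order_tendstoD(2)[OF sc inc]]) (use inc in simp)
      define Xn X where "Xn n s = - \<sigma> * pos (vn n) s" and "X s = - \<sigma> * pos v s" for n s
      define Vn V where "Vn n s = - \<sigma> * vn n s" and "V s = - \<sigma> * v s" for n s
      define z where "z = - \<sigma> * fst u"
      have p: "ptau \<sigma> (pos (vn n)) s (fst u) = tau (Xn n) s z" "ptau \<sigma> (pos v) s (fst u) = tau X s z" for n s
        unfolding ptau_def Xn_def X_def z_def by simp_all
      have 1: "trajectory (Xn n) (Vn n)" "trajectory X V" for n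
        unfolding Xn_def[abs_def] X_def[abs_def] Vn_def[abs_def] V_def[abs_def]
        by (rule trajectory.trajectory_scaled[OF mot_trajectory], rule m)+
      have 2: "(\<lambda>n. Xn n (sn n)) \<longlonglongrightarrow> X s" "(\<lambda>n. Vn n (sn n)) \<longlonglongrightarrow> V s"
        if "sn \<longlonglongrightarrow> s" "\<And>n. 0 \<le> sn n" for sn s
        unfolding Xn_def X_def Vn_def V_def
        by (intro tendsto_intros pos_tendsto[OF m lim that] mot_tendsto[OF m(1) lim that(1)])+
      have 3: "V t < z" using inc by (simp add: V_def z_def algebra_simps)
      have 4: "isCont (tau X t) z" using u(2) by (simp add: regular_def X_def[abs_def] z_def)
      have 5: "X t - X 0 \<noteq> t * z \<or> t = 0"
      proof -
        have "X t - X 0 = - \<sigma> * (pos v t - pos v 0)" "t * z = - \<sigma> * (t * fst u)" by (simp_all add: X_def z_def algebra_simps)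
        then show ?thesis using u(3) \<sigma> by auto
      qed
      note tt = tau_tendsto[where Xn = Xn and Vn = Vn and X = X and V = V, OF 1 2 t 3 4 5]
      let ?\<tau> = "tau X t z"
      have "(\<lambda>n. pert \<sigma> (vn n) (en n) (tn n) (yn n) u) \<longlonglongrightarrow> pert \<sigma> v e t y u"
      proof (cases "?\<tau> = 0")
        case True
        have "eventually (\<lambda>n. tau (Xn n) (tn n) z = 0) sequentially" by (rule tt(1)) (use True in auto)
        then have "eventually (\<lambda>n. pert \<sigma> (vn n) (en n) (tn n) (yn n) u = 0) sequentially"
          by (rule eventually_mono) (simp add: pert_def hit_def p)
        moreover have "pert \<sigma> v e t y u = 0" using True by (simp add: pert_def hit_def p)
        ultimately show ?thesis by (simp add: tendsto_eventually)
      next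
        case False
        then have pos: "0 < ?\<tau>" using tau_nonneg[of X t z] by simp
        have tl: "(\<lambda>n. tau (Xn n) (tn n) z) \<longlonglongrightarrow> ?\<tau>" by (rule tt(2)) (use pos in auto)
        have pos': "0 < ptau \<sigma> (pos v) t (fst u)" using pos by (simp add: p)
        have lt: "?\<tau> < t" using tr.ptau_root(1)[OF \<sigma> inc pos'] by (simp add: p)
        define \<xi>n \<xi> where "\<xi>n n = pback d (yn n) (tn n - tau (Xn n) (tn n) z) (snd u)" and "\<xi> = pback d y (t - ?\<tau>) (snd u)" for n
        have \<xi>i: "(\<lambda>n. \<xi>n n i) \<longlonglongrightarrow> \<xi> i" if "i \<in> {1..<d}" for i
          unfolding \<xi>n_def \<xi>_def pback_def using that by (auto intro!: tendsto_intros y(3) t tl)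
        have nl: "(\<lambda>n. perp_norm d (\<xi>n n)) \<longlonglongrightarrow> perp_norm d \<xi>" by (rule perp_norm_tendsto) (rule \<xi>i)
        have \<xi>sp: "\<xi>n n \<in> disk d r \<longleftrightarrow> perp_norm d (\<xi>n n) \<le> r" "\<xi> \<in> disk d r \<longleftrightarrow> perp_norm d \<xi> \<le> r" for n
          by (auto simp: disk_def \<xi>n_def \<xi>_def pback_in_space)
        have ev0: "eventually (\<lambda>n. 0 < tau (Xn n) (tn n) z) sequentially" by (rule order_tendstoD(1)[OF tl pos])
        have "perp_norm d \<xi> \<noteq> r" using u(4) pos lt by (simp add: p \<xi>_def)
        then consider (far) "r < perp_norm d \<xi>" | (near) "perp_norm d \<xi> < r" by linarith
        then show ?thesis
        proof cases
          case far
          have "eventually (\<lambda>n. pert \<sigma> (vn n) (en n) (tn n) (yn n) u = 0) sequentially"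
            using order_tendstoD(1)[OF nl far] by (rule eventually_mono) (auto simp: pert_def hit_def p \<xi>n_def[symmetric] \<xi>sp)
          moreover have "pert \<sigma> v e t y u = 0" using far by (simp add: pert_def hit_def p \<xi>_def[symmetric] \<xi>sp)
          ultimately show ?thesis by (simp add: tendsto_eventually)
        next
          case near
          have evd: "eventually (\<lambda>n. \<xi>n n \<in> disk d r) sequentially"
            using order_tendstoD(2)[OF nl near] by (rule eventually_mono) (simp add: \<xi>sp)
          have \<xi>d: "\<xi> \<in> disk d r" using near by (simp add: \<xi>sp)
          have rng: "\<bar>fst u - Vinf\<bar> \<le> G / 2" using mo.hit_range(1)[OF \<sigma> inc pos'] by simp
          have Jl: "(\<lambda>n. J \<sigma> (vn n (tau (Xn n) (tn n) z)) (fst u)) \<longlonglongrightarrow> J \<sigma> (v ?\<tau>) (fst u)"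
          proof (rule J_tendsto[OF mot_tendsto[OF m(1) lim tl] tendsto_const])
            fix n
            have "\<bar>vn n (tau (Xn n) (tn n) z) - Vinf\<bar> \<le> G / 2" by (rule mot_range[OF m(1)])
            then show "\<bar>vn n (tau (Xn n) (tn n) z) - Vinf\<bar> < gs" "\<bar>fst u - vn n (tau (Xn n) (tn n) z)\<bar> < 2 * gs"
              using rng G by linarith+
          qed
          \<comment> \<open>\<open>conv_dens\<close> asks for points of the disk for every
            \<open>n\<close>; the finitely many exceptions are replaced by the limit point.\<close>
          define \<eta>n where "\<eta>n n = (if \<xi>n n \<in> disk d r then \<xi>n n else \<xi>)" for n
          have ev\<eta>: "eventually (\<lambda>n. \<eta>n n = \<xi>n n) sequentially" using evd by (rule eventually_mono) (simp add: \<eta>n_def)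
          have "(\<lambda>n. \<eta>n n i) \<longlonglongrightarrow> \<xi> i" if "i \<in> {1..<d}" for i
            using \<xi>i[OF that] by (rule Lim_transform_eventually) (use ev\<eta> in \<open>auto elim: eventually_mono\<close>)
          then have "(\<lambda>n. en n (tau (Xn n) (tn n) z) (\<eta>n n) (fst u)) \<longlonglongrightarrow> e ?\<tau> \<xi> (fst u)"
            using e(3)[unfolded conv_dens_def] tl \<xi>d tau_nonneg by (auto simp: \<eta>n_def)
          then have el: "(\<lambda>n. en n (tau (Xn n) (tn n) z) (\<xi>n n) (fst u)) \<longlonglongrightarrow> e ?\<tau> \<xi> (fst u)"
            by (rule Lim_transform_eventually) (use ev\<eta> in \<open>auto elim: eventually_mono\<close>)
          have "(\<lambda>n. b (snd u) * (J \<sigma> (vn n (tau (Xn n) (tn n) z)) (fst u) + en n (tau (Xn n) (tn n) z) (\<xi>n n) (fst u) - a0 (fst u)))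
             \<longlonglongrightarrow> b (snd u) * (J \<sigma> (v ?\<tau>) (fst u) + e ?\<tau> \<xi> (fst u) - a0 (fst u))"
            by (intro tendsto_intros Jl el)
          moreover have "eventually (\<lambda>n. b (snd u) * (J \<sigma> (vn n (tau (Xn n) (tn n) z)) (fst u) + en n (tau (Xn n) (tn n) z) (\<xi>n n) (fst u) - a0 (fst u))
             = pert \<sigma> (vn n) (en n) (tn n) (yn n) u) sequentially"
            using evd ev0 by eventually_elim (simp add: pert_def hit_def p \<xi>n_def)
          moreover have "pert \<sigma> v e t y u = b (snd u) * (J \<sigma> (v ?\<tau>) (fst u) + e ?\<tau> \<xi> (fst u) - a0 (fst u))"
            using \<xi>d pos by (simp add: pert_def hit_def p \<xi>_def)
          ultimately show ?thesis by (simp add: Lim_transform_eventually)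
        qed
      qed
      then show ?thesis by (intro tendsto_mult b1 q(4)[OF u(1)])
    qed
  qed
qed

end

section \<open>Fixed point for the boundary densities, and its continuity and causality\<close>

context small_motion begin

text \<open>Picard iteration for the deviation \<open>e\<close>, started from the plain reflection
  of \<open>f0\<close>.\<close>

primrec err :: "real \<Rightarrow> (real \<Rightarrow> real) \<Rightarrow> nat \<Rightarrow> real \<Rightarrow> perp \<Rightarrow> real \<Rightarrow> real" where
  "err \<sigma> v 0 = (\<lambda>t y x. 0)"
| "err \<sigma> v (Suc n) = (\<lambda>t y x. Psi \<sigma> v (k (x - v t)) (err \<sigma> v n) t y)"

definition S0 where "S0 = cJ + aM"

lemma S0: "0 < S0" using cJ_nonneg aM by (simp add: S0_def)

lemma k_near: "\<bar>\<zeta>\<bar> \<le> G \<Longrightarrow> \<bar>k x \<zeta>\<bar> \<le> km"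
  using k_le[of \<zeta> x] k_nonneg[of x \<zeta>] G by auto

lemma k_meas1: "k x \<in> borel_measurable borel" by measurable

lemma contract: "0 \<le> D \<Longrightarrow> km * D * G \<le> D / 4"
proof -
  assume "0 \<le> D"
  then have "km * (2 * G) * D \<le> 1 / 4 * D" using small by (rule mult_right_mono[rotated])
  moreover have "0 \<le> km * D * G" using \<open>0 \<le> D\<close> km_nonneg G by simp
  ultimately show ?thesis by (simp add: algebra_simps)
qed

text \<open>The ball of radius \<open>S0\<close> is invariant: the perturbation is bounded by
  \<open>2 * S0\<close>, and reflection shrinks it at least by a factor 4.\<close>

lemma Psi_k_adm:
  assumes \<sigma>: "\<sigma> \<in> {1, -1}" and v: "mot v" and e: "adm S0 e"
  shows "adm S0 (\<lambda>t y x. Psi \<sigma> v (k (x - v t)) e t y)"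
  unfolding adm_def
proof (intro conjI allI ballI)
  have [measurable]: "v \<in> borel_measurable borel" by (rule mot_meas[OF v])
  have "(\<lambda>q. Psi \<sigma> v (k (snd (snd q) - v (fst q))) e (fst q) (fst (snd q))) \<in> borel_measurable (lborel \<Otimes>\<^sub>M (P \<Otimes>\<^sub>M lborel))"
    by (rule Psi_meas[OF v e, where q = "\<lambda>q. k (snd (snd q) - v (fst q))"]) measurable
  then show "(\<lambda>(t, y, x). Psi \<sigma> v (k (x - v t)) e t y) \<in> borel_measurable (lborel \<Otimes>\<^sub>M (P \<Otimes>\<^sub>M lborel))"
    by (simp add: case_prod_beta')
  fix t y x
  have "\<bar>Psi \<sigma> v (k (x - v t)) e t y\<bar> \<le> km * (S0 + cJ + aM) * G" by (rule Psi_bound[OF \<sigma> v e k_near])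
  also have "\<dots> \<le> (S0 + cJ + aM) / 4" by (rule contract) (use S0 in \<open>simp add: S0_def\<close>)
  also have "\<dots> \<le> S0" using S0 by (simp add: S0_def)
  finally show "\<bar>Psi \<sigma> v (k (x - v t)) e t y\<bar> \<le> S0" .
qed

lemma err_adm: "\<sigma> \<in> {1, -1} \<Longrightarrow> mot v \<Longrightarrow> adm S0 (err \<sigma> v n)"
proof (induction n)
  case 0
  then show ?case using S0 by (simp add: adm_def)
next
  case (Suc n)
  then show ?case using Psi_k_adm[of \<sigma> v "err \<sigma> v n"] by simp
qed

lemma err_step:
  assumes \<sigma>: "\<sigma> \<in> {1, -1}" and v: "mot v" and y: "y \<in> space P"
  shows "\<bar>err \<sigma> v (Suc n) t y x - err \<sigma> v n t y x\<bar> \<le> S0 * (1 / 4) ^ n"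
  using y
proof (induction n arbitrary: t y x)
  case 0
  have "adm S0 (err \<sigma> v (Suc 0))" by (rule err_adm[OF \<sigma> v])
  then have "\<bar>err \<sigma> v (Suc 0) t y x\<bar> \<le> S0" using 0 unfolding adm_def by blast
  then show ?case by simp
next
  case (Suc n)
  have "\<bar>Psi \<sigma> v (k (x - v t)) (err \<sigma> v (Suc n)) t y - Psi \<sigma> v (k (x - v t)) (err \<sigma> v n) t y\<bar> \<le> km * (S0 * (1 / 4) ^ n) * G"
    by (rule Psi_diff[OF \<sigma> v err_adm[OF \<sigma> v] err_adm[OF \<sigma> v] k_meas1 k_near Suc.prems Suc.IH])
  also have "\<dots> \<le> S0 * (1 / 4) ^ n / 4" by (rule contract) (use S0 in simp)
  finally show ?case by (simp add: mult.assoc)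
qed

definition errlim where "errlim \<sigma> v t y x = lim (\<lambda>n. err \<sigma> v n t y x)"

lemma errlim:
  assumes \<sigma>: "\<sigma> \<in> {1, -1}" and v: "mot v" and y: "y \<in> space P"
  shows "(\<lambda>n. err \<sigma> v n t y x) \<longlonglongrightarrow> errlim \<sigma> v t y x"
    and "\<bar>err \<sigma> v n t y x - errlim \<sigma> v t y x\<bar> \<le> 2 * S0 * (1 / 4) ^ n"
  unfolding errlim_def
  using geometric_limit[of "\<lambda>n. err \<sigma> v n t y x" S0, OF err_step[OF \<sigma> v y]] by auto

lemma errlim_adm:
  assumes \<sigma>: "\<sigma> \<in> {1, -1}" and v: "mot v"
  shows "adm S0 (errlim \<sigma> v)"
  unfolding adm_def
proof (intro conjI allI ballI)
  show "(\<lambda>(t, y, x). errlim \<sigma> v t y x) \<in> borel_measurable (lborel \<Otimes>\<^sub>M (P \<Otimes>\<^sub>M lborel))"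
  proof (rule borel_measurable_LIMSEQ_real)
    show "(\<lambda>(t, y, x). err \<sigma> v n t y x) \<in> borel_measurable (lborel \<Otimes>\<^sub>M (P \<Otimes>\<^sub>M lborel))" for n
      using err_adm[OF \<sigma> v, of n] by (simp add: adm_def)
    fix q :: "real \<times> perp \<times> real" assume "q \<in> space (lborel \<Otimes>\<^sub>M (P \<Otimes>\<^sub>M lborel))"
    then have "fst (snd q) \<in> space P" by (auto simp: space_pair_measure)
    from errlim(1)[OF \<sigma> v this, of "fst q" "snd (snd q)"]
    show "(\<lambda>n. case q of (t, y, x) \<Rightarrow> err \<sigma> v n t y x) \<longlonglongrightarrow> (case q of (t, y, x) \<Rightarrow> errlim \<sigma> v t y x)"
      by (simp add: case_prod_beta')
  qed
  fix t y x assume y: "y \<in> space P"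
  have "(\<lambda>n. \<bar>err \<sigma> v n t y x\<bar>) \<longlonglongrightarrow> \<bar>errlim \<sigma> v t y x\<bar>" by (intro tendsto_intros errlim \<sigma> v y)
  then show "\<bar>errlim \<sigma> v t y x\<bar> \<le> S0"
    by (rule LIMSEQ_le_const2) (use err_adm[OF \<sigma> v] y in \<open>auto simp: adm_def\<close>)
qed

lemma errlim_fix:
  assumes \<sigma>: "\<sigma> \<in> {1, -1}" and v: "mot v" and y: "y \<in> space P"
  shows "errlim \<sigma> v t y x = Psi \<sigma> v (k (x - v t)) (errlim \<sigma> v) t y"
proof (rule LIMSEQ_unique)
  show "(\<lambda>n. err \<sigma> v (Suc n) t y x) \<longlonglongrightarrow> errlim \<sigma> v t y x"
    by (rule LIMSEQ_Suc[OF errlim(1)[OF \<sigma> v y]])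
  have "(\<lambda>n. err \<sigma> v (Suc n) t y x - Psi \<sigma> v (k (x - v t)) (errlim \<sigma> v) t y) \<longlonglongrightarrow> 0"
  proof (rule Lim_null_comparison)
    show "eventually (\<lambda>n. norm (err \<sigma> v (Suc n) t y x - Psi \<sigma> v (k (x - v t)) (errlim \<sigma> v) t y) \<le> 2 * S0 * (1 / 4) ^ n) sequentially"
    proof (rule always_eventually, rule allI)
      fix n
      have "\<bar>Psi \<sigma> v (k (x - v t)) (err \<sigma> v n) t y - Psi \<sigma> v (k (x - v t)) (errlim \<sigma> v) t y\<bar> \<le> km * (2 * S0 * (1 / 4) ^ n) * G"
        by (rule Psi_diff[OF \<sigma> v err_adm[OF \<sigma> v] errlim_adm[OF \<sigma> v] k_meas1 k_near y errlim(2)[OF \<sigma> v]])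
      also have "\<dots> \<le> 2 * S0 * (1 / 4) ^ n / 4" by (rule contract) (use S0 in simp)
      also have "\<dots> \<le> 2 * S0 * (1 / 4) ^ n" using S0 by simp
      finally show "norm (err \<sigma> v (Suc n) t y x - Psi \<sigma> v (k (x - v t)) (errlim \<sigma> v) t y) \<le> 2 * S0 * (1 / 4) ^ n" by simp
    qed
    have "(\<lambda>n. 2 * S0 * (1 / 4) ^ n) \<longlonglongrightarrow> 2 * S0 * 0" by (intro tendsto_intros LIMSEQ_power_zero) simp
    then show "(\<lambda>n. 2 * S0 * (1 / 4) ^ n) \<longlonglongrightarrow> 0" by simp
  qed
  then show "(\<lambda>n. err \<sigma> v (Suc n) t y x) \<longlonglongrightarrow> Psi \<sigma> v (k (x - v t)) (errlim \<sigma> v) t y"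
    by (rule LIM_zero_cancel)
qed

lemma k_tendsto:
  assumes "f \<longlonglongrightarrow> x" "g \<longlonglongrightarrow> z" shows "(\<lambda>n. k (f n) (g n)) \<longlonglongrightarrow> k x z"
proof -
  have "isCont (\<lambda>(v, u). k v u) (x, z)" using k_cont by (simp add: continuous_on_eq_continuous_at)
  moreover have "(\<lambda>n. (f n, g n)) \<longlonglongrightarrow> (x, z)" by (intro tendsto_intros assms)
  ultimately show ?thesis using isCont_tendsto_compose[of "(x, z)" "\<lambda>(v, u). k v u"] by force
qed

lemma err_conv:
  assumes \<sigma>: "\<sigma> \<in> {1, -1}" and m: "\<And>n. mot (vn n)" "mot v" and lim: "\<And>t. (\<lambda>n. vn n t) \<longlonglongrightarrow> v t"
  shows "conv_dens (\<lambda>n. err \<sigma> (vn n) j) (err \<sigma> v j)"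
proof (induction j)
  case 0
  then show ?case by (simp add: conv_dens_def)
next
  case (Suc j)
  show ?case
    unfolding conv_dens_def err.simps
  proof (intro allI impI, elim conjE)
    fix sn :: "nat \<Rightarrow> real" and s yn y x
    assume s: "sn \<longlonglongrightarrow> s" "\<forall>n. 0 \<le> sn n" and y: "\<forall>n. yn n \<in> disk d r" "y \<in> disk d r" "\<forall>i\<in>{1..<d}. (\<lambda>n. yn n i) \<longlonglongrightarrow> y i"
    have vs: "(\<lambda>n. vn n (sn n)) \<longlonglongrightarrow> v s" by (rule mot_tendsto[OF m(1) lim s(1)])
    show "(\<lambda>n. Psi \<sigma> (vn n) (k (x - vn n (sn n))) (err \<sigma> (vn n) j) (sn n) (yn n)) \<longlonglongrightarrow> Psi \<sigma> v (k (x - v s)) (err \<sigma> v j) s y"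
      by (rule Psi_tendsto[where A = S0 and Q = km, OF \<sigma> m lim s(1) _ _ y(2) _ err_adm[OF \<sigma> m(1)] err_adm[OF \<sigma> m(2)] Suc k_meas1 k_meas1 k_near])
        (use s y in \<open>auto intro!: k_tendsto tendsto_intros vs\<close>)
  qed
qed

text \<open>The iterates converge at a rate that is uniform also in the motion, so the limit
  inherits the convergence in \<open>err_conv\<close>.\<close>

lemma errlim_conv:
  assumes \<sigma>: "\<sigma> \<in> {1, -1}" and m: "\<And>n. mot (vn n)" "mot v" and lim: "\<And>t. (\<lambda>n. vn n t) \<longlonglongrightarrow> v t"
  shows "conv_dens (\<lambda>n. errlim \<sigma> (vn n)) (errlim \<sigma> v)"
  unfolding conv_dens_def
proof (intro allI impI, elim conjE)
  fix sn :: "nat \<Rightarrow> real" and s yn y x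
  assume s: "sn \<longlonglongrightarrow> s" "\<forall>n. 0 \<le> sn n" and y: "\<forall>n. yn n \<in> disk d r" "y \<in> disk d r" "\<forall>i\<in>{1..<d}. (\<lambda>n. yn n i) \<longlonglongrightarrow> y i"
  have sp: "y \<in> space P" "yn n \<in> space P" for n using y by (auto simp: disk_def)
  show "(\<lambda>n. errlim \<sigma> (vn n) (sn n) (yn n) x) \<longlonglongrightarrow> errlim \<sigma> v s y x"
  proof (rule LIMSEQ_I)
    fix e :: real assume e: "0 < e"
    have "(\<lambda>n. 2 * S0 * (1 / 4) ^ n) \<longlonglongrightarrow> 2 * S0 * 0" by (intro tendsto_intros LIMSEQ_power_zero) simp
    then have "eventually (\<lambda>n. 2 * S0 * (1 / 4) ^ n < e / 3) sequentially" using e by (intro order_tendstoD(2)) auto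
    then obtain j where j: "2 * S0 * (1 / 4) ^ j < e / 3" by (auto simp: eventually_sequentially)
    have "(\<lambda>n. err \<sigma> (vn n) j (sn n) (yn n) x) \<longlonglongrightarrow> err \<sigma> v j s y x"
      using err_conv[OF \<sigma> m lim, of j] s y unfolding conv_dens_def by blast
    from LIMSEQ_D[OF this, of "e / 3"] e
    obtain N where N: "\<And>n. N \<le> n \<Longrightarrow> norm (err \<sigma> (vn n) j (sn n) (yn n) x - err \<sigma> v j s y x) < e / 3" by auto
    show "\<exists>no. \<forall>n\<ge>no. norm (errlim \<sigma> (vn n) (sn n) (yn n) x - errlim \<sigma> v s y x) < e"
    proof (intro exI[of _ N] allI impI)
      fix n assume "N \<le> n"
      from N[OF this] errlim(2)[OF \<sigma> m(1)[of n] sp(2)[of n], of j "sn n" x] errlim(2)[OF \<sigma> m(2) sp(1), of j s x] j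
      show "norm (errlim \<sigma> (vn n) (sn n) (yn n) x - errlim \<sigma> v s y x) < e"
        unfolding real_norm_def by linarith
    qed
  qed
qed

definition impQ where "impQ = Cl * gs powr p"

lemma impulse_near: "\<bar>\<zeta>\<bar> \<le> G \<Longrightarrow> \<bar>impulse k \<zeta>\<bar> \<le> impQ"
proof -
  assume "\<bar>\<zeta>\<bar> \<le> G"
  then have \<zeta>: "\<bar>\<zeta>\<bar> \<le> gs" using G by simp
  have "impulse k \<zeta> \<le> Cl * \<bar>\<zeta>\<bar> powr p" by (rule impulse_bounds(3)[OF \<zeta>])
  also have "\<dots> \<le> Cl * gs powr p" using \<zeta> p Cl_nonneg by (intro mult_left_mono powr_mono2) auto
  finally show ?thesis using impulse_nonneg by (simp add: impQ_def)
qed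

text \<open>The force at one end in excess of the one that \<open>f0\<close> would exert;
  \<open>force_eq\<close> confirms this for the constructed densities.\<close>

definition drag where
  "drag \<sigma> v t = (LINT y|P. indicat_real (disk d r) y * Psi \<sigma> v (impulse k) (errlim \<sigma> v) t y)"

lemma impulse_tendsto: "f \<longlonglongrightarrow> z \<Longrightarrow> z \<noteq> 0 \<Longrightarrow> (\<lambda>n. impulse k (f n)) \<longlonglongrightarrow> impulse k z"
  using continuous_on_interior[OF impulse_cont, of z] isCont_tendsto_compose[of z "impulse k" f]
  by (simp add: interior_open open_Compl)

lemma drag_meas:
  assumes \<sigma>: "\<sigma> \<in> {1, -1}" and v: "mot v"
  shows "(\<lambda>y. indicat_real (disk d r) y * Psi \<sigma> v (impulse k) (errlim \<sigma> v) t y) \<in> borel_measurable P"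
proof -
  have "(\<lambda>y. Psi \<sigma> v (impulse k) (errlim \<sigma> v) t y) \<in> borel_measurable P"
    by (rule Psi_meas[OF v errlim_adm[OF \<sigma> v], where q = "\<lambda>_. impulse k"]) measurable
  then show ?thesis by measurable
qed

lemma drag_dom:
  assumes \<sigma>: "\<sigma> \<in> {1, -1}" and v: "mot v"
  shows "\<bar>indicat_real (disk d r) y * Psi \<sigma> v (impulse k) (errlim \<sigma> v) t y\<bar> \<le> impQ * (2 * S0) * G * indicat_real (disk d r) y"
proof -
  have "\<bar>Psi \<sigma> v (impulse k) (errlim \<sigma> v) t y\<bar> \<le> impQ * (S0 + cJ + aM) * G"
    by (rule Psi_bound[OF \<sigma> v errlim_adm[OF \<sigma> v] impulse_near])
  also have "S0 + cJ + aM = 2 * S0" by (simp add: S0_def)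
  finally show ?thesis by (simp add: indicator_def)
qed

lemma drag_bound:
  assumes \<sigma>: "\<sigma> \<in> {1, -1}" and v: "mot v"
  shows "\<bar>drag \<sigma> v t\<bar> \<le> impQ * (2 * S0) * G * mu"
  unfolding drag_def
  by (rule LINT_abs_le[OF has_bochner_integral_mult_right[OF disk_int]], rule AE_I2) (rule drag_dom[OF \<sigma> v])

lemma drag_tendsto:
  assumes \<sigma>: "\<sigma> \<in> {1, -1}" and m: "\<And>n. mot (vn n)" "mot v" and lim: "\<And>t. (\<lambda>n. vn n t) \<longlonglongrightarrow> v t"
    and t: "tn \<longlonglongrightarrow> t" "\<And>n. 0 \<le> tn n"
  shows "(\<lambda>n. drag \<sigma> (vn n) (tn n)) \<longlonglongrightarrow> drag \<sigma> v t"
  unfolding drag_def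
proof (rule integral_dominated_convergence[where w = "\<lambda>y. impQ * (2 * S0) * G * indicat_real (disk d r) y"])
  show "integrable P (\<lambda>y. impQ * (2 * S0) * G * indicat_real (disk d r) y)"
    using disk_int by (auto simp: has_bochner_integral_iff)
  show "AE y in P. norm (indicat_real (disk d r) y * Psi \<sigma> (vn n) (impulse k) (errlim \<sigma> (vn n)) (tn n) y) \<le> impQ * (2 * S0) * G * indicat_real (disk d r) y" for n
    unfolding real_norm_def by (rule AE_I2) (rule drag_dom[OF \<sigma> m(1)])
  show "AE y in P. (\<lambda>n. indicat_real (disk d r) y * Psi \<sigma> (vn n) (impulse k) (errlim \<sigma> (vn n)) (tn n) y) \<longlonglongrightarrow>
      indicat_real (disk d r) y * Psi \<sigma> v (impulse k) (errlim \<sigma> v) t y"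
  proof (rule AE_I2)
    fix y
    show "(\<lambda>n. indicat_real (disk d r) y * Psi \<sigma> (vn n) (impulse k) (errlim \<sigma> (vn n)) (tn n) y) \<longlonglongrightarrow>
      indicat_real (disk d r) y * Psi \<sigma> v (impulse k) (errlim \<sigma> v) t y"
    proof (cases "y \<in> disk d r")
      case True
      have "(\<lambda>n. Psi \<sigma> (vn n) (impulse k) (errlim \<sigma> (vn n)) (tn n) y) \<longlonglongrightarrow> Psi \<sigma> v (impulse k) (errlim \<sigma> v) t y"
        by (rule Psi_tendsto[where A = S0 and Q = impQ, OF \<sigma> m lim t True True tendsto_const errlim_adm[OF \<sigma> m(1)] errlim_adm[OF \<sigma> m(2)]
             errlim_conv[OF \<sigma> m lim] _ _ impulse_near])
          (auto intro!: impulse_tendsto tendsto_intros mot_tendsto[OF m(1) lim t(1)])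
      then show ?thesis by (intro tendsto_intros)
    qed simp
  qed
qed (rule drag_meas[OF \<sigma>], rule m)+

text \<open>Densities at time \<open>t\<close> involve the motion only up to \<open>t\<close>, since
  contact times precede \<open>t\<close>. This lets the delay scheme below stabilise.\<close>

lemma err_causal:
  assumes v: "\<And>s. s \<le> T \<Longrightarrow> v s = v' s" and t: "t \<le> T"
  shows "err \<sigma> v n t y x = err \<sigma> v' n t y x"
proof -
  have pos: "pos v s = pos v' s" if "s \<le> T" for s
  proof -
    have "integral {0..s} v = integral {0..s} v'"
      by (rule Henstock_Kurzweil_Integration.integral_cong) (use v that in auto)
    then show ?thesis by (simp add: pos_def)
  qed
  have pt: "ptau \<sigma> (pos v) s z = ptau \<sigma> (pos v') s z" if "s \<le> T" for s z
    unfolding ptau_def by (rule tau_cong) (use pos that in auto)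
  have Psi: "Psi \<sigma> v q e s y = Psi \<sigma> v' q e' s y"
    if "s \<le> T" "\<And>s y x. s \<le> T \<Longrightarrow> e s y x = e' s y x" for q e e' s y
  proof -
    have le: "ptau \<sigma> (pos v') s z \<le> T" if "0 < ptau \<sigma> (pos v') s z" for z
    proof -
      have "0 \<le> s" using that tau_eq_0[of s] by (force simp: ptau_def)
      then show ?thesis using tau_le[of s "\<lambda>s. - \<sigma> * pos v' s" "- \<sigma> * z"] \<open>s \<le> T\<close> by (simp add: ptau_def)
    qed
    have "pert \<sigma> v e s y u = pert \<sigma> v' e' s y u" for u
      unfolding pert_def hit_def pt[OF \<open>s \<le> T\<close>] using le[of "fst u"] v that(2) by auto
    then show ?thesis using v[OF \<open>s \<le> T\<close>] by (simp add: Psi_def)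
  qed
  show ?thesis using t
  proof (induction n arbitrary: t y x)
    case (Suc n)
    have "Psi \<sigma> v q (err \<sigma> v n) t y = Psi \<sigma> v' q (err \<sigma> v' n) t y" for q
      by (rule Psi) (use Suc in auto)
    then show ?case using v[OF Suc.prems] by simp
  qed simp
qed

lemma drag_causal:
  assumes v: "\<And>s. s \<le> T \<Longrightarrow> v s = v' s" and t: "t \<le> T"
  shows "drag \<sigma> v t = drag \<sigma> v' t"
proof -
  have e: "errlim \<sigma> v s y x = errlim \<sigma> v' s y x" if "s \<le> T" for s y x
    using err_causal[of T v v' s, OF v that] by (simp add: errlim_def)
  have pos: "pos v s = pos v' s" if "s \<le> T" for s
  proof -
    have "integral {0..s} v = integral {0..s} v'"
      by (rule Henstock_Kurzweil_Integration.integral_cong) (use v that in auto)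
    then show ?thesis by (simp add: pos_def)
  qed
  have pt: "ptau \<sigma> (pos v) t z = ptau \<sigma> (pos v') t z" for z
    unfolding ptau_def by (rule tau_cong) (use pos t in auto)
  have le: "ptau \<sigma> (pos v') t z \<le> T" if "0 < ptau \<sigma> (pos v') t z" for z
  proof -
    have "0 \<le> t" using that tau_eq_0[of t] by (force simp: ptau_def)
    then show ?thesis using tau_le[of t "\<lambda>s. - \<sigma> * pos v' s" "- \<sigma> * z"] t by (simp add: ptau_def)
  qed
  have "pert \<sigma> v (errlim \<sigma> v) t y u = pert \<sigma> v' (errlim \<sigma> v') t y u" for y u
    unfolding pert_def hit_def pt using le[of "fst u"] v e by auto
  then show ?thesis using v[OF t] by (simp add: drag_def Psi_def)
qed

end

section \<open>Existence of the motion\<close>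

text \<open>\<open>L\<close> bounds the acceleration of every motion in \<open>mot\<close>, so one
  step of the scheme maps the class to itself.\<close>

locale tonelli = small_motion +
  fixes E V0 FB :: real
  assumes F0_cont: "continuous_on UNIV (F0 d r k f0)"
    and FB: "\<And>w. \<bar>w - Vinf\<bar> \<le> G / 2 \<Longrightarrow> \<bar>E - F0 d r k f0 w\<bar> \<le> FB"
    and L_ge: "FB + 2 * (impQ * (2 * S0) * G * mu) \<le> L"
    and V0: "\<bar>V0 - Vinf\<bar> \<le> G / 2"
begin

definition acc where
  "acc v t = E - F0 d r k f0 (v t) - (drag 1 v t - drag (-1) v t)"

lemma acc_bound: assumes v: "mot v" shows "\<bar>acc v t\<bar> \<le> L"
  using FB[OF mot_range[OF v, of t]] drag_bound[of 1, OF _ v, of t] drag_bound[of "-1", OF _ v, of t] L_ge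
  unfolding acc_def by simp

lemma acc_tendsto:
  assumes m: "\<And>n. mot (vn n)" "mot v" and lim: "\<And>t. (\<lambda>n. vn n t) \<longlonglongrightarrow> v t"
    and t: "tn \<longlonglongrightarrow> t" "\<And>n. 0 \<le> tn n"
  shows "(\<lambda>n. acc (vn n) (tn n)) \<longlonglongrightarrow> acc v t"
proof -
  have "isCont (F0 d r k f0) (v t)" using F0_cont by (simp add: continuous_on_eq_continuous_at)
  then have "(\<lambda>n. F0 d r k f0 (vn n (tn n))) \<longlonglongrightarrow> F0 d r k f0 (v t)"
    by (rule isCont_tendsto_compose) (rule mot_tendsto[OF m(1) lim t(1)])
  then show ?thesis unfolding acc_def
    by (intro tendsto_intros drag_tendsto[OF _ m lim t]) auto
qed

lemma acc_cont: assumes v: "mot v" shows "continuous_on {0..} (acc v)"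
  unfolding continuous_on_sequentially
proof (intro allI ballI impI)
  fix x :: "nat \<Rightarrow> real" and a assume "a \<in> {0..}" and x: "(\<forall>n. x n \<in> {0..}) \<and> x \<longlonglongrightarrow> a"
  show "(acc v \<circ> x) \<longlonglongrightarrow> acc v a"
    unfolding comp_def by (rule acc_tendsto[OF v v tendsto_const]) (use x in auto)
qed

lemma acc_causal: "(\<And>s. s \<le> T \<Longrightarrow> v s = v' s) \<Longrightarrow> t \<le> T \<Longrightarrow> acc v t = acc v' t"
  using drag_causal[of T v v' t] by (simp add: acc_def)

text \<open>Truncation keeps every approximation in \<open>mot\<close>, whatever the force does; it
  is shown to be inactive once the a priori estimate is available.\<close>

definition clamp where "clamp x = max (Vinf - G / 2) (min (Vinf + G / 2) x)"

lemma clamp_range: "\<bar>clamp x - Vinf\<bar> \<le> G / 2"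
proof -
  have "Vinf - G / 2 \<le> clamp x" "clamp x \<le> Vinf + G / 2" using G by (auto simp: clamp_def)
  then show ?thesis by linarith
qed

lemma clamp_lip: "\<bar>clamp x - clamp y\<bar> \<le> \<bar>x - y\<bar>"
  using G by (auto simp: clamp_def max_def min_def)

lemma clamp_id: "\<bar>x - Vinf\<bar> \<le> G / 2 \<Longrightarrow> clamp x = x"
proof -
  assume "\<bar>x - Vinf\<bar> \<le> G / 2"
  then have "Vinf - G / 2 \<le> x" "x \<le> Vinf + G / 2" by linarith+
  then show ?thesis by (simp add: clamp_def)
qed

lemma clamp_tendsto: "(f \<longlongrightarrow> l) F \<Longrightarrow> ((\<lambda>n. clamp (f n)) \<longlongrightarrow> clamp l) F"
  unfolding clamp_def by (intro tendsto_intros)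

definition step where
  "step n v t = clamp (V0 + integral {0..max 0 (t - 1 / real (Suc n))} (acc v))"

definition iter where "iter n m = (step n ^^ m) (\<lambda>_. V0)"

lemma step_mot: assumes v: "mot v" shows "mot (step n v)"
  unfolding mot_def
proof (intro conjI allI)
  fix s t
  have "\<bar>step n v s - step n v t\<bar> \<le>
    \<bar>integral {0..max 0 (s - 1 / real (Suc n))} (acc v) - integral {0..max 0 (t - 1 / real (Suc n))} (acc v)\<bar>"
    unfolding step_def by (rule order_trans[OF clamp_lip]) simp
  also have "\<dots> \<le> L * \<bar>max 0 (s - 1 / real (Suc n)) - max 0 (t - 1 / real (Suc n))\<bar>"
    by (rule integral_lip[OF acc_cont[OF v] acc_bound[OF v]]) auto
  also have "\<dots> \<le> L * \<bar>s - t\<bar>" using L by (intro mult_left_mono) auto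
  finally show "\<bar>step n v s - step n v t\<bar> \<le> L * \<bar>s - t\<bar>" .
  show "\<bar>step n v t - Vinf\<bar> \<le> G / 2" unfolding step_def by (rule clamp_range)
qed

lemma iter_mot: "mot (iter n m)"
proof (induction m)
  case 0
  then show ?case using V0 L by (simp add: iter_def mot_def)
next
  case (Suc m)
  then show ?case using step_mot by (simp add: iter_def)
qed

text \<open>The next iterate at time \<open>t\<close> depends only on the previous one up to
  \<open>t\<close> minus the delay, so each iteration settles the motion on a further interval of
  length \<open>1 / real (Suc n)\<close>.\<close>

lemma iter_stable: "t \<le> real m / real (Suc n) \<Longrightarrow> iter n (Suc m) t = iter n m t"
proof (induction m arbitrary: t)
  case 0
  then have "t \<le> 0" by simp
  moreover have "0 \<le> 1 / real (Suc n)" by simp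
  ultimately have "t - 1 / real (Suc n) \<le> 0" by linarith
  then have "max 0 (t - 1 / real (Suc n)) = 0" by simp
  then show ?case using clamp_id[OF V0] by (simp add: iter_def step_def)
next
  case (Suc m)
  have e: "t - 1 / real (Suc n) \<le> real m / real (Suc n)"
  proof -
    have "real (Suc m) / real (Suc n) = real m / real (Suc n) + 1 / real (Suc n)" by (simp add: add_divide_distrib)
    then show ?thesis using Suc.prems by linarith
  qed
  have "integral {0..max 0 (t - 1 / real (Suc n))} (acc (iter n (Suc m))) = integral {0..max 0 (t - 1 / real (Suc n))} (acc (iter n m))"
  proof (rule Henstock_Kurzweil_Integration.integral_cong)
    fix s assume "s \<in> {0..max 0 (t - 1 / real (Suc n))}"
    then have "s \<le> real m / real (Suc n)" using e by (auto simp: max_def split: if_splits)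
    then show "acc (iter n (Suc m)) s = acc (iter n m) s" using Suc.IH by (rule acc_causal[rotated])
  qed
  then have "step n (iter n (Suc m)) t = step n (iter n m) t" by (simp add: step_def)
  then show ?case by (simp add: iter_def)
qed

text \<open>\<open>n * Suc n\<close> iterations with delay \<open>1 / real (Suc n)\<close> settle
  the delayed equation up to time \<open>n\<close>.\<close>

definition approx where "approx n = iter n (n * Suc n)"

lemma approx_eq: "t \<le> real n \<Longrightarrow> approx n t = step n (approx n) t"
proof -
  assume "t \<le> real n"
  moreover have "real (n * Suc n) / real (Suc n) = real n"
    unfolding of_nat_mult by (rule nonzero_mult_div_cancel_right) simp
  ultimately have "t \<le> real (n * Suc n) / real (Suc n)" by (simp only:)
  from iter_stable[OF this] show ?thesis by (simp add: approx_def iter_def)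
qed

text \<open>A subsequence of the delayed motions converges at all rational times, hence by the
  common Lipschitz bound at all times, and the delay vanishes in the limit. \<open>U\<close> is the
  motion before truncation; unlike \<open>v\<close> it is differentiable even where the truncation
  sets in.\<close>

lemma motion_exists:
  obtains v U where "mot v" "U 0 = V0" "continuous_on {0..} (acc v)"
    "\<And>t. 0 \<le> t \<Longrightarrow> (U has_real_derivative acc v t) (at t within {0..})"
    "\<And>t. 0 \<le> t \<Longrightarrow> v t = clamp (U t)"
proof -
  have bnd: "norm (approx n q) \<le> \<bar>Vinf\<bar> + G" for n q
    using mot_range[OF iter_mot, of n "n * Suc n" q] G unfolding approx_def real_norm_def by linarith
  obtain \<kappa> :: "nat \<Rightarrow> nat" where \<kappa>: "strict_mono \<kappa>" "\<And>q. q \<in> \<rat> \<Longrightarrow> \<exists>l. (\<lambda>n. approx (\<kappa> n) q) \<longlonglongrightarrow> l"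
    using function_convergent_subsequence[of "\<rat> :: real set" approx "\<bar>Vinf\<bar> + G"] bnd countable_rat by blast
  define w where "w n = approx (\<kappa> n)" for n
  have wm: "mot (w n)" for n by (simp add: w_def approx_def iter_mot)
  have "Cauchy (\<lambda>n. w n t)" for t
  proof (rule metric_CauchyI)
    fix e :: real assume e: "0 < e"
    define \<delta> where "\<delta> = e / 4 / (L + 1)"
    have \<delta>: "0 < \<delta>" "L * \<delta> \<le> e / 4"
    proof -
      show "0 < \<delta>" using e L by (simp add: \<delta>_def)
      then have le: "L * \<delta> \<le> (L + 1) * \<delta>" by (intro mult_right_mono) auto
      have "c * (x / c) = x" if "c \<noteq> 0" for c x :: real by (simp add: that)
      then have "(L + 1) * \<delta> = e / 4" using L unfolding \<delta>_def by (metis add_nonneg_pos less_irrefl zero_less_one)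
      then show "L * \<delta> \<le> e / 4" using le by simp
    qed
    obtain q where q: "q \<in> \<rat>" "t < q" "q < t + \<delta>" using Rats_dense_in_real[of t "t + \<delta>"] \<delta> by auto
    have "Cauchy (\<lambda>n. w n q)" using \<kappa>(2)[OF q(1)] unfolding w_def by (intro convergent_Cauchy) (auto simp: convergent_def)
    then obtain N where N: "\<And>m n. N \<le> m \<Longrightarrow> N \<le> n \<Longrightarrow> dist (w m q) (w n q) < e / 4"
      using e unfolding Cauchy_def by (metis zero_less_divide_iff zero_less_numeral)
    have lip: "\<bar>w n t - w n q\<bar> \<le> e / 4" for n
    proof -
      have "\<bar>w n t - w n q\<bar> \<le> L * \<bar>t - q\<bar>" by (rule mot_lip[OF wm])
      also have "\<dots> \<le> L * \<delta>" using q L by (intro mult_left_mono) auto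
      finally show ?thesis using \<delta>(2) by simp
    qed
    show "\<exists>M. \<forall>m\<ge>M. \<forall>n\<ge>M. dist (w m t) (w n t) < e"
    proof (intro exI[of _ N] allI impI)
      fix m n assume "N \<le> m" "N \<le> n"
      then show "dist (w m t) (w n t) < e"
        using N[of m n] lip[of m] lip[of n] e unfolding dist_real_def by linarith
    qed
  qed
  then have lim: "(\<lambda>n. w n t) \<longlonglongrightarrow> lim (\<lambda>n. w n t)" for t
    by (simp add: Cauchy_convergent_iff convergent_LIMSEQ_iff)
  define v where "v t = lim (\<lambda>n. w n t)" for t
  have lim: "(\<lambda>n. w n t) \<longlonglongrightarrow> v t" for t using lim by (simp add: v_def)
  have vm: "mot v"
    unfolding mot_def
  proof (intro conjI allI)
    fix s t
    have "(\<lambda>n. \<bar>w n s - w n t\<bar>) \<longlonglongrightarrow> \<bar>v s - v t\<bar>" by (intro tendsto_intros lim)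
    then show "\<bar>v s - v t\<bar> \<le> L * \<bar>s - t\<bar>" by (rule LIMSEQ_le_const2) (use mot_lip[OF wm] in auto)
    have "(\<lambda>n. \<bar>w n t - Vinf\<bar>) \<longlonglongrightarrow> \<bar>v t - Vinf\<bar>" by (intro tendsto_intros lim)
    then show "\<bar>v t - Vinf\<bar> \<le> G / 2" by (rule LIMSEQ_le_const2) (use mot_range[OF wm] in auto)
  qed
  define U where "U t = V0 + integral {0..t} (acc v)" for t
  have veq: "v t = clamp (U t)" if t: "0 \<le> t" for t
  proof (rule LIMSEQ_unique[OF lim])
    have 1: "(\<lambda>n. integral {0..t} (acc (w n))) \<longlonglongrightarrow> integral {0..t} (acc v)"
    proof (rule dominated_convergence(2)[where h = "\<lambda>_. L"])
      show "acc (w n) integrable_on {0..t}" for n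
        by (rule integrable_continuous_interval) (rule continuous_on_subset[OF acc_cont[OF wm]], auto)
      show "(\<lambda>n. acc (w n) s) \<longlonglongrightarrow> acc v s" if "s \<in> {0..t}" for s
        using that by (intro acc_tendsto[OF wm vm lim tendsto_const]) auto
    qed (use acc_bound[OF wm] in auto)
    have 2: "(\<lambda>n. integral {0..max 0 (t - 1 / real (Suc (\<kappa> n)))} (acc (w n)) - integral {0..t} (acc (w n))) \<longlonglongrightarrow> 0"
    proof (rule Lim_null_comparison)
      show "eventually (\<lambda>n. norm (integral {0..max 0 (t - 1 / real (Suc (\<kappa> n)))} (acc (w n)) - integral {0..t} (acc (w n))) \<le> L * (1 / real (Suc n))) sequentially"
      proof (rule always_eventually, rule allI)
        fix n
        have "\<bar>integral {0..max 0 (t - 1 / real (Suc (\<kappa> n)))} (acc (w n)) - integral {0..t} (acc (w n))\<bar> \<le> L * \<bar>max 0 (t - 1 / real (Suc (\<kappa> n))) - t\<bar>"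
          using t by (intro integral_lip acc_cont[OF wm] acc_bound[OF wm]) auto
        also have "\<dots> \<le> L * (1 / real (Suc (\<kappa> n)))" using t L by (intro mult_left_mono) auto
        also have "\<dots> \<le> L * (1 / real (Suc n))"
          using strict_mono_imp_increasing[OF \<kappa>(1), of n] L by (intro mult_left_mono divide_left_mono) auto
        finally show "norm (integral {0..max 0 (t - 1 / real (Suc (\<kappa> n)))} (acc (w n)) - integral {0..t} (acc (w n))) \<le> L * (1 / real (Suc n))" by simp
      qed
      have "(\<lambda>n. L * (1 / real (Suc n))) \<longlonglongrightarrow> L * 0"
        by (intro tendsto_mult tendsto_const) (use LIMSEQ_inverse_real_of_nat in \<open>simp add: inverse_eq_divide\<close>)
      then show "(\<lambda>n. L * (1 / real (Suc n))) \<longlonglongrightarrow> 0" by simp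
    qed
    have "(\<lambda>n. clamp (V0 + (integral {0..max 0 (t - 1 / real (Suc (\<kappa> n)))} (acc (w n)) - integral {0..t} (acc (w n)) + integral {0..t} (acc (w n)))))
       \<longlonglongrightarrow> clamp (V0 + (0 + integral {0..t} (acc v)))"
      by (intro clamp_tendsto tendsto_intros 1 2)
    then have "(\<lambda>n. step (\<kappa> n) (w n) t) \<longlonglongrightarrow> clamp (U t)" by (simp add: step_def U_def)
    moreover have "eventually (\<lambda>n. step (\<kappa> n) (w n) t = w n t) sequentially"
      using eventually_ge_at_top[of "nat \<lceil>t\<rceil>"]
    proof (rule eventually_mono)
      fix n assume "nat \<lceil>t\<rceil> \<le> n"
      then have "t \<le> real n" by linarith
      also have "\<dots> \<le> real (\<kappa> n)" using strict_mono_imp_increasing[OF \<kappa>(1), of n] by simp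
      finally show "step (\<kappa> n) (w n) t = w n t" using approx_eq[of t "\<kappa> n"] by (simp add: w_def)
    qed
    ultimately show "(\<lambda>n. w n t) \<longlonglongrightarrow> clamp (U t)" by (rule Lim_transform_eventually)
  qed
  show thesis
  proof (rule that[OF vm _ acc_cont[OF vm] _ veq])
    show "U 0 = V0" by (simp add: U_def)
    show "(U has_real_derivative acc v t) (at t within {0..})" if "0 \<le> t" for t
      unfolding U_def[abs_def] using DERIV_add[OF DERIV_const integral_deriv[OF acc_cont[OF vm] that]] by simp
  qed
qed

end

section \<open>The solution determined by a motion\<close>

context kinetic begin

lemma U_nn:
  assumes [measurable]: "g \<in> borel_measurable borel" and nn: "\<And>x. 0 \<le> g x"
  shows "(\<integral>\<^sup>+u. ennreal (g (fst u) * b (snd u)) \<partial>U) = (\<integral>\<^sup>+x. ennreal (g x) \<partial>lborel)"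
proof -
  have b1: "(\<integral>\<^sup>+w. ennreal (b w) \<partial>P) = 1"
    using b_int nn_integral_eq_integral[of P b] b_nonneg by (simp add: has_bochner_integral_iff)
  have [measurable]: "(\<lambda>u. ennreal (g (fst u) * b (snd u))) \<in> borel_measurable (lborel \<Otimes>\<^sub>M P)" by measurable
  have "(\<integral>\<^sup>+u. ennreal (g (fst u) * b (snd u)) \<partial>U) = (\<integral>\<^sup>+x. \<integral>\<^sup>+w. ennreal (g x * b w) \<partial>P \<partial>lborel)"
    unfolding vec_measure_def
    by (subst sigma_finite_measure.nn_integral_fst[OF sf_perp, symmetric]) simp_all
  also have "\<dots> = (\<integral>\<^sup>+x. ennreal (g x) * (\<integral>\<^sup>+w. ennreal (b w) \<partial>P) \<partial>lborel)"
  proof (rule nn_integral_cong)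
    fix x
    have "(\<integral>\<^sup>+w. ennreal (g x * b w) \<partial>P) = (\<integral>\<^sup>+w. ennreal (g x) * ennreal (b w) \<partial>P)"
      using nn b_nonneg by (intro nn_integral_cong) (simp add: ennreal_mult)
    then show "(\<integral>\<^sup>+w. ennreal (g x * b w) \<partial>P) = ennreal (g x) * (\<integral>\<^sup>+w. ennreal (b w) \<partial>P)"
      by (simp add: nn_integral_cmult)
  qed
  finally show ?thesis by (simp add: b1)
qed

lemma impulse_ge_square: "w\<^sup>2 \<le> impulse k w"
  unfolding impulse_def second_moment_def set_lebesgue_integral_def
  using k_nonneg by (simp add: integral_nonneg_AE)

text \<open>The impulse dominates the square, so its integrability against \<open>f0\<close> gives a
  finite second moment of \<open>a0\<close>; near \<open>V\<close> the bound \<open>aM\<close>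
  suffices.\<close>

lemma a0_moment: "(\<integral>\<^sup>+z. ennreal (\<bar>z - V\<bar> * a0 z) \<partial>lborel) < \<infinity>"
proof -
  have "(\<integral>\<^sup>+z. ennreal ((z - V)\<^sup>2 * a0 z) \<partial>lborel) = (\<integral>\<^sup>+u. ennreal ((fst u - V)\<^sup>2 * a0 (fst u) * b (snd u)) \<partial>U)"
    using a0_nonneg by (intro U_nn[symmetric]) auto
  also have "\<dots> \<le> (\<integral>\<^sup>+u. ennreal (norm (impulse k (fst u - V) * f0 u)) \<partial>U)"
  proof (intro nn_integral_mono ennreal_leI)
    fix u assume u: "u \<in> space U"
    have "0 \<le> a0 (fst u) * b (snd u)" using u a0_nonneg by (auto simp: space_vec_measure b_nonneg)
    then have "(fst u - V)\<^sup>2 * (a0 (fst u) * b (snd u)) \<le> impulse k (fst u - V) * (a0 (fst u) * b (snd u))"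
      by (intro mult_right_mono impulse_ge_square)
    then show "(fst u - V)\<^sup>2 * a0 (fst u) * b (snd u) \<le> norm (impulse k (fst u - V) * f0 u)"
      by (simp add: f0_eq mult.assoc)
  qed
  also have "\<dots> < \<infinity>" using impulse_int[of V] by (simp add: integrable_iff_bounded)
  finally have 1: "(\<integral>\<^sup>+z. ennreal ((z - V)\<^sup>2 * a0 z) \<partial>lborel) < \<infinity>" .
  have "(\<integral>\<^sup>+z. ennreal (\<bar>z - V\<bar> * a0 z) \<partial>lborel) \<le> (\<integral>\<^sup>+z. ennreal ((z - V)\<^sup>2 * a0 z) + ennreal aM * indicator {V - 1..V + 1} z \<partial>lborel)"
  proof (rule nn_integral_mono)
    fix z
    show "ennreal (\<bar>z - V\<bar> * a0 z) \<le> ennreal ((z - V)\<^sup>2 * a0 z) + ennreal aM * indicator {V - 1..V + 1} z"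
    proof (cases "\<bar>z - V\<bar> \<le> 1")
      case True
      then have i: "indicator {V - 1..V + 1} z = (1 :: ennreal)" by (auto simp: indicator_def abs_le_iff)
      have "\<bar>z - V\<bar> * a0 z \<le> 1 * aM" using True a0_le[of z] a0_nonneg[of z] by (intro mult_mono) auto
      then have "ennreal (\<bar>z - V\<bar> * a0 z) \<le> ennreal aM" by (simp add: ennreal_leI)
      then show ?thesis using i by (simp add: add_increasing)
    next
      case False
      then have "\<bar>z - V\<bar> * 1 \<le> \<bar>z - V\<bar> * \<bar>z - V\<bar>" by (intro mult_left_mono) auto
      then have "\<bar>z - V\<bar> \<le> (z - V)\<^sup>2" by (simp add: power2_eq_square abs_mult[symmetric])
      then have "\<bar>z - V\<bar> * a0 z \<le> (z - V)\<^sup>2 * a0 z" using a0_nonneg by (intro mult_right_mono)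
      then show ?thesis by (simp add: ennreal_leI add_increasing2)
    qed
  qed
  also have "\<dots> = (\<integral>\<^sup>+z. ennreal ((z - V)\<^sup>2 * a0 z) \<partial>lborel) + ennreal aM * emeasure lborel {V - 1..V + 1}"
    by (subst nn_integral_add) (auto simp: nn_integral_cmult_indicator)
  also have "\<dots> < \<infinity>" using 1 by (simp add: ennreal_mult_less_top)
  finally show ?thesis .
qed

end

locale solution_build = small_motion +
  fixes H :: real and K :: "vec \<Rightarrow> vec \<Rightarrow> real" and KS :: "perp \<Rightarrow> vec \<Rightarrow> vec \<Rightarrow> real" and v :: "real \<Rightarrow> real"
  assumes H: "0 < H" and K_eq: "\<And>v u. K v u = k (fst v) (fst u) * b (snd v)"
    and mass: "\<And>u. (\<integral>\<^sup>+x. ennreal (indicat_real {0..} x * (x * k x u)) \<partial>lborel) = ennreal \<bar>u\<bar>"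
    and k_even: "\<And>x u. k (- x) u = k x u" and v: "mot v"
begin

text \<open>At large outgoing speeds the domination hypothesis gives nothing. But by mass
  conservation the reflected density, weighted with the relative outgoing speed, has total mass at
  most the first absolute moment of \<open>a0\<close> about \<open>V\<close>, which is finite; so
  the reflection integral converges for almost every \<open>x\<close>.\<close>

lemma J_int_AE:
  assumes \<sigma>: "\<sigma> \<in> {1, -1}"
  shows "AE x in lborel. 0 < \<sigma> * (x - V) \<longrightarrow>
    has_bochner_integral lborel (\<lambda>z. of_bool (\<sigma> * (z - V) \<le> 0) * (k (x - V) (z - V) * a0 z)) (J \<sigma> V x)"
proof -
  define c where "c x = indicat_real {0..} (\<sigma> * (x - V)) * (\<sigma> * (x - V))" for x
  have c0: "0 \<le> c x" for x by (auto simp: c_def indicator_def)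
  have [measurable]: "c \<in> borel_measurable borel" unfolding c_def by measurable
  have kk: "k (\<sigma> * y) u = k y u" for y u using \<sigma> k_even by auto
  have in_eq: "(\<integral>\<^sup>+x. ennreal (c x * k (x - V) u) \<partial>lborel) = ennreal \<bar>u\<bar>" for u
  proof -
    have "(\<integral>\<^sup>+x. ennreal (c x * k (x - V) u) \<partial>lborel) = \<bar>\<sigma>\<bar> * (\<integral>\<^sup>+y. ennreal (c (V + \<sigma> * y) * k (V + \<sigma> * y - V) u) \<partial>lborel)"
      using \<sigma> by (intro nn_integral_real_affine) auto
    also have "\<dots> = (\<integral>\<^sup>+y. ennreal (indicat_real {0..} y * (y * k y u)) \<partial>lborel)"
      using \<sigma> by (auto simp: c_def kk mult.assoc k_even)
    finally show ?thesis by (simp add: mass)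
  qed
  have "(\<integral>\<^sup>+x. \<integral>\<^sup>+z. ennreal (c x * k (x - V) (z - V) * a0 z) \<partial>lborel \<partial>lborel) =
      (\<integral>\<^sup>+z. \<integral>\<^sup>+x. ennreal (c x * k (x - V) (z - V) * a0 z) \<partial>lborel \<partial>lborel)"
    by (intro lborel_pair.Fubini'[symmetric]) measurable
  also have "\<dots> = (\<integral>\<^sup>+z. ennreal (\<bar>z - V\<bar> * a0 z) \<partial>lborel)"
  proof (rule nn_integral_cong)
    fix z
    have "(\<integral>\<^sup>+x. ennreal (c x * k (x - V) (z - V) * a0 z) \<partial>lborel) = (\<integral>\<^sup>+x. ennreal (c x * k (x - V) (z - V)) * ennreal (a0 z) \<partial>lborel)"
      using c0 k_nonneg a0_nonneg by (intro nn_integral_cong) (simp add: ennreal_mult)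
    also have "\<dots> = ennreal \<bar>z - V\<bar> * ennreal (a0 z)" by (subst nn_integral_multc) (auto simp: in_eq)
    finally show "(\<integral>\<^sup>+x. ennreal (c x * k (x - V) (z - V) * a0 z) \<partial>lborel) = ennreal (\<bar>z - V\<bar> * a0 z)"
      using a0_nonneg by (simp add: ennreal_mult)
  qed
  finally have fin: "(\<integral>\<^sup>+x. \<integral>\<^sup>+z. ennreal (c x * k (x - V) (z - V) * a0 z) \<partial>lborel \<partial>lborel) \<noteq> \<infinity>"
    using a0_moment[of V] by simp
  have "AE x in lborel. (\<integral>\<^sup>+z. ennreal (c x * k (x - V) (z - V) * a0 z) \<partial>lborel) \<noteq> \<infinity>"
    by (rule nn_integral_PInf_AE[OF _ fin]) measurable
  then show ?thesis
  proof (rule eventually_mono, intro impI)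
    fix x assume x: "(\<integral>\<^sup>+z. ennreal (c x * k (x - V) (z - V) * a0 z) \<partial>lborel) \<noteq> \<infinity>" "0 < \<sigma> * (x - V)"
    have cx: "0 < c x" using x by (simp add: c_def)
    have "(\<integral>\<^sup>+z. ennreal (c x * k (x - V) (z - V) * a0 z) \<partial>lborel) = (\<integral>\<^sup>+z. ennreal (c x) * ennreal (k (x - V) (z - V) * a0 z) \<partial>lborel)"
      using c0 k_nonneg a0_nonneg by (intro nn_integral_cong) (simp add: ennreal_mult mult.assoc)
    also have "\<dots> = ennreal (c x) * (\<integral>\<^sup>+z. ennreal (k (x - V) (z - V) * a0 z) \<partial>lborel)"
      by (rule nn_integral_cmult) measurable
    finally have "(\<integral>\<^sup>+z. ennreal (k (x - V) (z - V) * a0 z) \<partial>lborel) < \<infinity>"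
      using x(1) cx by (auto simp: ennreal_mult_eq_top_iff less_top)
    then have i: "integrable lborel (\<lambda>z. k (x - V) (z - V) * a0 z)"
      using k_nonneg a0_nonneg by (intro integrableI_nonneg) auto
    show "has_bochner_integral lborel (\<lambda>z. of_bool (\<sigma> * (z - V) \<le> 0) * (k (x - V) (z - V) * a0 z)) (J \<sigma> V x)"
      unfolding J_def
    proof (rule has_bochner_integral_integrable, rule Bochner_Integration.integrable_bound[OF i])
      show "AE z in lborel. norm (of_bool (\<sigma> * (z - V) \<le> 0) * (k (x - V) (z - V) * a0 z)) \<le> norm (k (x - V) (z - V) * a0 z)"
        by (rule AE_I2) (auto simp: abs_mult)
    qed measurable
  qed
qed

definition Fm where "Fm \<sigma> t y u = f0 u + pert \<sigma> v (errlim \<sigma> v) t y u"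

definition Fp where "Fp \<sigma> t y x = b (snd x) * (J \<sigma> (v t) (fst x) + errlim \<sigma> v t y (fst x))"

text \<open>The ends are told apart by their horizontal position, which is possible because
  \<open>H > 0\<close>; all other points carry the lateral densities.\<close>

definition fm :: density where
  "fm t x u = (if fst x = pos v t + H then Fm 1 t (snd x) u
     else if fst x = pos v t - H then Fm (-1) t (snd x) u else f0 u)"

definition fp :: density where
  "fp t x w = (if fst x = pos v t + H then Fp 1 t (snd x) w
     else if fst x = pos v t - H then Fp (-1) t (snd x) w
     else let \<nu> = (\<lambda>i\<in>{1..<d}. snd x i / r) in
       (LINT u:{u. perp_inner d \<nu> (snd u) \<le> 0}|U. KS \<nu> w u * f0 u))"

lemma fm_face: "\<sigma> \<in> {1, -1} \<Longrightarrow> fm t (pos v t + \<sigma> * H, y) u = Fm \<sigma> t y u"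
  and fp_face: "\<sigma> \<in> {1, -1} \<Longrightarrow> fp t (pos v t + \<sigma> * H, y) u = Fp \<sigma> t y u"
  using H by (auto simp: fm_def fp_def)

lemma lateral: "lateral_law d H r KS f0 (pos v) fm fp"
  unfolding lateral_law_def Let_def lateral_face_def by (auto simp: fm_def fp_def Let_def)

interpretation tr: trajectory "pos v" v by (rule mot_trajectory[OF v])

lemma reflection_eq':
  assumes "\<sigma> \<in> {1, -1}" "0 < \<sigma> * (fst x - w)"
  shows "reflection_integrand K w h x u =
    b (snd x) * (of_bool (\<sigma> * (fst u - w) \<le> 0) * (k (fst x - w) (fst u - w) * h u))"
  using incoming_iff[OF assms, of "fst u"]
  by (auto simp: reflection_integrand_def K_eq hshift_def indicator_def)

lemma reflection_f0':
  assumes "\<sigma> \<in> {1, -1}" "0 < \<sigma> * (fst x - w)"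
    "has_bochner_integral lborel (\<lambda>z. of_bool (\<sigma> * (z - w) \<le> 0) * (k (fst x - w) (z - w) * a0 z)) (J \<sigma> w (fst x))"
  shows "has_bochner_integral U (reflection_integrand K w f0 x) (b (snd x) * J \<sigma> w (fst x))"
proof -
  have "has_bochner_integral U (\<lambda>u. b (snd x) * (of_bool (\<sigma> * (fst u - w) \<le> 0) * (k (fst x - w) (fst u - w) * a0 (fst u)) * b (snd u)))
     (b (snd x) * J \<sigma> w (fst x))"
    by (intro has_bochner_integral_mult_right U_int assms)
  then show ?thesis unfolding reflection_eq'[OF assms(1,2), abs_def] f0_eq by (simp add: mult_ac)
qed

text \<open>The precollision law holds by construction of \<open>pert\<close>, and the reflection
  law is the fixed point equation \<open>errlim_fix\<close>.\<close>

lemma law: assumes \<sigma>: "\<sigma> \<in> {1, -1}" shows "end_law d H r K f0 (pos v) v fm fp \<sigma>"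
  unfolding end_law_def
proof (intro conjI allI impI)
  fix t :: real assume t: "0 \<le> t"
  have "AE q in P \<Otimes>\<^sub>M U. fst (snd q) \<noteq> v t" by (rule AE_pv_fst) (rule AE_lborel_singleton)
  with AE_pv_fst[OF AE_regular[OF \<sigma>, of "pos v" t]]
  show "AE (y, u) in P \<Otimes>\<^sub>M U. y \<in> disk d r \<and> incoming v \<sigma> t u \<longrightarrow>
      precollision_law d H r f0 (pos v) fm fp \<sigma> t (pos v t + \<sigma> * H, y) u"
  proof eventually_elim
    case (elim q)
    obtain y u where q: "q = (y, u)" by (cases q)
    have "precollision_law d H r f0 (pos v) fm fp \<sigma> t (pos v t + \<sigma> * H, y) u" if yd: "y \<in> disk d r" and inc0: "incoming v \<sigma> t u"
    proof -
      have "\<sigma> * (fst u - v t) \<noteq> 0" using elim(2) \<sigma> by (auto simp: q)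
      then have inc: "\<sigma> * (fst u - v t) < 0" using inc0 unfolding incoming_def by linarith
      show ?thesis
        unfolding tr.precollision_law_iff[OF \<sigma> yd inc elim(1)[unfolded q snd_conv]] fm_face[OF \<sigma>] fp_face[OF \<sigma>]
        by (simp add: Fm_def Fp_def pert_def f0_eq algebra_simps)
    qed
    then show ?case by (simp add: q)
  qed
  have "AE q in P \<Otimes>\<^sub>M U. fst (snd q) \<noteq> v t" by (rule AE_pv_fst) (rule AE_lborel_singleton)
  with AE_pv_fst[OF J_int_AE[OF \<sigma>, of "v t"]]
  show "AE (y, x) in P \<Otimes>\<^sub>M U. y \<in> disk d r \<and> outgoing v \<sigma> t x \<longrightarrow>
      has_bochner_integral U (reflection_integrand K (v t) (fm t (pos v t + \<sigma> * H, y)) x) (fp t (pos v t + \<sigma> * H, y) x)"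
  proof eventually_elim
    case (elim q)
    obtain y x where q: "q = (y, x)" by (cases q)
    have "has_bochner_integral U (reflection_integrand K (v t) (fm t (pos v t + \<sigma> * H, y)) x) (fp t (pos v t + \<sigma> * H, y) x)"
      if yd: "y \<in> disk d r" and out0: "outgoing v \<sigma> t x"
    proof -
      have ysp: "y \<in> space P" using yd by (simp add: disk_def)
      have "\<sigma> * (fst x - v t) \<noteq> 0" using elim(2) \<sigma> by (auto simp: q)
      then have out: "0 < \<sigma> * (fst x - v t)" using out0 unfolding outgoing_def by linarith
      have 1: "has_bochner_integral U (reflection_integrand K (v t) f0 x) (b (snd x) * J \<sigma> (v t) (fst x))"
        by (rule reflection_f0'[OF \<sigma> out]) (use elim(1) out in \<open>simp add: q\<close>)
      have 2: "has_bochner_integral U (\<lambda>u. b (snd x) * (of_bool (\<sigma> * (fst u - v t) \<le> 0) * (k (fst x - v t) (fst u - v t) * pert \<sigma> v (errlim \<sigma> v) t y u)))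
         (b (snd x) * errlim \<sigma> v t y (fst x))"
        unfolding errlim_fix[OF \<sigma> v ysp, of t "fst x"] Psi_def
        by (intro has_bochner_integral_mult_right has_bochner_integral_integrable integrand_int[OF \<sigma> v errlim_adm[OF \<sigma> v] k_meas1 k_near ysp])
      have "(\<lambda>u. reflection_integrand K (v t) f0 x u + b (snd x) * (of_bool (\<sigma> * (fst u - v t) \<le> 0) * (k (fst x - v t) (fst u - v t) * pert \<sigma> v (errlim \<sigma> v) t y u)))
         = reflection_integrand K (v t) (fm t (pos v t + \<sigma> * H, y)) x"
        unfolding reflection_eq'[OF \<sigma> out] fun_eq_iff fm_face[OF \<sigma>] Fm_def by (simp add: algebra_simps)
      then show ?thesis
        using has_bochner_integral_add[OF 1 2] unfolding fp_face[OF \<sigma>] Fp_def by (simp add: distrib_left)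
    qed
    then show ?case by (simp add: q)
  qed
qed

lemma W_le: "u \<in> space U \<Longrightarrow> W u \<le> bM"
  using bM_pos by (auto simp: W_def space_vec_measure indicator_def b_le)

lemma Fm_meas: assumes \<sigma>: "\<sigma> \<in> {1, -1}"
  shows "(\<lambda>(t, y, u). Fm \<sigma> t y u) \<in> borel_measurable (lborel \<Otimes>\<^sub>M (P \<Otimes>\<^sub>M U))"
proof -
  have [measurable]: "(\<lambda>q. pert \<sigma> v (errlim \<sigma> v) (fst q) (fst (snd q)) (snd (snd q))) \<in> borel_measurable (lborel \<Otimes>\<^sub>M (P \<Otimes>\<^sub>M U))"
    by (rule pert_meas[OF v errlim_adm[OF \<sigma> v]]) measurable
  show ?thesis unfolding Fm_def case_prod_beta' by measurable
qed

lemma Fp_meas: assumes \<sigma>: "\<sigma> \<in> {1, -1}"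
  shows "(\<lambda>(t, y, u). Fp \<sigma> t y u) \<in> borel_measurable (lborel \<Otimes>\<^sub>M (P \<Otimes>\<^sub>M U))"
proof -
  have [measurable]: "v \<in> borel_measurable borel" by (rule mot_meas[OF v])
  have em: "(\<lambda>(t, y, x). errlim \<sigma> v t y x) \<in> borel_measurable (lborel \<Otimes>\<^sub>M (P \<Otimes>\<^sub>M lborel))"
    using errlim_adm[OF \<sigma> v] by (simp add: adm_def)
  have [measurable]: "(\<lambda>q. errlim \<sigma> v (fst q) (fst (snd q)) (fst (snd (snd q)))) \<in> borel_measurable (lborel \<Otimes>\<^sub>M (P \<Otimes>\<^sub>M U))"
  proof (rule measurable_split3[OF em])
    show "fst \<in> lborel \<Otimes>\<^sub>M (P \<Otimes>\<^sub>M U) \<rightarrow>\<^sub>M lborel" by measurable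
    show "(\<lambda>q. fst (snd q)) \<in> lborel \<Otimes>\<^sub>M (P \<Otimes>\<^sub>M U) \<rightarrow>\<^sub>M P" by measurable
    have "(\<lambda>q. fst (snd (snd q))) \<in> lborel \<Otimes>\<^sub>M (P \<Otimes>\<^sub>M U) \<rightarrow>\<^sub>M borel" by measurable
    then show "(\<lambda>q. fst (snd (snd q))) \<in> lborel \<Otimes>\<^sub>M (P \<Otimes>\<^sub>M U) \<rightarrow>\<^sub>M lborel" by simp
  qed
  show ?thesis unfolding Fp_def case_prod_beta' by measurable
qed

text \<open>\<open>fp\<close> is the reflection of \<open>f0\<close> plus \<open>b\<close> times a
  bounded deviation, which fits the relative form of the bound.\<close>

lemma Linf: assumes \<sigma>: "\<sigma> \<in> {1, -1}" shows "end_Linfinity d H r K f0 (pos v) v fm fp \<sigma>"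
  unfolding end_Linfinity_def
proof (intro conjI)
  have [measurable]: "v \<in> borel_measurable borel" by (rule mot_meas[OF v])
  note [measurable] = Fm_meas[OF \<sigma>] Fp_meas[OF \<sigma>]
  have in_set: "{q \<in> space (lborel \<Otimes>\<^sub>M (P \<Otimes>\<^sub>M U)). 0 \<le> fst q \<and> fst (snd q) \<in> disk d r \<and> \<sigma> * (fst (snd (snd q)) - v (fst q)) \<le> 0} \<in> sets (lborel \<Otimes>\<^sub>M (P \<Otimes>\<^sub>M U))"
    and out_set: "{q \<in> space (lborel \<Otimes>\<^sub>M (P \<Otimes>\<^sub>M U)). 0 \<le> fst q \<and> fst (snd q) \<in> disk d r \<and> 0 \<le> \<sigma> * (fst (snd (snd q)) - v (fst q))} \<in> sets (lborel \<Otimes>\<^sub>M (P \<Otimes>\<^sub>M U))"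
    by measurable
  have m: "(\<lambda>q. indicat_real A q *\<^sub>R g q) \<in> borel_measurable (lborel \<Otimes>\<^sub>M (P \<Otimes>\<^sub>M U))"
    if "{q \<in> space (lborel \<Otimes>\<^sub>M (P \<Otimes>\<^sub>M U)). q \<in> A} \<in> sets (lborel \<Otimes>\<^sub>M (P \<Otimes>\<^sub>M U))" "g \<in> borel_measurable (lborel \<Otimes>\<^sub>M (P \<Otimes>\<^sub>M U))" for A and g :: "real \<times> perp \<times> vec \<Rightarrow> real"
  proof -
    have "(\<lambda>q. indicat_real {q \<in> space (lborel \<Otimes>\<^sub>M (P \<Otimes>\<^sub>M U)). q \<in> A} q *\<^sub>R g q) \<in> borel_measurable (lborel \<Otimes>\<^sub>M (P \<Otimes>\<^sub>M U))"
      using that by (intro borel_measurable_scaleR borel_measurable_indicator)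
    then show ?thesis by (rule measurable_cong[THEN iffD1, rotated]) (auto simp: indicator_def)
  qed
  show "set_borel_measurable (lborel \<Otimes>\<^sub>M (P \<Otimes>\<^sub>M U)) {(t, y, u). 0 \<le> t \<and> y \<in> disk d r \<and> incoming v \<sigma> t u}
       (\<lambda>(t, y, u). fm t (pos v t + \<sigma> * H, y) u)"
    unfolding set_borel_measurable_def fm_face[OF \<sigma>]
    by (rule m[OF _ Fm_meas[OF \<sigma>]]) (use in_set in \<open>simp add: incoming_def case_prod_beta'\<close>)
  show "set_borel_measurable (lborel \<Otimes>\<^sub>M (P \<Otimes>\<^sub>M U)) {(t, y, u). 0 \<le> t \<and> y \<in> disk d r \<and> outgoing v \<sigma> t u}
       (\<lambda>(t, y, u). fp t (pos v t + \<sigma> * H, y) u)"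
    unfolding set_borel_measurable_def fp_face[OF \<sigma>]
    by (rule m[OF _ Fp_meas[OF \<sigma>]]) (use out_set in \<open>simp add: outgoing_def case_prod_beta'\<close>)
  show "\<exists>M. \<forall>t\<ge>0. AE (y, u) in P \<Otimes>\<^sub>M U. y \<in> disk d r \<and> incoming v \<sigma> t u \<longrightarrow> \<bar>fm t (pos v t + \<sigma> * H, y) u\<bar> \<le> M"
  proof (intro exI[of _ "aM * bM + 2 * S0 * bM"] allI impI)
    fix t :: real assume "0 \<le> t"
    have "AE q in P \<Otimes>\<^sub>M U. fst (snd q) \<noteq> v t" by (rule AE_pv_fst) (rule AE_lborel_singleton)
    moreover have "AE q in P \<Otimes>\<^sub>M U. q \<in> space (P \<Otimes>\<^sub>M U)" by (rule AE_space)
    ultimately show "AE (y, u) in P \<Otimes>\<^sub>M U. y \<in> disk d r \<and> incoming v \<sigma> t u \<longrightarrow> \<bar>fm t (pos v t + \<sigma> * H, y) u\<bar> \<le> aM * bM + 2 * S0 * bM"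
    proof eventually_elim
      case (elim q)
      obtain y u where q: "q = (y, u)" by (cases q)
      have u: "u \<in> space U" using elim(2) by (simp add: q space_pair_measure)
      have bu: "0 \<le> b (snd u)" "b (snd u) \<le> bM" using u by (auto simp: space_vec_measure b_nonneg b_le)
      have "\<bar>Fm \<sigma> t y u\<bar> \<le> aM * bM + 2 * S0 * bM" if inc0: "incoming v \<sigma> t u"
      proof -
        have "\<sigma> * (fst u - v t) \<noteq> 0" using elim(1) \<sigma> by (auto simp: q)
        then have inc: "\<sigma> * (fst u - v t) < 0" using inc0 unfolding incoming_def by linarith
        have "\<bar>pert \<sigma> v (errlim \<sigma> v) t y u\<bar> \<le> (S0 + cJ + aM) * W u" by (rule pert_bound(1)[OF \<sigma> v errlim_adm[OF \<sigma> v] u inc])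
        also have "\<dots> \<le> 2 * S0 * bM" using W_le[OF u] S0 by (intro mult_mono) (auto simp: S0_def W_nonneg[OF u])
        finally have "\<bar>pert \<sigma> v (errlim \<sigma> v) t y u\<bar> \<le> 2 * S0 * bM" .
        moreover have "\<bar>f0 u\<bar> \<le> aM * bM"
          unfolding f0_eq abs_mult using bu a0_le[of "fst u"] a0_nonneg[of "fst u"] by (intro mult_mono) auto
        ultimately show ?thesis unfolding Fm_def by linarith
      qed
      then show ?case by (simp add: q fm_face[OF \<sigma>])
    qed
  qed
  show "\<exists>M. \<forall>t\<ge>0. AE (y, x) in P \<Otimes>\<^sub>M U. y \<in> disk d r \<and> outgoing v \<sigma> t x \<longrightarrow>
     \<bar>fp t (pos v t + \<sigma> * H, y) x\<bar> \<le> M * (1 + (LINT u|U. reflection_integrand K (v t) f0 x u))"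
  proof (intro exI[of _ "1 + bM * S0"] allI impI)
    fix t :: real assume "0 \<le> t"
    have "AE q in P \<Otimes>\<^sub>M U. fst (snd q) \<noteq> v t" by (rule AE_pv_fst) (rule AE_lborel_singleton)
    moreover have "AE q in P \<Otimes>\<^sub>M U. q \<in> space (P \<Otimes>\<^sub>M U)" by (rule AE_space)
    moreover note AE_pv_fst[OF J_int_AE[OF \<sigma>, of "v t"]]
    ultimately show "AE (y, x) in P \<Otimes>\<^sub>M U. y \<in> disk d r \<and> outgoing v \<sigma> t x \<longrightarrow>
     \<bar>fp t (pos v t + \<sigma> * H, y) x\<bar> \<le> (1 + bM * S0) * (1 + (LINT u|U. reflection_integrand K (v t) f0 x u))"
    proof eventually_elim
      case (elim q)
      obtain y x where q: "q = (y, x)" by (cases q)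
      have x: "x \<in> space U" and y: "y \<in> space P" using elim(2) by (simp_all add: q space_pair_measure)
      have bx: "0 \<le> b (snd x)" "b (snd x) \<le> bM" using x by (auto simp: space_vec_measure b_nonneg b_le)
      have "\<bar>Fp \<sigma> t y x\<bar> \<le> (1 + bM * S0) * (1 + (LINT u|U. reflection_integrand K (v t) f0 x u))" if out0: "outgoing v \<sigma> t x"
      proof -
        have "\<sigma> * (fst x - v t) \<noteq> 0" using elim(1) \<sigma> by (auto simp: q)
        then have out: "0 < \<sigma> * (fst x - v t)" using out0 unfolding outgoing_def by linarith
        have "(LINT u|U. reflection_integrand K (v t) f0 x u) = b (snd x) * J \<sigma> (v t) (fst x)"
          by (rule has_bochner_integral_integral_eq[OF reflection_f0'[OF \<sigma> out]]) (use elim(3) out in \<open>simp add: q\<close>)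
        moreover define j where "j = b (snd x) * J \<sigma> (v t) (fst x)"
        moreover have j0: "0 \<le> j" using bx J_nonneg by (simp add: j_def)
        moreover have "\<bar>b (snd x) * errlim \<sigma> v t y (fst x)\<bar> \<le> bM * S0"
          unfolding abs_mult using bx errlim_adm[OF \<sigma> v] y bM_pos by (intro mult_mono) (auto simp: adm_def)
        moreover have "Fp \<sigma> t y x = j + b (snd x) * errlim \<sigma> v t y (fst x)" by (simp add: Fp_def j_def distrib_left)
        moreover have "j + bM * S0 \<le> (1 + bM * S0) * (1 + j)"
          using j0 bM_pos S0 by (simp add: algebra_simps)
        ultimately show ?thesis by simp
      qed
      then show ?case by (simp add: q fp_face[OF \<sigma>])
    qed
  qed
qed

lemma conv: assumes t: "0 \<le> t" shows "force_convergent d H r k (pos v) v fm t"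
  unfolding force_convergent_def set_integrable_def
proof (intro ballI)
  fix \<sigma> :: real assume \<sigma>: "\<sigma> \<in> {1, -1}"
  let ?s = "\<lambda>q. of_bool (fst q \<in> disk d r \<and> \<sigma> * (fst (snd q) - v t) \<le> 0) :: real"
  have [measurable]: "v \<in> borel_measurable borel" by (rule mot_meas[OF v])
  have [measurable]: "(\<lambda>q. pert \<sigma> v (errlim \<sigma> v) t (fst q) (snd q)) \<in> borel_measurable (P \<Otimes>\<^sub>M U)"
    by (rule pert_meas[OF v errlim_adm[OF \<sigma> v]]) measurable
  have "has_bochner_integral (P \<Otimes>\<^sub>M U) (\<lambda>q. indicat_real (disk d r) (fst q) * (impulse k (fst (snd q) - v t) * f0 (snd q)))
      (mu * (LINT u|U. impulse k (fst u - v t) * f0 u))"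
    by (intro PU_int disk_int has_bochner_integral_integrable impulse_int)
  then have i0: "integrable (P \<Otimes>\<^sub>M U) (\<lambda>q. indicat_real (disk d r) (fst q) * (impulse k (fst (snd q) - v t) * f0 (snd q)))"
    by (auto simp: has_bochner_integral_iff)
  have i1: "integrable (P \<Otimes>\<^sub>M U) (\<lambda>q. ?s q * (impulse k (fst (snd q) - v t) * f0 (snd q)))"
  proof (rule Bochner_Integration.integrable_bound[OF i0])
    show "AE q in P \<Otimes>\<^sub>M U. norm (?s q * (impulse k (fst (snd q) - v t) * f0 (snd q))) \<le> norm (indicat_real (disk d r) (fst q) * (impulse k (fst (snd q) - v t) * f0 (snd q)))"
      by (rule AE_I2) (auto simp: indicator_def abs_mult)
  qed measurable
  have "has_bochner_integral (P \<Otimes>\<^sub>M U) (\<lambda>q. indicat_real (disk d r) (fst q) * (impQ * (S0 + cJ + aM) * W (snd q))) (mu * (impQ * (S0 + cJ + aM) * G))"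
    by (intro PU_int disk_int has_bochner_integral_mult_right W_int)
  then have i2: "integrable (P \<Otimes>\<^sub>M U) (\<lambda>q. indicat_real (disk d r) (fst q) * (impQ * (S0 + cJ + aM) * W (snd q)))"
    by (auto simp: has_bochner_integral_iff)
  have i3: "integrable (P \<Otimes>\<^sub>M U) (\<lambda>q. ?s q * (impulse k (fst (snd q) - v t) * pert \<sigma> v (errlim \<sigma> v) t (fst q) (snd q)))"
  proof (rule Bochner_Integration.integrable_bound[OF i2])
    have ne: "AE q in P \<Otimes>\<^sub>M U. fst (snd q) \<noteq> v t" by (rule AE_pv_fst) (rule AE_lborel_singleton)
    show "AE q in P \<Otimes>\<^sub>M U. norm (?s q * (impulse k (fst (snd q) - v t) * pert \<sigma> v (errlim \<sigma> v) t (fst q) (snd q)))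
       \<le> norm (indicat_real (disk d r) (fst q) * (impQ * (S0 + cJ + aM) * W (snd q)))"
      using ne AE_space
    proof eventually_elim
      case (elim q)
      have u: "snd q \<in> space U" using elim(2) by (auto simp: space_pair_measure)
      have "\<bar>of_bool (\<sigma> * (fst (snd q) - v t) \<le> 0) * (impulse k (fst (snd q) - v t) * pert \<sigma> v (errlim \<sigma> v) t (fst q) (snd q))\<bar>
         \<le> impQ * (S0 + cJ + aM) * W (snd q)"
        by (rule integrand_bound[OF \<sigma> v errlim_adm[OF \<sigma> v] impulse_near u elim(1)])
      from order_trans[OF this abs_ge_self] show ?case by (cases "fst q \<in> disk d r") (auto simp: abs_mult)
    qed
  qed measurable
  have "(\<lambda>q. ?s q * (impulse k (fst (snd q) - v t) * f0 (snd q)) + ?s q * (impulse k (fst (snd q) - v t) * pert \<sigma> v (errlim \<sigma> v) t (fst q) (snd q)))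
     = (\<lambda>q. indicat_real {(y, u). y \<in> disk d r \<and> incoming v \<sigma> t u} q *\<^sub>R (case q of (y, u) \<Rightarrow> impulse k (fst u - v t) * fm t (pos v t + \<sigma> * H, y) u))"
    by (auto simp: fun_eq_iff fm_face[OF \<sigma>] Fm_def incoming_def indicator_def distrib_left)
  with Bochner_Integration.integrable_add[OF i1 i3]
  show "integrable (P \<Otimes>\<^sub>M U) (\<lambda>q. indicat_real {(y, u). y \<in> disk d r \<and> incoming v \<sigma> t u} q *\<^sub>R (case q of (y, u) \<Rightarrow> impulse k (fst u - v t) * fm t (pos v t + \<sigma> * H, y) u))"
    by (simp only:)
qed

lemma solution:
  assumes a: "0 < a"
    and gap: "\<And>V x. \<bar>V - Vinf\<bar> \<le> G / 2 \<Longrightarrow> \<bar>x - Vinf\<bar> \<le> G / 2 \<Longrightarrow>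
       J (-1) V x + km * (2 * G) * (2 * (cJ + aM)) + a \<le> a0 x"
  shows "full_solution d r k f0 a0 b Vinf p gs km bM aM cl Cl \<delta>b bl M (pos v) v G T H K fm fp a"
  by (intro full_solution.intro mot_motion[OF v] full_solution_axioms.intro K_eq law Linf conv small a gap)

lemma force_eq:
  assumes a: "0 < a"
    and gap: "\<And>V x. \<bar>V - Vinf\<bar> \<le> G / 2 \<Longrightarrow> \<bar>x - Vinf\<bar> \<le> G / 2 \<Longrightarrow>
       J (-1) V x + km * (2 * G) * (2 * (cJ + aM)) + a \<le> a0 x"
    and t: "0 \<le> t"
  shows "force d H r k (pos v) v fm t = F0 d r k f0 (v t) + (drag 1 v t - drag (-1) v t)"
proof -
  interpret f: full_solution d r k f0 a0 b Vinf p gs km bM aM cl Cl \<delta>b bl M "pos v" v G 0 H K fm fp a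
    by (rule solution[OF a gap])
  have D: "f.D \<sigma> t = drag \<sigma> v t" if \<sigma>: "\<sigma> \<in> {1, -1}" for \<sigma>
  proof -
    let ?F = "\<lambda>q. f.side \<sigma> t q * (impulse k (fst (snd q) - v t) * (fm t (pos v t + \<sigma> * H, fst q) (snd q) - f0 (snd q)))"
    have i: "integrable (P \<Otimes>\<^sub>M U) ?F" using f.parts(1)[OF t \<sigma>] by (auto simp: has_bochner_integral_iff)
    have "f.D \<sigma> t = (LINT y|P. LINT u|U. ?F (y, u))"
      unfolding f.D_def using perp_vec.integral_fst'[OF i] by simp
    also have "\<dots> = drag \<sigma> v t"
      unfolding drag_def
    proof (rule Bochner_Integration.integral_cong[OF refl])
      fix y
      show "(LINT u|U. ?F (y, u)) = indicat_real (disk d r) y * Psi \<sigma> v (impulse k) (errlim \<sigma> v) t y"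
        by (cases "y \<in> disk d r") (simp_all add: f.side_def Psi_def fm_face[OF \<sigma>] Fm_def)
    qed
    finally show ?thesis .
  qed
  show ?thesis using f.force_split[OF t] D[of 1] D[of "-1"] by simp
qed

end

section \<open>Motion near equilibrium\<close>

text \<open>Points of shrinking cubes converge to \<open>perp_zero d\<close> in each coordinate of
  \<open>{1..<d}\<close> and agree with it elsewhere by extensionality, so they converge in the
  product topology, for which \<open>b\<close> is continuous.\<close>

lemma pbox_lower_bound:
  fixes b :: "perp \<Rightarrow> real"
  assumes b: "continuous_on (space (perp_measure d)) b" "0 < b (perp_zero d)"
  obtains \<delta> where "0 < \<delta>" "\<And>w. w \<in> pbox d \<delta> \<Longrightarrow> b (perp_zero d) / 2 \<le> b w"
proof -
  have "\<exists>n. \<forall>w\<in>pbox d (1 / real (Suc n)). b (perp_zero d) / 2 \<le> b w"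
  proof (rule ccontr)
    assume "\<not> ?thesis"
    then obtain w where w: "\<And>n. w n \<in> pbox d (1 / real (Suc n))" "\<And>n. b (w n) < b (perp_zero d) / 2"
      by (metis not_le)
    have sp: "w n \<in> space (perp_measure d)" for n using w(1) by (simp add: pbox_def)
    have z: "perp_zero d \<in> space (perp_measure d)" by (simp add: perp_zero_def perp_measure_def space_PiM)
    have "(\<lambda>n. w n i) \<longlonglongrightarrow> perp_zero d i" for i
    proof (cases "i \<in> {1..<d}")
      case True
      have "(\<lambda>n. w n i) \<longlonglongrightarrow> 0"
      proof (rule Lim_null_comparison)
        show "\<forall>\<^sub>F n in sequentially. norm (w n i) \<le> 1 / real (Suc n)"
          using w(1) True by (simp add: pbox_def)
        show "(\<lambda>n. 1 / real (Suc n)) \<longlonglongrightarrow> 0" by (rule LIMSEQ_Suc) (rule lim_1_over_n)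
      qed
      then show ?thesis using True by (simp add: perp_zero_def)
    next
      case False
      have "w n i = perp_zero d i" for n
        using sp[of n] z False by (auto simp: perp_measure_def space_PiM PiE_def extensional_def)
      then show ?thesis by simp
    qed
    then have "w \<longlonglongrightarrow> perp_zero d"
      unfolding limitin_canonical_iff[symmetric] euclidean_product_topology[symmetric] limitin_componentwise
      by simp
    then have "(\<lambda>n. b (w n)) \<longlonglongrightarrow> b (perp_zero d)"
      by (rule continuous_on_tendsto_compose[OF b(1) _ z]) (simp add: sp)
    then have "b (perp_zero d) \<le> b (perp_zero d) / 2"
      by (rule LIMSEQ_le_const2) (use w(2) in \<open>auto intro: less_imp_le\<close>)
    then show False using b(2) by simp
  qed
  then obtain n where "\<forall>w\<in>pbox d (1 / real (Suc n)). b (perp_zero d) / 2 \<le> b w" by blast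
  then show ?thesis by (intro that[of "1 / real (Suc n)"]) auto
qed

lemma second_moment_nonneg:
  assumes "\<And>v u. 0 \<le> k v u" shows "0 \<le> second_moment k w"
  unfolding second_moment_def set_lebesgue_integral_def
  using assms by (simp add: integral_nonneg_AE)

text \<open>Only the product of \<open>a0\<close> and \<open>b\<close> is assumed bounded; dividing
  by the positive values \<open>b (perp_zero d)\<close> and \<open>a0 Vinf\<close> bounds each
  factor. The radius is at most 1 so that
  \<open>w\<^sup>2 \<le> \<bar>w\<bar> powr p\<close>.\<close>

lemma kinetic_exists:
  assumes d: "1 \<le> d" "0 < r" "0 < \<gamma>s" and fact: "factorization d K f0 k a0 b"
    and kb: "kernel_bounded k \<gamma>s" and sm: "second_moment_condition k p \<gamma>s"
    and dom: "domination k a0 Vinf \<gamma>s" and F0: "F0_regular d r k f0 Vinf \<gamma>s"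
    and a0: "0 < a0 Vinf"
  obtains gs km bM aM cl Cl \<delta>b bl M where "gs \<le> \<gamma>s" "kinetic d r k f0 a0 b Vinf p gs km bM aM cl Cl \<delta>b bl M"
proof -
  note fact' = fact[unfolded factorization_def]
  have f0_eq: "f0 v = a0 (fst v) * b (snd v)" for v using fact' by blast
  have a0n: "0 \<le> a0 z" and kn: "0 \<le> k v u" for z v u using fact' by blast+
  have bn: "0 \<le> b w" if "w \<in> space (perp_measure d)" for w using fact' that by blast
  have b0: "0 < b (perp_zero d)" using fact' by blast
  have z: "perp_zero d \<in> space (perp_measure d)" by (simp add: perp_zero_def perp_measure_def space_PiM)
  define gs where "gs = min \<gamma>s 1"
  have gs: "0 < gs" "gs \<le> \<gamma>s" "gs \<le> 1" using d by (auto simp: gs_def)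
  have "bounded (f0 ` space (vec_measure d))" using fact' by blast
  then obtain B where B: "\<And>u. u \<in> space (vec_measure d) \<Longrightarrow> \<bar>f0 u\<bar> \<le> B" unfolding bounded_iff by auto
  have B': "a0 x * b w \<le> B" if "w \<in> space (perp_measure d)" for x w
    using B[of "(x, w)"] that by (auto simp: space_vec_measure f0_eq)
  have Bpos: "0 < B" using B'[OF z, of Vinf] mult_pos_pos[OF a0 b0] by linarith
  obtain \<delta>b where \<delta>b: "0 < \<delta>b" "\<And>w. w \<in> pbox d \<delta>b \<Longrightarrow> b (perp_zero d) / 2 \<le> b w"
    using pbox_lower_bound[of d b] fact' b0 by blast
  obtain km where km: "\<And>u v. \<bar>u\<bar> \<le> \<gamma>s \<Longrightarrow> k v u \<le> km" using kb unfolding kernel_bounded_def by blast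
  note sm' = sm[unfolded second_moment_condition_def]
  obtain c' C' where c': "0 < c'" "0 < C'" "\<And>u. u \<in> {-\<gamma>s..\<gamma>s} \<Longrightarrow> c' * \<bar>u\<bar> powr p \<le> second_moment k u \<and> second_moment k u \<le> C' * \<bar>u\<bar> powr p"
    using sm' by blast
  have p: "0 < p" "p \<le> 2" using sm' by blast+
  have sm0: "0 \<le> second_moment k w" for w by (rule second_moment_nonneg[OF kn])
  obtain M where M: "integrable lborel M" "\<And>v y z. \<bar>v\<bar> < 2 * \<gamma>s \<Longrightarrow> \<bar>y\<bar> < \<gamma>s \<Longrightarrow> k v (z - y - Vinf) * a0 z \<le> M z"
    using dom unfolding domination_def by blast
  have sq: "w\<^sup>2 \<le> \<bar>w\<bar> powr p" if "\<bar>w\<bar> \<le> 1" for w :: real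
  proof (cases "w = 0")
    case False
    have "w\<^sup>2 = \<bar>w\<bar> powr 2" using False by (simp add: powr_numeral)
    also have "\<dots> \<le> \<bar>w\<bar> powr p" using False that p by (intro powr_mono') auto
    finally show ?thesis .
  qed simp
  show ?thesis
  proof (rule that[of gs km "B / a0 Vinf" "B / b (perp_zero d)" c' "C' + 1" \<delta>b "b (perp_zero d) / 2" M])
    show "kinetic d r k f0 a0 b Vinf p gs km (B / a0 Vinf) (B / b (perp_zero d)) c' (C' + 1) \<delta>b (b (perp_zero d) / 2) M"
    proof
      show "1 \<le> d" "0 < r" "0 < p" "0 < gs" using d p gs by auto
      show "continuous_on UNIV a0" "continuous_on UNIV (\<lambda>(v, u). k v u)" "has_bochner_integral (perp_measure d) b 1"
        using fact' by blast+
      show "a0 x \<le> B / b (perp_zero d)" for x using B'[OF z, of x] b0 by (simp add: field_simps)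
      show "0 < B / b (perp_zero d)" using Bpos b0 by simp
      show "b w \<le> B / a0 Vinf" if "w \<in> space (perp_measure d)" for w
        using B'[OF that, of Vinf] a0 by (simp add: field_simps)
      show "k v u \<le> km" if "\<bar>u\<bar> \<le> gs" for v u using km that gs by simp
      show "0 \<le> impulse k w" for w using sm0[of w] by (simp add: impulse_def)
      show "c' * \<bar>w\<bar> powr p \<le> impulse k w" if "\<bar>w\<bar> \<le> gs" for w
        using c'(3)[of w] that gs zero_le_power2[of w] unfolding impulse_def atLeastAtMost_iff by linarith
      show "impulse k w \<le> (C' + 1) * \<bar>w\<bar> powr p" if "\<bar>w\<bar> \<le> gs" for w
        using c'(3)[of w] sq[of w] that gs unfolding impulse_def atLeastAtMost_iff distrib_right by linarith
      show "continuous_on (- {0}) (impulse k)"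
        unfolding impulse_def[abs_def] using sm'
        by (intro continuous_intros C1_differentiable_imp_continuous_on) blast
      show "integrable (vec_measure d) (\<lambda>u. impulse k (fst u - w) * f0 u)" for w
        using F0 unfolding F0_regular_def by blast
      show "k v (z - y - Vinf) * a0 z \<le> M z" if "\<bar>v\<bar> < 2 * gs" "\<bar>y\<bar> < gs" for v y z
        using that gs by (intro M) auto
      show "0 < b (perp_zero d) / 2" using b0 by simp
    qed (fact f0_eq a0n bn kn c' M \<delta>b)+
  qed (rule gs)
qed

lemma reversal_criterion_iff:
  "reversal_criterion k a0 Vinf \<longleftrightarrow>
     (LINT z|lborel. of_bool (-1 * (z - Vinf) \<le> 0) * (k (Vinf - Vinf) (z - Vinf) * a0 z)) < a0 Vinf"
proof -
  have "(LINT z|lborel. of_bool (-1 * (z - Vinf) \<le> 0) * (k (Vinf - Vinf) (z - Vinf) * a0 z)) =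
    \<bar>1\<bar> *\<^sub>R (LINT z|lborel. of_bool (-1 * (Vinf + 1 * z - Vinf) \<le> 0) * (k (Vinf - Vinf) (Vinf + 1 * z - Vinf) * a0 (Vinf + 1 * z)))"
    by (rule lborel_integral_real_affine) simp
  also have "\<dots> = (LINT z:{0..}|lborel. k 0 z * a0 (z + Vinf))"
    unfolding set_lebesgue_integral_def by (auto intro!: Bochner_Integration.integral_cong simp: indicator_def add.commute)
  finally show ?thesis by (simp add: reversal_criterion_def)
qed

lemma AE_rbound_cong:
  assumes "\<And>t. 0 < t \<Longrightarrow> t < T \<Longrightarrow> rbound c3 C3 p d X V t (R t) \<Longrightarrow> rbound c3 C3 p d X' V' t (R' t)"
    and "AE t in lborel. 0 < t \<and> t < T \<longrightarrow> rbound c3 C3 p d X V t (R t)"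
  shows "AE t in lborel. 0 < t \<and> t < T \<longrightarrow> rbound c3 C3 p d X' V' t (R' t)"
  using assms(2) by (rule eventually_mono) (use assms(1) in blast)

text \<open>\<open>rbound\<close> sees the motion only through differences of a mean and a velocity,
  so passing to a frame moving with velocity \<open>w\<close> does not change it.\<close>

lemma rbound_shift:
  assumes t: "0 < t" and eq: "\<And>s. 0 \<le> s \<Longrightarrow> s \<le> t \<Longrightarrow> Y s = X s - w * s" "W t = V t - w"
  shows "rbound c3 C3 p d Y W t \<rho> \<longleftrightarrow> rbound c3 C3 p d X V t \<rho>"
proof -
  have m: "mean Y s t - W t = mean X s t - V t" if "0 \<le> s" "s < t" for s
  proof -
    have "Y t - Y s = (X t - X s) - w * (t - s)" using eq(1)[of t] eq(1)[of s] that by (simp add: algebra_simps)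
    then have "mean Y s t = mean X s t - w" using that by (simp add: mean_def diff_divide_distrib)
    then show ?thesis using eq by simp
  qed
  have m': "W t - mean Y s t = V t - mean X s t" if "0 \<le> s" "s < t" for s using m[OF that] by simp
  have "mean_above Y W t = mean_above X V t"
    unfolding mean_above_def fun_eq_iff by (auto simp: m)
  moreover have "mean_below Y W t = mean_below X V t"
    unfolding mean_below_def fun_eq_iff by (auto simp: m')
  moreover have "mean Y 0 t - W t = mean X 0 t - V t" using m t by simp
  ultimately show ?thesis unfolding rbound_def by presburger
qed

context kinetic begin

text \<open>Half of the strict gap in the criterion survives near \<open>Vinf\<close>, by continuity
  of \<open>J\<close> and \<open>a0\<close> along radii \<open>gn\<close> that tend to 0.\<close>

lemma reversal_gap:
  assumes rev: "J (-1) Vinf Vinf < a0 Vinf"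
  obtains a g where "0 < a" "0 < g" "g < gs" "km * (2 * g) \<le> 1 / 4"
    "\<And>V x. \<bar>V - Vinf\<bar> \<le> g / 2 \<Longrightarrow> \<bar>x - Vinf\<bar> \<le> g / 2 \<Longrightarrow> J (-1) V x + km * (2 * g) * (2 * (cJ + aM)) + a \<le> a0 x"
proof -
  define a where "a = (a0 Vinf - J (-1) Vinf Vinf) / 2"
  have a: "0 < a" using rev by (simp add: a_def)
  define g0 where "g0 = min (gs / 2) (1 / (8 * (km + 1)))"
  have g0: "0 < g0" "g0 \<le> gs / 2" using gs km_nonneg by (auto simp: g0_def)
  have "g0 \<le> 1 / (8 * (km + 1))" by (simp add: g0_def)
  then have g0': "(km + 1) * g0 \<le> 1 / 8" using km_nonneg by (simp add: field_simps)
  define gn where "gn n = g0 / real (Suc n)" for n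
  have gn: "0 < gn n" "gn n \<le> g0" for n using g0 by (auto simp: gn_def field_simps)
  have gn0: "gn \<longlonglongrightarrow> 0"
    unfolding gn_def by (rule LIMSEQ_Suc) (rule lim_const_over_n)
  have "\<exists>n. \<forall>V x. \<bar>V - Vinf\<bar> \<le> gn n / 2 \<longrightarrow> \<bar>x - Vinf\<bar> \<le> gn n / 2 \<longrightarrow>
      J (-1) V x + km * (2 * gn n) * (2 * (cJ + aM)) + a \<le> a0 x"
  proof (rule ccontr)
    assume "\<not> ?thesis"
    then have "\<forall>n. \<exists>V x. \<bar>V - Vinf\<bar> \<le> gn n / 2 \<and> \<bar>x - Vinf\<bar> \<le> gn n / 2 \<and> a0 x < J (-1) V x + km * (2 * gn n) * (2 * (cJ + aM)) + a"
      by (auto simp: not_le)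
    then obtain V x where V: "\<And>n. \<bar>V n - Vinf\<bar> \<le> gn n / 2" and x: "\<And>n. \<bar>x n - Vinf\<bar> \<le> gn n / 2"
      and lt: "\<And>n. a0 (x n) < J (-1) (V n) (x n) + km * (2 * gn n) * (2 * (cJ + aM)) + a" by metis
    have lim: "f \<longlonglongrightarrow> Vinf" if f: "\<And>n. \<bar>f n - Vinf\<bar> \<le> gn n / 2" for f :: "nat \<Rightarrow> real"
    proof (rule Lim_null[THEN iffD2], rule Lim_null_comparison)
      show "\<forall>\<^sub>F n in sequentially. norm (f n - Vinf) \<le> gn n / 2" using f by simp
      show "(\<lambda>n. gn n / 2) \<longlonglongrightarrow> 0" using tendsto_divide[OF gn0 tendsto_const, of 2] by simp
    qed
    have "(\<lambda>n. J (-1) (V n) (x n)) \<longlonglongrightarrow> J (-1) Vinf Vinf"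
    proof (rule J_tendsto[OF lim[OF V] lim[OF x]])
      show "\<bar>V n - Vinf\<bar> < gs" for n using V[of n] gn[of n] g0 gs by linarith
      show "\<bar>x n - V n\<bar> < 2 * gs" for n using V[of n] x[of n] gn[of n] g0 gs by linarith
    qed
    then have "(\<lambda>n. J (-1) (V n) (x n) + km * (2 * gn n) * (2 * (cJ + aM)) + a) \<longlonglongrightarrow>
        J (-1) Vinf Vinf + km * (2 * 0) * (2 * (cJ + aM)) + a"
      by (intro tendsto_intros gn0)
    moreover have "(\<lambda>n. a0 (x n)) \<longlonglongrightarrow> a0 Vinf"
      using a0_cont lim[OF x] by (auto intro: continuous_on_tendsto_compose)
    ultimately have "a0 Vinf \<le> J (-1) Vinf Vinf + km * (2 * 0) * (2 * (cJ + aM)) + a"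
      by (intro LIMSEQ_le[of "\<lambda>n. a0 (x n)"]) (use lt in \<open>auto intro: less_imp_le\<close>)
    then show False using a rev by (simp add: a_def field_simps)
  qed
  then obtain n where n: "\<And>V x. \<bar>V - Vinf\<bar> \<le> gn n / 2 \<Longrightarrow> \<bar>x - Vinf\<bar> \<le> gn n / 2 \<Longrightarrow>
      J (-1) V x + km * (2 * gn n) * (2 * (cJ + aM)) + a \<le> a0 x" by blast
  have "km * (2 * gn n) \<le> (km + 1) * (2 * g0)" using gn[of n] km_nonneg by (intro mult_mono) auto
  then have "km * (2 * gn n) \<le> 1 / 4" using g0' by simp
  moreover have "gn n < gs" using gn[of n] g0 gs by linarith
  ultimately show ?thesis using a gn n by (intro that[of a "gn n"])
qed

end

text \<open>The interface to the barrier argument, shared by true solutions and by the untruncated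
  motion \<open>U\<close> of the existence proof. The threshold \<open>2 * \<gamma>\<close> is
  \<open>G / 2\<close> for \<open>G = 4 * \<gamma>\<close>, the radius within which the force bounds
  hold.\<close>

definition perturbed_motion ::
  "nat \<Rightarrow> (real \<Rightarrow> real) \<Rightarrow> real \<Rightarrow> real \<Rightarrow> real \<Rightarrow> real \<Rightarrow> real \<Rightarrow> (real \<Rightarrow> real) \<Rightarrow> (real \<Rightarrow> real) \<Rightarrow> (real \<Rightarrow> real) \<Rightarrow> bool"
where
  "perturbed_motion d F Vinf p c3 C3 \<gamma> Y W R \<longleftrightarrow> trajectory Y W \<and> W 0 = \<gamma> \<and> continuous_on {0..} R \<and>
     (\<forall>t\<ge>0. (W has_real_derivative (- (F (Vinf + W t) - F Vinf) - R t)) (at t within {0..})) \<and>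
     (\<forall>T>0. (\<forall>s. 0 \<le> s \<and> s < T \<longrightarrow> \<bar>W s\<bar> \<le> 2 * \<gamma>) \<longrightarrow>
        (AE t in lborel. 0 < t \<and> t < T \<longrightarrow> rbound c3 C3 p d Y W t (R t)))"

text \<open>The late estimate starts at \<open>\<bar>ln \<gamma>\<bar> / BM + 1\<close>, which is no
  later than \<open>t0 + 1\<close> for every admissible \<open>K0\<close>, since
  \<open>K0 \<ge> 1 / B0 \<ge> 1 / BM\<close>.\<close>

definition reversed_decay :: "nat \<Rightarrow> (real \<Rightarrow> real) \<Rightarrow> real \<Rightarrow> real \<Rightarrow> real \<Rightarrow> real \<Rightarrow> real \<Rightarrow> real \<Rightarrow> (real \<Rightarrow> real) \<Rightarrow> bool" where
  "reversed_decay d F Vinf p BM c C \<gamma> W \<longleftrightarrow> (\<forall>t\<ge>0. \<bar>W t\<bar> \<le> \<gamma>) \<and>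
     (\<forall>t\<ge>0. \<gamma> * exp (- max_slope F Vinf \<gamma> * t) - c * \<gamma> powr (p + 1) / (1 + t) powr (real d + p) < W t) \<and>
     (\<forall>t>0. W t < \<gamma> * exp (- min_slope F Vinf \<gamma> * t)) \<and>
     (\<forall>t\<ge>\<bar>ln \<gamma>\<bar> / BM + 1. W t < \<gamma> * exp (- min_slope F Vinf \<gamma> * t) - C * \<gamma> powr (p + 1) / t powr (real d + p))"

section \<open>From slope bounds on the unperturbed force to the decay estimate\<close>

context
  fixes F :: "real \<Rightarrow> real" and Vinf :: real
  assumes F_deriv: "\<And>w. (F has_real_derivative deriv F w) (at w)" and F'_cont: "continuous_on UNIV (deriv F)"
begin

lemma slope_bounds:
  assumes "\<bar>w - Vinf\<bar> \<le> \<gamma>"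
  shows "min_slope F Vinf \<gamma> \<le> deriv F w" "deriv F w \<le> max_slope F Vinf \<gamma>"
proof -
  have "compact (deriv F ` {Vinf - \<gamma>..Vinf + \<gamma>})"
    by (intro compact_continuous_image continuous_on_subset[OF F'_cont]) auto
  then have "bounded (deriv F ` {Vinf - \<gamma>..Vinf + \<gamma>})" by (rule compact_imp_bounded)
  moreover have "w \<in> {Vinf - \<gamma>..Vinf + \<gamma>}" using assms unfolding atLeastAtMost_iff by linarith
  ultimately show "min_slope F Vinf \<gamma> \<le> deriv F w" "deriv F w \<le> max_slope F Vinf \<gamma>"
    unfolding min_slope_def max_slope_def
    by (auto intro!: cINF_lower cSUP_upper bounded_imp_bdd_below bounded_imp_bdd_above)
qed

lemma increment_eq:
  assumes "\<bar>x\<bar> \<le> \<gamma>"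
  obtains m where "min_slope F Vinf \<gamma> \<le> m" "m \<le> max_slope F Vinf \<gamma>" "F (Vinf + x) - F Vinf = m * x"
proof (cases x "0 :: real" rule: linorder_cases)
  case greater
  then obtain z where z: "Vinf < z" "z < Vinf + x" "F (Vinf + x) - F Vinf = (Vinf + x - Vinf) * deriv F z"
    using MVT2[of Vinf "Vinf + x" F "deriv F"] F_deriv by auto
  then show ?thesis using assms slope_bounds[of z \<gamma>] by (intro that[of "deriv F z"]) auto
next
  case less
  then obtain z where z: "Vinf + x < z" "z < Vinf" "F Vinf - F (Vinf + x) = (Vinf - (Vinf + x)) * deriv F z"
    using MVT2[of "Vinf + x" Vinf F "deriv F"] F_deriv by auto
  then show ?thesis using assms slope_bounds[of z \<gamma>] by (intro that[of "deriv F z"]) (auto simp: algebra_simps)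
next
  case equal
  then show ?thesis using assms slope_bounds[of Vinf \<gamma>] by (intro that[of "deriv F Vinf"]) auto
qed

lemma perturbed_motion_decays:
  assumes d: "1 \<le> (d::nat)" and p: "0 < p" and b: "0 < bm" and c: "0 < c3" "0 < C3" and gs: "0 < gs"
    and slopes: "\<And>w. \<bar>w - Vinf\<bar> \<le> gs \<Longrightarrow> bm \<le> deriv F w \<and> deriv F w \<le> BM"
  obtains \<gamma>1 c C where "0 < \<gamma>1" "\<gamma>1 \<le> gs" "0 < c" "0 < C"
    "\<And>\<gamma> Y W R. 0 < \<gamma> \<Longrightarrow> \<gamma> < \<gamma>1 \<Longrightarrow> perturbed_motion d F Vinf p c3 C3 \<gamma> Y W R \<Longrightarrow> reversed_decay d F Vinf p BM c C \<gamma> W"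
proof -
  have "bm \<le> BM" using slopes[of Vinf] gs by simp
  then obtain \<gamma>1 c C where bb: "0 < \<gamma>1" "0 < c" "0 < C"
    "\<And>\<gamma> B0 Binf Y W \<Phi> R. \<lbrakk>0 < \<gamma>; \<gamma> < \<gamma>1; bm \<le> Binf; Binf \<le> B0; B0 \<le> BM; trajectory Y W; W 0 = \<gamma>;
      \<And>t. 0 \<le> t \<Longrightarrow> (W has_real_derivative (- \<Phi> (W t) - R t)) (at t within {0..});
      continuous_on {0..} R; continuous_on {-\<gamma>..\<gamma>} \<Phi>;
      \<And>x. 0 \<le> x \<Longrightarrow> x \<le> \<gamma> \<Longrightarrow> Binf * x \<le> \<Phi> x \<and> \<Phi> x \<le> B0 * x;
      \<And>x. - \<gamma> \<le> x \<Longrightarrow> x \<le> 0 \<Longrightarrow> B0 * x \<le> \<Phi> x \<and> \<Phi> x \<le> Binf * x;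
      \<And>T. 0 < T \<Longrightarrow> (\<And>s. 0 \<le> s \<Longrightarrow> s < T \<Longrightarrow> \<bar>W s\<bar> \<le> 2 * \<gamma>) \<Longrightarrow>
         AE t in lborel. 0 < t \<and> t < T \<longrightarrow> rbound c3 C3 p d Y W t (R t)\<rbrakk> \<Longrightarrow>
      (\<forall>t\<ge>0. \<bar>W t\<bar> \<le> \<gamma>) \<and>
      (\<forall>t\<ge>0. \<gamma> * exp (- B0 * t) - c * \<gamma> powr (p + 1) / (1 + t) powr (real d + p) < W t) \<and>
      (\<forall>t>0. W t < \<gamma> * exp (- Binf * t)) \<and>
      (\<forall>t\<ge>\<bar>ln \<gamma>\<bar> / BM + 1. W t < \<gamma> * exp (- Binf * t) - C * \<gamma> powr (p + 1) / t powr (real d + p))"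
    using barrier_bounds[OF d p b _ c, of BM] by blast
  show ?thesis
  proof (rule that[of "min \<gamma>1 gs" c C])
    fix \<gamma> Y W R assume \<gamma>: "0 < \<gamma>" "\<gamma> < min \<gamma>1 gs" and pm: "perturbed_motion d F Vinf p c3 C3 \<gamma> Y W R"
    let ?B = "max_slope F Vinf \<gamma>" and ?b = "min_slope F Vinf \<gamma>" and ?\<Phi> = "\<lambda>x. F (Vinf + x) - F Vinf"
    have inc: "\<exists>m. ?b \<le> m \<and> m \<le> ?B \<and> ?\<Phi> x = m * x" if "\<bar>x\<bar> \<le> \<gamma>" for x
      using increment_eq[OF that] by metis
    have F_cont: "continuous_on S F" for S
      by (meson F_deriv DERIV_isCont continuous_at_imp_continuous_on)
    note pm' = pm[unfolded perturbed_motion_def]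
    show "reversed_decay d F Vinf p BM c C \<gamma> W"
      unfolding reversed_decay_def
    proof (rule bb(4)[where \<Phi> = ?\<Phi> and Y = Y and R = R])
      show "0 < \<gamma>" "\<gamma> < \<gamma>1" using \<gamma> by auto
      show "bm \<le> ?b" unfolding min_slope_def
        by (rule cINF_greatest) (use \<gamma> slopes in \<open>auto simp: abs_le_iff\<close>)
      show "?B \<le> BM" unfolding max_slope_def
        by (rule cSUP_least) (use \<gamma> slopes in \<open>auto simp: abs_le_iff\<close>)
      show "?b \<le> ?B" using slope_bounds[of Vinf \<gamma>] \<gamma> by simp
      show "trajectory Y W" "W 0 = \<gamma>" "continuous_on {0..} R" using pm' by blast+
      show "(W has_real_derivative (- ?\<Phi> (W t) - R t)) (at t within {0..})" if "0 \<le> t" for t using pm' that by blast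
      show "continuous_on {-\<gamma>..\<gamma>} ?\<Phi>"
        by (intro continuous_intros continuous_on_compose2[OF F_cont[of UNIV]]) auto
      show "?b * x \<le> ?\<Phi> x \<and> ?\<Phi> x \<le> ?B * x" if x: "0 \<le> x" "x \<le> \<gamma>" for x
        using inc[of x] x by (auto intro: mult_right_mono)
      show "?B * x \<le> ?\<Phi> x \<and> ?\<Phi> x \<le> ?b * x" if x: "- \<gamma> \<le> x" "x \<le> 0" for x
        using inc[of x] x by (auto intro: mult_right_mono_neg simp: abs_le_iff)
      show "AE t in lborel. 0 < t \<and> t < T \<longrightarrow> rbound c3 C3 p d Y W t (R t)"
        if "0 < T" "\<And>s. 0 \<le> s \<Longrightarrow> s < T \<Longrightarrow> \<bar>W s\<bar> \<le> 2 * \<gamma>" for T using pm' that by blast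
    qed
  qed (use bb gs in auto)
qed

end

locale equilibrium = kinetic +
  fixes H E X0 :: real and K :: "vec \<Rightarrow> vec \<Rightarrow> real" and KS :: "perp \<Rightarrow> vec \<Rightarrow> vec \<Rightarrow> real" and a g :: real
  assumes H: "0 < H" and K_eq: "\<And>v u. K v u = k (fst v) (fst u) * b (snd v)"
    and mass: "\<And>u. (\<integral>\<^sup>+x. ennreal (indicat_real {0..} x * (x * k x u)) \<partial>lborel) = ennreal \<bar>u\<bar>"
    and k_even: "\<And>x u. k (- x) u = k x u"
    and E_eq: "E = F0 d r k f0 Vinf" and F0_cont: "continuous_on UNIV (F0 d r k f0)"
    and a: "0 < a" and g: "0 < g" "g < gs" and small: "km * (2 * g) \<le> 1 / 4"
    and gap: "\<And>V x. \<bar>V - Vinf\<bar> \<le> g / 2 \<Longrightarrow> \<bar>x - Vinf\<bar> \<le> g / 2 \<Longrightarrow> J (-1) V x + km * (2 * g) * (2 * (cJ + aM)) + a \<le> a0 x"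
begin

lemma small': assumes "G \<le> g" shows "km * (2 * G) \<le> 1 / 4"
  using mult_left_mono[of "2 * G" "2 * g" km] assms km_nonneg small by linarith

lemma gap':
  assumes G: "G \<le> g" and V: "\<bar>V - Vinf\<bar> \<le> G / 2" "\<bar>x - Vinf\<bar> \<le> G / 2"
  shows "J (-1) V x + km * (2 * G) * (2 * (cJ + aM)) + a \<le> a0 x"
proof -
  have "km * (2 * G) * (2 * (cJ + aM)) \<le> km * (2 * g) * (2 * (cJ + aM))"
    using G km_nonneg cJ_nonneg aM by (intro mult_right_mono mult_left_mono) auto
  moreover have "J (-1) V x + km * (2 * g) * (2 * (cJ + aM)) + a \<le> a0 x" using G V by (intro gap) linarith+
  ultimately show ?thesis by linarith
qed

text \<open>The bound \<open>2 * \<gamma>\<close> on the velocity is the range condition of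
  \<open>full_solution\<close> for \<open>G = 4 * \<gamma>\<close>, and \<open>rbound_shift\<close>
  removes the equilibrium drift.\<close>

lemma solution_perturbed:
  assumes \<gamma>: "0 < \<gamma>" "4 * \<gamma> \<le> g"
    and sol: "body_particle_solution d H r E K k KS f0 X0 (Vinf + \<gamma>) X V fm fp"
  shows "perturbed_motion d (F0 d r k f0) Vinf p (c3 a) C3 \<gamma> (\<lambda>t. X t - Vinf * t) (\<lambda>t. V t - Vinf)
    (\<lambda>t. force d H r k X V fm t - F0 d r k f0 (V t))"
  unfolding perturbed_motion_def
proof (intro conjI allI impI)
  note sol' = sol[unfolded body_particle_solution_def]
  have dX: "(X has_real_derivative V t) (at t within {0..})"
    and dV: "(V has_real_derivative E - force d H r k X V fm t) (at t within {0..})" if "0 \<le> t" for t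
    using sol' that by blast+
  have cV: "continuous_on {0..} V"
    using dV by (auto intro!: DERIV_continuous_on)
  interpret tr: trajectory X V by (rule trajectory.intro[OF dX cV])
  show "trajectory (\<lambda>t. X t - Vinf * t) (\<lambda>t. V t - Vinf)"
  proof
    show "((\<lambda>t. X t - Vinf * t) has_real_derivative V t - Vinf) (at t within {0..})" if "0 \<le> t" for t
      using dX[OF that] by (auto intro!: derivative_eq_intros)
  qed (intro continuous_intros cV)
  show "V 0 - Vinf = \<gamma>" using sol' by simp
  have "continuous_on {0..} (\<lambda>t. E - force d H r k X V fm t)" using sol' by blast
  then have "continuous_on {0..} (\<lambda>t. E - (E - force d H r k X V fm t) - F0 d r k f0 (V t))"
    by (intro continuous_on_diff[OF continuous_on_diff[OF continuous_on_const]] continuous_on_compose2[OF F0_cont cV]) auto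
  then show "continuous_on {0..} (\<lambda>t. force d H r k X V fm t - F0 d r k f0 (V t))"
    by (rule continuous_on_eq) simp
  show "((\<lambda>t. V t - Vinf) has_real_derivative - (F0 d r k f0 (Vinf + (V t - Vinf)) - F0 d r k f0 Vinf)
      - (force d H r k X V fm t - F0 d r k f0 (V t))) (at t within {0..})" if "0 \<le> t" for t
    using DERIV_diff[OF dV[OF that] DERIV_const, of Vinf] by (simp add: E_eq)
  fix T :: real assume T: "0 < T" and W: "\<forall>s. 0 \<le> s \<and> s < T \<longrightarrow> \<bar>V s - Vinf\<bar> \<le> 2 * \<gamma>"
  interpret f: full_solution d r k f0 a0 b Vinf p gs km bM aM cl Cl \<delta>b bl M X V "4 * \<gamma>" T H K fm fp a
    by (intro full_solution.intro motion.intro kinetic_axioms tr.trajectory_axioms motion_axioms.intro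
      full_solution_axioms.intro K_eq small' a gap'[of "4 * \<gamma>"])
      (use sol' W \<gamma> g in auto)
  show "AE t in lborel. 0 < t \<and> t < T \<longrightarrow> rbound (c3 a) C3 p d (\<lambda>t. X t - Vinf * t) (\<lambda>t. V t - Vinf) t
      (force d H r k X V fm t - F0 d r k f0 (V t))"
  proof (rule AE_rbound_cong[OF _ f.force_rbound])
    fix t :: real assume "0 < t" "rbound (c3 a) C3 p d X V t (force d H r k X V fm t - F0 d r k f0 (V t))"
    then show "rbound (c3 a) C3 p d (\<lambda>t. X t - Vinf * t) (\<lambda>t. V t - Vinf) t (force d H r k X V fm t - F0 d r k f0 (V t))"
      using rbound_shift[of t "\<lambda>t. X t - Vinf * t" X Vinf "\<lambda>t. V t - Vinf" V] by simp
  qed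
qed

text \<open>As long as \<open>U\<close> stays within \<open>2 * \<gamma>\<close> of
  \<open>Vinf\<close> the truncation is inactive, so \<open>U\<close> is driven by its own force and
  satisfies \<open>perturbed_motion\<close>. The decay estimate then yields the smaller radius
  \<open>\<gamma>\<close> for all times, so the truncation never acts.\<close>

lemma solution_exists:
  assumes \<gamma>: "0 < \<gamma>" "4 * \<gamma> \<le> g"
    and decay: "\<And>Y W R t. perturbed_motion d (F0 d r k f0) Vinf p (c3 a) C3 \<gamma> Y W R \<Longrightarrow> 0 \<le> t \<Longrightarrow> \<bar>W t\<bar> \<le> \<gamma>"
  shows "\<exists>X V fm fp. body_particle_solution d H r E K k KS f0 X0 (Vinf + \<gamma>) X V fm fp"
proof -
  \<comment> \<open>The truncation acts at distance \<open>G / 2 = 2 * \<gamma>\<close>, strictly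
    beyond the a priori bound \<open>\<gamma>\<close>.\<close>
  define G where "G = 4 * \<gamma>"
  have G: "0 < G" "G \<le> g" "G < gs" using \<gamma> g by (auto simp: G_def)
  have "compact ((\<lambda>w. E - F0 d r k f0 w) ` {Vinf - G / 2..Vinf + G / 2})"
    by (intro compact_continuous_image continuous_intros continuous_on_subset[OF F0_cont]) auto
  then have "bounded ((\<lambda>w. E - F0 d r k f0 w) ` {Vinf - G / 2..Vinf + G / 2})" by (rule compact_imp_bounded)
  then obtain FB where "\<forall>w\<in>{Vinf - G / 2..Vinf + G / 2}. \<bar>E - F0 d r k f0 w\<bar> \<le> FB"
    unfolding bounded_iff by auto
  then have FB: "\<bar>E - F0 d r k f0 w\<bar> \<le> FB" if "w \<in> {Vinf - G / 2..Vinf + G / 2}" for w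
    using that by blast
  have FB0: "0 \<le> FB" using FB[of Vinf] G by auto
  \<comment> \<open>The bound on the unperturbed force plus the drag bounds of both ends, written
    out because \<open>impQ\<close> and \<open>S0\<close> belong to a locale that takes
    \<open>L\<close> as a parameter.\<close>
  define L where "L = FB + 2 * (Cl * gs powr p * (2 * (cJ + aM)) * G * mu)"
  have L: "0 \<le> L" unfolding L_def using FB0 Cl_nonneg cJ_nonneg aM G mu_nonneg by simp
  interpret sm: small_motion d r k f0 a0 b Vinf p gs km bM aM cl Cl \<delta>b bl M G L X0
    by unfold_locales (use G small'[OF G(2)] L in auto)
  interpret to: tonelli d r k f0 a0 b Vinf p gs km bM aM cl Cl \<delta>b bl M G L X0 E "Vinf + \<gamma>" FB
  proof
    show "continuous_on UNIV (F0 d r k f0)" by (rule F0_cont)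
    show "\<bar>E - F0 d r k f0 w\<bar> \<le> FB" if "\<bar>w - Vinf\<bar> \<le> G / 2" for w
      by (rule FB) (use that in \<open>unfold atLeastAtMost_iff, linarith\<close>)
    show "FB + 2 * (sm.impQ * (2 * sm.S0) * G * mu) \<le> L"
      by (simp add: L_def sm.impQ_def sm.S0_def)
    show "\<bar>Vinf + \<gamma> - Vinf\<bar> \<le> G / 2" using \<gamma> by (simp add: G_def)
  qed
  obtain v U where v: "sm.mot v" and U0: "U 0 = Vinf + \<gamma>" and ac: "continuous_on {0..} (to.acc v)"
    and dU: "\<And>t. 0 \<le> t \<Longrightarrow> (U has_real_derivative to.acc v t) (at t within {0..})"
    and vU: "\<And>t. 0 \<le> t \<Longrightarrow> v t = to.clamp (U t)"
    using to.motion_exists by blast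
  interpret sb: solution_build d r k f0 a0 b Vinf p gs km bM aM cl Cl \<delta>b bl M G L X0 H K KS v
    by unfold_locales (use H K_eq mass k_even v in auto)
  note gapG = gap'[OF G(2)]
  have force: "force d H r k (sm.pos v) v sb.fm t = E - to.acc v t" if "0 \<le> t" for t
    using sb.force_eq[OF a gapG that] by (simp add: to.acc_def)
  have cU: "continuous_on {0..} U" using dU by (auto intro!: DERIV_continuous_on)
  define Y where "Y t = X0 + integral {0..t} U - Vinf * t" for t
  define R where "R t = - to.acc v t - (F0 d r k f0 (U t) - E)" for t
  have "perturbed_motion d (F0 d r k f0) Vinf p (c3 a) C3 \<gamma> Y (\<lambda>t. U t - Vinf) R"
    unfolding perturbed_motion_def
  proof (intro conjI allI impI)
    show "trajectory Y (\<lambda>t. U t - Vinf)"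
    proof
      show "(Y has_real_derivative U t - Vinf) (at t within {0..})" if "0 \<le> t" for t
        unfolding Y_def by (auto intro!: derivative_eq_intros sm.integral_deriv[OF cU that])
    qed (intro continuous_intros cU)
    show "U 0 - Vinf = \<gamma>" using U0 by simp
    show "continuous_on {0..} R" unfolding R_def
      by (intro continuous_intros ac continuous_on_compose2[OF F0_cont] cU) auto
    show "((\<lambda>t. U t - Vinf) has_real_derivative - (F0 d r k f0 (Vinf + (U t - Vinf)) - F0 d r k f0 Vinf) - R t) (at t within {0..})"
      if "0 \<le> t" for t
      using DERIV_diff[OF dU[OF that] DERIV_const, of Vinf] by (simp add: R_def E_eq)
    fix T :: real assume T: "0 < T" and W: "\<forall>s. 0 \<le> s \<and> s < T \<longrightarrow> \<bar>U s - Vinf\<bar> \<le> 2 * \<gamma>"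
    have vs: "v s = U s" if "0 \<le> s" "s < T" for s
      unfolding vU[OF that(1)] by (rule to.clamp_id) (use W that in \<open>auto simp: G_def\<close>)
    interpret f: full_solution d r k f0 a0 b Vinf p gs km bM aM cl Cl \<delta>b bl M "sm.pos v" v G T H K sb.fm sb.fp a
      by (rule sb.solution[OF a gapG])
    show "AE t in lborel. 0 < t \<and> t < T \<longrightarrow> rbound (c3 a) C3 p d Y (\<lambda>t. U t - Vinf) t (R t)"
    proof (rule AE_rbound_cong[OF _ f.force_rbound])
      fix t assume t: "0 < t" "t < T"
        and rb: "rbound (c3 a) C3 p d (sm.pos v) v t (force d H r k (sm.pos v) v sb.fm t - F0 d r k f0 (v t))"
      have Y: "Y s = sm.pos v s - Vinf * s" if "0 \<le> s" "s \<le> t" for s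
      proof -
        have "integral {0..s} U = integral {0..s} v" by (intro integral_cong) (use vs that t in auto)
        then show ?thesis by (simp add: Y_def sm.pos_def)
      qed
      have "R t = force d H r k (sm.pos v) v sb.fm t - F0 d r k f0 (v t)"
        using force[of t] vs[of t] t by (simp add: R_def)
      then show "rbound (c3 a) C3 p d Y (\<lambda>t. U t - Vinf) t (R t)"
        using rb rbound_shift[of t Y "sm.pos v" Vinf "\<lambda>t. U t - Vinf" v] t Y vs[of t] by simp
    qed
  qed
  from decay[OF this] have W: "\<bar>U t - Vinf\<bar> \<le> \<gamma>" if "0 \<le> t" for t using that by simp
  have v_eq: "v t = U t" if "0 \<le> t" for t
    unfolding vU[OF that] by (rule to.clamp_id) (use W[OF that] \<gamma> in \<open>simp add: G_def\<close>)
  interpret tr: trajectory "sm.pos v" v by (rule sm.mot_trajectory[OF v])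
  have "body_particle_solution d H r E K k KS f0 X0 (Vinf + \<gamma>) (sm.pos v) v sb.fm sb.fp"
    unfolding body_particle_solution_def
  proof (intro conjI allI impI ballI)
    show "sm.pos v 0 = X0" by (simp add: sm.pos_def)
    show "v 0 = Vinf + \<gamma>" using v_eq[of 0] U0 by simp
    show "(sm.pos v has_real_derivative v t) (at t within {0..})" if "0 \<le> t" for t by (rule tr.deriv[OF that])
    show "force_convergent d H r k (sm.pos v) v sb.fm t" if "0 \<le> t" for t by (rule sb.conv[OF that])
    show "(v has_real_derivative E - force d H r k (sm.pos v) v sb.fm t) (at t within {0..})" if "0 \<le> t" for t
      unfolding force[OF that]
      by (rule has_field_derivative_transform_within[where f = U and d = 1]) (use dU[OF that] that v_eq in auto)
    show "continuous_on {0..} (\<lambda>t. E - force d H r k (sm.pos v) v sb.fm t)"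
      by (rule continuous_on_eq[OF ac]) (simp add: force)
  qed (use sb.law sb.Linf sb.lateral in auto)
  then show ?thesis by blast
qed

end

text \<open>The exponential is dominated by the power with exponent \<open>q + 1\<close>, which
  beats exponent \<open>q\<close> by a factor \<open>t\<close>.\<close>

lemma eventually_exp_less_powr:
  fixes B D q \<gamma> :: real
  assumes "0 < B" "0 < D" "0 < q" "0 < \<gamma>"
  shows "\<forall>\<^sub>F t in at_top. \<gamma> * exp (- B * t) < D / t powr q"
proof -
  define A where "A = exp (B - (q + 1) - (q + 1) * ln (B / (q + 1)))"
  have "\<forall>\<^sub>F t in at_top. max 1 (\<gamma> * A / D) < t" by (rule eventually_gt_at_top)
  then show ?thesis
  proof (rule eventually_mono)
    fix t assume t: "max 1 (\<gamma> * A / D) < t"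
    have "exp (- B * t) \<le> A * (1 + t) powr (- (q + 1))"
      unfolding A_def by (rule powr_le_exp) (use assms t in auto)
    also have "\<dots> \<le> A * t powr (- (q + 1))"
      using t assms by (intro mult_left_mono powr_mono2') (auto simp: A_def)
    also have "t powr (- (q + 1)) = 1 / (t * t powr q)" using t by (subst powr_minus_divide) (simp add: powr_add)
    finally have "\<gamma> * exp (- B * t) \<le> \<gamma> * (A * (1 / (t * t powr q)))" using assms by (intro mult_left_mono) auto
    also have "\<dots> = (\<gamma> * A / t) / t powr q" by simp
    also have "\<dots> < D / t powr q"
      using t assms by (intro divide_strict_right_mono) (auto simp: field_simps)
    finally show "\<gamma> * exp (- B * t) < D / t powr q" .
  qed
qed

theorem theorem1p2:
  fixes d :: nat and H r E Vinf p \<gamma>s X0 :: real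
    and K :: "vec \<Rightarrow> vec \<Rightarrow> real" and k :: "real \<Rightarrow> real \<Rightarrow> real"
    and KS :: "perp \<Rightarrow> vec \<Rightarrow> vec \<Rightarrow> real"
    and f0 :: "vec \<Rightarrow> real" and a0 :: "real \<Rightarrow> real" and b :: "perp \<Rightarrow> real"
  assumes "1 \<le> d" and "0 < H" and "0 < r" and "0 < \<gamma>s"
    and "mass_conservation d K"
    and "factorization d K f0 k a0 b"
    and "kernel_bounded k \<gamma>s"
    and "second_moment_condition k p \<gamma>s"
    and "domination k a0 Vinf \<gamma>s"
    and "lateral_kernel d KS"
    and "F0_regular d r k f0 Vinf \<gamma>s"
    and "0 \<le> Vinf" and "0 \<le> E" and "E = F0 d r k f0 Vinf"
    and "reversal_criterion k a0 Vinf"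
  shows "\<exists>\<gamma>1>0. \<exists>c>0. \<exists>C>0. \<forall>\<gamma>. 0 < \<gamma> \<and> \<gamma> < \<gamma>1 \<longrightarrow>
    (\<exists>X V fm fp. body_particle_solution d H r E K k KS f0 X0 (Vinf + \<gamma>) X V fm fp) \<and>
    (\<forall>X V fm fp. body_particle_solution d H r E K k KS f0 X0 (Vinf + \<gamma>) X V fm fp \<longrightarrow>
      (let B0 = max_slope (F0 d r k f0) Vinf \<gamma>; Binf = min_slope (F0 d r k f0) Vinf \<gamma> in
        \<forall>K0. 1 / B0 \<le> K0 \<and> K0 \<le> 2 / B0 \<longrightarrow>
          (let t0 = K0 * \<bar>ln \<gamma>\<bar> in
            \<forall>t>0.
              \<gamma> * exp (- B0 * t) - c * \<gamma> powr (p + 1) / (1 + t) powr (real d + p) < V t - Vinf \<and>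
              V t - Vinf < \<gamma> * exp (- Binf * t)
                - C * \<gamma> powr (p + 1) / t powr (real d + p) * indicat_real {t0 + 1..} t)) \<and>
      (\<forall>\<^sub>F t in at_top. V t < Vinf))"
proof -
  let ?F = "F0 d r k f0"
  note hyp = assms
  note fact' = hyp(6)[unfolded factorization_def]
  have f0_eq: "f0 v = a0 (fst v) * b (snd v)" and K_eq: "K v u = k (fst v) (fst u) * b (snd v)"
    and a0n: "0 \<le> a0 z" and kn: "0 \<le> k x y" and k_even: "k (- x) y = k x y" for v u z x y
    using fact' by blast+
  have z: "perp_zero d \<in> space (perp_measure d)" by (simp add: perp_zero_def perp_measure_def space_PiM)
  \<comment> \<open>The integral in the criterion is nonnegative, so the strict inequality forces
    \<open>a0 Vinf\<close> to be positive.\<close>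
  have "0 \<le> (LINT z:{0..}|lborel. k 0 z * a0 (z + Vinf))"
    unfolding set_lebesgue_integral_def using kn a0n by (simp add: integral_nonneg_AE)
  then have a0: "0 < a0 Vinf" using hyp(15) unfolding reversal_criterion_def by linarith
  obtain gs km bM aM cl Cl \<delta>b bl M where gs_le: "gs \<le> \<gamma>s" and kin: "kinetic d r k f0 a0 b Vinf p gs km bM aM cl Cl \<delta>b bl M"
    by (rule kinetic_exists[OF hyp(1,3,4,6,7,8,9,11) a0])
  interpret kinetic d r k f0 a0 b Vinf p gs km bM aM cl Cl \<delta>b bl M by (rule kin)
  have "J (-1) Vinf Vinf < a0 Vinf" using hyp(15) unfolding reversal_criterion_iff J_def .
  then obtain a g where a: "0 < a" and g: "0 < g" "g < gs" "km * (2 * g) \<le> 1 / 4"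
    "\<And>V x. \<bar>V - Vinf\<bar> \<le> g / 2 \<Longrightarrow> \<bar>x - Vinf\<bar> \<le> g / 2 \<Longrightarrow> J (-1) V x + km * (2 * g) * (2 * (cJ + aM)) + a \<le> a0 x"
    using reversal_gap by blast
  note F0r = hyp(11)[unfolded F0_regular_def]
  obtain D where D: "\<And>w. (?F has_vector_derivative D w) (at w)" "continuous_on UNIV D"
    using F0r unfolding C1_differentiable_on_def by blast
  have D': "(?F has_real_derivative D w) (at w)" for w
    using D(1) by (simp add: has_real_derivative_iff_has_vector_derivative)
  then have deriv_F: "deriv ?F = D" by (auto intro: DERIV_imp_deriv)
  have F_deriv: "(?F has_real_derivative deriv ?F w) (at w)" for w using D' by (simp add: deriv_F)
  have F'_cont: "continuous_on UNIV (deriv ?F)" using D(2) by (simp add: deriv_F)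
  have F_cont: "continuous_on UNIV ?F"
    by (meson F_deriv DERIV_isCont continuous_at_imp_continuous_on)
  \<comment> \<open>Slopes on the fixed interval of radius \<open>gs\<close> control
    \<open>B0\<close> and \<open>Binf\<close> for every smaller \<open>\<gamma>\<close>; this makes
    the final constants independent of \<open>\<gamma>\<close>.\<close>
  define bm BM where "bm = min_slope ?F Vinf gs" and "BM = max_slope ?F Vinf gs"
  have slopes: "bm \<le> deriv ?F w \<and> deriv ?F w \<le> BM" if "\<bar>w - Vinf\<bar> \<le> gs" for w
    using slope_bounds[OF F_deriv F'_cont that] by (simp add: bm_def BM_def)
  have gs0: "0 < gs" by (rule kinetic.gs[OF kin])
  \<comment> \<open>By compactness the infimum of the slopes is attained, hence positive.\<close>
  obtain w where w: "w \<in> {Vinf - gs..Vinf + gs}" "\<And>x. x \<in> {Vinf - gs..Vinf + gs} \<Longrightarrow> deriv ?F w \<le> deriv ?F x"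
    using continuous_attains_inf[of "{Vinf - gs..Vinf + gs}" "deriv ?F"] continuous_on_subset[OF F'_cont] gs0 by auto
  have "0 < deriv ?F w" using F0r[THEN conjunct2, THEN conjunct2, THEN conjunct2, rule_format, of w] w(1) gs_le by simp
  also have "deriv ?F w \<le> bm" unfolding bm_def min_slope_def using w gs0 by (intro cINF_greatest) auto
  finally have bm: "0 < bm" .
  obtain \<gamma>1 c C where \<gamma>1: "0 < \<gamma>1" "\<gamma>1 \<le> gs" and c: "0 < c" "0 < C"
    and dec: "\<And>\<gamma> Y W R. 0 < \<gamma> \<Longrightarrow> \<gamma> < \<gamma>1 \<Longrightarrow> perturbed_motion d ?F Vinf p (c3 a) C3 \<gamma> Y W R \<Longrightarrow> reversed_decay d ?F Vinf p BM c C \<gamma> W"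
    using perturbed_motion_decays[OF F_deriv F'_cont d p bm c3_pos[OF a] C3_pos gs0 slopes] by blast
  interpret equilibrium d r k f0 a0 b Vinf p gs km bM aM cl Cl \<delta>b bl M H E X0 K KS a g
  proof
    show "0 < H" "E = F0 d r k f0 Vinf" "continuous_on UNIV (F0 d r k f0)" "0 < a" "0 < g" "g < gs" "km * (2 * g) \<le> 1 / 4"
      by (fact hyp(2,14) F_cont a g)+
    show "(\<integral>\<^sup>+x. ennreal (indicat_real {0..} x * (x * k x u)) \<partial>lborel) = ennreal \<bar>u\<bar>" for u
    proof -
      \<comment> \<open>The kernel does not see the transversal part of \<open>u\<close>, so it is
        set to zero; integrating out the transversal part of \<open>v\<close> against
        \<open>b\<close> leaves the one-dimensional identity.\<close>
      have "has_bochner_integral (vec_measure d)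
          (\<lambda>v. indicat_real {v. 0 \<le> fst v} v * (fst v * K v (u, perp_zero d))) \<bar>fst (u, perp_zero d)\<bar>"
        using hyp(5) z unfolding mass_conservation_def by (auto simp: space_vec_measure)
      then have i: "has_bochner_integral (vec_measure d)
          (\<lambda>v. indicat_real {0..} (fst v) * (fst v * k (fst v) u) * b (snd v)) \<bar>u\<bar>"
        by (simp add: K_eq indicator_def mult.assoc)
      have "(\<integral>\<^sup>+x. ennreal (indicat_real {0..} x * (x * k x u)) \<partial>lborel) =
          (\<integral>\<^sup>+v. ennreal (indicat_real {0..} (fst v) * (fst v * k (fst v) u) * b (snd v)) \<partial>vec_measure d)"
        using kn by (intro U_nn[symmetric]) (auto simp: indicator_def)
      also have "\<dots> = ennreal \<bar>u\<bar>"
      proof (subst nn_integral_eq_integral)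
        show "AE v in vec_measure d. 0 \<le> indicat_real {0..} (fst v) * (fst v * k (fst v) u) * b (snd v)"
          by (rule AE_I2) (auto simp: indicator_def space_vec_measure b_nonneg kn)
      qed (use i in \<open>auto simp: has_bochner_integral_iff\<close>)
      finally show ?thesis .
    qed
  qed (fact K_eq k_even g)+
  have g1: "0 < min \<gamma>1 (g / 4)" using \<gamma>1 g by simp
  show ?thesis
  proof (rule exI[of _ "min \<gamma>1 (g / 4)"], rule conjI[OF g1], rule exI[of _ c], rule conjI[OF c(1)],
      rule exI[of _ C], rule conjI[OF c(2)], intro conjI allI impI)
    fix \<gamma> assume "0 < \<gamma> \<and> \<gamma> < min \<gamma>1 (g / 4)"
    then have \<gamma>: "0 < \<gamma>" "\<gamma> < \<gamma>1" "4 * \<gamma> \<le> g" "\<gamma> \<le> gs" using \<gamma>1 by auto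
    show "\<exists>X V fm fp. body_particle_solution d H r E K k KS f0 X0 (Vinf + \<gamma>) X V fm fp"
      by (rule solution_exists[OF \<gamma>(1,3)]) (use dec[OF \<gamma>(1,2)] in \<open>auto simp: reversed_decay_def\<close>)
    let ?B = "max_slope ?F Vinf \<gamma>" and ?b = "min_slope ?F Vinf \<gamma>"
    have bb: "bm \<le> ?b" unfolding min_slope_def
      by (rule cINF_greatest) (use \<gamma> slopes in \<open>auto simp: abs_le_iff\<close>)
    have bB: "?b \<le> ?B" using slope_bounds[OF F_deriv F'_cont, of Vinf Vinf \<gamma>] \<gamma> by simp
    have BB: "?B \<le> BM" unfolding max_slope_def
      by (rule cSUP_least) (use \<gamma> slopes in \<open>auto simp: abs_le_iff\<close>)
    fix X V fm fp assume sol: "body_particle_solution d H r E K k KS f0 X0 (Vinf + \<gamma>) X V fm fp"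
    have rd: "reversed_decay d ?F Vinf p BM c C \<gamma> (\<lambda>t. V t - Vinf)"
      by (rule dec[OF \<gamma>(1,2) solution_perturbed[OF \<gamma>(1,3) sol]])
    note rd' = rd[unfolded reversed_decay_def]
    show "let B0 = ?B; Binf = ?b in
        \<forall>K0. 1 / B0 \<le> K0 \<and> K0 \<le> 2 / B0 \<longrightarrow>
          (let t0 = K0 * \<bar>ln \<gamma>\<bar> in
            \<forall>t>0.
              \<gamma> * exp (- B0 * t) - c * \<gamma> powr (p + 1) / (1 + t) powr (real d + p) < V t - Vinf \<and>
              V t - Vinf < \<gamma> * exp (- Binf * t)
                - C * \<gamma> powr (p + 1) / t powr (real d + p) * indicat_real {t0 + 1..} t)"
      unfolding Let_def
    proof (intro allI impI conjI)
      fix K0 t assume K0: "1 / ?B \<le> K0 \<and> K0 \<le> 2 / ?B" and t: "(0::real) < t"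
      show "\<gamma> * exp (- ?B * t) - c * \<gamma> powr (p + 1) / (1 + t) powr (real d + p) < V t - Vinf"
        using rd' t by auto
      show "V t - Vinf < \<gamma> * exp (- ?b * t) - C * \<gamma> powr (p + 1) / t powr (real d + p) * indicat_real {K0 * \<bar>ln \<gamma>\<bar> + 1..} t"
      proof (cases "K0 * \<bar>ln \<gamma>\<bar> + 1 \<le> t")
        case True
        have "1 / BM \<le> 1 / ?B" using bm bb bB BB by (intro divide_left_mono) auto
        then have "1 / BM \<le> K0" using K0 by linarith
        then have "1 / BM * \<bar>ln \<gamma>\<bar> \<le> K0 * \<bar>ln \<gamma>\<bar>" by (intro mult_right_mono) auto
        then have "\<bar>ln \<gamma>\<bar> / BM + 1 \<le> t" using True by simp
        then have "V t - Vinf < \<gamma> * exp (- ?b * t) - C * \<gamma> powr (p + 1) / t powr (real d + p)" using rd' by blast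
        then show ?thesis using True by simp
      next
        case False
        then show ?thesis using rd' t by auto
      qed
    qed
    have "\<forall>\<^sub>F t in at_top. \<gamma> * exp (- ?b * t) < C * \<gamma> powr (p + 1) / t powr (real d + p)"
      by (rule eventually_exp_less_powr) (use bm bb c \<gamma> p in auto)
    moreover have "\<forall>\<^sub>F t in at_top. \<bar>ln \<gamma>\<bar> / BM + 1 \<le> t" by (rule eventually_ge_at_top)
    ultimately show "\<forall>\<^sub>F t in at_top. V t < Vinf"
    proof eventually_elim
      case (elim t)
      then have "V t - Vinf < \<gamma> * exp (- ?b * t) - C * \<gamma> powr (p + 1) / t powr (real d + p)" using rd' by blast
      then show ?case using elim(1) by linarith
    qed
  qed
qed

end
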